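(* Let $N\ge2$, $V_\pm>0$, $\rho_\pm>0$ and $\gamma\ge 0$. The problem $(\mathrm{P})$ $$\min\left\{\mathcal F(\Omega):\ \Omega\subset\mathbb R^N \text{ is of finite perimeter},\ \rho_-|\Omega_-|=V_-,\ \rho_+|\Omega_+|=V_+\right\}$$ has a minimizer $\Omega$. Moreover, it is of one of the two types (type I or type II) described in the context.
   Context: Let $\mathbb R^N_-=\{x_1<0\}$, $\mathbb R^N_+=\{x_1>0\}$, $\Sigma=\{x_1=0\}$. For a set of finite perimeter $\Omega\subset\mathbb R^N$ put $\Omega_\pm=\Omega\cap\mathbb R^N_\pm$, $\Gamma_\pm=\partial\Omega\cap\mathbb R^N_\pm$, $\Gamma_0=\partial\Omega\cap\Sigma$. Here $|\cdot|$ is Lebesgue measure, $P(\Omega,A)$ is the relative perimeter of $\Omega$ in $A$ in the sense of De Giorgi, and $\mathcal H^{N-1}$ is Hausdorff measure. The functional is $$\mathcal F(\Omega)=\rho_-P(\Omega,\mathbb R^N_-)+\rho_+P(\Omega,\mathbb R^N_+)+\gamma\,\mathcal H^{N-1}(\Gamma_0).$$ Convention: sets of finite perimeter are identified when they differ by a Lebesgue-null set, and $\partial\Omega$ denotes the topological boundary of a representative with $\partial\Omega=\{x:0<|\Omega\cap B(x,r)|<|B(x,r)|\ \forall r>0\}$ (the support of the Gauss–Green measure). Types of minimizers. In both types $\Omega$ is connected and $\Gamma_-$, $\Gamma_+$ are spherical caps (a spherical cap is the part in $\mathbb R^N_\pm$ of a sphere that crosses $\Sigma$). Type I: the boundaries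 of the manifolds $\Gamma_-$ and $\Gamma_+$ coincide and $\overline\Omega\cap\Sigma$ is an $(N-1)$-dimensional ball; in this case $\mathcal H^{N-1}(\Gamma_0)=0$. Type II: $\overline\Omega\cap\Sigma$ is an $(N-1)$-dimensional ball, but the boundaries of the manifolds $\Gamma_-$ and $\Gamma_+$ are $(N-2)$-spheres in $\Sigma$ whose radii are distinct and whose centers do not necessarily coincide; in this case $\mathcal H^{N-1}(\Gamma_0)>0$. *)

theory Defs
  imports "HOL-Analysis.Analysis"
begin

text \<open>The half-spaces and the hyperplane are taken with respect to the coordinate \<open>k\<close>, an
  arbitrary element of the index type, in the role of the first coordinate.\<close>

definition halfspace_neg :: "'n \<Rightarrow> (real ^ 'n) set"
  where "halfspace_neg k = {x. x $ k < 0}"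

definition halfspace_pos :: "'n \<Rightarrow> (real ^ 'n) set"
  where "halfspace_pos k = {x. x $ k > 0}"

definition interface :: "'n \<Rightarrow> (real ^ 'n) set"
  where "interface k = {x. x $ k = 0}"


section \<open>Hausdorff measure\<close>

text \<open>Normalised so that on \<open>m\<close>-planes the \<open>m\<close>-dimensional measure is Lebesgue measure.
  Intended for \<open>s > 0\<close>: as \<open>0 powr 0 = 0\<close>, the case \<open>s = 0\<close> is not counting measure.\<close>

definition hausdorff_premeasure :: "real \<Rightarrow> real \<Rightarrow> 'a::metric_space set \<Rightarrow> ennreal" where
  "hausdorff_premeasure s \<delta> A =
     (INF U \<in> {U :: nat \<Rightarrow> 'a set. A \<subseteq> (\<Union>n. U n) \<and> (\<forall>n. bounded (U n) \<and> diameter (U n) \<le> \<delta>)}.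
        \<Sum>n. ennreal (unit_ball_vol s * (diameter (U n) / 2) powr s))"

definition hausdorff_measure :: "real \<Rightarrow> 'a::metric_space set \<Rightarrow> ennreal" where
  "hausdorff_measure s A = (SUP \<delta> \<in> {0<..}. hausdorff_premeasure s \<delta> A)"


section \<open>Perimeter\<close>

definition divergence :: "(real ^ 'n \<Rightarrow> real ^ 'n) \<Rightarrow> real ^ 'n \<Rightarrow> real" where
  "divergence T x = trace (jacobian T (at x))"

definition test_fields :: "(real ^ 'n) set \<Rightarrow> (real ^ 'n \<Rightarrow> real ^ 'n) set" where
  "test_fields A =
     {T. T differentiable_on UNIV \<and> continuous_on UNIV (\<lambda>x. jacobian T (at x)) \<and>
         compact (closure {x. T x \<noteq> 0}) \<and> closure {x. T x \<noteq> 0} \<subseteq> A \<and> (\<forall>x. norm (T x) \<le> 1)}"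

text \<open>De Giorgi perimeter of a Lebesgue measurable set \<open>\<Omega>\<close> in an open set \<open>A\<close>. The truncation of
  negative values by \<^term>\<open>ennreal\<close> is harmless, since the zero field is a test field.\<close>

definition perimeter :: "(real ^ 'n) set \<Rightarrow> (real ^ 'n) set \<Rightarrow> ennreal" where
  "perimeter \<Omega> A = (SUP T \<in> test_fields A. ennreal (LINT x:\<Omega>|lebesgue. divergence T x))"

definition finite_perimeter :: "(real ^ 'n) set \<Rightarrow> bool" where
  "finite_perimeter \<Omega> \<longleftrightarrow> \<Omega> \<in> sets lebesgue \<and> perimeter \<Omega> UNIV < \<infinity>"


section \<open>The boundary\<close>

text \<open>The support of the Gauss--Green measure. It is unchanged under modification of \<open>\<Omega>\<close> on a
  null set.\<close>

definition bdry :: "(real ^ 'n) set \<Rightarrow> (real ^ 'n) set" where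
  "bdry \<Omega> = {x. \<forall>r>0. 0 < emeasure lebesgue (\<Omega> \<inter> ball x r) \<and>
                      emeasure lebesgue (\<Omega> \<inter> ball x r) < emeasure lebesgue (ball x r)}"

text \<open>The representatives with which the topological notions (connectedness, closure) are used.
  Lemma \<open>normalized_representative\<close> shows that each measurable set has one.\<close>

definition normalized :: "(real ^ 'n) set \<Rightarrow> bool" where
  "normalized \<Omega> \<longleftrightarrow> frontier \<Omega> = bdry \<Omega>"

definition Gamma_neg :: "'n \<Rightarrow> (real ^ 'n) set \<Rightarrow> (real ^ 'n) set"
  where "Gamma_neg k \<Omega> = bdry \<Omega> \<inter> halfspace_neg k"

definition Gamma_pos :: "'n \<Rightarrow> (real ^ 'n) set \<Rightarrow> (real ^ 'n) set"
  where "Gamma_pos k \<Omega> = bdry \<Omega> \<inter> halfspace_pos k"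

definition Gamma_0 :: "'n \<Rightarrow> (real ^ 'n) set \<Rightarrow> (real ^ 'n) set"
  where "Gamma_0 k \<Omega> = bdry \<Omega> \<inter> interface k"


section \<open>The variational problem\<close>

definition energy :: "'n \<Rightarrow> real \<Rightarrow> real \<Rightarrow> real \<Rightarrow> (real ^ 'n) set \<Rightarrow> ennreal" where
  "energy k \<rho>n \<rho>p \<gamma> \<Omega> =
     ennreal \<rho>n * perimeter \<Omega> (halfspace_neg k) + ennreal \<rho>p * perimeter \<Omega> (halfspace_pos k)
     + ennreal \<gamma> * hausdorff_measure (real CARD('n) - 1) (Gamma_0 k \<Omega>)"

definition admissible :: "'n \<Rightarrow> real \<Rightarrow> real \<Rightarrow> real \<Rightarrow> real \<Rightarrow> (real ^ 'n) set \<Rightarrow> bool" where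
  "admissible k \<rho>n \<rho>p Vn Vp \<Omega> \<longleftrightarrow> finite_perimeter \<Omega> \<and>
     ennreal \<rho>n * emeasure lebesgue (\<Omega> \<inter> halfspace_neg k) = ennreal Vn \<and>
     ennreal \<rho>p * emeasure lebesgue (\<Omega> \<inter> halfspace_pos k) = ennreal Vp"

definition minimizer ::
    "'n \<Rightarrow> real \<Rightarrow> real \<Rightarrow> real \<Rightarrow> real \<Rightarrow> real \<Rightarrow> (real ^ 'n) set \<Rightarrow> bool" where
  "minimizer k \<rho>n \<rho>p \<gamma> Vn Vp \<Omega> \<longleftrightarrow> admissible k \<rho>n \<rho>p Vn Vp \<Omega> \<and>
     (\<forall>\<Omega>'. admissible k \<rho>n \<rho>p Vn Vp \<Omega>' \<longrightarrow> energy k \<rho>n \<rho>p \<gamma> \<Omega> \<le> energy k \<rho>n \<rho>p \<gamma> \<Omega>')"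


section \<open>The two types\<close>

text \<open>\<open>H\<close> is to be one of the two half-spaces. A sphere crosses the interface if it has points
  strictly on both sides; tangent spheres are excluded.\<close>

definition spherical_cap :: "'n \<Rightarrow> (real ^ 'n) set \<Rightarrow> (real ^ 'n) set \<Rightarrow> bool" where
  "spherical_cap k H C \<longleftrightarrow> (\<exists>c r. r > 0 \<and>
     sphere c r \<inter> halfspace_neg k \<noteq> {} \<and> sphere c r \<inter> halfspace_pos k \<noteq> {} \<and> C = sphere c r \<inter> H)"

text \<open>The boundary of a spherical cap as a manifold. (Caps are relatively closed in their open
  half-space, so this is \<open>closure C - C\<close>.)\<close>

definition rim :: "'n \<Rightarrow> (real ^ 'n) set \<Rightarrow> (real ^ 'n) set" where
  "rim k C = closure C \<inter> interface k"

definition flat_ball :: "'n \<Rightarrow> (real ^ 'n) set \<Rightarrow> bool" where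
  "flat_ball k D \<longleftrightarrow> (\<exists>c r. c \<in> interface k \<and> r > 0 \<and> D = cball c r \<inter> interface k)"

definition common_shape :: "'n \<Rightarrow> (real ^ 'n) set \<Rightarrow> bool" where
  "common_shape k \<Omega> \<longleftrightarrow> connected \<Omega> \<and>
     spherical_cap k (halfspace_neg k) (Gamma_neg k \<Omega>) \<and>
     spherical_cap k (halfspace_pos k) (Gamma_pos k \<Omega>) \<and>
     flat_ball k (closure \<Omega> \<inter> interface k)"

definition type_I :: "'n \<Rightarrow> (real ^ 'n) set \<Rightarrow> bool" where
  "type_I k \<Omega> \<longleftrightarrow> common_shape k \<Omega> \<and>
     rim k (Gamma_neg k \<Omega>) = rim k (Gamma_pos k \<Omega>) \<and>
     hausdorff_measure (real CARD('n) - 1) (Gamma_0 k \<Omega>) = 0"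

definition type_II :: "'n \<Rightarrow> (real ^ 'n) set \<Rightarrow> bool" where
  "type_II k \<Omega> \<longleftrightarrow> common_shape k \<Omega> \<and>
     (\<exists>c r c' r'. c \<in> interface k \<and> c' \<in> interface k \<and> r > 0 \<and> r' > 0 \<and> r \<noteq> r' \<and>
        rim k (Gamma_neg k \<Omega>) = sphere c r \<inter> interface k \<and>
        rim k (Gamma_pos k \<Omega>) = sphere c' r' \<inter> interface k) \<and>
     hausdorff_measure (real CARD('n) - 1) (Gamma_0 k \<Omega>) > 0"


section \<open>Normalized representatives\<close>

lemma negligible_Union_locally:
  fixes S :: "(real ^ 'n) set"
  assumes "\<And>x. x \<in> G \<Longrightarrow> \<exists>r>0. negligible (S \<inter> ball x r)"
  shows "negligible (S \<inter> G)"
proof -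
  obtain r where r: "\<And>x. x \<in> G \<Longrightarrow> r x > 0 \<and> negligible (S \<inter> ball x (r x))"
    using assms by metis
  obtain F where F: "F \<subseteq> (\<lambda>x. ball x (r x)) ` G" "countable F" "\<Union>F = (\<Union>x\<in>G. ball x (r x))"
    using Lindelof[of "(\<lambda>x. ball x (r x)) ` G"] by (smt (verit) imageE open_ball)
  have "negligible (\<Union>B\<in>F. S \<inter> B)"
    using F r by (intro negligible_countable_Union) auto
  moreover have "S \<inter> G \<subseteq> (\<Union>B\<in>F. S \<inter> B)"
    using F(3) r by fastforce
  ultimately show ?thesis
    using negligible_subset by blast
qed

lemma normalized_representative:
  fixes \<Omega> :: "(real ^ 'n) set"
  assumes \<Omega>: "\<Omega> \<in> sets lebesgue"
  shows "\<exists>\<Omega>'. \<Omega>' \<in> sets lebesgue \<and> negligible ((\<Omega>' - \<Omega>) \<union> (\<Omega> - \<Omega>')) \<and> normalized \<Omega>'"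
proof -
  define U where "U = {x. \<exists>r>0. negligible (ball x r - \<Omega>)}"
  define V where "V = {x. \<exists>r>0. negligible (\<Omega> \<inter> ball x r)}"
  define \<Omega>' where "\<Omega>' = (\<Omega> \<union> U) - V"
  have sub: "\<exists>s>0. ball y s \<subseteq> ball x r" if "y \<in> ball x r" for x y :: "real ^ 'n" and r
    using that open_ball openE by blast
  have "open U"
    unfolding open_contains_ball
  proof
    fix x assume "x \<in> U"
    then obtain r where r: "r > 0" "negligible (ball x r - \<Omega>)"
      by (auto simp: U_def)
    have "y \<in> U" if y: "y \<in> ball x r" for y
    proof -
      obtain s where s: "s > 0" "ball y s \<subseteq> ball x r"
        using sub[OF y] by blast
      have "negligible (ball y s - \<Omega>)"
        by (rule negligible_subset[OF r(2)]) (use s in auto)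
      then show ?thesis
        using s(1) unfolding U_def by blast
    qed
    then show "\<exists>e>0. ball x e \<subseteq> U"
      using r(1) by blast
  qed
  have "open V"
    unfolding open_contains_ball
  proof
    fix x assume "x \<in> V"
    then obtain r where r: "r > 0" "negligible (\<Omega> \<inter> ball x r)"
      by (auto simp: V_def)
    have "y \<in> V" if y: "y \<in> ball x r" for y
    proof -
      obtain s where s: "s > 0" "ball y s \<subseteq> ball x r"
        using sub[OF y] by blast
      have "negligible (\<Omega> \<inter> ball y s)"
        by (rule negligible_subset[OF r(2)]) (use s in auto)
      then show ?thesis
        using s(1) unfolding V_def by blast
    qed
    then show "\<exists>e>0. ball x e \<subseteq> V"
      using r(1) by blast
  qed
  have nU: "negligible (U - \<Omega>)"
    using negligible_Union_locally[of U "- \<Omega>"] by (auto simp: U_def Diff_eq Int_commute)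
  have nV: "negligible (\<Omega> \<inter> V)"
    using negligible_Union_locally[of V \<Omega>] by (auto simp: V_def)
  have null: "negligible ((\<Omega>' - \<Omega>) \<union> (\<Omega> - \<Omega>'))"
    by (rule negligible_subset[OF negligible_Un[OF nU nV]]) (auto simp: \<Omega>'_def)
  have meas: "\<Omega>' \<in> sets lebesgue"
    unfolding \<Omega>'_def using \<Omega> \<open>open U\<close> \<open>open V\<close>
    by (intro sets.Diff sets.Un) (simp_all add: sets_completionI_sets borel_open)
  have em: "emeasure lebesgue (\<Omega>' \<inter> ball x r) = emeasure lebesgue (\<Omega> \<inter> ball x r)" for x r
  proof -
    have "negligible ((\<Omega>' \<inter> ball x r) - (\<Omega> \<inter> ball x r))"
         "negligible ((\<Omega> \<inter> ball x r) - (\<Omega>' \<inter> ball x r))"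
      by (rule negligible_subset[OF null], auto)+
    then have "(\<Omega>' \<inter> ball x r - \<Omega> \<inter> ball x r) \<union> (\<Omega> \<inter> ball x r - \<Omega>' \<inter> ball x r) \<in> null_sets lebesgue"
      by (simp add: negligible_iff_null_sets null_sets.Un)
    then have "AE y in lebesgue. y \<in> \<Omega>' \<inter> ball x r \<longleftrightarrow> y \<in> \<Omega> \<inter> ball x r"
      by (rule AE_I') auto
    then show ?thesis
      using meas \<Omega> by (intro emeasure_eq_AE) auto
  qed
  have bd: "x \<in> bdry \<Omega> \<longleftrightarrow> x \<notin> U \<and> x \<notin> V" for x
  proof -
    have pos: "0 < emeasure lebesgue S \<longleftrightarrow> \<not> negligible S"
      if "S \<in> sets lebesgue" for S :: "(real ^ 'n) set"
      using that by (auto simp: negligible_iff_null_sets null_sets_def zero_less_iff_neq_zero)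
    have 1: "0 < emeasure lebesgue (\<Omega> \<inter> ball x r) \<longleftrightarrow> \<not> negligible (\<Omega> \<inter> ball x r)" for r
      using \<Omega> by (intro pos) auto
    have 2: "emeasure lebesgue (\<Omega> \<inter> ball x r) < emeasure lebesgue (ball x r)
        \<longleftrightarrow> \<not> negligible (ball x r - \<Omega>)" for r
    proof -
      have fin: "emeasure lebesgue (\<Omega> \<inter> ball x r) \<noteq> \<infinity>"
        using emeasure_mono[of "\<Omega> \<inter> ball x r" "ball x r" lebesgue]
              emeasure_bounded_finite[of "ball x r"]
        by (auto simp: top_unique)
      have "emeasure lebesgue (ball x r) =
          emeasure lebesgue (\<Omega> \<inter> ball x r) + emeasure lebesgue (ball x r - \<Omega>)"
        (is "_ = ?a + ?b")
      proof -
        have "\<Omega> \<inter> ball x r \<union> (ball x r - \<Omega>) = ball x r"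
          by auto
        then show ?thesis
          using plus_emeasure[of "\<Omega> \<inter> ball x r" lebesgue "ball x r - \<Omega>"] \<Omega> by fastforce
      qed
      moreover have "?a < ?a + ?b \<longleftrightarrow> 0 < ?b"
        using fin ennreal_add_left_cancel_less[of ?a 0 ?b] by simp
      ultimately have "?a < emeasure lebesgue (ball x r) \<longleftrightarrow> 0 < ?b"
        by (simp only:)
      also have "\<dots> \<longleftrightarrow> \<not> negligible (ball x r - \<Omega>)"
        using \<Omega> by (intro pos) auto
      finally show ?thesis .
    qed
    show ?thesis
      unfolding bdry_def U_def V_def using 1 2 by auto
  qed
  have bd': "bdry \<Omega>' = bdry \<Omega>"
    by (simp add: bdry_def em)
  have "U \<inter> V = {}"
  proof (rule ccontr)
    assume "U \<inter> V \<noteq> {}"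
    then obtain x r s where "r > 0" "negligible (ball x r - \<Omega>)" "s > 0" "negligible (\<Omega> \<inter> ball x s)"
      by (auto simp: U_def V_def)
    then have "negligible ((ball x r - \<Omega>) \<union> (\<Omega> \<inter> ball x s))"
      by (intro negligible_Un)
    then have "negligible (ball x (min r s))"
      by (rule negligible_subset) auto
    then show False
      using \<open>r > 0\<close> \<open>s > 0\<close> open_not_negligible[of "ball x (min r s)"] by auto
  qed
  have "frontier \<Omega>' = bdry \<Omega>'"
  proof (intro equalityI subsetI)
    fix x assume x: "x \<in> frontier \<Omega>'"
    have "U \<subseteq> interior \<Omega>'"
      using \<open>open U\<close> \<open>U \<inter> V = {}\<close> by (intro interior_maximal) (auto simp: \<Omega>'_def)
    moreover have "V \<inter> closure \<Omega>' = {}"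
      using \<open>open V\<close> by (auto simp: open_Int_closure_eq_empty \<Omega>'_def)
    ultimately show "x \<in> bdry \<Omega>'"
      using x by (auto simp: bd bd' frontier_def)
  next
    fix x assume x: "x \<in> bdry \<Omega>'"
    then have x0: "\<And>r. r > 0 \<Longrightarrow> 0 < emeasure lebesgue (\<Omega>' \<inter> ball x r)"
      and x1: "\<And>r. r > 0 \<Longrightarrow> emeasure lebesgue (\<Omega>' \<inter> ball x r) < emeasure lebesgue (ball x r)"
      by (auto simp: bdry_def)
    have "\<Omega>' \<inter> ball x r \<noteq> {}" if "r > 0" for r
      using x0[OF that] by force
    moreover have "\<not> ball x r \<subseteq> \<Omega>'" if "r > 0" for r
      using x1[OF that] by (metis inf.absorb2 less_irrefl)
    ultimately show "x \<in> frontier \<Omega>'"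
      by (force simp: frontier_def closure_approachable mem_interior dist_commute)
  qed
  then show ?thesis
    using meas null by (auto simp: normalized_def)
qed

end

theory Submission
 imports Defs "HOL-Analysis.Analysis"
begin

text \<open>A multiplier \<open>l\<close> with \<open>\<bar>l\<bar>\<close> at most the interface weight fixes contact angles and radii of two spherical caps
 with the prescribed volumes. The Brunn--Minkowski inequality yields on each side a Wulff-type inequality
 with the cap as Wulff shape; it is applied to mollifications of a competitor, and the two trace terms
 differ by at most the area of the boundary on the interface. Weighted with \<open>l\<close> the sum bounds the energy
 below by that of two concentric caps, provided \<open>l\<close> makes the discs agree or is extremal. In the equality
 case, cutting by hyperplanes shows that each half is a translate of its cap, and the traces
 force the discs to be nested.\<close>

text \<open>For \<gamma> = 0 the interface is free, the multiplier is 0 and both caps are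
  half-balls, which can slide along the interface independently, even until they are apart. Hence
  the type is claimed for one minimizer in that case, and for every minimizer if \<gamma> > 0. A
  competitor is only measurable, so equality cannot be discussed on its boundary. It is carried by
  sequences of C1 functions: a set is extremal if the Wulff-type inequality becomes sharp along such
  a sequence. The mollifications are shifted towards the inside of the half-space by a multiple of
  their radius; their traces then see one side of the set only, and the traces of the two sides
  agree in the limit off the boundary. The multiplier encodes the contact angles: the balance
  \<open>dens sg * angle sg = - (sg * l)\<close> merges the two contact terms into \<open>l\<close>
  times the difference of the traces. Hausdorff measure on the interface is compared with Lebesgue
  area up to the factor \<open>hm\<close> of the unit flat cube, which is shown to be positive and
  finite and is absorbed into the constant \<open>g\<close>.\<close>

notation inner (infix "<.>" 70)
notation scaleR (infixr "*R" 75)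
notation abs ("<|_|>")

abbreviation iff' (infixr "<->" 25) where "A <-> B == (A::bool) = B"

abbreviation seqlim :: "(nat => 'a::topological_space) => 'a => bool" (infixr "---->" 60)
 where "X ----> L == filterlim X (nhds L) sequentially"

abbreviation hrd :: "(real => real) => real => real filter => bool" (infix "hrd" 50)
 where "(f hrd D) F == (f has_real_derivative D) F"

abbreviation "em == emeasure lborel"

abbreviation "cont == continuous_on UNIV"

abbreviation "hm == hausdorff_measure"

abbreviation "hp == hausdorff_premeasure"

abbreviation nn_int (binder "NN " 10) where "nn_int f == nn_integral lborel f"

abbreviation ae_all (binder "AEL " 10) where "ae_all P == AE x in lborel. P x"

abbreviation ev_seq (binder "EVS " 10) where "ev_seq P == \<forall>\<^sub>F n in sequentially. P n"

abbreviation "fin E == emeasure lborel E < \<infinity>"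

abbreviation "vl == measure lebesgue"

abbreviation "bor == sets borel"

abbreviation "bm == borel_measurable borel"

abbreviation "lint == integrable lborel"

abbreviation "sint == set_integrable lborel"

abbreviation "ind == indicator"

abbreviation "inv_Suc n == inverse (real (Suc n))"

abbreviation tends (infixr "~~>" 55) where "(f ~~> l) F == filterlim f (nhds l) F"

lemmas sli_def = set_lebesgue_integral_def

abbreviation vol :: "'a::euclidean_space set => real" where "vol == measure lborel"

abbreviation pm :: "real => bool" where "pm sg == <|sg|> = 1"

section \<open>Sum sets and cuts by hyperplanes\<close>

definition sumset :: "'a::plus set => 'a set => 'a set" where
 "sumset A B = {x + y | x y. x : A & y : B}"

lemma sumset_mono: "A <= A' ==> B <= B' ==> sumset A B <= sumset A' B'"
 by (auto simp: sumset_def)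

lemma open_sumset:
 fixes A B :: "'a::euclidean_space set"
 assumes "open A" shows "open (sumset A B)"
proof -
 have "sumset A B = (UN x:A. UN y:B. {x + y})" by (auto simp: sumset_def)
 thus ?thesis using open_sums[of A B] assms by simp
qed

lemma bounded_sumset:
 fixes A B :: "'a::euclidean_space set"
 assumes "bounded A" "bounded B" shows "bounded (sumset A B)"
proof -
 have "sumset A B = (UN x:A. UN y:B. {x + y})" by (auto simp: sumset_def)
 thus ?thesis using bounded_sums[OF assms] by simp
qed

lemma halfspace_lebesgue [simp]:
 fixes a :: "'a::euclidean_space"
 shows "{x. c < x <.> a} : sets lebesgue" "{x. x <.> a < c} : sets lebesgue"
  "{x. c <= x <.> a} : sets lebesgue" "{x. x <.> a <= c} : sets lebesgue"
 by (simp_all add: open_halfspace_gt open_halfspace_lt closed_halfspace_ge closed_halfspace_le inner_commute[of _ a])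

lemma measure_halfspace_continuous:
 fixes S :: "'a::euclidean_space set"
 assumes S: "S : lmeasurable" and a: "a ~= 0"
 shows "cont (%w. vl (S Int {x. w < x <.> a}))"
 unfolding continuous_on_sequentially comp_def
proof safe
 fix f :: "nat => real" and w assume f: "f ----> w"
 have hs: "{x. c < x <.> a} : sets lebesgue" for c
  by simp
 have m: "S Int {x. c < x <.> a} : lmeasurable" for c
  using fmeasurable_Int_fmeasurable[OF S hs] .
 have eq: "vl (S Int {x. c < x <.> a}) = (LINT x|lebesgue. ind (S Int {x. c < x <.> a}) x)" for c
  using m[of c] by simp
 have "AE x in lebesgue. x <.> a ~= w"
 proof (rule AE_I')
  show "{x. a <.> x = w} : null_sets lebesgue"
   using negligible_hyperplane[of a w] a negligible_iff_null_sets by blast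
 qed (auto simp: inner_commute)
 hence lim: "AE x in lebesgue. (%n. ind (S Int {x. f n < x <.> a}) x :: real) ----> ind (S Int {x. w < x <.> a}) x"
 proof eventually_elim
  case (elim x)
  then consider "x <.> a < w" | "w < x <.> a" by linarith
  hence "EVS n. (f n < x <.> a) = (w < x <.> a)"
  proof cases
   case 1 hence "EVS n. x <.> a < f n" using f order_tendstoD(1) by blast
   thus ?thesis by eventually_elim (use 1 in auto)
  next
   case 2 hence "EVS n. f n < x <.> a" using f order_tendstoD(2) by blast
   thus ?thesis by eventually_elim (use 2 in auto)
  qed
  thus ?case by (intro tendsto_eventually) (auto elim!: eventually_mono simp: indicator_def)
 qed
 show "(%n. vl (S Int {x. f n < x <.> a})) ----> vl (S Int {x. w < x <.> a})"
  unfolding eq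
 proof (rule integral_dominated_convergence[where w="ind S"])
  show "integrable lebesgue (ind S :: 'a => real)" using S by (simp add: lmeasurable_iff_integrable)
 qed (use lim m in \<open>auto simp: indicator_def fmeasurableD\<close>)
qed

lemma halfspace_split:
 fixes S :: "'a::euclidean_space set"
 assumes S: "S : lmeasurable" and a: "a ~= 0"
 shows "vl S = vl (S Int {x. w < x <.> a}) + vl (S Int {x. x <.> a < w})"
proof -
 let ?A = "S Int {x. w < x <.> a}" and ?B = "S Int {x. x <.> a < w}"
 have m: "?A : lmeasurable" "?B : lmeasurable"
  using fmeasurable_Int_fmeasurable[OF S] by auto
 have "S - (?A Un ?B) <= {x. a <.> x = w}" by (auto simp: inner_commute)
 hence n: "negligible (S - (?A Un ?B))"
  using negligible_hyperplane[of a w] a negligible_subset by blast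
 have "?A Un ?B - S = {}" by auto
 hence "vl S = vl (?A Un ?B)"
  using m n by (intro measure_negligible_symdiff) (auto simp: fmeasurableD S)
 also have "... = vl ?A + vl ?B"
  using m by (subst measure_Un3) (auto, smt (verit) Int_emptyI disjoint_iff measure_empty mem_Collect_eq IntD2)
 finally show ?thesis .
qed

lemma measure_halfspace_ex:
 fixes S :: "'a::euclidean_space set"
 assumes S: "S : lmeasurable" "bounded S" and a: "a ~= 0" and th: "0 <= th" "th <= 1"
 obtains w where "vl (S Int {x. w < x <.> a}) = th * vl S"
proof -
 let ?f = "%w. vl (S Int {x. w < x <.> a})"
 obtain R where R: "!!x. x : S ==> norm x < R" "R > 0" using S(2) bounded_pos_less by blast
 have B: "<|x <.> a|> < R * norm a" if "x : S" for x
 proof -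
  have "<|x <.> a|> <= norm x * norm a" by (rule Cauchy_Schwarz_ineq2)
  also have "... < R * norm a" using R(1)[OF that] a by simp
  finally show ?thesis .
 qed
 let ?r = "R * norm a"
 have 1: "S Int {x. - ?r < x <.> a} = S" using B by fastforce
 have 2: "S Int {x. ?r < x <.> a} = {}" using B by fastforce
 have "EX w. - ?r <= w & w <= ?r & ?f w = th * vl S"
 proof (rule IVT2')
  show "?f ?r <= th * vl S" unfolding 2 using th by simp
  show "th * vl S <= ?f (- ?r)" unfolding 1 using th by (simp add: mult_left_le_one_le)
  show "- ?r <= ?r" using R by simp
  show "continuous_on {- ?r..?r} ?f" using measure_halfspace_continuous[OF S(1) a] continuous_on_subset by blast
 qed
 thus ?thesis using that by blast
qed

section \<open>The Brunn--Minkowski inequality\<close>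

definition brunn_minkowski :: "'a::euclidean_space set => 'a set => bool" where
 "brunn_minkowski A B <->
  (root DIM('a) (vl A) + root DIM('a) (vl B)) ^ DIM('a)
   <= vl (sumset A B)"

lemma brunn_minkowski_commute: "brunn_minkowski A B <-> brunn_minkowski B (A :: 'a::euclidean_space set)"
proof -
 have "sumset A B = sumset B A" by (force simp: sumset_def add.commute)
 thus ?thesis by (simp add: brunn_minkowski_def add.commute)
qed

text \<open>The arithmetic-geometric mean inequality is applied to the ratios
  \<open>al i / (al i + be i)\<close> and to \<open>be i / (al i + be i)\<close>: the two arithmetic
  means add up to 1, which leaves the root of the volume of the sum box.\<close>

lemma brunn_minkowski_box:
 fixes a b c d :: "'a::euclidean_space"
 assumes ab: "box a b ~= {}" and cd: "box c d ~= {}"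
 shows "brunn_minkowski (box a b) (box c d)"
proof -
 let ?n = "DIM('a)"
 have ab': "a <.> i < b <.> i" and cd': "c <.> i < d <.> i" if "i : Basis" for i
  using ab cd that by (auto simp: box_ne_empty)
 have sub: "box (a + c) (b + d) <= sumset (box a b) (box c d)"
 proof
  fix z assume z: "z : box (a + c) (b + d)"
  \<comment> \<open>The relative position of \<open>z\<close> in the sum box along axis
    \<open>i\<close>; the two summands are taken at this same relative position in their own
    boxes.\<close>
  define t where "t i = (z <.> i - a <.> i - c <.> i) / (b <.> i + d <.> i - a <.> i - c <.> i)" for i
  have t: "0 < t i" "t i < 1" if "i : Basis" for i
   using z ab'[OF that] cd'[OF that] that by (auto simp: t_def mem_box inner_add_left field_simps)
  define x where "x = (SUM i:Basis. (a <.> i + t i * (b <.> i - a <.> i)) *R i)"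
  have x: "x <.> i = a <.> i + t i * (b <.> i - a <.> i)" if "i : Basis" for i
   using that by (simp add: x_def)
  have zx: "(z - x) <.> i = c <.> i + t i * (d <.> i - c <.> i)" if "i : Basis" for i
  proof -
   have "t i * (b <.> i + d <.> i - a <.> i - c <.> i) = z <.> i - a <.> i - c <.> i"
    using ab'[OF that] cd'[OF that] by (simp add: t_def)
   thus ?thesis using x[OF that] by (simp add: inner_diff_left algebra_simps)
  qed
  have bd: "p < p + s * (q - p)" "p + s * (q - p) < q" if "p < q" "0 < s" "s < 1" for p q s :: real
  proof -
   show "p < p + s * (q - p)" using that by simp
   have "s * (q - p) < 1 * (q - p)" using that by (intro mult_strict_right_mono) auto
   thus "p + s * (q - p) < q" by simp
  qed
  have "x : box a b" "z - x : box c d"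
   using bd ab' cd' t by (auto simp: mem_box x zx)
  moreover have "z = x + (z - x)" by simp
  ultimately show "z : sumset (box a b) (box c d)"
   unfolding sumset_def by blast
 qed
 define al be where "al i = b <.> i - a <.> i" and "be i = d <.> i - c <.> i" for i
 have pos: "al i > 0" "be i > 0" if "i : Basis" for i using ab'[OF that] cd'[OF that] by (auto simp: al_def be_def)
 have m1: "vl (box a b) = prod al Basis"
  using ab' by (subst measure_completion) (auto simp: measure_lborel_box_eq al_def less_imp_le inner_diff_left)
 have m2: "vl (box c d) = prod be Basis"
  using cd' by (subst measure_completion) (auto simp: measure_lborel_box_eq be_def less_imp_le inner_diff_left)
 have m3: "vl (box (a + c) (b + d)) = (PROD i:Basis. al i + be i)"
  using cd' ab' by (subst measure_completion)
   (auto simp: measure_lborel_box_eq be_def al_def less_imp_le inner_diff_left inner_add_left add_mono algebra_simps intro!: prod.cong)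
 define P where "P = (PROD i:Basis. al i + be i)"
 have P: "P > 0" unfolding P_def using pos by (intro prod_pos) (auto simp: add_pos_pos)
 have ne: "al i + be i ~= 0" if "i : Basis" for i using pos[OF that] by simp
 have frac: "root ?n (prod f Basis) <= root ?n P * (SUM i:Basis. f i / (al i + be i) / ?n)"
  if f: "!!i. i : Basis ==> f i > 0" for f
 proof -
  have nn: "0 <= f i / (al i + be i)" if "i : Basis" for i
   using f[OF that] pos[OF that] by simp
  have "root ?n (prod f Basis) = root ?n (P * (PROD i:Basis. f i / (al i + be i)))"
   using ne by (simp add: prod_dividef P_def)
  also have "... = root ?n P * root ?n (PROD i:Basis. f i / (al i + be i))" by (simp add: real_root_mult)
  also have "root ?n (PROD i:Basis. f i / (al i + be i)) = (PROD i:Basis. f i / (al i + be i)) powr (1 / ?n)"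
   using nn by (subst root_powr_inverse) (auto intro!: prod_nonneg)
  also have "... <= (SUM i:Basis. f i / (al i + be i) / ?n)"
   using nn by (intro arith_geom_mean) auto
  finally show ?thesis using P by (simp add: mult_left_mono)
 qed
 have "root ?n (prod al Basis) + root ?n (prod be Basis)
  <= root ?n P * (SUM i:Basis. al i / (al i + be i) / ?n) + root ?n P * (SUM i:Basis. be i / (al i + be i) / ?n)"
  using pos by (intro add_mono frac) auto
 also have "... = root ?n P * (SUM i:(Basis::'a set). 1 / ?n)"
  using pos by (simp add: distrib_left[symmetric] sum.distrib[symmetric] add_divide_distrib[symmetric]
   del: sum_constant) (rule disjI2, rule sum.cong, auto, smt (verit) divide_self pos)
 also have "... = root ?n P" by simp
 finally have "(root ?n (prod al Basis) + root ?n (prod be Basis)) ^ ?n <= (root ?n P) ^ ?n"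
 proof (rule power_mono)
  have "0 <= prod al Basis" "0 <= prod be Basis" using pos by (auto intro!: prod_nonneg intro: less_imp_le)
  thus "0 <= root ?n (prod al Basis) + root ?n (prod be Basis)" by simp
 qed
 also have "... = P" using P by simp
 also have "P <= vl (sumset (box a b) (box c d))"
  unfolding P_def m3[symmetric] using sub
  by (intro measure_mono_fmeasurable) (auto intro!: lmeasurable_open bounded_sumset bounded_box open_sumset)
 finally show ?thesis unfolding brunn_minkowski_def m1 m2 .
qed

text \<open>The Hadwiger--Ohmann step: a hyperplane cutting \<open>A\<close> is matched with a parallel hyperplane
 cutting \<open>B\<close> in the same proportion.\<close>

lemma brunn_minkowski_cut:
 fixes A B :: "'a::euclidean_space set"
 assumes A: "open A" "bounded A" and B: "open B" "bounded B" and e: "e ~= 0"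
  and w: "vl (B Int {x. w < x <.> e}) = vl (A Int {x. z < x <.> e}) / vl A * vl B"
  and Apos: "vl A > 0"
  and 1: "brunn_minkowski (A Int {x. z < x <.> e}) (B Int {x. w < x <.> e})"
  and 2: "brunn_minkowski (A Int {x. x <.> e < z}) (B Int {x. x <.> e < w})"
 shows "brunn_minkowski A B"
proof -
 let ?n = "DIM('a)"
 let ?A1 = "A Int {x. z < x <.> e}" and ?A2 = "A Int {x. x <.> e < z}"
 let ?B1 = "B Int {x. w < x <.> e}" and ?B2 = "B Int {x. x <.> e < w}"
 have lm: "A : lmeasurable" "B : lmeasurable" using A B by (auto intro: lmeasurable_open)
 define th where "th = vl ?A1 / vl A"
 have s: "vl A = vl ?A1 + vl ?A2"
  "vl B = vl ?B1 + vl ?B2"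
  using halfspace_split[OF lm(1) e] halfspace_split[OF lm(2) e] by auto
 have th: "0 <= th" "th <= 1" using Apos s(1) by (auto simp: th_def divide_le_eq_1)
 let ?a = "vl A" and ?b = "vl B"
 have A1: "vl ?A1 = th * ?a" and B1: "vl ?B1 = th * ?b"
  using Apos w by (auto simp: th_def)
 have A2: "vl ?A2 = (1 - th) * ?a" and B2: "vl ?B2 = (1 - th) * ?b"
  using s A1 B1 by (auto simp: algebra_simps)
 define M where "M = (root ?n ?a + root ?n ?b) ^ ?n"
 \<comment> \<open>Cutting both sets in the proportion \<open>th\<close> scales both volumes by
   \<open>th\<close>, and the Brunn-Minkowski expression is homogeneous of degree one in a common
   factor of the volumes.\<close>
 have scale: "(root ?n (t * ?a) + root ?n (t * ?b)) ^ ?n = t * M" if "t >= 0" for t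
  using that by (simp add: M_def real_root_mult distrib_left[symmetric] power_mult_distrib)
 have op: "open ?A1" "open ?A2"
  using A by (auto intro!: open_Int simp: open_halfspace_gt open_halfspace_lt inner_commute[of _ e])
 have lmS: "sumset ?A1 ?B1 : lmeasurable" "sumset ?A2 ?B2 : lmeasurable" "sumset A B : lmeasurable"
  using A B op by (auto intro!: lmeasurable_open bounded_sumset open_sumset bounded_Int)
 \<comment> \<open>The hyperplane at level \<open>z + w\<close> separates the two sum sets.\<close>
 have "sumset ?A1 ?B1 Int sumset ?A2 ?B2 = {}"
  by (auto simp: sumset_def) (smt (verit) inner_add_left)
 hence "vl (sumset ?A1 ?B1) + vl (sumset ?A2 ?B2) = vl (sumset ?A1 ?B1 Un sumset ?A2 ?B2)"
  using lmS by (simp add: measure_Un3)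
 also have "... <= vl (sumset A B)"
  using lmS by (intro measure_mono_fmeasurable) (auto simp: sumset_def)
 finally have "th * M + (1 - th) * M <= vl (sumset A B)"
  using 1 2 unfolding brunn_minkowski_def A1 A2 B1 B2 using scale[of th] scale[of "1-th"] th by linarith
 thus ?thesis by (simp add: brunn_minkowski_def M_def algebra_simps)
qed

lemma disjoint_boxes_separated:
 fixes a b c d :: "'a::euclidean_space"
 assumes "box a b ~= {}" "box c d ~= {}" "box a b Int box c d = {}"
 obtains i where "i : Basis" "b <.> i <= c <.> i | d <.> i <= a <.> i"
proof -
 have "EX i:Basis. b <.> i <= c <.> i | d <.> i <= a <.> i"
  using assms unfolding disjoint_interval box_ne_empty by (smt (verit))
 thus ?thesis using that by blast
qed

lemma box_halfspace:
 fixes a b :: "'a::euclidean_space"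
 assumes i: "i : Basis"
 shows "EX c. box a b Int {x. z < x <.> i} = box c b" (is ?G1) "EX c. box a b Int {x. x <.> i < z} = box a c" (is ?G2)
proof -
 define c where "c = (SUM j:Basis. (if j = i then max (a <.> j) z else a <.> j) *R j)"
 have c: "c <.> j < y <-> a <.> j < y & (j = i --> z < y)" if "j : Basis" for j y
  using that by (simp add: c_def)
 have "box a b Int {x. z < x <.> i} = box c b"
  using i by (auto simp: mem_box c)
 thus ?G1 by blast
 define d where "d = (SUM j:Basis. (if j = i then min (b <.> j) z else b <.> j) *R j)"
 have d: "y < d <.> j <-> y < b <.> j & (j = i --> y < z)" if "j : Basis" for j y
  using that by (simp add: d_def)
 have "box a b Int {x. x <.> i < z} = box a d"
  using i by (auto simp: mem_box d)
 thus ?G2 by blast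
qed


lemma vol_open_pos:
 fixes U :: "'a::euclidean_space set"
 assumes "open U" "bounded U" "U ~= {}" shows "0 < vl U"
 using assms lmeasurable_open open_not_negligible negligible_iff_measure
 by (metis measure_nonneg order_le_less)

text \<open>Induction on the number of boxes. The family \<open>T\<close> of second sets is a
  parameter because the second set is cut along with the union: \<open>T\<close> must be closed
  under such cuts and contain the case of a single box against a member. It is instantiated with the
  boxes and then with the bounded open sets.\<close>

lemma brunn_minkowski_Union:
 fixes T :: "'a::euclidean_space set set"
 assumes T: "!!B. B : T ==> open B & bounded B & vl B > 0"
  and T1: "!!B i w. B : T ==> i : Basis ==> vl (B Int {x. w < x <.> i}) > 0 ==> B Int {x. w < x <.> i} : T"
  and T2: "!!B i w. B : T ==> i : Basis ==> vl (B Int {x. x <.> i < w}) > 0 ==> B Int {x. x <.> i < w} : T"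
  and base: "!!a b B. box a b ~= {} ==> B : T ==> brunn_minkowski (box a b) B"
  and D: "finite D" "D ~= {}" "!!A. A : D ==> A ~= {} & (EX a b. A = box a b)" "pairwise disjnt D"
  and B: "B : T"
 shows "brunn_minkowski (\<Union>D) B"
 using D B
proof (induction "card D" arbitrary: D B rule: less_induct)
 case less
 show ?case
 proof (cases "EX A. D = {A}")
  case True
  thus ?thesis using less.prems base by fastforce
 next
  case False
  then obtain A1 A2 where A: "A1 : D" "A2 : D" "A1 ~= A2" using less.prems(2) by blast
  obtain a b where ab: "A1 = box a b" "box a b ~= {}" using less.prems(3) A by metis
  obtain c d where cd: "A2 = box c d" "box c d ~= {}" using less.prems(3) A by metis
  have dis: "box a b Int box c d = {}" using less.prems(4) A ab cd by (metis disjnt_def pairwiseD)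
  obtain i where i: "i : Basis" "b <.> i <= c <.> i | d <.> i <= a <.> i"
   using disjoint_boxes_separated[OF ab(2) cd(2) dis] by blast
  \<comment> \<open>A coordinate hyperplane has at least one of the boxes entirely on each side, so
    either half of the union consists of fewer boxes.\<close>
  have "EX z A1 A2. A1 : D & A2 : D & A1 <= {x. x <.> i < z} & A2 <= {x. z < x <.> i}"
   using i(2)
  proof
   assume le: "b <.> i <= c <.> i"
   have "A1 <= {x. x <.> i < b <.> i}" "A2 <= {x. b <.> i < x <.> i}"
    using ab cd i(1) le by (fastforce simp: mem_box)+
   thus ?thesis using A by blast
  next
   assume le: "d <.> i <= a <.> i"
   have "A2 <= {x. x <.> i < d <.> i}" "A1 <= {x. d <.> i < x <.> i}"
    using ab cd i(1) le by (fastforce simp: mem_box)+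
   thus ?thesis using A by blast
  qed
  then obtain z A1 A2 where A: "A1 : D" "A2 : D" "A1 <= {x. x <.> i < z}" "A2 <= {x. z < x <.> i}" by blast
  let ?P = "{x. z < x <.> i}" and ?M = "{x. x <.> i < z}"
  define D1 where "D1 = (%A. A Int ?P) ` D - {{}}"
  define D2 where "D2 = (%A. A Int ?M) ` D - {{}}"
  have U1: "\<Union>D1 = \<Union>D Int ?P" and U2: "\<Union>D2 = \<Union>D Int ?M" by (auto simp: D1_def D2_def)
  have "D1 <= (%A. A Int ?P) ` (D - {A1})" using A by (force simp: D1_def)
  hence "card D1 <= card (D - {A1})"
   by (meson card_image_le card_mono finite_Diff finite_imageI le_trans less.prems(1))
  hence c1: "card D1 < card D" using A less.prems(1) by (metis card_Diff1_less le_less_trans)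
  have "D2 <= (%A. A Int ?M) ` (D - {A2})" using A by (force simp: D2_def)
  hence "card D2 <= card (D - {A2})"
   by (meson card_image_le card_mono finite_Diff finite_imageI le_trans less.prems(1))
  hence c2: "card D2 < card D" using A less.prems(1) by (metis card_Diff1_less le_less_trans)
  have f: "finite D1" "finite D2" using less.prems(1) by (auto simp: D1_def D2_def)
  have e: "A2 = A2 Int ?P" "A1 = A1 Int ?M" using A by auto
  have "A2 : (%A. A Int ?P) ` D" "A1 : (%A. A Int ?M) ` D"
   by (rule image_eqI[of A2 "%A. A Int ?P" A2, OF e(1) A(2)], rule image_eqI[of A1 "%A. A Int ?M" A1, OF e(2) A(1)])
  moreover have "A2 ~= {}" "A1 ~= {}" using A less.prems(3) by blast+
  ultimately have "A2 : D1" "A1 : D2" unfolding D1_def D2_def by blast+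
  hence n: "D1 ~= {}" "D2 ~= {}" by auto
  have b1: "A ~= {} & (EX a b. A = box a b)" if AD: "A : D1" for A
  proof -
   obtain C where C: "C : D" "A = C Int ?P" "A ~= {}" using AD unfolding D1_def by auto
   then obtain p q where "C = box p q" using less.prems(3) by blast
   thus ?thesis using C box_halfspace(1)[OF i(1), of p q z] by auto
  qed
  have b2: "A ~= {} & (EX a b. A = box a b)" if AD: "A : D2" for A
  proof -
   obtain C where C: "C : D" "A = C Int ?M" "A ~= {}" using AD unfolding D2_def by auto
   then obtain p q where "C = box p q" using less.prems(3) by blast
   thus ?thesis using C box_halfspace(2)[OF i(1), of p q z] by auto
  qed
  have p: "pairwise disjnt D1" "pairwise disjnt D2"
   using less.prems(4) by (auto simp: D1_def D2_def pairwise_def disjnt_def)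
  have opn: "open (\<Union>D')" "bounded (\<Union>D')" "vl (\<Union>D') > 0"
   if D': "finite D'" "D' ~= {}" "!!A. A : D' ==> A ~= {} & (EX a b. A = box a b)" for D' :: "'a set set"
  proof -
   show o: "open (\<Union>D')" using D'(3) by (intro open_Union ballI) (metis open_box)
   show b: "bounded (\<Union>D')" using D' by (intro bounded_Union ballI) (auto, metis bounded_box)
   show "vl (\<Union>D') > 0" using D' by (intro vol_open_pos o b) auto
  qed
  have D: "open (\<Union>D)" "bounded (\<Union>D)" "vl (\<Union>D) > 0"
   by (rule opn[OF less.prems(1,2)], erule less.prems(3))+
  have D1: "vl (\<Union>D1) > 0" and D2: "vl (\<Union>D2) > 0"
   by (rule opn(3)[OF f(1) n(1)], erule b1) (rule opn(3)[OF f(2) n(2)], erule b2)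
  have Bo: "open B" "bounded B" "vl B > 0" using T[OF less.prems(5)] by blast+
  have Blm: "B : lmeasurable" "\<Union>D : lmeasurable" using Bo D by (auto intro: lmeasurable_open)
  have i0: "i ~= 0" using i(1) by auto
  have split: "vl (\<Union>D) = vl (\<Union>D1) + vl (\<Union>D2)"
   using halfspace_split[OF Blm(2) i0, of z] by (simp add: U1 U2)
  define th where "th = vl (\<Union>D1) / vl (\<Union>D)"
  have th: "0 < th" "th < 1" using split D(3) D1 D2 by (auto simp: th_def)
  obtain w where w: "vl (B Int {x. w < x <.> i}) = th * vl B"
   using measure_halfspace_ex[OF Blm(1) Bo(2) i0, of th] th by auto
  have w2: "vl (B Int {x. x <.> i < w}) = (1 - th) * vl B"
   using halfspace_split[OF Blm(1) i0, of w] w by (simp add: algebra_simps)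
  have "B Int {x. w < x <.> i} : T" "B Int {x. x <.> i < w} : T"
   using T1[OF less.prems(5) i(1), of w] T2[OF less.prems(5) i(1), of w] unfolding w w2
   using th Bo(3) by simp_all
  hence IH: "brunn_minkowski (\<Union>D1) (B Int {x. w < x <.> i})" "brunn_minkowski (\<Union>D2) (B Int {x. x <.> i < w})"
   using less.hyps[OF c1 f(1) n(1) b1 p(1)] less.hyps[OF c2 f(2) n(2) b2 p(2)] by auto
  have w': "vl (B Int {x. w < x <.> i}) = vl (\<Union>D Int {x. z < x <.> i}) / vl (\<Union>D) * vl B"
   using w by (simp only: th_def U1)
  show ?thesis
   by (rule brunn_minkowski_cut[OF D(1,2) Bo(1,2) i0 w' D(3) IH[unfolded U1 U2]])
 qed
qed

lemma open_approx_boxes: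
 fixes U :: "'a::euclidean_space set"
 assumes U: "open U" "bounded U" and e: "e > 0"
 obtains D where "finite D" "!!A. A : D ==> A ~= {} & (EX a b. A = box a b)" "pairwise disjnt D" "\<Union>D <= U"
  "vl U - e < vl (\<Union>D)"
proof -
 obtain a where a: "U <= cbox (-a) a" using bounded_subset_cbox_symmetric[OF U(2)] by blast
 define b where "b = (SUM i:Basis. (<|a <.> i|> + 1) *R i) - (0::'a)"
 have b: "b <.> i = <|a <.> i|> + 1" if "i : Basis" for i using that by (simp add: b_def)
 have sub: "U <= cbox (-b) b" using a b by (fastforce simp: mem_box)
 have ne: "box (-b) b ~= {}" using b by (auto simp: box_ne_empty)
 \<comment> \<open>This gauge forces every interval of the covering with its tag in \<open>U\<close>
   to stay in \<open>U\<close>, so the intervals fill \<open>U\<close> exactly.\<close>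
 have g: "gauge (%x. if x : U then U else UNIV)" using U by (auto simp: gauge_def)
 obtain \<D> where \<D>: "countable \<D>"
  "!!K. K : \<D> ==> interior K ~= {} & (EX c d. K = cbox c d)"
  "pairwise (%A B. interior A Int interior B = {}) \<D>"
  "!!K. K : \<D> ==> EX x:U Int K. K <= (if x : U then U else UNIV)" "U <= \<Union>\<D>"
  using covering_lemma[OF sub ne g] by metis
 have UD: "\<Union>\<D> = U" using \<D>(4,5) by fastforce
 have lm: "U : lmeasurable" using U by (auto intro: lmeasurable_open)
 have box: "interior K = box c d" if "K = cbox c d" for K :: "'a set" and c d using that by (simp add: interior_cbox)
 obtain D' where D': "D' <= \<D>" "finite D'" "vl U - e < vl (\<Union>D')"
 proof (rule measure_countable_Union_approachable[OF \<D>(1) e])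
  show "d : lmeasurable" if "d : \<D>" for d using \<D>(2)[OF that] by auto
  show "vl (\<Union>D') <= vl U" if "D' <= \<D>" "finite D'" for D'
  proof -
   have "\<Union>D' : lmeasurable" using \<D>(2) that by (intro fmeasurable.finite_Union) auto
   thus ?thesis using UD that lm by (intro measure_mono_fmeasurable) auto
  qed
 qed (use UD in auto)
 define D where "D = interior ` D'"
 have "finite D" using D' by (simp add: D_def)
 moreover have "A ~= {} & (EX a b. A = box a b)" if "A : D" for A
 proof -
  obtain K where K: "K : D'" "A = interior K" using \<open>A : D\<close> unfolding D_def by blast
  hence KD: "interior K ~= {}" "EX c d. K = cbox c d" using D'(1) \<D>(2)[of K] by auto
  thus ?thesis using K(2) box by metis
 qed
 moreover have "pairwise disjnt D"
 proof -
  have "disjnt (interior K) (interior L)" if "K : D'" "L : D'" "interior K ~= interior L" for K L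
  proof -
   have "K : \<D>" "L : \<D>" "K ~= L" using that D'(1) by auto
   thus ?thesis using \<D>(3) unfolding pairwise_def disjnt_def by simp
  qed
  thus ?thesis unfolding D_def pairwise_image by (simp add: pairwise_def)
 qed
 moreover have sub: "\<Union>D <= U"
 proof
  fix x assume "x : \<Union>D"
  then obtain K where K: "K : D'" "x : interior K" unfolding D_def by auto
  hence "x : K" "K : \<D>" using interior_subset D'(1) by auto
  thus "x : U" using UD by auto
 qed
 moreover have "vl (\<Union>D) = vl (\<Union>D')"
 proof (rule measure_negligible_symdiff)
  have "K : lmeasurable" if K: "K : D'" for K
  proof -
   have "K : \<D>" using K D'(1) by auto
   then obtain c d where "K = cbox c d" using \<D>(2) by blast
   thus ?thesis by simp
  qed
  thus "\<Union>D' : lmeasurable" using D'(2) by (intro fmeasurable.finite_Union) auto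
  have "\<Union>D' - \<Union>D <= (UN K:D'. frontier K)" using closure_subset by (auto simp: D_def frontier_def)
  moreover have "negligible (UN K:D'. frontier K)"
  proof (rule negligible_Union)
   fix F assume "F : frontier ` D'"
   then obtain K where K: "F = frontier K" "K : \<D>" using D'(1) by auto
   thus "negligible F" using \<D>(2)[OF K(2)] negligible_convex_frontier convex_box(1) by metis
  qed (use D' in auto)
  ultimately have n: "negligible (\<Union>D' - \<Union>D)" using negligible_subset by blast
  have "\<Union>D - \<Union>D' = {}" using interior_subset by (auto simp: D_def)
  with n show "negligible (\<Union>D' - \<Union>D Un (\<Union>D - \<Union>D'))" by simp
 qed
 ultimately show ?thesis using that[of D] D'(3) by simp
qed

text \<open>\<open>A\<close> is exhausted from inside by finite unions of disjoint boxes. As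
  \<open>sumset\<close> is monotone, only the volume of the first set has to converge.\<close>

lemma brunn_minkowski_approx:
 fixes A B :: "'a::euclidean_space set"
 assumes A: "open A" "bounded A" "A ~= {}" and B: "open B" "bounded B"
  and D: "!!D. finite D ==> D ~= {} ==> (!!A. A : D ==> A ~= {} & (EX a b. A = box a b)) ==> pairwise disjnt D
   ==> brunn_minkowski (\<Union>D) B"
 shows "brunn_minkowski A B"
proof -
 let ?n = "DIM('a)"
 let ?m = "vl A"
 have m: "?m > 0" using vol_open_pos A by blast
 have lm: "A : lmeasurable" "sumset A B : lmeasurable"
  using A B by (auto intro!: lmeasurable_open bounded_sumset open_sumset)
 have "(root ?n (?m - inv_Suc k) + root ?n (vl B)) ^ ?n <= vl (sumset A B)"
  if k: "inv_Suc k < ?m" for k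
 proof -
  obtain D where D': "finite D" "!!A. A : D ==> A ~= {} & (EX a b. A = box a b)" "pairwise disjnt D" "\<Union>D <= A"
   "?m - inv_Suc k < vl (\<Union>D)"
   using open_approx_boxes[OF A(1,2), of "inv_Suc k"] by (metis inverse_positive_iff_positive of_nat_0_less_iff zero_less_Suc)
  have "D ~= {}" using D'(5) k by auto
  have "open (\<Union>D)" using D'(2) by (intro open_Union ballI) (metis open_box)
  have "(root ?n (?m - inv_Suc k) + root ?n (vl B)) ^ ?n
   <= (root ?n (vl (\<Union>D)) + root ?n (vl B)) ^ ?n"
   using D'(5) k by (intro power_mono add_mono) auto
  also have "... <= vl (sumset (\<Union>D) B)"
   using D[OF D'(1) \<open>D ~= {}\<close> D'(2,3)] by (simp add: brunn_minkowski_def)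
  also have "... <= vl (sumset A B)"
  proof (rule measure_mono_fmeasurable)
   show "sumset (\<Union>D) B : sets lebesgue"
    using open_sumset[OF \<open>open (\<Union>D)\<close>] by (simp add: sets_completionI_sets borel_open)
  qed (use lm sumset_mono[OF D'(4) subset_refl] in auto)
  finally show ?thesis .
 qed
 moreover have "EVS k. inv_Suc k < ?m"
  using LIMSEQ_inverse_real_of_nat m order_tendstoD(2) by blast
 ultimately have ev: "EVS k. (root ?n (?m - inv_Suc k) + root ?n (vl B)) ^ ?n <= vl (sumset A B)"
  by (auto elim: eventually_mono)
 have "(%k. (root ?n (?m - inv_Suc k) + root ?n (vl B)) ^ ?n)
  ----> (root ?n (?m - 0) + root ?n (vl B)) ^ ?n"
  using LIMSEQ_inverse_real_of_nat by (intro tendsto_intros)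
 thus ?thesis unfolding brunn_minkowski_def
  using tendsto_upperbound[OF _ ev] by simp
qed

theorem brunn_minkowski:
 fixes A B :: "'a::euclidean_space set"
 assumes A: "open A" "bounded A" "A ~= {}" and B: "open B" "bounded B" "B ~= {}"
 shows "(root DIM('a) (vl A) + root DIM('a) (vl B)) ^ DIM('a)
   <= vl (sumset A B)"
proof -
 define T1 where "T1 = {B :: 'a set. EX a b. B = box a b & B ~= {}}"
 \<comment> \<open>Here the open set is approximated by unions of boxes and the given box is the set
   being cut. By symmetry the result is the base case for two open sets.\<close>
 have box_open: "brunn_minkowski (box a b) B" if B: "open B" "bounded B" "B ~= {}" and ab: "box a b ~= {}" for a b and B :: "'a set"
 proof (subst brunn_minkowski_commute, rule brunn_minkowski_approx[OF B open_box bounded_box])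
  fix D :: "'a set set"
  assume D: "finite D" "D ~= {}" "!!A. A : D ==> A ~= {} & (EX a b. A = box a b)" "pairwise disjnt D"
  show "brunn_minkowski (\<Union>D) (box a b)"
  proof (rule brunn_minkowski_Union[where T = T1])
   show "B Int {x. w < x <.> i} : T1"
    if "B : T1" "i : Basis" "vl (B Int {x. w < x <.> i}) > 0" for B i w
   proof -
    obtain p q where "B = box p q" using \<open>B : T1\<close> unfolding T1_def by blast
    hence "EX c d. B Int {x. w < x <.> i} = box c d" using box_halfspace(1)[OF that(2), of p q w] by auto
    moreover have "B Int {x. w < x <.> i} ~= {}" using that(3) by auto
    ultimately show ?thesis unfolding T1_def by blast
   qed
   show "B Int {x. x <.> i < w} : T1"
    if "B : T1" "i : Basis" "vl (B Int {x. x <.> i < w}) > 0" for B i w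
   proof -
    obtain p q where "B = box p q" using \<open>B : T1\<close> unfolding T1_def by blast
    hence "EX c d. B Int {x. x <.> i < w} = box c d" using box_halfspace(2)[OF that(2), of p q w] by auto
    moreover have "B Int {x. x <.> i < w} ~= {}" using that(3) by auto
    ultimately show ?thesis unfolding T1_def by blast
   qed
   show "open B & bounded B & 0 < vl B" if "B : T1" for B
   proof -
    have "open B" "bounded B" "B ~= {}" using that by (auto simp: T1_def)
    thus ?thesis using vol_open_pos by blast
   qed
   show "brunn_minkowski (box c d) B" if "box c d ~= {}" "B : T1" for c d B
    using that brunn_minkowski_box unfolding T1_def by blast
  qed (use D ab in \<open>auto simp: T1_def\<close>)
 qed
 define T2 where "T2 = {B :: 'a set. open B & bounded B & B ~= {}}"
 have "brunn_minkowski A B"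
 proof (rule brunn_minkowski_approx[OF A B(1,2)])
  fix D :: "'a set set"
  assume D: "finite D" "D ~= {}" "!!A. A : D ==> A ~= {} & (EX a b. A = box a b)" "pairwise disjnt D"
  show "brunn_minkowski (\<Union>D) B"
  proof (rule brunn_minkowski_Union[where T = T2])
   show "B Int {x. w < x <.> i} : T2"
    if "B : T2" "i : Basis" "vl (B Int {x. w < x <.> i}) > 0" for B i w
    using that unfolding T2_def by (auto intro!: open_Int bounded_Int simp: open_halfspace_gt inner_commute[of _ i])
   show "B Int {x. x <.> i < w} : T2"
    if "B : T2" "i : Basis" "vl (B Int {x. x <.> i < w}) > 0" for B i w
    using that unfolding T2_def by (auto intro!: open_Int bounded_Int simp: open_halfspace_lt inner_commute[of _ i])
   show "open B & bounded B & 0 < vl B" if "B : T2" for B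
    using that vol_open_pos unfolding T2_def by blast
  qed (use D B box_open in \<open>auto simp: T2_def\<close>)
 qed
 thus ?thesis by (simp add: brunn_minkowski_def)
qed

section \<open>Continuously differentiable functions of bounded support\<close>

definition C1 :: "('a::euclidean_space => real) => ('a => 'a) => bool" where
 "C1 u Du <-> (ALL x. (u has_derivative (%h. Du x <.> h)) (at x)) & cont Du"

text \<open>Vanishing outside a ball, instead of a compact closure, is the form that passes directly
  to products, translates and gradients.\<close>

definition csupp :: "('a::real_normed_vector => 'b::zero) => bool" where
 "csupp u <-> (EX R. ALL x. R <= norm x --> u x = 0)"

lemma csuppI: "(!!x. R <= norm x ==> u x = 0) ==> csupp u"
 by (auto simp: csupp_def)

lemma csuppE:
 assumes "csupp u" obtains R where "R > 0" "!!x. R <= norm x ==> u x = 0"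
proof -
 obtain R where "!!x. R <= norm x ==> u x = 0" using assms by (auto simp: csupp_def)
 hence "max R 1 > 0" "!!x. max R 1 <= norm x ==> u x = 0" by auto
 thus ?thesis using that by blast
qed

lemma C1_has_derivative: "C1 u Du ==> (u has_derivative (%h. Du x <.> h)) (at x)"
 by (simp add: C1_def)

lemma C1_cont: "C1 u Du ==> cont u"
 by (metis C1_def continuous_at_imp_continuous_on has_derivative_continuous)

lemma C1_cont_grad: "C1 u Du ==> cont Du"
 by (simp add: C1_def)

lemma grad_unique:
 assumes "(u has_derivative (%h. a <.> h)) (at x)" "(u has_derivative (%h. b <.> h)) (at x)"
 shows "a = (b :: 'a::euclidean_space)"
proof -
 have "(%h. a <.> h) = (%h. b <.> h)" using has_derivative_unique assms by blast
 thus ?thesis by (metis vector_eq_rdot inner_commute)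
qed

lemma C1_grad_zero:
 assumes u: "C1 u Du" and S: "open S" "!!y. y : S ==> u y = c" "x : S"
 shows "Du x = 0"
proof -
 have "(u has_derivative (%h. 0)) (at x)"
  by (rule has_derivative_transform_within_open[OF _ S(1,3), of "%_. c"]) (use S in auto)
 thus ?thesis
  using grad_unique[OF C1_has_derivative[OF u, of x], of 0] by simp
qed

lemma C1_grad_zero_outside:
 assumes u: "C1 u Du" and R: "!!x. R <= norm x ==> u x = 0" and x: "R < norm x"
 shows "Du x = 0"
proof (rule C1_grad_zero[OF u])
 show "open {y. R < norm y}" by (intro open_Collect_less continuous_intros)
qed (use R x in auto)

lemma csupp_grad:
 assumes u: "C1 u Du" "csupp u" shows "csupp Du"
proof -
 obtain R where R: "!!x. R <= norm x ==> u x = 0" using u(2) by (auto simp: csupp_def)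
 thus ?thesis using C1_grad_zero_outside[OF u(1) R] by (intro csuppI[of "R + 1"]) auto
qed

lemma lint_csupp:
 fixes f :: "'a::euclidean_space => 'b::{banach,second_countable_topology}"
 assumes f: "cont f" and c: "csupp f"
 shows "lint f"
proof -
 obtain R where R: "!!x. R <= norm x ==> f x = 0" using c by (auto simp: csupp_def)
 have "lint (%x. ind (cball 0 R) x *R f x)"
  by (rule borel_integrable_compact) (auto intro: continuous_on_subset[OF f])
 moreover have "(%x. ind (cball 0 R) x *R f x) = f"
  using R by (auto simp: indicator_def fun_eq_iff)
 ultimately show ?thesis by simp
qed

lemma csupp_inner: "csupp f ==> csupp (%x. f x <.> e)"
 by (auto simp: csupp_def) (metis inner_zero_left)

lemma csupp_mult: "csupp f ==> csupp (%x. f x * g x :: real)" "csupp f ==> csupp (%x. g x * f x :: real)"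
 by (auto simp: csupp_def)

lemma csupp_norm: "csupp f ==> csupp (%x. norm (f x))"
 by (auto simp: csupp_def)

lemma csupp_add: "csupp f ==> csupp g ==> csupp (%x. f x + g x :: 'b::real_vector)"
proof -
 assume "csupp f" "csupp g"
 then obtain R R' where "!!x. R <= norm x ==> f x = 0" "!!x. R' <= norm x ==> g x = 0"
  by (auto simp: csupp_def)
 thus ?thesis by (intro csuppI[of "max R R'"]) auto
qed

lemma csupp_translate:
 assumes "csupp f" shows "csupp (%x. f (x + a))"
proof -
 obtain R where R: "!!x. R <= norm x ==> f x = 0" using assms by (auto simp: csupp_def)
 have "f (x + a) = 0" if "R + norm a <= norm x" for x
  using R[of "x + a"] that norm_triangle_ineq2[of x "-a"] by simp
 thus ?thesis by (rule csuppI)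
qed

lemma csupp_uniformly_continuous:
 fixes f :: "'a::euclidean_space => 'b::real_normed_vector"
 assumes f: "cont f" and c: "csupp f" and e: "e > 0"
 obtains d where "d > 0" "!!x y. norm (x - y) < d ==> norm (f x - f y) < e"
proof -
 obtain R where R: "R > 0" "!!x. R <= norm x ==> f x = 0" using c by (rule csuppE) blast
 have "uniformly_continuous_on (cball 0 (R + 1)) f"
  by (intro compact_uniformly_continuous continuous_on_subset[OF f]) auto
 then obtain d where d: "d > 0" "!!x y. x : cball 0 (R+1) ==> y : cball 0 (R+1) ==> dist y x < d ==> dist (f y) (f x) < e"
  unfolding uniformly_continuous_on_def using e by metis
 have "norm (f x - f y) < e" if xy: "norm (x - y) < min d 1" for x y
 proof (cases "x : cball 0 (R+1) & y : cball 0 (R+1)")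
  case True
  thus ?thesis using d(2)[of y x] xy by (simp add: dist_norm)
 next
  case False
  hence "R <= norm x & R <= norm y"
   using xy norm_triangle_ineq3[of x y] by auto
  thus ?thesis using R(2) e by simp
 qed
 thus ?thesis using that[of "min d 1"] d(1) by auto
qed

text \<open>Mean value inequality for \<open>u\<close> minus its linearisation at \<open>x\<close>.
  Since \<open>Du\<close> is uniformly continuous, \<open>d\<close> does not depend on
  \<open>x\<close>, and the estimate can be integrated.\<close>

lemma C1_uniform_remainder:
 assumes u: "C1 u Du" "csupp u" and e: "e > 0"
 obtains d where "d > 0" "!!x h. norm h < d ==> <|u (x + h) - u x - Du x <.> h|> <= e * norm h"
proof -
 obtain d where d: "d > 0" "!!x y. norm (x - y) < d ==> norm (Du x - Du y) < e"
  using csupp_uniformly_continuous[OF C1_cont_grad[OF u(1)] csupp_grad[OF u] e] by blast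
 have "<|u (x + h) - u x - Du x <.> h|> <= e * norm h" if h: "norm h < d" for x h
 proof -
  have "norm ((u (x + h) - Du x <.> (x + h)) - (u x - Du x <.> x)) <= e * norm (x + h - x)"
  proof (rule differentiable_bound[of "ball x d" "%y. u y - Du x <.> y" "%y k. Du y <.> k - Du x <.> k"])
   show "((%y. u y - Du x <.> y) has_derivative (%k. Du y <.> k - Du x <.> k)) (at y within ball x d)" for y
    by (intro derivative_intros has_derivative_at_withinI[OF C1_has_derivative[OF u(1)]])
   show "onorm (%k. Du y <.> k - Du x <.> k) <= e" if "y : ball x d" for y
   proof (rule onorm_bound)
    fix k
    have "norm (Du y - Du x) < e" using d(2) that by (simp add: dist_norm norm_minus_commute)
    have "<|(Du y - Du x) <.> k|> <= norm (Du y - Du x) * norm k" by (rule Cauchy_Schwarz_ineq2)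
    also have "... <= e * norm k" using \<open>norm (Du y - Du x) < e\<close> by (intro mult_right_mono) auto
    finally show "norm (Du y <.> k - Du x <.> k) <= e * norm k" by (simp add: inner_diff_left)
   qed (use e in auto)
  qed (use h d in \<open>auto simp: dist_norm\<close>)
  thus ?thesis by (simp add: inner_add_right algebra_simps)
 qed
 thus ?thesis using that d(1) by blast
qed

lemma C1_add: "C1 u Du ==> C1 v Dv ==> C1 (%x. u x + v x) (%x. Du x + Dv x)"
 unfolding C1_def by (auto intro!: continuous_intros derivative_eq_intros simp: inner_add_left)

lemma C1_mult: "C1 u Du ==> C1 v Dv ==> C1 (%x. u x * v x) (%x. u x *R Dv x + v x *R Du x)"
 using C1_cont[of u Du] C1_cont[of v Dv]
 unfolding C1_def by (auto intro!: continuous_intros derivative_eq_intros simp: inner_add_left)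

lemma C1_compose:
 assumes "C1 u Du" "!!t. (F hrd F' t) (at t)" "cont F'"
 shows "C1 (%x. F (u x)) (%x. F' (u x) *R Du x)"
 unfolding C1_def
proof safe
 fix x
 have "(F has_derivative (%h. F' (u x) * h)) (at (u x))"
  using assms(2)[of "u x"] by (simp add: has_field_derivative_def)
 from has_derivative_compose[OF C1_has_derivative[OF assms(1)] this]
 show "((%x. F (u x)) has_derivative (%h. (F' (u x) *R Du x) <.> h)) (at x)" by simp
 show "cont (%x. F' (u x) *R Du x)"
  using C1_cont[OF assms(1)] C1_cont_grad[OF assms(1)] continuous_on_compose2[OF assms(3)]
  by (intro continuous_intros) auto
qed

lemma C1_translate:
 assumes "C1 u Du" shows "C1 (%x. u (x + a)) (%x. Du (x + a))"
 unfolding C1_def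
proof safe
 fix x
 have "((%x. x + a) has_derivative (%h. h)) (at x)" by (auto intro!: derivative_eq_intros)
 from has_derivative_compose[OF this C1_has_derivative[OF assms]]
 show "((%x. u (x + a)) has_derivative (%h. Du (x + a) <.> h)) (at x)" .
 show "cont (%x. Du (x + a))"
  by (intro continuous_on_compose2[OF C1_cont_grad[OF assms]] continuous_intros) auto
qed

lemma C1_const: "C1 (%x. c) (%x. 0)"
 by (auto simp: C1_def)

lemma C1_inner: "C1 (%x. x <.> a) (%x. a)"
 unfolding C1_def by (auto intro!: derivative_eq_intros simp: inner_commute)

lemma C1_norm_sq: "C1 (%x. (norm (x - p))^2) (%x. 2 *R (x - p))"
 unfolding C1_def power2_norm_eq_inner
 by (auto intro!: continuous_intros derivative_eq_intros simp: inner_commute algebra_simps)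

section \<open>Integrals over translates\<close>

lemma integral_translate:
 fixes f :: "'a::euclidean_space => 'b::{banach,second_countable_topology}"
 assumes "f : bm"
 shows "(LBINT x. f (x + a)) = (LBINT x. f x)"
proof -
 have "(LBINT x. f x) = (LINT x|distr lborel borel ((+) a). f x)" by (simp add: lborel_distr_plus)
 also have "... = (LBINT x. f (a + x))" using assms by (intro integral_distr) auto
 finally show ?thesis by (simp add: add.commute)
qed

lemma borel_csupp:
 "cont f ==> f : borel_measurable (borel :: 'a::euclidean_space measure)"
 by (rule borel_measurable_continuous_onI)

lemma sint_csupp:
 fixes f :: "'a::euclidean_space => 'b::{banach,second_countable_topology}"
 assumes "cont f" "csupp f" "A : bor"
 shows "sint A f"
 unfolding set_integrable_def
 using integrable_mult_indicator[of A lborel f] lint_csupp[OF assms(1,2)] assms(3) by simp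

lemma set_integral_translate:
 fixes f :: "'a::euclidean_space => 'b::{banach,second_countable_topology}"
 assumes "f : bm" "A : bor"
 shows "(LBINT x:A. f (x + a)) = (LBINT x:{x. x - a : A}. f x)"
proof -
 have m: "{x. x - a : A} : bor"
  using measurable_sets[of "%x. x - a" borel borel A] assms(2) by (simp add: vimage_def)
 have "(LBINT x. (%x. ind {x. x - a : A} x *R f x) (x + a)) = (LBINT x. ind {x. x - a : A} x *R f x)"
  using assms m by (intro integral_translate) auto
 thus ?thesis by (simp add: sli_def indicator_def)
qed

text \<open>Differentiation under the integral over an arbitrary Borel set: the remainder is
  uniformly small and, for small \<open>t\<close>, supported in one fixed ball.\<close>

lemma translated_integral_deriv:
 fixes u :: "'a::euclidean_space => real"
 assumes u: "C1 u Du" "csupp u" and A: "A : bor"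
 shows "((%t. LBINT x:A. u (x + t *R e)) hrd (LBINT x:A. Du x <.> e)) (at 0)"
proof -
 obtain R where R: "R > 0" "!!x. R <= norm x ==> u x = 0" using u(2) by (rule csuppE) blast
 let ?B = "ball (0::'a) (R + norm e + 1)"
 define m where "m = vol ?B"
 have cu: "cont u" and cD: "cont (%x. Du x <.> e)"
  using C1_cont[OF u(1)] C1_cont_grad[OF u(1)] by (auto intro!: continuous_intros)
 have i1: "sint A (%x. u (x + t *R e))" for t
  using cu by (intro sint_csupp csupp_translate u A continuous_on_compose2[OF cu] continuous_intros) auto
 have i2: "sint A u" and i3: "sint A (%x. Du x <.> e)"
  using sint_csupp[OF cu u(2) A] sint_csupp[OF cD csupp_inner[OF csupp_grad[OF u]] A] by auto
 have mB: "lint (ind ?B :: 'a => real)"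
  using emeasure_bounded_finite[of ?B] by (subst integrable_indicator_iff) auto
 have "EX d>0. ALL t. <|t|> < d --> <|(LBINT x:A. u (x + t *R e)) - (LBINT x:A. u x) - t * (LBINT x:A. Du x <.> e)|> <= ep * <|t|>"
  if "ep > 0" for ep
 proof -
  \<comment> \<open>Integrating \<open>e' * norm (t *R e)\<close> over the ball of volume
    \<open>m\<close> then gives at most \<open>ep * <|t|>\<close>; the summands 1 keep the
    denominator positive.\<close>
  define e' where "e' = ep / ((norm e + 1) * (m + 1))"
  have m0: "m >= 0" by (simp add: m_def)
  have "e' > 0" using that m0 by (simp add: e'_def add_nonneg_pos)
  then obtain d where d: "d > 0" "!!x h. norm h < d ==> <|u (x + h) - u x - Du x <.> h|> <= e' * norm h"
   using C1_uniform_remainder[OF u] by blast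
  let ?d = "min 1 (d / (norm e + 1))"
  have "<|(LBINT x:A. u (x + t *R e)) - (LBINT x:A. u x) - t * (LBINT x:A. Du x <.> e)|> <= ep * <|t|>"
   if t: "<|t|> < ?d" for t
  proof -
   have "norm (t *R e) <= <|t|> * (norm e + 1)" by (simp add: mult_left_mono)
   also have "... < d" using t by (simp add: pos_less_divide_eq add_nonneg_pos)
   finally have td: "norm (t *R e) < d" .
   let ?f = "%x. u (x + t *R e) - u x - t * (Du x <.> e)"
   have bd: "<|ind A x *R ?f x|> <= e' * (<|t|> * norm e) * ind ?B x" for x
   proof (cases "x : ?B")
    case True
    thus ?thesis using d(2)[OF td, of x] by (auto simp: indicator_def)
   next
    case False
    hence nx: "R + norm e + 1 <= norm x" by simp
    have "norm (t *R e) <= norm e" using t by (simp add: mult_left_le_one_le)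
    hence "R <= norm (x + t *R e)" using nx norm_triangle_ineq2[of x "- t *R e"] by simp
    moreover have "R <= norm x" using nx by (smt (verit) norm_ge_zero)
    moreover have "Du x = 0" using C1_grad_zero_outside[OF u(1), of R x] R(2) nx by (smt (verit) norm_ge_zero)
    ultimately have "?f x = 0" using R(2) by simp
    thus ?thesis using False by simp
   qed
   have I: "(LBINT x:A. u (x + t *R e)) - (LBINT x:A. u x) - t * (LBINT x:A. Du x <.> e) = (LBINT x:A. ?f x)"
    using i1[of t] i2 i3 by (simp add: set_integral_diff set_integrable_mult_right)
   have "<|LBINT x:A. ?f x|> <= (LBINT x. <|ind A x *R ?f x|>)"
    unfolding sli_def by (rule integral_abs_bound)
   also have "... <= (LBINT x. e' * (<|t|> * norm e) * ind ?B x)"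
    using mB bd \<open>e' > 0\<close> by (intro integral_mono' integrable_mult_right) auto
   also have "... = e' * (<|t|> * norm e) * m" by (simp add: m_def)
   also have "... <= e' * (<|t|> * (norm e + 1)) * (m + 1)"
    using \<open>e' > 0\<close> m0 by (intro mult_mono) (auto simp: mult_left_mono)
   also have "... = ep * <|t|>"
    using m0 by (simp add: e'_def) (smt (verit) norm_ge_zero nonzero_eq_divide_eq)
   finally show ?thesis using I by simp
  qed
  moreover have "?d > 0" using d(1) by (simp add: add_nonneg_pos)
  ultimately show ?thesis by blast
 qed
 hence H: "ALL ep>0. EX d>0. ALL t. norm (t - 0) < d --> norm ((LBINT x:A. u (x + t *R e)) - (LBINT x:A. u (x + 0 *R e)) - (LBINT x:A. Du x <.> e) * (t - 0)) <= ep * norm (t - 0)"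
  by (simp add: mult.commute)
 show ?thesis
  unfolding has_field_derivative_def has_derivative_at_alt using H by (simp add: bounded_linear_mult_right)
qed

lemma integral_grad_zero:
 fixes u :: "'a::euclidean_space => real"
 assumes u: "C1 u Du" "csupp u"
 shows "(LBINT x. Du x <.> e) = 0"
proof -
 have "((%t. LBINT x:UNIV. u (x + t *R e)) hrd (LBINT x:UNIV. Du x <.> e)) (at 0)"
  by (rule translated_integral_deriv[OF u]) simp
 moreover have "(%t. LBINT x:UNIV. u (x + t *R e)) = (%t. LBINT x. u x)"
  using integral_translate[of u] borel_csupp[OF C1_cont[OF u(1)]] by (simp add: sli_def)
 ultimately show ?thesis
  using DERIV_unique[OF _ DERIV_const] by (auto simp: sli_def)
qed

section \<open>A Wulff-type inequality in cones\<close>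

lemma nn_integral_layer_cake:
 fixes f :: "'a::euclidean_space => real"
 assumes f[measurable]: "f : bm"
 shows "(NN x. ennreal (f x)) = (NN s. ind {0<..} s * em {x. s < f x})"
proof -
 let ?h = "%(x, s). ind {p :: 'a \<times> real. 0 < snd p & snd p < f (fst p)} (x, s) :: ennreal"
 have "{p : space (lborel \<Otimes>\<^sub>M lborel :: ('a \<times> real) measure). 0 < snd p & snd p < f (fst p)} : sets (lborel \<Otimes>\<^sub>M lborel)"
  by measurable
 hence [measurable]: "{p :: 'a \<times> real. 0 < snd p & snd p < f (fst p)} : sets (lborel \<Otimes>\<^sub>M lborel)"
  by (simp add: space_pair_measure)
 have h: "?h : borel_measurable (lborel \<Otimes>\<^sub>M lborel)" by measurable
 have "(NN x. ennreal (f x)) = (NN x. (NN s. ?h (x, s)))"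
 proof (rule nn_integral_cong)
  fix x
  have "(NN s. ?h (x, s)) = (NN s. ind {0<..<f x} s)"
   by (intro nn_integral_cong) (auto simp: indicator_def)
  also have "... = ennreal (f x)"
   by (cases "0 <= f x") (auto simp: ennreal_neg)
  finally show "ennreal (f x) = (NN s. ?h (x, s))" by simp
 qed
 also have "... = (NN s. (NN x. ?h (x, s)))"
  using lborel_pair.Fubini[OF h] by simp
 also have "... = (NN s. ind {0<..} s * em {x. s < f x})"
 proof (rule nn_integral_cong)
  fix s :: real
  have "(NN x. ?h (x, s)) = (NN x. ind {0<..} s * ind {x. s < f x} x)"
   by (intro nn_integral_cong) (auto simp: indicator_def)
  also have "... = ind {0<..} s * em {x. s < f x}"
   by (subst nn_integral_cmult) auto
  finally show "(NN x. ?h (x, s)) = ind {0<..} s * em {x. s < f x}" .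
 qed
 finally show ?thesis .
qed


text \<open>Bernoulli's inequality extracts the first order in \<open>t\<close> of the
  Brunn-Minkowski inequality, a term with the power (n-1)/n of \<open>vol A\<close>. This power is
  bounded below by a multiple of \<open>min (vol A) v\<close>, since a linear expression can be
  summed over superlevel sets.\<close>

lemma brunn_minkowski_dilate:
 fixes A K :: "'a::euclidean_space set" and t v :: real
 assumes A: "open A" "bounded A" and K: "open K" "bounded K" "K ~= {}" and t: "t > 0" and v: "v > 0"
 shows "vol A + DIM('a) * t * root DIM('a) (vol K / v) * min (vol A) v
  <= vol (sumset A (scaleR t ` K))"
proof (cases "A = {}")
 case True
 thus ?thesis using v by (simp add: sumset_def)
next
 case False
 let ?n = "DIM('a)" and ?m = "vol A" and ?k = "vol K"
 have tK: "open (scaleR t ` K)" "bounded (scaleR t ` K)" "scaleR t ` K ~= {}"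
  using K t by (auto intro: open_scaling bounded_scaling)
 have m: "?m > 0" using vol_open_pos[OF A False] A(1) by (simp add: measure_completion)
 have "vl (scaleR t ` K) = <|t|> ^ ?n * vl K"
  using measure_lebesgue_affine[of t 0 K] by simp
 hence mtK: "vol (scaleR t ` K) = t ^ ?n * ?k"
  using t K tK by (simp add: measure_completion borel_open)
 define r where "r = root ?n ?m"
 define kp where "kp = root ?n ?k"
 have r: "r > 0" "r ^ ?n = ?m" "kp >= 0" using m by (auto simp: r_def kp_def)
 have n0: "?n = Suc (?n - 1)" by simp
 have rr: "r ^ ?n = r * r ^ (?n - 1)" by (metis n0 power_Suc)
 have "(root ?n ?m + root ?n (t ^ ?n * ?k)) ^ ?n <= vol (sumset A (scaleR t ` K))"
  using brunn_minkowski[OF A False tK] A(1) K(1) tK(1) mtK open_sumset[OF A(1), of "scaleR t ` K"]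
  by (simp add: measure_completion borel_open)
 also have "root ?n (t ^ ?n * ?k) = t * kp" using t by (simp add: real_root_mult real_root_power_cancel kp_def)
 finally have BM: "(r + t * kp) ^ ?n <= vol (sumset A (scaleR t ` K))" by (simp add: r_def)
 have "?m + ?n * t * kp * r ^ (?n - 1) = r ^ ?n * (1 + ?n * (t * kp / r))"
  using r(1) rr unfolding r(2)[symmetric] by (simp add: field_simps)
 also have "... <= r ^ ?n * (1 + t * kp / r) ^ ?n"
  using r t by (intro mult_left_mono Bernoulli_inequality) (auto intro: order_trans[of _ 0])
 also have "... = (r + t * kp) ^ ?n" using r(1) by (simp add: power_mult_distrib[symmetric] field_simps)
 finally have 1: "?m + ?n * t * kp * r ^ (?n - 1) <= vol (sumset A (scaleR t ` K))" using BM by simp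
 \<comment> \<open>Up to \<open>v\<close> the concave power lies above its chord through 0; beyond
   \<open>v\<close> it is increasing.\<close>
 have "min ?m v / root ?n v <= r ^ (?n - 1)"
 proof (cases "?m <= v")
  case True
  have "?m / root ?n v <= ?m / r" using True m v by (intro divide_left_mono) (auto simp: r_def)
  also have "?m / r = r ^ (?n - 1)" using r(1) rr unfolding r(2)[symmetric] by simp
  finally show ?thesis using True by simp
 next
  case False
  have "v / root ?n v = root ?n v ^ (?n - 1)"
  proof -
   have "v = root ?n v ^ Suc (?n - 1)" using v by (subst n0[symmetric]) simp
   thus ?thesis using v by (metis nonzero_mult_div_cancel_left power_Suc real_root_gt_zero DIM_positive less_irrefl)
  qed
  also have "... <= r ^ (?n - 1)" using False v by (intro power_mono) (auto simp: r_def)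
  finally show ?thesis using False by simp
 qed
 hence "?n * t * kp * (min ?m v / root ?n v) <= ?n * t * kp * r ^ (?n - 1)"
  using t r(3) by (intro mult_left_mono) auto
 thus ?thesis using 1 by (simp add: real_root_divide kp_def)
qed

text \<open>The Brunn--Minkowski inequality is applied to the superlevel sets of \<open>u\<close>: those of
 \<open>u + t * g\<close> contain, up to an error, the superlevel sets of \<open>u\<close> enlarged by \<open>t * K\<close>. The
 inequality is the derivative at \<open>t = 0\<close> of the resulting inequality between integrals.\<close>

theorem wulff_inequality:
 fixes u g :: "'a::euclidean_space => real"
 assumes u: "C1 u Du" "csupp u" "!!x. 0 <= u x"
  and C: "open C" and K: "open K" "bounded K" "K ~= {}"
  and cone: "!!x y t. x : C ==> y : K ==> t > 0 ==> x + t *R y : C"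
  and g: "cont g" "csupp g" "!!x y. x : C ==> y : K ==> - (Du x <.> y) <= g x"
  and E: "E : bor" "E <= C" "vol E > 0" "fin E"
 shows "DIM('a) * root DIM('a) (vol K / vol E) * (LBINT x:E. min (u x) 1)
  <= (LBINT x:C. g x)"
proof -
 let ?n = "DIM('a)" and ?v = "vol E"
 obtain R1 where R1: "R1 > 0" "!!x. R1 <= norm x ==> u x = 0" using u(2) by (rule csuppE) blast
 obtain R2 where R2: "R2 > 0" "!!x. R2 <= norm x ==> g x = 0" using g(2) by (rule csuppE) blast
 define R where "R = max R1 R2"
 obtain rh where rh: "rh > 0" "!!y. y : K ==> norm y <= rh" using K(2) bounded_pos by blast
 let ?B = "ball (0::'a) (R + rh)"
 have cu: "cont u" by (rule C1_cont[OF u(1)])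
 note [measurable] = borel_csupp[OF cu] borel_csupp[OF g(1)] E(1) borel_open[OF C]
 have mB: "sint C (ind ?B :: 'a => real)"
 proof -
  have "lint (ind ?B :: 'a => real)"
   using emeasure_bounded_finite[of ?B] by (subst integrable_indicator_iff) auto
  thus ?thesis unfolding set_integrable_def
   using integrable_mult_indicator[of C lborel "ind ?B :: 'a => real"] C by auto
 qed
 define mB where "mB = (LBINT x:C. ind ?B x :: real)"
 have iu: "sint C u" and ig: "sint C g"
  using sint_csupp[OF cu u(2)] sint_csupp[OF g(1,2)] C by auto
 define mu where "mu x = min (u x) 1" for x
 have cmu: "cont mu" unfolding mu_def using cu by (intro continuous_intros)
 have smu: "csupp mu" using R1 by (intro csuppI[of R1]) (auto simp: mu_def)
 have imu: "sint E mu" by (rule sint_csupp[OF cmu smu]) (use E in auto)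
 define c where "c = ?n * root ?n (vol K / ?v)"
 have c0: "c >= 0" by (simp add: c_def)
 \<comment> \<open>\<open>ea\<close> dominates the first-order remainder of \<open>u\<close> divided
   by the step \<open>t\<close>; it is multiplied by the finite measure \<open>mB\<close> and
   removed at the end.\<close>
 have key: "c * (LBINT x:E. mu x) <= (LBINT x:C. g x) + ea * mB" if ea: "ea > 0" for ea
 proof -
  obtain d where d: "d > 0" "!!x h. norm h < d ==> <|u (x + h) - u x - Du x <.> h|> <= (ea / rh) * norm h"
   using C1_uniform_remainder[OF u(1,2), of "ea / rh"] ea rh by auto
  define t where "t = min 1 (d / (2 * rh))"
  have t: "0 < t" "t <= 1" "t * rh < d" using d rh
   by (auto simp: t_def min_def field_simps)
  have step: "u (x - t *R y) <= u x + t * (g x + ea)" if "x : C" "y : K" for x y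
  proof -
   have "norm (t *R y) <= t * rh" using t rh(2)[OF that(2)] by simp
   hence n: "norm (- (t *R y)) < d" "norm (- (t *R y)) <= t * rh" using t(3) by auto
   have "<|u (x + - (t *R y)) - u x - Du x <.> - (t *R y)|> <= (ea / rh) * norm (- (t *R y))"
    by (rule d(2)[OF n(1)])
   also have "... <= (ea / rh) * (t * rh)" using n(2) ea rh by (intro mult_left_mono) auto
   also have "... = t * ea" using rh by simp
   finally have "u (x - t *R y) <= u x + t * (- (Du x <.> y)) + t * ea" by simp
   moreover have "t * (- (Du x <.> y)) <= t * g x" using g(3)[OF that] t by (intro mult_left_mono) auto
   ultimately show ?thesis by (simp add: algebra_simps)
  qed
  \<comment> \<open>First-order upper bound for the values \<open>u (x - t *R y)\<close>. The error
    is confined to a ball containing all points reached from the support, so \<open>w\<close> stays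
    integrable.\<close>
  define w where "w x = ind C x * (u x + t * (g x + ea * ind ?B x))" for x
  have [measurable]: "?B : bor" by simp
  have [measurable]: "w : bm" unfolding w_def by measurable
  obtain y0 where y0: "y0 : K" using K(3) by blast
  \<comment> \<open>On the ball \<open>w\<close> dominates a value of \<open>u\<close> by
    \<open>step\<close>; outside of it \<open>u\<close>, \<open>g\<close> and the error
    vanish.\<close>
  have w0: "0 <= w x" for x
  proof (cases "x : C")
   case True
   show ?thesis
   proof (cases "x : ?B")
    case True
    thus ?thesis using step[OF \<open>x : C\<close> y0] u(3)[of "x - t *R y0"] by (auto simp: w_def indicator_def)
   next
    case False
    hence "R1 <= norm x" "R2 <= norm x" using rh(1) by (auto simp: R_def)
    thus ?thesis using R1(2) R2(2) False by (simp add: w_def)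
   qed
  qed (simp add: w_def)
  have level: "ennreal (c * t) * em {x. s < ind E x * mu x} + em {x. s < ind C x * u x} <= em {x. s < w x}"
   if s: "s > 0" for s
  proof -
   define A where "A = {x : C. s < u x}"
   have A: "{x. s < ind C x * u x} = A" using s by (auto simp: A_def indicator_def)
   have oA: "open A"
   proof -
    have "A = C Int {x. s < u x}" by (auto simp: A_def)
    thus ?thesis using C open_Collect_less[OF continuous_on_const cu] by (simp add: open_Int)
   qed
   have AR: "norm x < R" if "x : A" for x
    using that R1(2)[of x] s by (auto simp: A_def R_def) (smt (verit))
   hence bA: "bounded A" by (auto simp: bounded_iff intro: less_imp_le)
   let ?S = "sumset A (scaleR t ` K)"
   have sub: "?S <= {x. s < w x}"
   proof
    fix x assume "x : ?S"
    then obtain x0 y where xy: "x0 : A" "y : K" "x = x0 + t *R y" by (auto simp: sumset_def)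
    have xC: "x : C" using cone[of x0 y t] xy t by (auto simp: A_def)
    have "norm (t *R y) <= 1 * rh" using t rh(2)[OF xy(2)] unfolding norm_scaleR by (intro mult_mono) auto
    hence xB: "x : ?B" using AR[OF xy(1)] norm_triangle_ineq[of x0 "t *R y"] xy(3) by simp
    have "s < u (x - t *R y)" using xy by (auto simp: A_def)
    also have "... <= u x + t * (g x + ea)" by (rule step[OF xC xy(2)])
    also have "... = w x" using xC xB by (simp add: w_def)
    finally show "x : {x. s < w x}" by simp
   qed
   have oS: "open ?S" by (rule open_sumset[OF oA])
   have bS: "bounded ?S" using bounded_sumset[OF bA bounded_scaling[OF K(2)]] .
   have fin: "fin A" "fin ?S"
    using emeasure_bounded_finite[OF bA] emeasure_bounded_finite[OF bS] oA oS by auto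
   have EE: "{x. s < ind E x * mu x} <= A Int E" using s E(2) by (auto simp: A_def indicator_def mu_def split: if_splits)
   have mE: "{x. s < ind E x * mu x} : sets lborel" unfolding mu_def by measurable
   \<comment> \<open>The superlevel set of \<open>min u 1\<close> on \<open>E\<close> lies both in
     \<open>A\<close> and in \<open>E\<close>, so its volume may replace the truncated volume of
     \<open>A\<close>.\<close>
   have "vol {x. s < ind E x * mu x} <= min (vol A) ?v"
    using EE mE fin E oA by (auto intro!: measure_mono_fmeasurable simp: fmeasurable_def borel_open)
   hence "c * t * vol {x. s < ind E x * mu x} <= c * t * min (vol A) ?v"
    using c0 t by (intro mult_left_mono) auto
   hence "c * t * vol {x. s < ind E x * mu x} + vol A <= vol ?S"
    using brunn_minkowski_dilate[OF oA bA K t(1) E(3)] by (simp add: c_def algebra_simps)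
   hence "ennreal (c * t * vol {x. s < ind E x * mu x} + vol A) <= ennreal (vol ?S)"
    by (rule ennreal_leI)
   moreover have "em {x. s < ind E x * mu x} < \<infinity>"
    using emeasure_mono[of "{x. s < ind E x * mu x}" A lborel] EE fin(1) oA by (auto intro: le_less_trans)
   ultimately have "ennreal (c * t) * em {x. s < ind E x * mu x} + em A <= em ?S"
    using fin c0 t by (simp add: emeasure_eq_ennreal_measure ennreal_plus ennreal_mult less_top[symmetric])
   also have "... <= em {x. s < w x}" using sub by (intro emeasure_mono) auto
   finally show ?thesis unfolding A .
  qed
  have "ennreal (c * t) * (NN x. ennreal (ind E x * mu x)) + (NN x. ennreal (ind C x * u x))
   <= (NN x. ennreal (w x))"
  proof -
   have m1: "(%s. ind {0<..} s * em {x. s < f x}) : borel_measurable lborel"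
    if [measurable]: "f : bm" for f :: "'a => real"
   proof -
    have "{p : space (lborel \<Otimes>\<^sub>M lborel :: (real \<times> 'a) measure). fst p < f (snd p)} : sets (lborel \<Otimes>\<^sub>M lborel)"
     by measurable
    hence Q: "{p :: real \<times> 'a. fst p < f (snd p)} : sets (lborel \<Otimes>\<^sub>M lborel)" by (simp add: space_pair_measure)
    have "(%s. em (Pair s -` {p :: real \<times> 'a. fst p < f (snd p)})) : borel_measurable lborel"
     by (rule lborel.measurable_emeasure_Pair[OF Q])
    thus ?thesis by (simp add: vimage_def)
   qed
   have mm: "(%x. ind E x * mu x) : bm" "(%x. ind C x * u x) : bm"
    unfolding mu_def by measurable
   have "ennreal (c * t) * (NN x. ennreal (ind E x * mu x)) + (NN x. ennreal (ind C x * u x))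
    = (NN s. ennreal (c * t) * (ind {0<..} s * em {x. s < ind E x * mu x}) + ind {0<..} s * em {x. s < ind C x * u x})"
    unfolding nn_integral_layer_cake[OF mm(1)] nn_integral_layer_cake[OF mm(2)]
    using m1[OF mm(1)] m1[OF mm(2)] by (subst nn_integral_add) (auto simp: nn_integral_cmult)
   also have "... <= (NN s. ind {0<..} s * em {x. s < w x})"
    using level by (intro nn_integral_mono) (auto simp: indicator_def)
   also have "... = (NN x. ennreal (w x))"
    by (rule nn_integral_layer_cake[symmetric]) simp
   finally show ?thesis .
  qed
  moreover have "lint (%x. ind E x * mu x)" "lint (%x. ind C x * u x)"
   using imu iu by (auto simp: set_integrable_def)
  moreover have iw: "lint w"
   using set_integral_add(1)[OF iu set_integrable_mult_right[of t, OF set_integral_add(1)[OF ig set_integrable_mult_right[of ea, OF mB]]]]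
   by (simp add: set_integrable_def w_def[abs_def])
  ultimately have "ennreal (c * t) * ennreal (LBINT x. ind E x * mu x) + ennreal (LBINT x. ind C x * u x) <= ennreal (LBINT x. w x)"
   using w0 u(3) by (subst (asm) (1 2 3) nn_integral_eq_integral) (auto simp: mu_def)
  moreover have nn: "0 <= (LBINT x. ind E x * mu x)" "0 <= (LBINT x. ind C x * u x)" "0 <= (LBINT x. w x)"
   using u(3) w0 by (auto intro!: integral_nonneg_AE simp: mu_def)
  ultimately have "c * t * (LBINT x. ind E x * mu x) + (LBINT x. ind C x * u x) <= (LBINT x. w x)"
   using c0 t by (simp add: ennreal_mult[symmetric] ennreal_plus[symmetric] del: ennreal_plus)
  also have "(LBINT x. w x) = (LBINT x:C. u x + t * (g x + ea * ind ?B x))"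
   by (simp add: sli_def w_def)
  also have "... = (LBINT x:C. u x) + t * ((LBINT x:C. g x) + ea * mB)"
   using iu ig mB by (simp add: mB_def set_integral_add set_integrable_mult_right)
  finally have "t * (c * (LBINT x:E. mu x)) <= t * ((LBINT x:C. g x) + ea * mB)"
   by (simp add: sli_def mult_ac)
  thus ?thesis using t(1) by simp
 qed
 have mB0: "mB >= 0" unfolding mB_def sli_def by (intro integral_nonneg_AE) auto
 have "c * (LBINT x:E. mu x) <= (LBINT x:C. g x)"
 proof (rule field_le_epsilon)
  fix e :: real assume e: "e > 0"
  have "c * (LBINT x:E. mu x) <= (LBINT x:C. g x) + e / (mB + 1) * mB"
   using key[of "e / (mB + 1)"] e mB0 by simp
  also have "e / (mB + 1) * mB <= e" using e mB0 by (simp add: field_simps)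
  finally show "c * (LBINT x:E. mu x) <= (LBINT x:C. g x) + e" by simp
 qed
 thus ?thesis by (simp add: c_def mu_def)
qed

section \<open>Sections of sets by parallel hyperplanes\<close>

lemma halfspace_borel [measurable]:
 fixes a :: "'a::euclidean_space"
 shows "{x. c < x <.> a} : bor" "{x. x <.> a < c} : bor"
 by (simp_all add: open_halfspace_gt open_halfspace_lt inner_commute[of _ a])

lemma section_continuous:
 fixes E :: "'a::euclidean_space set"
 assumes E: "E : bor" "fin E" and a: "a ~= 0"
 shows "cont (%s. vol (E Int {x. s < x <.> a}))"
proof -
 have "E : lmeasurable" using E by (simp add: fmeasurable_def)
 from measure_halfspace_continuous[OF this a] show ?thesis
  using E halfspace_borel by (simp add: measure_completion)
qed

lemma section_split:
 fixes E :: "'a::euclidean_space set"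
 assumes E: "E : bor" "fin E" and a: "a ~= 0"
 shows "vol (E Int {x. x <.> a < s}) = vol E - vol (E Int {x. s < x <.> a})"
proof -
 have "E : lmeasurable" using E by (simp add: fmeasurable_def)
 from halfspace_split[OF this a, of s] show ?thesis
  using E halfspace_borel by (simp add: measure_completion)
qed

lemma section_mono:
 fixes E :: "'a::euclidean_space set"
 assumes E: "E : bor" "fin E" and "s <= s'"
 shows "vol (E Int {x. s' < x <.> a}) <= vol (E Int {x. s < x <.> a})"
proof (rule measure_mono_fmeasurable)
 have "em (E Int {x. s < x <.> a}) <= em E" using E by (intro emeasure_mono) auto
 thus "E Int {x. s < x <.> a} : fmeasurable lborel" using E by (auto simp: fmeasurable_def)
qed (use assms in auto)

lemma section_limits:
 fixes E :: "'a::euclidean_space set"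
 assumes E: "E : bor" "fin E" and c: "c > 0"
 obtains s where "vol (E Int {x. s < x <.> a}) < c" "vol E - c < vol (E Int {x. - s < x <.> a})"
proof -
 have fE: "E : fmeasurable lborel" using E by (simp add: fmeasurable_def)
 have "(%n. vol (E Int ball 0 (real n))) ----> vol (UN n. E Int ball 0 (real n))"
 proof (rule Lim_measure_incseq)
  show "incseq (%n. E Int ball 0 (real n))" by (auto simp: incseq_def)
  have "em (UN n. E Int ball 0 (real n)) <= em E" using E by (intro emeasure_mono) auto
  thus "em (UN n. E Int ball 0 (real n)) ~= \<infinity>" using E by auto
 qed (use E in auto)
 moreover have "(UN n. E Int ball 0 (real n)) = E"
  using reals_Archimedean2 by (auto simp: dist_norm)
 ultimately obtain n where n: "vol E - c < vol (E Int ball 0 (real n))"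
  using order_tendstoD(1)[of _ "vol E" sequentially "vol E - c"] c eventually_sequentially
  by (metis diff_less_eq less_add_same_cancel1 order_refl)
 define s where "s = real n * norm a + 1"
 have bd: "<|x <.> a|> < s" if "norm x < real n" for x
  using Cauchy_Schwarz_ineq2[of x a] mult_right_mono[of "norm x" "real n" "norm a"] that by (simp add: s_def)
 have sE: "S : fmeasurable lborel" if "S <= E" "S : bor" for S
  using fmeasurableI2[OF fE that(1)] that(2) by simp
 have m: "vol (E - E Int ball 0 (real n)) < c"
  using n measure_Diff[of lborel E "E Int ball 0 (real n)"] E by simp
 have "vol (E Int {x. s < x <.> a}) <= vol (E - E Int ball 0 (real n))"
  using E bd by (intro measure_mono_fmeasurable sE) (fastforce simp: dist_norm)+
 moreover have "vol (E Int ball 0 (real n)) <= vol (E Int {x. - s < x <.> a})"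
  using E bd by (intro measure_mono_fmeasurable sE) (fastforce simp: dist_norm)+
 ultimately show ?thesis using that[of s] m n by linarith
qed

text \<open>The map moves points along \<open>e\<close> only. On every line in direction
  \<open>e\<close> it is affine with slope \<open>t\<close>, because \<open>w\<close> is orthogonal
  to \<open>e\<close>, so a one-dimensional substitution under Fubini suffices.\<close>

lemma nn_integral_coordinate_affine:
 fixes f :: "'a::euclidean_space => ennreal"
 assumes f[measurable]: "f : bm" and e: "e : Basis" and w: "w <.> e = 0" and t: "t ~= 0"
 shows "(NN x. f x) = ennreal <|t|> * (NN x. f (x + ((t - 1) * (x <.> e) + x <.> w + c) *R e))"
proof -
 define I where "I = (Basis :: 'a set) - {e}"
 have I: "finite I" "e ~: I" "insert e I = Basis" using e by (auto simp: I_def)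
 interpret product_sigma_finite "%_::'a. lborel :: real measure" ..
 define \<Phi> where "\<Phi> g = (SUM b:Basis. g b *R b)" for g :: "'a => real"
 have [measurable]: "\<Phi> : measurable (Pi\<^sub>M (insert e I) (%_. lborel)) borel"
  unfolding \<Phi>_def I(3) by measurable
 have \<Phi>: "\<Phi> (g(e := y)) = y *R e + (SUM b:I. g b *R b)" for g y
 proof -
  have "\<Phi> (g(e := y)) = (SUM b:insert e I. (g(e := y)) b *R b)" by (simp add: \<Phi>_def I(3))
  also have "... = y *R e + (SUM b:I. (g(e := y)) b *R b)" using I by (subst sum.insert) auto
  also have "(SUM b:I. (g(e := y)) b *R b) = (SUM b:I. g b *R b)" using I by (intro sum.cong) auto
  finally show ?thesis .
 qed
 have lb: "lborel = distr (Pi\<^sub>M (insert e I) (%_. lborel)) borel \<Phi>"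
  unfolding \<Phi>_def I(3) by (rule lborel_eq)
 have iter: "(NN x. F x) = (\<integral>\<^sup>+g. (NN y. F (y *R e + (SUM b:I. g b *R b))) \<partial>Pi\<^sub>M I (%_. lborel))"
  if [measurable]: "F : bm" for F :: "'a => ennreal"
 proof -
  have "(NN x. F x) = (\<integral>\<^sup>+g. F (\<Phi> g) \<partial>Pi\<^sub>M (insert e I) (%_. lborel))"
   by (subst lb, subst nn_integral_distr) auto
  also have "... = (\<integral>\<^sup>+g. (NN y. F (\<Phi> (g(e := y)))) \<partial>Pi\<^sub>M I (%_. lborel))"
   by (rule product_nn_integral_insert[OF I(1,2)]) measurable
  finally show ?thesis by (simp only: \<Phi>)
 qed
 define h where "h x = ((t - 1) * (x <.> e) + x <.> w + c)" for x
 have [measurable]: "(%x. f (x + h x *R e)) : bm" unfolding h_def by measurable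
 have "(NN y. f (y *R e + S)) = ennreal <|t|> * (NN y. f ((y *R e + S) + h (y *R e + S) *R e))"
  if S: "S <.> e = 0" for S
 proof -
  have yy: "(y *R e + S) + h (y *R e + S) *R e = ((S <.> w + c) + t * y) *R e + S" for y
   using e w S by (simp add: h_def inner_add_left inner_commute[of e w] algebra_simps)
  show ?thesis unfolding yy by (rule nn_integral_real_affine) (use t in auto)
 qed
 moreover have "(SUM b:I. g b *R b) <.> e = 0" for g
  using e by (auto simp: inner_sum_left I_def inner_Basis intro!: sum.neutral)
 ultimately have eq: "(NN y. f (y *R e + (SUM b:I. g b *R b))) = ennreal <|t|> * (NN y. f ((y *R e + (SUM b:I. g b *R b)) + h (y *R e + (SUM b:I. g b *R b)) *R e))" for g
  by blast
 have "(NN x. f x) = ennreal <|t|> * (NN x. f (x + h x *R e))"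
  unfolding iter[OF f] iter[OF \<open>(%x. f (x + h x *R e)) : bm\<close>] eq
  by (rule nn_integral_cmult) measurable
 thus ?thesis unfolding h_def .
qed

lemma measure_slab:
 fixes K :: "'a::euclidean_space set"
 assumes K[measurable]: "K : bor" and e: "e : Basis" and nu: "nu <.> e = 1" and t: "t > 0"
 shows "vol (K Int {x. s < x <.> nu & x <.> nu < s + t})
  = t * vol {x. 0 < x <.> nu & x <.> nu < 1 & x + (s + (t - 1) * (x <.> nu)) *R e : K}"
  (is "vol ?S = t * vol ?T")
proof -
 \<comment> \<open>Chosen so that the motion along \<open>e\<close> turns the height
   \<open>x <.> nu\<close> into \<open>s + t * (x <.> nu)\<close>.\<close>
 define w where "w = (t - 1) *R (nu - e)"
 define L where "L x = x + ((t - 1) * (x <.> e) + x <.> w + s) *R e" for x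
 have w: "w <.> e = 0" using nu e by (simp add: w_def inner_diff_left)
 have L: "L x = x + (s + (t - 1) * (x <.> nu)) *R e" for x
  by (simp add: L_def w_def inner_diff_right algebra_simps)
 have "L x <.> nu = s + t * (x <.> nu)" for x
  using nu by (simp add: L inner_add_left inner_commute[of e] algebra_simps)
 hence ST: "L x : ?S <-> x : ?T" for x
  using t by (auto simp: L[symmetric] zero_less_mult_iff)
 have "?S = K Int {x. s < x <.> nu} Int {x. x <.> nu < s + t}" by auto
 hence S: "?S : bor" by simp
 have Lm: "L : bm" unfolding L_def by measurable
 have "?T = L -` ?S" using ST by auto
 hence T: "?T : bor" using measurable_sets[OF Lm S] by simp
 have "em ?S = (NN x. ind ?S x)" using S by simp
 also have "... = ennreal <|t|> * (NN x. ind ?S (L x))"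
  unfolding L_def using S t by (intro nn_integral_coordinate_affine[OF _ e w]) auto
 also have "(%x. ind ?S (L x) :: ennreal) = ind ?T" using ST by (auto simp: indicator_def fun_eq_iff)
 also have "(NN x. ind ?T x) = em ?T" using T by simp
 finally have "em ?S = ennreal t * em ?T" using t by simp
 thus ?thesis using t by (simp add: measure_def enn2real_mult)
qed

text \<open>Dividing by \<open>p0 - p\<close> bounds \<open>Q\<close> from below for
  \<open>p < p0\<close> and from above for \<open>p > p0\<close>. Both bounds tend to
  \<open>R p / (p0 - p)\<close>, which is close to \<open>- D\<close>; so inequalities with a free
  parameter determine the limit of \<open>Q\<close>.\<close>

lemma squeeze_difference_quotient:
 fixes Q :: "'a => real"
 assumes ineq: "\<forall>\<^sub>F p in at p0. \<forall>\<^sub>F s in F. B s p <= (p0 - p) * Q s"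
  and lim: "\<forall>\<^sub>F p in at p0. ((%s. B s p) ~~> R p) F"
  and R: "(R hrd D) (at p0)" "R p0 = 0"
 shows "(Q ~~> - D) F"
proof (rule order_tendstoI)
 have q: "((%p. R p / (p - p0)) ~~> D) (at p0)"
  using R by (simp add: has_field_derivative_iff)
 note ev = eventually_conj[OF ineq lim]
 {
  fix c assume c: "c < - D"
  have "\<forall>\<^sub>F p in at p0. R p / (p - p0) < - c" using order_tendstoD(2)[OF q] c by simp
  hence "\<forall>\<^sub>F p in at_left p0. R p / (p - p0) < - c & p < p0 & (\<forall>\<^sub>F s in F. B s p <= (p0 - p) * Q s) & ((%s. B s p) ~~> R p) F"
   using ev unfolding eventually_at_split by (intro eventually_conj) (auto simp: eventually_at_filter elim: eventually_mono)
  then obtain p where p: "R p / (p - p0) < - c" "p < p0" "\<forall>\<^sub>F s in F. B s p <= (p0 - p) * Q s" "((%s. B s p) ~~> R p) F"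
   using eventually_happens' by (metis (mono_tags, lifting) trivial_limit_at_left_real)
  have "c * (p0 - p) < R p" using p(1,2) by (simp add: field_simps)
  hence "\<forall>\<^sub>F s in F. c * (p0 - p) < B s p" using order_tendstoD(1)[OF p(4)] by blast
  with p(3) show "\<forall>\<^sub>F s in F. c < Q s"
  proof eventually_elim
   case (elim s)
   hence "c * (p0 - p) < Q s * (p0 - p)" by (simp add: mult.commute)
   thus ?case using p(2) by simp
  qed
 }
 {
  fix c assume c: "- D < c"
  have "\<forall>\<^sub>F p in at p0. - c < R p / (p - p0)" using order_tendstoD(1)[OF q] c by simp
  hence "\<forall>\<^sub>F p in at_right p0. - c < R p / (p - p0) & p0 < p & (\<forall>\<^sub>F s in F. B s p <= (p0 - p) * Q s) & ((%s. B s p) ~~> R p) F"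
   using ev unfolding eventually_at_split by (intro eventually_conj) (auto simp: eventually_at_filter elim: eventually_mono)
  then obtain p where p: "- c < R p / (p - p0)" "p0 < p" "\<forall>\<^sub>F s in F. B s p <= (p0 - p) * Q s" "((%s. B s p) ~~> R p) F"
   using eventually_happens' by (metis (mono_tags, lifting) trivial_limit_at_right_real)
  have "c * (p0 - p) < R p" using p(1,2) by (simp add: field_simps)
  hence "\<forall>\<^sub>F s in F. c * (p0 - p) < B s p" using order_tendstoD(1)[OF p(4)] by blast
  with p(3) show "\<forall>\<^sub>F s in F. Q s < c"
  proof eventually_elim
   case (elim s)
   hence "c * (p0 - p) < Q s * (p0 - p)" by (simp add: mult.commute)
   thus ?case using p(2) by (simp add: mult_less_cancel_right)
  qed
 }
qed


text \<open>By \<open>measure_slab\<close> the difference quotient is minus the volume of a set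
  \<open>T\<close> over the unit slab. As the slab of \<open>K\<close> gets thinner, these sets
  converge to a cylinder over the section of \<open>K\<close> at height \<open>s\<close>; convexity
  makes the boundary of that cylinder null.\<close>

lemma convex_section_derivative:
 fixes K :: "'a::euclidean_space set"
 assumes K: "open K" "bounded K" "convex K" and e: "e : Basis" and nu: "nu <.> e = 1" and p: "p : K" "p <.> nu = s"
 shows "EX a>0. ((%s. vol (K Int {x. s < x <.> nu})) hrd - a) (at s)"
proof -
 let ?e = e
 define T where "T r t = {x. 0 < x <.> nu & x <.> nu < 1 & x + (r + t * (x <.> nu)) *R ?e : K}" for r t :: real
 have enu: "?e <.> nu = 1" using nu by (simp add: inner_commute)
 have nu0: "nu ~= 0" using nu by auto
 have oT: "open (T r t)" for r t
 proof -
  have "open ((%x. x + (r + t * (x <.> nu)) *R ?e) -` K)"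
   by (rule open_vimage[OF K(1)]) (auto intro!: continuous_intros)
  moreover have "T r t = {x. 0 < x <.> nu} Int {x. x <.> nu < 1} Int (%x. x + (r + t * (x <.> nu)) *R ?e) -` K"
   by (auto simp: T_def)
  ultimately show ?thesis by (auto simp: open_halfspace_gt open_halfspace_lt inner_commute[of _ nu] intro!: open_Int)
 qed
 define a where "a = vol (T s (-1))"
 obtain R where R: "R > 0" "!!x. x : K ==> norm x <= R" using K(2) bounded_pos by blast
 have TR: "T r t <= cball 0 (R + <|s|> + 3)" if "<|r - s|> <= 1" "<|t|> <= 2" for r t
 proof
  fix x assume x: "x : T r t"
  have "norm x <= norm (x + (r + t * (x <.> nu)) *R ?e) + norm ((r + t * (x <.> nu)) *R ?e)"
   by (metis add_diff_cancel_right' norm_triangle_ineq4)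
  also have "norm (x + (r + t * (x <.> nu)) *R ?e) <= R" using x R(2) by (auto simp: T_def)
  also have "norm ((r + t * (x <.> nu)) *R ?e) = <|r + t * (x <.> nu)|>" by (simp add: e)
  also have "... <= <|r|> + <|t|> * <|x <.> nu|>" by (metis abs_mult abs_triangle_ineq)
  also have "<|t|> * <|x <.> nu|> <= 2 * 1" using x that by (intro mult_mono) (auto simp: T_def)
  finally show "x : cball 0 (R + <|s|> + 3)" using that by simp
 qed
 \<comment> \<open>The map is the projection along \<open>e\<close> to height \<open>s\<close>. A
   point projected to the frontier of \<open>K\<close> is a frontier point of the convex preimage of
   \<open>K\<close>, because the segment from it to \<open>p\<close> projects into
   \<open>K\<close>.\<close>
 have null: "negligible {x. x + (s + (-1) * (x <.> nu)) *R ?e : frontier K}"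
 proof -
  let ?\<pi> = "%x. x + (s + (-1) * (x <.> nu)) *R ?e"
  let ?C = "?\<pi> -` K"
  have aff: "?\<pi> ((1 - l) *R x + l *R y) = (1 - l) *R ?\<pi> x + l *R ?\<pi> y" for l x y
   by (simp add: algebra_simps inner_add_left)
  have oC: "open ?C" by (rule open_vimage[OF K(1)]) (auto intro!: continuous_intros)
  have cC: "convex ?C"
  proof (rule convexI)
   fix x y and u v :: real assume "x : ?C" "y : ?C" "0 <= u" "0 <= v" "u + v = 1"
   moreover have "u = 1 - v" using \<open>u + v = 1\<close> by simp
   ultimately show "u *R x + v *R y : ?C"
    using convexD[OF K(3), of "?\<pi> x" "?\<pi> y" u v] aff[of v x y] by simp
  qed
  have \<pi>p: "?\<pi> p = p" using p(2) by simp
  have "{x. ?\<pi> x : frontier K} <= frontier ?C"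
  proof
   fix x assume "x : {x. ?\<pi> x : frontier K}"
   hence x: "?\<pi> x : closure K" "?\<pi> x ~: K" using K(1) by (auto simp: frontier_def interior_open)
   have seg: "(1 - l) *R x + l *R p : ?C" if "0 < l" "l < 1" for l
   proof -
    have "?\<pi> x ~= p" using x p by auto
    hence "(1 - l) *R ?\<pi> x + l *R p : open_segment (?\<pi> x) p" using that by (auto simp: in_segment)
    hence "(1 - l) *R ?\<pi> x + l *R p : interior K"
     using in_interior_closure_convex_segment[OF K(3), of p "?\<pi> x"] x p K(1) by (auto simp: interior_open open_segment_commute)
    moreover have "?\<pi> ((1 - l) *R x + l *R p) = (1 - l) *R ?\<pi> x + l *R p"
     by (simp only: aff \<pi>p)
    ultimately show ?thesis using K(1) by (simp only: interior_open vimage_eq)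
   qed
   have "x : closure ?C"
    unfolding closure_sequential
   proof (intro exI conjI allI)
    show "(1 - inverse (real (Suc (Suc n)))) *R x + inverse (real (Suc (Suc n))) *R p : ?C" for n
     by (rule seg) (auto simp: inverse_less_1_iff)
    have "(%n. (1 - inverse (real (Suc (Suc n)))) *R x + inverse (real (Suc (Suc n))) *R p) ----> (1 - 0) *R x + 0 *R p"
     by (intro tendsto_intros LIMSEQ_Suc[OF LIMSEQ_inverse_real_of_nat])
    thus "(%n. (1 - inverse (real (Suc (Suc n)))) *R x + inverse (real (Suc (Suc n))) *R p) ----> x" by simp
   qed
   thus "x : frontier ?C" using x(2) oC by (simp add: frontier_def interior_open)
  qed
  thus ?thesis using negligible_convex_frontier[OF cC] negligible_subset by blast
 qed
 have lim: "(%n. vol (T (r n) (t n))) ----> a"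
  if rt: "r ----> s" "t ----> -1" for r t :: "nat => real"
 proof -
  have "EVS n. <|r n - s|> < 1" "EVS n. <|t n - (-1)|> < 1"
   using tendstoD[OF rt(1), of 1] tendstoD[OF rt(2), of 1] by (auto simp: dist_real_def)
  hence "EVS n. <|r n - s|> <= 1 & <|t n|> <= 2" by eventually_elim auto
  then obtain n0 where n0: "!!n. n0 <= n ==> <|r n - s|> <= 1 & <|t n|> <= 2"
   unfolding eventually_sequentially by blast
  let ?B = "cball (0 :: 'a) (R + <|s|> + 3)"
  have "(%n. LBINT x. ind (T (r (n + n0)) (t (n + n0))) x :: real) ----> (LBINT x. ind (T s (-1)) x)"
  proof (rule integral_dominated_convergence[where w = "ind ?B"])
   show "lint (ind ?B :: 'a => real)"
    using emeasure_bounded_finite[of ?B] by (subst integrable_indicator_iff) auto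
   show "AEL x. norm (ind (T (r (n + n0)) (t (n + n0))) x :: real) <= ind ?B x" for n
    using TR[of "r (n + n0)" "t (n + n0)"] n0[of "n + n0"] by (intro AE_I2) (auto simp: indicator_def)
   have "{x. x + (s + (-1) * (x <.> nu)) *R ?e : frontier K} : null_sets lborel"
   proof -
    have "(%x. x + (s + (-1) * (x <.> nu)) *R ?e) -` frontier K : bor"
    proof -
     have "cont (%x. x + (s + (-1) * (x <.> nu)) *R ?e)" by (intro continuous_intros)
     moreover have "frontier K : bor" by simp
     ultimately show ?thesis using measurable_sets[OF borel_measurable_continuous_onI] by fastforce
    qed
    thus ?thesis using null by (simp add: negligible_iff_null_sets vimage_def null_sets_def emeasure_completion)
   qed
   hence "AEL x. x + (s + (-1) * (x <.> nu)) *R ?e ~: frontier K"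
    by (rule AE_I') auto
   thus "AEL x. (%n. ind (T (r (n + n0)) (t (n + n0))) x :: real) ----> ind (T s (-1)) x"
   proof eventually_elim
    case (elim x)
    let ?y = "%n. x + (r (n + n0) + t (n + n0) * (x <.> nu)) *R ?e"
    have y: "?y ----> x + (s + (-1) * (x <.> nu)) *R ?e"
     by (intro tendsto_intros LIMSEQ_ignore_initial_segment rt)
    have "EVS n. (?y n : K) = (x + (s + (-1) * (x <.> nu)) *R ?e : K)"
    proof (cases "x + (s + (-1) * (x <.> nu)) *R ?e : K")
     case True
     thus ?thesis using topological_tendstoD[OF y K(1)] by (auto elim: eventually_mono)
    next
     case False
     hence "x + (s + (-1) * (x <.> nu)) *R ?e : - closure K" using elim K(1) by (auto simp: frontier_def interior_open)
     hence "EVS n. ?y n : - closure K" using topological_tendstoD[OF y, of "- closure K"] by auto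
     thus ?thesis using False closure_subset by (auto elim!: eventually_mono)
    qed
    thus ?case by (intro tendsto_eventually) (auto elim!: eventually_mono simp: T_def indicator_def)
   qed
  qed (auto intro!: borel_measurable_indicator borel_open oT)
  hence "(%n. vol (T (r (n + n0)) (t (n + n0)))) ----> a"
   using oT by (simp add: a_def borel_open)
  thus ?thesis by (rule LIMSEQ_offset)
 qed
 have Kb: "K : bor" "fin K" using K emeasure_bounded_finite[OF K(2)] by auto
 define f where "f s = vol (K Int {x. s < x <.> nu})" for s
 have slab: "f r - f (r + t) = t * vol (T r (t - 1))" if "t > 0" for r t
 proof -
  have "f r - f (r + t) = vol (K Int {x. r < x <.> nu} Int {x. x <.> nu < r + t})"
  proof -
   have "K Int {x. r < x <.> nu} Int {x. r + t < x <.> nu} = K Int {x. r + t < x <.> nu}" using that by auto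
   moreover have "fin (K Int {x. r < x <.> nu})"
    using emeasure_mono[of "K Int {x. r < x <.> nu}" K lborel] Kb by (auto intro: le_less_trans)
   ultimately show ?thesis
    using section_split[of "K Int {x. r < x <.> nu}" nu "r + t"] Kb nu0 by (simp add: f_def)
  qed
  also have "K Int {x. r < x <.> nu} Int {x. x <.> nu < r + t} = K Int {x. r < x <.> nu & x <.> nu < r + t}" by auto
  finally show ?thesis unfolding T_def using measure_slab[OF Kb(1) e nu that] by simp
 qed
 have "((%h. (f (s + h) - f s) / h) ~~> - a) (at 0)"
  unfolding tendsto_at_iff_sequentially
 proof (intro allI impI)
  fix X :: "nat => real" assume X0: "ALL i. X i : UNIV - {0}" and X: "X ----> 0"
  \<comment> \<open>The slab between \<open>s\<close> and \<open>s + X i\<close> starts at the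
    smaller of the two heights and has thickness \<open><|X i|>\<close>.\<close>
  have "(%i. min s (s + X i)) ----> min s (s + 0)" "(%i. <|X i|> - 1) ----> <|0|> - 1"
   by (intro tendsto_intros X)+
  hence "(%i. - vol (T (min s (s + X i)) (<|X i|> - 1))) ----> - a"
   by (intro tendsto_minus lim) simp_all
  moreover have "(f (s + X i) - f s) / X i = - vol (T (min s (s + X i)) (<|X i|> - 1))" for i
  proof (cases "X i > 0")
   case True
   thus ?thesis using slab[of "X i" s] by (simp add: min_def field_simps)
  next
   case False
   hence "X i < 0" using X0 by (metis Diff_iff linorder_neqE_linordered_idom singletonI)
   thus ?thesis using slab[of "- X i" "s + X i"] by (simp add: min_def field_simps)
  qed
  ultimately show "((%h. (f (s + h) - f s) / h) \<circ> X) ----> - a" by (simp add: comp_def)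
 qed
 hence "(f hrd - a) (at s)" by (simp add: DERIV_def)
 moreover have "a > 0"
 proof -
  \<comment> \<open>The point \<open>p\<close>, moved along \<open>e\<close> to height 1/2, shows
    that the open limit set is non-empty, so \<open>a\<close> is positive.\<close>
  have "p + (1 / 2 - s) *R ?e : T s (-1)"
  proof -
   have "p + (1 / 2 - s) *R e + (s - 1 / 2) *R e = p" by (simp add: scaleR_diff_left)
   thus ?thesis using p enu by (simp add: T_def inner_add_left add.assoc)
  qed
  moreover have "bounded (T s (-1))" using TR[of s "-1"] bounded_subset bounded_cball by auto
  ultimately show ?thesis using vol_open_pos[OF oT[of s "-1"]] oT[of s "-1"] by (auto simp: a_def)
 qed
 ultimately show ?thesis unfolding f_def[abs_def] by blast
qed

section \<open>Extremal sets for the Wulff-type inequality\<close>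

lemma AE_hyperplane:
 fixes nu :: "'a::euclidean_space"
 assumes "nu ~= 0" shows "AEL x. x <.> nu ~= z"
proof -
 have "{x. nu <.> x = z} : null_sets lebesgue"
  using negligible_hyperplane[of nu z] assms negligible_iff_null_sets by blast
 hence "AE x in lebesgue. x <.> nu ~= z" by (rule AE_I') (auto simp: inner_commute)
 thus ?thesis by (simp add: AE_completion_iff)
qed

lemma set_integral_halfspace_split:
 fixes f :: "'a::euclidean_space => real"
 assumes f: "sint H f" and H: "H : bor" and nu: "nu ~= 0"
 shows "(LBINT x:H. f x) = (LBINT x:H Int {x. z < x <.> nu}. f x) + (LBINT x:H Int {x. x <.> nu < z}. f x)"
proof -
 have i: "sint (H Int {x. z < x <.> nu}) f" "sint (H Int {x. x <.> nu < z}) f"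
  using H by (auto intro!: set_integrable_subset[OF f])
 have "(LBINT x:H. f x) = (LBINT x:(H Int {x. z < x <.> nu}) Un (H Int {x. x <.> nu < z}). f x)"
 proof (rule set_integral_cong_set)
  show "set_borel_measurable lborel H f"
   using f unfolding set_integrable_def set_borel_measurable_def by (rule borel_measurable_integrable)
  show "set_borel_measurable lborel ((H Int {x. z < x <.> nu}) Un (H Int {x. x <.> nu < z})) f"
   using set_integrable_Un[OF i] H unfolding set_integrable_def set_borel_measurable_def
   by (auto intro!: borel_measurable_integrable)
  show "AEL x. (x : H Int {x. z < x <.> nu} Un H Int {x. x <.> nu < z}) = (x : H)"
   using AE_hyperplane[OF nu, of z] by eventually_elim auto
 qed
 also have "... = (LBINT x:H Int {x. z < x <.> nu}. f x) + (LBINT x:H Int {x. x <.> nu < z}. f x)"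
  by (rule set_integral_Un[OF _ i]) auto
 finally show ?thesis .
qed

definition wulff_data :: "'a::euclidean_space set => 'a set => ('a => real) => ('a => 'a) => ('a => real) => bool" where
 "wulff_data H K u Du g <-> C1 u Du & csupp u & (ALL x. 0 <= u x) & cont g & csupp g &
  (ALL x:H. ALL y:K. - (Du x <.> y) <= g x)"

text \<open>The indicator of \<open>E\<close> is not C1, so equality is expressed by approximating
  functions. If \<open>vol K = vol E\<close> and \<open>wulff_inequality\<close> applies,
  \<open>DIM('a) * vol E\<close> is the smallest possible limit of the integrals of
  \<open>g i\<close>.\<close>

definition wulff_extremal :: "'a::euclidean_space set => 'a set => 'a set => bool" where
 "wulff_extremal H K E <-> (EX u Du g. (ALL i. wulff_data H K (u i) (Du i) (g i)) &
  (%i::nat. LBINT x:H. <|u i x - ind E x|>) ----> 0 &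
  (%i. LBINT x:H. g i x) ----> DIM('a) * vol E)"

lemma set_integrable_indicator:
 assumes "E : bor" "fin E" "H : bor"
 shows "sint H (ind E :: 'a::euclidean_space => real)"
 unfolding set_integrable_def using assms integrable_real_indicator[of E lborel]
 by (intro integrable_mult_indicator) auto

lemma L1_bound:
 fixes f h u :: "'a::euclidean_space => real"
 assumes A: "A : bor" "A <= H" and H: "H : bor" and f: "sint A f" "sint A h"
  and u: "sint H u" and E: "sint H (ind E :: 'a => real)"
  and b: "!!x. x : A ==> <|f x - h x|> <= <|u x - ind E x|>"
 shows "<|(LBINT x:A. f x) - (LBINT x:A. h x)|> <= (LBINT x:H. <|u x - ind E x|>)"
proof -
 have i: "sint A (%x. f x - h x)" using f by (rule set_integral_diff)
 have j: "sint H (%x. <|u x - ind E x|>)" using set_integrable_abs[OF set_integral_diff(1)[OF u E]] .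
 have "<|(LBINT x:A. f x) - (LBINT x:A. h x)|> = <|LBINT x. ind A x *R (f x - h x)|>"
  using set_integral_diff(2)[OF f] by (simp add: sli_def)
 also have "... <= (LBINT x. <|ind A x *R (f x - h x)|>)" by (rule integral_abs_bound)
 also have "... <= (LBINT x. ind H x *R <|u x - ind E x|>)"
 proof (rule integral_mono)
  show "<|ind A x *R (f x - h x)|> <= ind H x *R <|u x - ind E x|>" for x
   using b[of x] A(2) by (cases "x : A") auto
 qed (use i j in \<open>auto simp: set_integrable_def\<close>)
 finally show ?thesis by (simp add: sli_def)
qed

lemma finite_sub:
 assumes "fin E" "S <= E" "E : bor" shows "fin S"
 using emeasure_mono[of S E lborel] assms by (auto intro: le_less_trans)

lemma min_integral_tendsto:
 fixes u :: "nat => 'a::euclidean_space => real"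
 assumes u: "!!i. cont (u i)" "!!i. csupp (u i)" and E: "E : bor" "E <= H" "fin E"
  and H: "H : bor" and L: "(%i. LBINT x:H. <|u i x - ind E x|>) ----> 0" and A: "A : bor" "A <= E"
 shows "(%i. LBINT x:A. min (u i x) 1) ----> vol A"
proof (rule LIM_zero_cancel, rule Lim_null_comparison[OF _ L], intro always_eventually allI)
 fix i
 have iA: "sint A (%x. 1 :: real)"
  using finite_sub[OF E(3) A(2) E(1)] A(1) by (simp add: set_integrable_def integrable_indicator_iff)
 have "cont (%x. min (u i x) 1)" using u(1) by (intro continuous_intros)
 moreover obtain R where "!!x. R <= norm x ==> u i x = 0" using u(2)[of i] by (auto simp: csupp_def)
 hence "csupp (%x. min (u i x) 1)" by (intro csuppI[of R]) auto
 ultimately have m: "sint A (%x. min (u i x) 1)" using A(1) by (rule sint_csupp)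
 have "<|min (u i x) 1 - 1|> <= <|u i x - ind E x|>" if "x : A" for x using subsetD[OF A(2) that] by (auto simp: min_def)
 hence "<|(LBINT x:A. min (u i x) 1) - (LBINT x:A. 1)|> <= (LBINT x:H. <|u i x - ind E x|>)"
  by (intro L1_bound[OF A(1) _ H m iA sint_csupp[OF u H] set_integrable_indicator[OF E(1,3) H]]) (use A E in auto)
 moreover have "(LBINT x:A. 1) = vol A" using A(1) by (simp add: sli_def)
 ultimately show "norm ((LBINT x:A. min (u i x) 1) - vol A) <= (LBINT x:H. <|u i x - ind E x|>)" by simp
qed

text \<open>Translating \<open>K\<close> by \<open>- a *R e\<close> changes the bound
  \<open>g\<close> by \<open>a * (Du x <.> e)\<close>. On one piece of a cut domain the integral of
  this term need not vanish; it is going to be the difference quotient of the section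
  function.\<close>

lemma wulff_shift:
 fixes u g :: "'a::euclidean_space => real"
 assumes u: "C1 u Du" "csupp u" "!!x. 0 <= u x" and g: "cont g" "csupp g"
  and C: "open C" and K: "open K" "bounded K" "K ~= {}"
  and cone: "!!x y t. x : C ==> y : K ==> t > 0 ==> x + t *R (y - a *R e) : C"
  and gK: "!!x y. x : C ==> y : K ==> - (Du x <.> y) <= g x"
  and E: "E : bor" "E <= C" "vol E > 0" "fin E"
 shows "DIM('a) * root DIM('a) (vol K / vol E) * (LBINT x:E. min (u x) 1)
  <= (LBINT x:C. g x) + a * (LBINT x:C. Du x <.> e)"
proof -
 let ?K = "(%x. x - a *R e) ` K"
 have D: "cont (%x. Du x <.> e)" "csupp (%x. Du x <.> e)"
  using C1_cont_grad[OF u(1)] csupp_inner[OF csupp_grad[OF u(1,2)]] by (auto intro!: continuous_intros)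
 have o: "open ?K" using open_translation_subtract[OF K(1)] .
 have "vl ?K = vl K" by (rule measure_translation_subtract)
 hence m: "vol ?K = vol K" using o K(1) by (simp add: measure_completion)
 have "DIM('a) * root DIM('a) (vol ?K / vol E) * (LBINT x:E. min (u x) 1)
  <= (LBINT x:C. g x + a * (Du x <.> e))"
 proof (rule wulff_inequality[OF u C o _ _ _ _ _ _ E])
  show "bounded ?K" using bounded_translation_minus[OF K(2)] .
  show "cont (%x. g x + a * (Du x <.> e))" by (intro continuous_on_add continuous_on_mult continuous_on_const g(1) D(1))
  show "csupp (%x. g x + a * (Du x <.> e))" by (intro csupp_add csupp_mult g D)
  show "- (Du x <.> y) <= g x + a * (Du x <.> e)" if "x : C" "y : ?K" for x y
   using that gK by (force simp: inner_diff_right)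
 qed (use K(3) cone in auto)
 also have "... = (LBINT x:C. g x) + a * (LBINT x:C. Du x <.> e)"
  using sint_csupp[OF g, of C] sint_csupp[OF D, of C] C by (simp add: set_integral_add set_integrable_mult_right)
 finally show ?thesis unfolding m .
qed

text \<open>The half-space \<open>H\<close> is cut by a hyperplane and the Wulff-type inequality is applied on both
 sides, with independent translations of \<open>K\<close> along \<open>e\<close>.\<close>

lemma extremal_cut:
 fixes H K E :: "'a::euclidean_space set" and nu :: 'a and v F :: "real => real" and V :: real
 defines "v \<equiv> %r. vol (E Int {x. r < x <.> nu})" and "F \<equiv> %r. vol (K Int {x. r < x <.> nu})" and "V \<equiv> vol E"
 assumes H: "open H" "!!x y t. x : H ==> y : K ==> t > 0 ==> x + t *R y : H" "!!x t. x : H ==> x + t *R e : H"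
  and K: "open K" "bounded K" and nu: "nu <.> e = 1"
  and E: "E : bor" "E <= H" "fin E" and ext: "wulff_extremal H K E"
  and s: "s < s'" and vs: "0 < v s'" "v s < V" and pq: "0 < F p" "F q < vol K"
 shows "DIM('a) * (root DIM('a) (F p / v s') * v s' + root DIM('a) ((vol K - F q) / (V - v s)) * (V - v s))
  <= DIM('a) * V + (q - p) * ((v s - v s') / (s' - s))"
proof -
 obtain u Du g where D: "!!i. wulff_data H K (u i) (Du i) (g i)"
  and L1: "(%i::nat. LBINT x:H. <|u i x - ind E x|>) ----> 0"
  and Q: "(%i. LBINT x:H. g i x) ----> DIM('a) * V"
  using ext unfolding wulff_extremal_def V_def by blast
 have u: "C1 (u i) (Du i)" "csupp (u i)" "!!x. 0 <= u i x" and g: "cont (g i)" "csupp (g i)"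
   "!!x y. x : H ==> y : K ==> - (Du i x <.> y) <= g i x" for i
  using D[of i] by (auto simp: wulff_data_def)
 have nu0: "nu ~= 0" using nu by auto
 have enu: "e <.> nu = 1" using nu by (simp add: inner_commute)
 have Hb: "H : bor" using H(1) by simp
 have Kb: "K : bor" "fin K" using K(1) emeasure_bounded_finite[OF K(2)] by auto
 let ?n = "real DIM('a)" and ?up = "%E r. E Int {x. r < x <.> nu}" and ?lo = "%E r. E Int {x. x <.> nu < r}"
 have iu: "sint A (u i)" if "A : bor" for A i
  using sint_csupp[OF C1_cont[OF u(1)] u(2) that] .
 have iD: "sint H (%x. Du i x <.> e)" for i
  using C1_cont_grad[OF u(1)] csupp_inner[OF csupp_grad[OF u(1,2)]] Hb by (intro sint_csupp) (auto intro!: continuous_intros)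
 have H_e: "x - t *R e : H <-> x : H" for x t
  using H(3)[of x "- t"] H(3)[of "x - t *R e" t] by auto
 \<comment> \<open>The mass of \<open>u i\<close> above height \<open>r\<close> is an approximation
   of \<open>v r\<close> that has a derivative, namely the gradient integral over the piece that is
   cut off.\<close>
 define M where "M i r = (LBINT x:?up H r. u i x)" for i r
 have dM: "(M i hrd (LBINT x:?up H r. Du i x <.> e)) (at r)" for i r
 proof -
  have "(LBINT x:?up H r. u i (x + t *R e)) = M i (r + t)" for t
  proof -
   have "{x. x - t *R e : ?up H r} = ?up H (r + t)" using enu H_e by (auto simp: inner_diff_left)
   thus ?thesis unfolding M_def
    using set_integral_translate[OF borel_csupp[OF C1_cont[OF u(1)]], of "?up H r" i "t *R e"] Hb by simp
  qed
  hence "((%t. M i (r + t)) hrd (LBINT x:?up H r. Du i x <.> e)) (at 0)"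
   using translated_integral_deriv[OF u(1,2), of "?up H r" i e] Hb by simp
  thus ?thesis using DERIV_shift[of "M i" _ 0 r] by (simp add: add.commute)
 qed
 have H0: "(LBINT x:H. Du i x <.> e) = 0" for i
 proof -
  have "(LBINT x:H. u i (x + t *R e)) = (LBINT x:H. u i x)" for t
   using set_integral_translate[OF borel_csupp[OF C1_cont[OF u(1)]], of H i "t *R e"] Hb H_e by simp
  thus ?thesis
   using translated_integral_deriv[OF u(1,2), of H i e] Hb DERIV_unique[OF _ DERIV_const] by auto
 qed
 have Fq: "vol (?lo K q) = vol K - F q" and vs2: "vol (?lo E s) = V - v s"
  using section_split[OF Kb nu0] section_split[OF E(1,3) nu0] by (simp_all add: F_def v_def V_def)
 have vF: "vol (?up E r) = v r" "vol (?up K r) = F r" for r by (simp_all add: v_def F_def)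
 have shift: "x + t *R (y - a *R e) : H" (is ?G1) "(x + t *R (y - a *R e)) <.> nu = x <.> nu + t * (y <.> nu - a)" (is ?G2)
  if xy: "x : H" "y : K" "0 < t" for x y a t
 proof -
  have "x + t *R (y - a *R e) = (x + t *R y) - (t * a) *R e" by (simp add: scaleR_right_diff_distrib)
  thus ?G1 using H(2)[OF xy] by (simp only: H_e)
  show ?G2 using enu by (simp add: inner_add_left inner_diff_left)
 qed
 have main: "?n * (root DIM('a) (F p / v s') * (LBINT x:?up E s'. min (u i x) 1)
   + root DIM('a) ((vol K - F q) / (V - v s)) * (LBINT x:?lo E s. min (u i x) 1))
  <= (LBINT x:H. g i x) + (q - p) * ((M i s - M i s') / (s' - s))" for i
 proof -
  \<comment> \<open>The cut is placed where the mean value theorem turns the gradient integral into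
    the difference quotient of \<open>M i\<close> between \<open>s\<close> and \<open>s'\<close>.
    That quotient converges in \<open>i\<close>, whereas no limit of the gradients is
    available.\<close>
  obtain z where z: "s < z" "z < s'" "M i s' - M i s = (s' - s) * (LBINT x:?up H z. Du i x <.> e)"
   using MVT2[OF s, of "M i" "%r. LBINT x:?up H r. Du i x <.> e"] dM by blast
  define D where "D = (LBINT x:?up H z. Du i x <.> e)"
  have Dz: "- D = (M i s - M i s') / (s' - s)" using z s by (simp add: D_def field_simps)
  \<comment> \<open>\<open>H\<close> is invariant along \<open>e\<close>, so the gradient integrals
    over the two pieces cancel.\<close>
  have D2: "(LBINT x:?lo H z. Du i x <.> e) = - D"
   using set_integral_halfspace_split[OF iD Hb nu0, of i z] H0[of i] by (simp add: D_def)
  have Q12: "(LBINT x:H. g i x) = (LBINT x:?up H z. g i x) + (LBINT x:?lo H z. g i x)"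
   by (rule set_integral_halfspace_split[OF sint_csupp[OF g(1,2) Hb] Hb nu0])
  have op: "open (?up K p)" "open (?lo K q)" "open (?up H z)" "open (?lo H z)"
   using K(1) H(1) by (auto intro!: open_Int simp: open_halfspace_gt open_halfspace_lt inner_commute[of _ nu])
  have bd: "bounded (?up K p)" "bounded (?lo K q)" using K(2) by auto
  \<comment> \<open>The part of \<open>K\<close> above height \<open>p\<close>, translated by
    \<open>- p *R e\<close>, consists of directions pointing into the upper piece; the part below
    \<open>q\<close> is treated likewise.\<close>
  have 1: "?n * root DIM('a) (vol (?up K p) / vol (?up E s')) * (LBINT x:?up E s'. min (u i x) 1)
    <= (LBINT x:?up H z. g i x) + p * (LBINT x:?up H z. Du i x <.> e)"
  proof (rule wulff_shift[OF u g(1,2) op(3,1) bd(1)])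
   show "?up K p ~= {}" using pq(1) by (auto simp: F_def)
   show "x + t *R (y - p *R e) : ?up H z" if "x : ?up H z" "y : ?up K p" "0 < t" for x y t
    using shift[of x y t p] that add_strict_mono[of 0 "t * (y <.> nu - p)" z "x <.> nu"] by (simp add: add.commute)
   show "fin (?up E s')" by (rule finite_sub[OF E(3) _ E(1)]) auto
  qed (use E g(3) z vs in \<open>auto simp: v_def\<close>)
  have 2: "?n * root DIM('a) (vol (?lo K q) / vol (?lo E s)) * (LBINT x:?lo E s. min (u i x) 1)
    <= (LBINT x:?lo H z. g i x) + q * (LBINT x:?lo H z. Du i x <.> e)"
  proof (rule wulff_shift[OF u g(1,2) op(4,2) bd(2)])
   show "?lo K q ~= {}" using pq(2) Fq by auto
   show "x + t *R (y - q *R e) : ?lo H z" if "x : ?lo H z" "y : ?lo K q" "0 < t" for x y t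
    using shift[of x y t q] that add_strict_mono[of "t * (y <.> nu - q)" 0 "x <.> nu" z] mult_pos_neg[of t "y <.> nu - q"] by (simp add: add.commute)
   show "fin (?lo E s)" by (rule finite_sub[OF E(3) _ E(1)]) auto
   show "0 < vol (?lo E s)" using vs(2) vs2 by simp
  qed (use E g(3) z in auto)
  show ?thesis
   using 1 2 unfolding Q12 D2 D_def[symmetric] Dz[symmetric] Fq vs2 vF by (simp add: algebra_simps)
 qed
 have M: "(%i. M i r) ----> v r" for r
 proof (rule LIM_zero_cancel, rule Lim_null_comparison[OF _ L1], intro always_eventually allI)
  fix i
  have "(%x. ind (?up H r) x *R ind E x :: real) = ind (?up E r)"
   using E(2) by (auto simp: indicator_def fun_eq_iff)
  hence vr: "v r = (LBINT x:?up H r. ind E x)" using E(1) by (simp add: v_def sli_def)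
  have A: "?up H r : bor" using Hb by auto
  note iE = set_integrable_indicator[OF E(1,3)]
  show "norm (M i r - v r) <= (LBINT x:H. <|u i x - ind E x|>)" unfolding M_def vr real_norm_def
   by (rule L1_bound[OF A _ Hb iu[OF A] iE[OF A] iu[OF Hb] iE[OF Hb]]) auto
 qed
 note Emin = min_integral_tendsto[OF C1_cont[OF u(1)] u(2) E Hb L1]
 have "(%i. LBINT x:?up E s'. min (u i x) 1) ----> v s'" "(%i. LBINT x:?lo E s. min (u i x) 1) ----> V - v s"
  using Emin[of "?up E s'"] Emin[of "?lo E s"] E(1) vs2 by (simp_all add: v_def)
 note lim = this
 show ?thesis
 proof (rule LIMSEQ_le)
  show "(%i. ?n * (root DIM('a) (F p / v s') * (LBINT x:?up E s'. min (u i x) 1)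
   + root DIM('a) ((vol K - F q) / (V - v s)) * (LBINT x:?lo E s. min (u i x) 1)))
   ----> ?n * (root DIM('a) (F p / v s') * v s' + root DIM('a) ((vol K - F q) / (V - v s)) * (V - v s))"
   by (intro tendsto_intros lim)
  show "(%i. (LBINT x:H. g i x) + (q - p) * ((M i s - M i s') / (s' - s))) ----> ?n * V + (q - p) * ((v s - v s') / (s' - s))"
   using s Q by (intro tendsto_intros M) auto
 qed (use main in blast)
qed

text \<open>The factor \<open>n\<close> cancels the 1/n coming from the root, so at a point where
  \<open>f\<close> has the value \<open>c\<close> the expression has the same derivative as
  \<open>f\<close>.\<close>

lemma root_normalized_derivative:
 fixes f :: "real => real"
 assumes f: "(f hrd D) (at p)" "f p = c" and c: "c > 0" and n: "n > 0"
 shows "((%x. real n * (root n (f x / c) * c - c)) hrd D) (at p)"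
proof -
 have 1: "((%x. f x / c) hrd D / c) (at p)" using f(1) c by (auto intro!: derivative_eq_intros)
 have 2: "(root n hrd inverse (real n * root n (f p / c) ^ (n - Suc 0))) (at (f p / c))"
  using f c n by (intro DERIV_real_root) auto
 have "((%x. root n (f x / c)) hrd inverse (real n * root n (f p / c) ^ (n - Suc 0)) * (D / c)) (at p)"
  by (rule DERIV_chain2[OF 2 1])
 hence "((%x. root n (f x / c)) hrd inverse (real n) * (D / c)) (at p)"
  using f(2) c n by simp
 from DERIV_cmult[OF DERIV_diff[OF DERIV_cmult_right[OF this, of c] DERIV_const[of c]], of "real n"]
 show ?thesis using c n by (simp add: mult.assoc[symmetric])
qed

text \<open>Hypothesis \<open>ode\<close> says that \<open>v\<close> solves the autonomous equation
  satisfied by \<open>F\<close>. With \<open>G\<close> an inverse of \<open>F\<close>, the function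
  \<open>G (v s) - s\<close> has derivative 0 where \<open>v s\<close> is strictly between 0 and
  \<open>V\<close>; monotonicity settles the two extreme values.\<close>

lemma translate_of_same_ode:
 fixes v F :: "real => real"
 assumes anti: "antimono v" "antimono F" and cont: "cont v" "cont F"
  and V: "V > 0" "!!s. 0 <= v s" "!!s. v s <= V" "!!s. 0 <= F s" "!!s. F s <= V"
  and lv: "!!c. c > 0 ==> EX s. v s < c & V - c < v (- s)"
  and lF: "!!c. c > 0 ==> EX s. F s < c & V - c < F (- s)"
  and ode: "!!s p. 0 < v s ==> v s < V ==> F p = v s ==> EX D<0. (F hrd D) (at p) & (v hrd D) (at s)"
 shows "EX b. ALL s. v s = F (s - b)"
proof -
 have ivt: "EX s. f s = y" if f: "antimono f" "cont f" "!!c. c > 0 ==> EX s. f s < c & V - c < f (- s)" and y: "0 < y" "y < V"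
  for f :: "real => real" and y
 proof -
  obtain s where s: "f s < min y (V - y)" "V - min y (V - y) < f (- s)" using f(3)[of "min y (V - y)"] y by auto
  hence sy: "f s < y" "y < f (- s)" by auto
  have "- s < s"
  proof (rule ccontr)
   assume "~ - s < s"
   hence "f (- s) <= f s" by (intro antimonoD[OF f(1)]) simp
   thus False using sy by simp
  qed
  moreover have "continuous_on {- s..s} f" using f(2) continuous_on_subset by blast
  ultimately show ?thesis using IVT2'[of f s y "- s"] sy by auto
 qed
 have v_ivt: "EX s. v s = y" and F_ivt: "EX s. F s = y" if "0 < y" "y < V" for y
  by (rule ivt[OF anti(1) cont(1) lv that], assumption) (rule ivt[OF anti(2) cont(2) lF that], assumption)
 have FD: "EX D<0. (F hrd D) (at p)" if p: "0 < F p" "F p < V" for p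
 proof -
  obtain s where s: "v s = F p" using v_ivt[OF p] by blast
  have "0 < v s" "v s < V" "F p = v s" unfolding s using p by simp_all
  from ode[OF this] show ?thesis by blast
 qed
 have Finj: "p = p'" if p: "0 < F p" "F p < V" "F p = F p'" for p p'
 proof -
  have False if lt: "a < b" and ab: "0 < F a" "F a < V" "F a = F b" for a b
  proof -
   obtain D where D: "D < 0" "(F hrd D) (at a)" using FD[OF ab(1,2)] by blast
   obtain d where d: "d > 0" "!!h. 0 < h ==> h < d ==> F (a + h) < F a"
    using DERIV_neg_dec_right[OF D(2,1)] by blast
   let ?h = "min (d / 2) (b - a)"
   have "F (a + ?h) < F a" using d lt by (intro d(2)) auto
   moreover have "F b <= F (a + ?h)" by (rule antimonoD[OF anti(2)]) (auto simp: min_def)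
   ultimately show False using ab by simp
  qed
  thus ?thesis using p by (metis linorder_neqE_linordered_idom)
 qed
 define G where "G y = (SOME p. F p = y)" for y
 have FG: "F (G y) = y" if "0 < y" "y < V" for y
  unfolding G_def by (rule someI_ex[OF F_ivt[OF that]])
 have GF: "G (F p) = p" if "0 < F p" "F p < V" for p
  using Finj[of p "G (F p)"] FG[OF that] that by simp
 have cF: "isCont F p" for p using cont(2) by (simp add: continuous_on_eq_continuous_at)
 have Gc: "isCont G (F p)" if p: "0 < F p" "F p < V" for p
 proof -
  have "\<forall>\<^sub>F x in nhds p. F x : {0<..<V}"
   using topological_tendstoD[OF cF[of p, unfolded isCont_def tendsto_at_iff_tendsto_nhds], of "{0<..<V}"] p by simp
  then obtain d where d: "d > 0" "!!x. <|x - p|> < d ==> 0 < F x & F x < V"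
   unfolding eventually_nhds_metric by (auto simp: dist_real_def)
  show ?thesis
  proof (rule isCont_inverse_function[where d = "d / 2" and f = F and g = G and x = p])
   show "G (F z) = z" if "<|z - p|> <= d / 2" for z
   proof -
    have "<|z - p|> < d" using that d(1) by simp
    thus ?thesis using d(2) GF by blast
   qed
  qed (use d cF in auto)
 qed
 define sg where "sg s = G (v s)" for s
 have dsg: "(sg hrd 1) (at s)" if s: "0 < v s" "v s < V" for s
 proof -
  let ?p = "G (v s)"
  have Fp: "F ?p = v s" using FG[OF s] .
  obtain D where D: "D < 0" "(F hrd D) (at ?p)" "(v hrd D) (at s)"
   using ode[OF s Fp] by blast
  have "(G hrd inverse D) (at (v s))"
  proof (rule DERIV_inverse_function[where f = F and a = 0 and b = V])
   show "isCont G (v s)" using Gc[of ?p] Fp s by simp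
  qed (use D s FG in auto)
  from DERIV_chain2[OF this D(3)] show ?thesis unfolding sg_def[abs_def] using D(1) by simp
 qed
 have const: "sg s - s = sg t - t" if st: "s < t" "0 < v s" "v s < V" "0 < v t" "v t < V" for s t
 proof -
  have mid: "0 < v x & v x < V" if "s <= x" "x <= t" for x
   using antimonoD[OF anti(1) that(1)] antimonoD[OF anti(1) that(2)] st by linarith
  have der: "((%x. sg x - x) hrd 0) (at x)" if "s <= x" "x <= t" for x
   using DERIV_diff[OF dsg DERIV_ident, of x] mid[OF that] by simp
  have "continuous_on {s..t} (%x. sg x - x)"
   by (rule DERIV_continuous_on[where D = "%_. 0"]) (auto intro!: has_field_derivative_at_within[OF der])
  thus ?thesis using DERIV_isconst2[OF st(1), of "%x. sg x - x" t] der st(1) by auto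
 qed
 have "EX s. v s = V / 2" by (rule v_ivt) (use V(1) in simp_all)
 then obtain s0 where s0: "v s0 = V / 2" by blast
 have s0': "0 < v s0" "v s0 < V" using V(1) by (simp_all add: s0)
 define b where "b = s0 - sg s0"
 have inI: "v s = F (s - b)" if s: "0 < v s" "v s < V" for s
 proof -
  have "sg s - s = sg s0 - s0"
  proof (cases s s0 rule: linorder_cases)
   case less thus ?thesis by (rule const[OF _ s s0'])
  next
   case greater thus ?thesis by (rule const[OF _ s0' s, symmetric])
  qed (simp only:)
  hence "sg s = s - b" by (simp add: b_def)
  thus ?thesis using FG[OF s] by (simp add: sg_def)
 qed
 have "v s = F (s - b)" for s
 proof -
  consider "0 < v s & v s < V" | "v s = 0" | "v s = V" using V(2,3)[of s] by linarith
  thus ?thesis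
  proof cases
   case 2
   \<comment> \<open>Otherwise \<open>v\<close> would attain a positive value below
     \<open>F (s - b)\<close> at some \<open>s1 > s\<close>, although it vanishes from
     \<open>s\<close> on.\<close>
   have "F (s - b) = 0"
   proof (rule ccontr)
    assume "F (s - b) ~= 0"
    hence pos: "F (s - b) > 0" using V(4)[of "s - b"] by simp
    define y where "y = min (F (s - b)) V / 2"
    have y: "0 < y" "y < V" "y < F (s - b)" using pos V(1) by (auto simp: y_def)
    obtain s1 where s1: "v s1 = y" using v_ivt[OF y(1,2)] by blast
    have "v s1 = F (s1 - b)" by (rule inI) (simp_all add: s1 y)
    hence "F (s1 - b) < F (s - b)" using s1 y by simp
    hence "s < s1" using antimonoD[OF anti(2), of "s1 - b" "s - b"] by linarith
    hence "v s1 <= v s" using antimonoD[OF anti(1)] by simp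
    thus False using s1 2 y by simp
   qed
   thus ?thesis using 2 by simp
  next
   case 3
   have "F (s - b) = V"
   proof (rule ccontr)
    assume "F (s - b) ~= V"
    hence lt: "F (s - b) < V" using V(5)[of "s - b"] by simp
    define y where "y = (F (s - b) + V) / 2"
    have y: "0 < y" "y < V" "F (s - b) < y" using lt V(1) V(4)[of "s - b"] by (auto simp: y_def)
    obtain s1 where s1: "v s1 = y" using v_ivt[OF y(1,2)] by blast
    have "v s1 = F (s1 - b)" by (rule inI) (simp_all add: s1 y)
    hence "F (s - b) < F (s1 - b)" using s1 y by simp
    hence "s1 < s" using antimonoD[OF anti(2), of "s - b" "s1 - b"] by linarith
    hence "v s <= v s1" using antimonoD[OF anti(1)] by simp
    thus False using s1 3 y by simp
   qed
   thus ?thesis using 3 by simp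
  qed (use inI in auto)
 qed
 thus ?thesis by blast
qed

text \<open>At heights with \<open>F p0 = v s0\<close> the inequality of \<open>extremal_cut\<close>
  becomes an equality in the limit \<open>s = s' = s0\<close>, \<open>p = q = p0\<close>, and it
  holds for all \<open>p\<close> and \<open>q\<close> near \<open>p0\<close>. Varying one of them
  forces \<open>v\<close> to have at \<open>s0\<close> the derivative that \<open>F\<close> has at
  \<open>p0\<close>.\<close>

lemma extremal_distribution:
 fixes H K E :: "'a::euclidean_space set"
 assumes H: "open H" "!!x y t. x : H ==> y : K ==> t > 0 ==> x + t *R y : H" "!!x t. x : H ==> x + t *R e : H"
  and K: "open K" "bounded K" "convex K" "K ~= {}" and e: "e : Basis" and nu: "nu <.> e = 1"
  and E: "E : bor" "E <= H" "fin E" and ext: "wulff_extremal H K E"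
  and EK: "vol E = vol K"
 shows "EX b. ALL s. vol (E Int {x. s < x <.> nu}) = vol (K Int {x. s - b < x <.> nu})"
proof -
 define v where "v r = vol (E Int {x. r < x <.> nu})" for r
 define F where "F r = vol (K Int {x. r < x <.> nu})" for r
 define V where "V = vol E"
 let ?n = "DIM('a)"
 have nu0: "nu ~= 0" using nu by auto
 have Kb: "K : bor" "fin K" using K(1) emeasure_bounded_finite[OF K(2)] by auto
 have V: "V > 0" using vol_open_pos[OF K(1,2,4)] K(1) EK by (simp add: V_def)
 have VK: "vol K = V" using EK by (simp add: V_def)
 have cv: "cont v" unfolding v_def by (rule section_continuous[OF E(1,3) nu0])
 have cF: "cont F" unfolding F_def by (rule section_continuous[OF Kb nu0])
 have cv': "isCont v s" and cF': "isCont F s" for s using cv cF by (auto simp: continuous_on_eq_continuous_at)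
 have cut: "?n * (root ?n (F p / v s') * v s' + root ?n ((V - F q) / (V - v s)) * (V - v s))
   <= ?n * V + (q - p) * ((v s - v s') / (s' - s))"
  if "s < s'" "0 < v s'" "v s < V" "0 < F p" "F q < V" for s s' p q
  using extremal_cut[OF H K(1,2) nu E ext that(1), of p q] that(2-5) unfolding v_def F_def V_def EK[symmetric] by simp
 have deriv: "(v hrd D) (at s0)"
  if s0: "0 < v s0" "v s0 < V" "F p0 = v s0" and D: "(F hrd D) (at p0)" for s0 p0 D
 proof -
  have Fpos: "\<forall>\<^sub>F p in at p0. 0 < F p" "\<forall>\<^sub>F p in at p0. F p < V"
   using order_tendstoD[OF cF'[of p0, unfolded isCont_def]] s0 by auto
  have vpos: "\<forall>\<^sub>F s in at s0. 0 < v s" "\<forall>\<^sub>F s in at s0. v s < V"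
   using order_tendstoD[OF cv'[of s0, unfolded isCont_def]] s0 by auto
  have vl: "(v ~~> v s0) (at_left s0)" "(v ~~> v s0) (at_right s0)"
   using cv'[of s0] by (auto simp: isCont_def filterlim_at_split)
  have r1: "root ?n 1 = 1" by simp
  \<comment> \<open>Right derivative: the lower cut stays at \<open>s0\<close> with
    \<open>q = p0\<close>, so its term is constant, and \<open>p\<close> varies.\<close>
  have "((%s. (v s0 - v s) / (s - s0)) ~~> - D) (at_right s0)"
  proof (rule squeeze_difference_quotient[where R = "%p. real ?n * (root ?n (F p / v s0) * v s0 - v s0)"
     and B = "%s p. real ?n * (root ?n (F p / v s) * v s - v s0)" and ?p0.0 = p0])
   show "\<forall>\<^sub>F p in at p0. \<forall>\<^sub>F s in at_right s0. real ?n * (root ?n (F p / v s) * v s - v s0) <= (p0 - p) * ((v s0 - v s) / (s - s0))"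
    using Fpos(1)
   proof eventually_elim
    case (elim p)
    have "\<forall>\<^sub>F s in at_right s0. s0 < s & 0 < v s"
     using vpos(1) unfolding eventually_at_split by (auto simp: eventually_at_filter elim: eventually_mono)
    thus ?case
    proof eventually_elim
     case (elim s)
     have "(V - F p0) / (V - v s0) = 1" using s0 by simp
     thus ?case using cut[of s0 s p p0] elim s0 \<open>0 < F p\<close> by (simp add: algebra_simps)
    qed
   qed
   show "\<forall>\<^sub>F p in at p0. ((%s. real ?n * (root ?n (F p / v s) * v s - v s0)) ~~> real ?n * (root ?n (F p / v s0) * v s0 - v s0)) (at_right s0)"
    using s0 by (intro always_eventually allI tendsto_intros vl) auto
   show "((%p. real ?n * (root ?n (F p / v s0) * v s0 - v s0)) hrd D) (at p0)"
    by (rule root_normalized_derivative[OF D s0(3,1)]) simp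
  qed (use s0 in simp)
  hence R: "((%s. (v s - v s0) / (s - s0)) ~~> D) (at_right s0)"
   using tendsto_minus by (fastforce simp: minus_divide_left)
  \<comment> \<open>Left derivative: the upper cut stays at \<open>s0\<close> with
    \<open>p = p0\<close>, and \<open>q\<close> varies.\<close>
  have "((%s. (v s - v s0) / (s - s0)) ~~> - (- D)) (at_left s0)"
  proof (rule squeeze_difference_quotient[where R = "%q. real ?n * (root ?n ((V - F q) / (V - v s0)) * (V - v s0) - (V - v s0))"
     and B = "%s q. real ?n * (root ?n ((V - F q) / (V - v s)) * (V - v s) - (V - v s0))" and ?p0.0 = p0])
   show "\<forall>\<^sub>F q in at p0. \<forall>\<^sub>F s in at_left s0. real ?n * (root ?n ((V - F q) / (V - v s)) * (V - v s) - (V - v s0)) <= (p0 - q) * ((v s - v s0) / (s - s0))"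
    using Fpos(2)
   proof eventually_elim
    case (elim q)
    have "\<forall>\<^sub>F s in at_left s0. s < s0 & v s < V"
     using vpos(2) unfolding eventually_at_split by (auto simp: eventually_at_filter elim: eventually_mono)
    thus ?case
    proof eventually_elim
     case (elim s)
     have "F p0 / v s0 = 1" using s0 by simp
     moreover have "(p0 - q) * ((v s - v s0) / (s - s0)) = (q - p0) * ((v s - v s0) / (s0 - s))"
      using elim by (simp add: field_simps)
     ultimately show ?case using cut[of s s0 p0 q] elim s0 \<open>F q < V\<close> by (simp add: algebra_simps)
    qed
   qed
   show "\<forall>\<^sub>F q in at p0. ((%s. real ?n * (root ?n ((V - F q) / (V - v s)) * (V - v s) - (V - v s0))) ~~> real ?n * (root ?n ((V - F q) / (V - v s0)) * (V - v s0) - (V - v s0))) (at_left s0)"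
    using s0 by (intro always_eventually allI tendsto_intros vl) auto
   show "((%q. real ?n * (root ?n ((V - F q) / (V - v s0)) * (V - v s0) - (V - v s0))) hrd - D) (at p0)"
    using s0 by (intro root_normalized_derivative) (auto intro!: derivative_eq_intros D)
  qed (use s0 in simp)
  hence "((%s. (v s - v s0) / (s - s0)) ~~> D) (at_left s0)" by simp
  with R have "((%s. (v s - v s0) / (s - s0)) ~~> D) (at s0)" by (simp add: filterlim_at_split)
  thus ?thesis by (simp add: has_field_derivative_iff)
 qed
 have "EX b. ALL s. v s = F (s - b)"
 proof (rule translate_of_same_ode[where V = V])
  show "antimono v" unfolding v_def by (intro antimonoI section_mono E)
  show "antimono F" unfolding F_def by (intro antimonoI section_mono Kb)
  have sub: "vol (S Int {x. s < x <.> nu}) <= vol S" if "S : bor" "fin S" for S s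
   using that by (intro measure_mono_fmeasurable) (auto simp: fmeasurable_def)
  show "v s <= V" "F s <= V" for s unfolding v_def F_def using sub[OF E(1,3)] sub[OF Kb] VK by (auto simp: V_def)
  show "EX s. v s < c & V - c < v (- s)" if "c > 0" for c
   using section_limits[OF E(1,3) that, of nu] unfolding v_def V_def by metis
  show "EX s. F s < c & V - c < F (- s)" if "c > 0" for c
   using section_limits[OF Kb that, of nu] unfolding F_def VK by metis
  show "EX D<0. (F hrd D) (at p) & (v hrd D) (at s)"
   if sp: "0 < v s" "v s < V" "F p = v s" for s p
  proof -
   have "EX x:K. x <.> nu = p"
   proof -
    have "K Int {x. p < x <.> nu} ~= {}" using sp by (auto simp: F_def)
    then obtain x where x: "x : K" "p < x <.> nu" by auto
    have "K Int {x. x <.> nu < p} ~= {}" using sp section_split[OF Kb nu0, of p] VK by (auto simp: F_def)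
    then obtain y where y: "y : K" "y <.> nu < p" by auto
    have "connected ((%x. x <.> nu) ` K)"
     by (intro connected_continuous_image continuous_intros convex_connected K)
    hence "p : (%x. x <.> nu) ` K"
     using x y connectedD_interval[of "(%x. x <.> nu) ` K" "y <.> nu" "x <.> nu" p] by auto
    thus ?thesis by auto
   qed
   then obtain x where "x : K" "x <.> nu = p" by blast
   then obtain a where "a > 0" "(F hrd - a) (at p)"
    using convex_section_derivative[OF K(1-3) e nu] unfolding F_def[abs_def] by blast
   thus ?thesis using deriv[OF sp] by (intro exI[of _ "- a"]) auto
  qed
 qed (use V cv cF in \<open>auto simp: v_def F_def\<close>)
 thus ?thesis unfolding v_def F_def .
qed

text \<open>Equal section functions mean equal distributions of \<open>x <.> nu\<close> up to the
  shift \<open>b\<close>. So the first moment of the possibly unbounded set \<open>E\<close> exists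
  because that of \<open>K\<close> does, and \<open>b\<close> can be read off the moments.\<close>

lemma section_moment:
 fixes E K :: "'a::euclidean_space set"
 assumes E: "E : bor" "fin E" and K: "K : bor" "bounded K"
  and eq: "!!s. vol (E Int {x. s < x <.> nu}) = vol (K Int {x. s - b < x <.> nu})"
 shows "sint E (%x. x <.> nu)" (is ?G1)
  and "(LBINT x:E. x <.> nu) = (LBINT x:K. x <.> nu) + b * vol K" (is ?G2)
proof -
 have Kf: "fin K" using emeasure_bounded_finite[OF K(2)] by simp
 define M1 where "M1 = distr (density lborel (%x. ennreal (ind E x))) borel (%x. x <.> nu)"
 define M2 where "M2 = distr (density lborel (%x. ennreal (ind K x))) borel (%x. x <.> nu + b)"
 have e1: "emeasure M1 {s<..} = em (E Int {x. s < x <.> nu})" for s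
 proof -
  have "(%x. x <.> nu) -` {s<..} = {x. s < x <.> nu}" by auto
  thus ?thesis unfolding M1_def using E(1)
   by (simp add: emeasure_distr emeasure_density ennreal_indicator indicator_inter_arith[symmetric])
 qed
 have e2: "emeasure M2 {s<..} = em (K Int {x. s - b < x <.> nu})" for s
 proof -
  have "(%x. x <.> nu + b) -` {s<..} = {x. s - b < x <.> nu}" by auto
  thus ?thesis unfolding M2_def using K(1)
   by (simp add: emeasure_distr emeasure_density ennreal_indicator indicator_inter_arith[symmetric])
 qed
 have fin: "fin (E Int {x. s < x <.> nu})" "fin (K Int {x. s < x <.> nu})" for s
  by (rule finite_sub[OF E(2) _ E(1)], blast) (rule finite_sub[OF Kf _ K(1)], blast)
 have M: "M1 = M2"
 proof (rule measure_eqI_lessThan)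
  show "emeasure M1 {x<..} < \<infinity>" for x using fin e1 by simp
  show "emeasure M1 {x<..} = emeasure M2 {x<..}" for x
   unfolding e1 e2 using eq[of x] fin(1)[of x] fin(2)[of "x - b"] by (simp add: emeasure_eq_ennreal_measure less_top[symmetric])
 qed (auto simp: M1_def M2_def)
 obtain R where R: "!!x. x : K ==> norm x <= R" using K(2) bounded_iff by blast
 have iK: "lint (ind K :: 'a => real)" using K(1) Kf by (simp add: integrable_indicator_iff)
 have i2: "lint (%x. ind K x *R (x <.> nu + c))" for c
 proof (rule Bochner_Integration.integrable_bound[OF integrable_mult_right[OF iK, of "R * norm nu + <|c|>"]])
  show "AEL x. norm (ind K x *R (x <.> nu + c)) <= norm ((R * norm nu + <|c|>) * ind K x)" (is "AE x in _. ?G3 x")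
  proof (intro AE_I2)
   fix x
   show "?G3 x"
   proof (cases "x : K")
    case True
    have "<|x <.> nu|> <= R * norm nu"
     using Cauchy_Schwarz_ineq2[of x nu] mult_right_mono[OF R[OF True], of "norm nu"] by simp
    thus ?thesis using True by simp
   qed simp
  qed
 qed (use K(1) in auto)
 have "integrable M2 (%y. y)"
  unfolding M2_def using i2[of b] K(1) by (simp add: integrable_distr_eq integrable_density)
 hence "integrable M1 (%y. y)" by (simp add: M)
 thus ?G1
  unfolding M1_def using E(1) by (simp add: integrable_distr_eq integrable_density set_integrable_def)
 have "(LBINT x:E. x <.> nu) = (LINT y|M1. y)"
  unfolding M1_def using E(1) by (simp add: integral_distr integral_density sli_def)
 also have "... = (LBINT x:K. x <.> nu + b)"
  unfolding M M2_def using K(1) by (simp add: integral_distr integral_density sli_def)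
 also have "... = (LBINT x:K. x <.> nu) + (LBINT x:K. b)"
  using i2[of 0] integrable_mult_left[OF iK, of b] by (intro set_integral_add) (auto simp: set_integrable_def)
 also have "(LBINT x:K. b) = b * vol K"
  using K(1) Kf by (simp add: sli_def)
 finally show ?G2 .
qed

text \<open>The translation in direction \<open>nu\<close> is determined by the barycentres, hence is linear in \<open>nu\<close>;
 so \<open>E\<close> has the same supporting half-spaces as a translate of \<open>K\<close>.\<close>

theorem extremal_unique:
 fixes H K E :: "(real^'n) set"
 assumes H: "open H" "!!x y t. x : H ==> y : K ==> t > 0 ==> x + t *R y : H"
   "!!e x t. e : Basis ==> e ~= e0 ==> x : H ==> x + t *R e : H"
  and dim: "CARD('n) >= 2"
  and K: "open K" "bounded K" "convex K" "K ~= {}"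
  and E: "E : bor" "E <= H" "fin E" and ext: "wulff_extremal H K E"
  and EK: "vol E = vol K"
 shows "EX b. negligible (E - (%x. x + b) ` K Un ((%x. x + b) ` K - E))"
proof -
 define V where "V = vol K"
 have V: "V > 0" using vol_open_pos[OF K(1,2,4)] K(1) by (simp add: V_def)
 have Kb: "K : bor" using K(1) by simp
 have dist: "EX b. ALL s. vol (E Int {x. s < x <.> nu}) = vol (K Int {x. s - b < x <.> nu})"
  if "e : Basis" "e ~= e0" "nu <.> e = 1" for e nu
  by (rule extremal_distribution[OF H(1,2) H(3)[OF that(1,2)] K that(1,3) E ext EK])
 have "EX e:(Basis :: (real^'n) set). e ~= e0"
 proof (rule ccontr)
  assume "~ ?thesis"
  hence "(Basis :: (real^'n) set) <= {e0}" by auto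
  hence "card (Basis :: (real^'n) set) <= 1" by (metis card_mono card.empty card.insert finite.emptyI finite_insert One_nat_def empty_iff)
  thus False using dim by simp
 qed
 then obtain e where e: "e : Basis" "e ~= e0" by blast
 have ee: "e <.> e = 1" using e(1) by (simp add: inner_same_Basis)
 \<comment> \<open>The direction \<open>e0\<close> itself is not covered by \<open>dist\<close>, but
   \<open>e + e0\<close> is, because it has component 1 along \<open>e\<close>; the moment along
   \<open>e0\<close> is a difference.\<close>
 have iE: "sint E (%x. x <.> i)" if i: "i : Basis" for i
 proof (cases "i = e0")
  case True
  have "(e + i) <.> e = 1" using e True i by (simp add: inner_add_left inner_Basis)
  then obtain b where "!!s. vol (E Int {x. s < x <.> (e + i)}) = vol (K Int {x. s - b < x <.> (e + i)})"
   using dist[OF e] by blast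
  hence 1: "sint E (%x. x <.> (e + i))" by (rule section_moment(1)[OF E(1,3) Kb K(2)])
  obtain b where "!!s. vol (E Int {x. s < x <.> e}) = vol (K Int {x. s - b < x <.> e})"
   using dist[OF e ee] by blast
  hence "sint E (%x. x <.> e)" by (rule section_moment(1)[OF E(1,3) Kb K(2)])
  from set_integral_diff(1)[OF 1 this] show ?thesis by (simp add: inner_add_right)
 next
  case False
  have "i <.> i = 1" using i by (simp add: inner_same_Basis)
  then obtain b where "!!s. vol (E Int {x. s < x <.> i}) = vol (K Int {x. s - b < x <.> i})"
   using dist[OF i False] by blast
  thus ?thesis by (rule section_moment(1)[OF E(1,3) Kb K(2)])
 qed
 have iK: "sint K (%x. x <.> i)" for i
  by (rule section_moment(1)[OF Kb _ Kb K(2), of i 0]) (use emeasure_bounded_finite[OF K(2)] in auto)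
 define be where "be = (SUM i:Basis. (((LBINT x:E. x <.> i) - (LBINT x:K. x <.> i)) / V) *R i)"
 have lin: "(LBINT x:A. x <.> nu) = (SUM i:Basis. (nu <.> i) * (LBINT x:A. x <.> i))"
  if "!!i. i : Basis ==> sint A (%x. x <.> i)" for A and nu :: "real^'n"
 proof -
  have "(LBINT x:A. x <.> nu) = (LBINT x:A. (SUM i:Basis. (nu <.> i) * (x <.> i)))"
   by (subst euclidean_inner) (simp add: mult.commute)
  also have "... = (LBINT x. (SUM i:Basis. (nu <.> i) * (ind A x * (x <.> i))))"
   by (simp add: sli_def sum_distrib_left mult.left_commute)
  also have "... = (SUM i:Basis. (nu <.> i) * (LBINT x:A. x <.> i))"
   using that by (subst Bochner_Integration.integral_sum) (auto simp: set_integrable_def sli_def)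
  finally show ?thesis .
 qed
 have sec: "vol (E Int {x. s < x <.> nu}) = vol (K Int {x. s - be <.> nu < x <.> nu})"
  if nu: "nu <.> e = 1" for nu s
 proof -
  obtain b where b: "!!s. vol (E Int {x. s < x <.> nu}) = vol (K Int {x. s - b < x <.> nu})"
   using dist[OF e nu] by blast
  have "b * V = (LBINT x:E. x <.> nu) - (LBINT x:K. x <.> nu)"
   using section_moment(2)[OF E(1,3) Kb K(2) b] by (simp add: V_def)
  also have "... = (SUM i:Basis. (nu <.> i) * ((LBINT x:E. x <.> i) - (LBINT x:K. x <.> i)))"
   using lin[OF iE, of nu] lin[OF iK, of nu] by (simp add: sum_subtractf right_diff_distrib)
  also have "... = (SUM i:Basis. V * ((be <.> i) * (nu <.> i)))"
   using V by (intro sum.cong) (auto simp: be_def)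
  also have "... = V * (be <.> nu)"
   by (simp add: sum_distrib_left[symmetric] euclidean_inner[symmetric])
  finally have "b = be <.> nu" using V by simp
  thus ?thesis using b by simp
 qed
 define K' where "K' = (%x. x + be) ` K"
 have K': "open K'" "bounded K'" "convex K'" "K' ~= {}"
 proof -
  have eq: "K' = (+) be ` K" by (simp add: K'_def add.commute)
  show "open K'" "bounded K'" "convex K'" "K' ~= {}" unfolding eq
   using open_translation[OF K(1)] bounded_translation[OF K(2)] convex_translation[OF K(3)] K(4) by auto
 qed
 have mK': "vol K' = V"
 proof -
  have "vl ((+) be ` K) = vl K" by (rule measure_translation)
  thus ?thesis using K(1) K'(1) by (simp add: K'_def V_def measure_completion add.commute)
 qed
 have nu0: "nu ~= 0" if "nu <.> e = 1" for nu using that by auto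
 \<comment> \<open>A half-space that contains a neighbourhood of \<open>y\<close> and misses
   \<open>K'\<close> meets \<open>E\<close> in a null set, by the section formula
   \<open>sec\<close>.\<close>
 have loc: "EX r>0. negligible (E Int ball y r)" if y: "y : - closure K'" for y
 proof -
  obtain a c where ac: "a <.> y < c" "!!x. x : closure K' ==> c < a <.> x"
   using separating_hyperplane_closed_point[of "closure K'" y] y K'(3) convex_closure by auto
  obtain R where R: "R > 0" "!!x. x : K' ==> norm (x - y) <= R"
  proof -
   have "bounded ((%x. x - y) ` K')" using bounded_translation_minus[OF K'(2)] .
   thus ?thesis using that unfolding bounded_pos by auto
  qed
  define gap where "gap = c - a <.> y"
  have gap: "gap > 0" using ac by (simp add: gap_def)
  \<comment> \<open>Only normals with a non-zero component along \<open>e\<close> can be scaled to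
    \<open>nu <.> e = 1\<close>; a separating normal orthogonal to \<open>e\<close> is tilted
    towards \<open>e\<close>, which uses up half of the gap.\<close>
  have "EX a' m. m > 0 & a' <.> e ~= 0 & (ALL x:K'. a' <.> y + m <= a' <.> x)"
  proof (cases "a <.> e = 0")
   case False
   have "ALL x:K'. a <.> y + gap <= a <.> x" using ac(2) closure_subset by (force simp: gap_def)
   thus ?thesis using False gap by blast
  next
   case True
   define d where "d = gap / (2 * R)"
   have d: "d > 0" "d * R = gap / 2" using gap R by (auto simp: d_def)
   have "(a + d *R e) <.> y + gap / 2 <= (a + d *R e) <.> x" if "x : K'" for x
   proof -
    have "x : closure K'" using that closure_subset by blast
    have "<|e <.> (x - y)|> <= norm e * norm (x - y)" by (rule Cauchy_Schwarz_ineq2)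
    also have "... <= R" using R(2)[OF that] e(1) by simp
    finally have "d * <|e <.> (x - y)|> <= gap / 2" using d by (metis mult_left_mono less_imp_le)
    hence "<|d * (e <.> (x - y))|> <= gap / 2" using d by (simp add: abs_mult)
    hence "- (gap / 2) <= d * (e <.> x) - d * (e <.> y)" unfolding inner_diff_right right_diff_distrib by linarith
    moreover have "a <.> y + gap < a <.> x" using ac(2)[OF \<open>x : closure K'\<close>] by (simp add: gap_def)
    ultimately show ?thesis unfolding inner_add_left inner_scaleR_left by linarith
   qed
   moreover have "(a + d *R e) <.> e ~= 0" using True d ee by (simp add: inner_add_left)
   ultimately show ?thesis using gap by (intro exI[of _ "a + d *R e"] exI[of _ "gap / 2"]) auto
  qed
  then obtain a' m where a': "m > 0" "a' <.> e ~= 0" "!!x. x : K' ==> a' <.> y + m <= a' <.> x" by blast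
  define t where "t = a' <.> e"
  define nu where "nu = (1 / t) *R a'"
  have nu: "nu <.> e = 1" using a'(2) by (simp add: nu_def t_def)
  have mem: "z + be : K'" if "z : K" for z using that by (simp add: K'_def)
  have nullset: "negligible (E Int S)" if "vol (E Int S) = 0" "S : bor" for S
  proof -
   have "fin (E Int S)" by (rule finite_sub[OF E(3) _ E(1)]) auto
   hence "em (E Int S) = 0" using that(1) by (simp add: emeasure_eq_ennreal_measure less_top[symmetric])
   hence "E Int S : null_sets lborel" using that(2) E(1) by (simp add: null_sets_def)
   hence "E Int S : null_sets lebesgue" by (rule null_sets_completionI)
   thus ?thesis by (simp add: negligible_iff_null_sets)
  qed
  have half: "x / 2 < x" if "0 < x" for x :: real using that by simp
  have half': "x < x / 2" if "x < 0" for x :: real using that by simp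
  have "EX S. open S & y : S & negligible (E Int S)"
  proof (cases "t > 0")
   case True
   define s where "s = y <.> nu + m / t / 2"
   have "K Int {x. s - be <.> nu < x <.> nu} = K"
   proof -
    have "s - be <.> nu < z <.> nu" if "z : K" for z
    proof -
     have "(a' <.> y + m) / t <= (a' <.> (z + be)) / t" using a'(3)[OF mem[OF that]] True by (intro divide_right_mono) auto
     hence "y <.> nu + m / t <= z <.> nu + be <.> nu" by (simp add: nu_def inner_add_right add_divide_distrib inner_commute)
     moreover have "m / t / 2 < m / t" using divide_pos_pos[OF a'(1) True] by (rule half)
     ultimately show ?thesis by (simp add: s_def)
    qed
    thus ?thesis by auto
   qed
   hence "vol (E Int {x. s < x <.> nu}) = vol E" using sec[OF nu, of s] EK by simp
   hence "vol (E Int {x. x <.> nu < s}) = 0" using section_split[OF E(1,3) nu0[OF nu]] by simp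
   hence "negligible (E Int {x. x <.> nu < s})" by (rule nullset) simp
   moreover have "y : {x. x <.> nu < s}" using True a'(1) by (simp add: s_def)
   moreover have "open {x. x <.> nu < s}" by (simp add: open_halfspace_lt inner_commute[of _ nu])
   ultimately show ?thesis by blast
  next
   case False
   hence t: "t < 0" using a'(2) by (simp add: t_def)
   define s where "s = y <.> nu + m / t / 2"
   have "K Int {x. s - be <.> nu < x <.> nu} = {}"
   proof -
    have "z <.> nu < s - be <.> nu" if "z : K" for z
    proof -
     have "(a' <.> (z + be)) / t <= (a' <.> y + m) / t" using a'(3)[OF mem[OF that]] t by (intro divide_right_mono_neg) auto
     hence "z <.> nu + be <.> nu <= y <.> nu + m / t" by (simp add: nu_def inner_add_right add_divide_distrib inner_commute)
     moreover have "m / t < m / t / 2" using divide_pos_neg[OF a'(1) t] by (rule half')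
     ultimately show ?thesis by (simp add: s_def)
    qed
    thus ?thesis by fastforce
   qed
   hence "vol (E Int {x. s < x <.> nu}) = 0" using sec[OF nu, of s] by simp
   hence "negligible (E Int {x. s < x <.> nu})" by (rule nullset) simp
   moreover have "y : {x. s < x <.> nu}" using t a'(1) by (simp add: s_def divide_neg_pos divide_pos_neg)
   moreover have "open {x. s < x <.> nu}" by (simp add: open_halfspace_gt inner_commute[of _ nu])
   ultimately show ?thesis by blast
  qed
  then obtain S where S: "open S" "y : S" "negligible (E Int S)" by blast
  then obtain r where "r > 0" "ball y r <= S" using open_contains_ball by blast
  thus ?thesis using negligible_subset[OF S(3), of "E Int ball y r"] by auto
 qed
 have n1: "negligible (E Int - closure K')" by (rule negligible_Union_locally) (rule loc)
 have nf: "negligible (frontier K')" by (rule negligible_convex_frontier[OF K'(3)])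
 have "E - K' <= (E Int - closure K') Un frontier K'" using K'(1) by (auto simp: frontier_def interior_open)
 hence n2: "negligible (E - K')" using n1 nf negligible_subset negligible_Un by blast
 have lm: "E : lmeasurable" "K' : lmeasurable"
  using E(1,3) by (simp add: fmeasurable_def) (rule lmeasurable_open[OF K'(2,1)])
 have mE: "vl E = V" "vl K' = V"
  using E(1) EK K'(1) mK' by (simp_all add: measure_completion V_def)
 \<comment> \<open>\<open>E\<close> lies in \<open>K'\<close> up to a null set; having the same
   volume, it also fills \<open>K'\<close>.\<close>
 have "vl (E Int K') = vl E"
  using n2 lm by (intro measure_negligible_symdiff) (auto simp: Diff_Int elim!: negligible_subset)
 hence "vl (K' - (E Int K')) = 0"
  using lm mE by (subst measurable_measure_Diff) (auto intro: fmeasurableD)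
 moreover have "K' - (E Int K') : lmeasurable" using lm by (intro fmeasurable_Diff) (auto intro: fmeasurableD)
 ultimately have "negligible (K' - (E Int K'))" by (simp add: negligible_iff_measure)
 moreover have "K' - (E Int K') = K' - E" by auto
 ultimately show ?thesis using n2 negligible_Un unfolding K'_def[symmetric] by (intro exI[of _ be]) (auto simp: K'_def[symmetric])
qed

section \<open>Hausdorff measure on the interface\<close>

lemma hp_le:
 assumes "A <= (UN n. U n)" "!!n. bounded (U n) & diameter (U n) <= de"
 shows "hp s de A <= (\<Sum>n. ennreal (unit_ball_vol s * (diameter (U n) / 2) powr s))"
 unfolding hausdorff_premeasure_def using assms by (intro INF_lower) auto

lemma hausdorff_premeasure_mono: "A <= B ==> hp s de A <= hp s de B"
 unfolding hausdorff_premeasure_def by (intro INF_superset_mono) auto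

lemma hausdorff_mono: "A <= B ==> hm s A <= hm s B"
 unfolding hausdorff_measure_def by (intro SUP_mono) (blast intro: hausdorff_premeasure_mono)

lemma hp_le_measure: "de > 0 ==> hp s de A <= hm s A"
 unfolding hausdorff_measure_def by (intro SUP_upper) auto

lemma hausdorff_premeasure_subadditive:
 fixes A :: "nat => 'a::metric_space set"
 shows "hp s de (UN n. A n) <= (\<Sum>n. hp s de (A n))"
proof (rule ennreal_le_epsilon)
 fix e :: real assume e: "e > 0" and fin: "(\<Sum>n. hp s de (A n)) < top"
 define c where "c U = (\<Sum>n. ennreal (unit_ball_vol s * (diameter (U n) / 2) powr s))" for U :: "nat => 'a set"
 have "EX U. A n <= (UN i. U i) & (ALL i. bounded (U i) & diameter (U i) <= de) & c U <= hp s de (A n) + ennreal (e * (1/2) ^ Suc n)" for n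
 proof -
  have "hp s de (A n) ~= top"
   using ennreal_suminf_lessD[OF fin] by (metis less_irrefl)
  hence "hp s de (A n) < hp s de (A n) + ennreal (e * (1/2) ^ Suc n)"
   using e ennreal_add_left_cancel_less[of _ 0] by (simp add: ennreal_zero_less_mult_iff)
  then obtain U where "A n <= (UN i. U i)" "ALL i. bounded (U i) & diameter (U i) <= de"
   "c U < hp s de (A n) + ennreal (e * (1/2) ^ Suc n)"
   unfolding hausdorff_premeasure_def[of s de "A n"] INF_less_iff c_def by blast
  thus ?thesis by (intro exI[of _ U]) (auto intro: less_imp_le)
 qed
 then obtain U where U: "!!n. A n <= (UN i. U n i)" "!!n i. bounded (U n i) & diameter (U n i) <= de"
  "!!n. c (U n) <= hp s de (A n) + ennreal (e * (1/2) ^ Suc n)" by metis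
 define W where "W m = (case prod_decode m of (n, i) => U n i)" for m
 have "(UN n. A n) <= (UN m. W m)"
 proof
  fix x assume "x : (UN n. A n)"
  then obtain n where "x : A n" by blast
  then obtain i where "x : U n i" using U(1) by blast
  hence "x : W (prod_encode (n, i))" by (simp add: W_def)
  thus "x : (UN m. W m)" by blast
 qed
 moreover have "bounded (W m) & diameter (W m) <= de" for m using U(2) by (auto simp: W_def split: prod.split)
 ultimately have "hp s de (UN n. A n) <= c W"
  unfolding c_def by (intro hp_le)
 also have "c W = (\<Sum>n. c (U n))"
 proof -
  define f where "f p = ennreal (unit_ball_vol s * (diameter (U (fst p) (snd p)) / 2) powr s)" for p
  have "(\<Sum>i. f (prod_decode i)) = (\<Sum>n. c (U n))"
   by (rule suminf_ennreal_2dimen) (auto simp: f_def c_def)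
  moreover have "f (prod_decode i) = ennreal (unit_ball_vol s * (diameter (W i) / 2) powr s)" for i
   by (simp add: f_def W_def split: prod.split)
  ultimately show ?thesis by (simp add: c_def)
 qed
 also have "... <= (\<Sum>n. hp s de (A n) + ennreal (e * (1/2) ^ Suc n))"
  using U(3) by (intro suminf_le) auto
 also have "... = (\<Sum>n. hp s de (A n)) + (\<Sum>n. ennreal (e * (1/2) ^ Suc n))"
  by (rule suminf_add[symmetric]) auto
 also have "(\<Sum>n. ennreal (e * (1/2) ^ Suc n)) = ennreal e"
 proof -
  have "(%n. e * (1/2) ^ Suc n) sums (e * 1)" by (intro sums_mult power_half_series)
  thus ?thesis using e by (intro suminf_ennreal_eq) auto
 qed
 finally show "hp s de (UN n. A n) <= (\<Sum>n. hp s de (A n)) + ennreal e" .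
qed

lemma hausdorff_subadditive:
 fixes A :: "nat => 'a::metric_space set"
 shows "hm s (UN n. A n) <= (\<Sum>n. hm s (A n))"
 unfolding hausdorff_measure_def[of s "UN n. A n"]
proof (rule SUP_least)
 fix de :: real assume "de : {0<..}"
 hence "hp s de (A n) <= hm s (A n)" for n
  by (intro hp_le_measure) auto
 hence "(\<Sum>n. hp s de (A n)) <= (\<Sum>n. hm s (A n))"
  by (intro suminf_le) auto
 with hausdorff_premeasure_subadditive show "hp s de (UN n. A n) <= (\<Sum>n. hm s (A n))"
  by (rule order_trans)
qed

lemma hausdorff_empty: "hm s {} = 0"
proof -
 have "hp s de {} <= 0" if "de > 0" for de :: real
  using hp_le[of "{}" "%_. {}" de s] that by simp
 thus ?thesis unfolding hausdorff_measure_def by (intro antisym SUP_least) auto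
qed

lemma hausdorff_Un: "hm s (A Un B) <= hm s A + hm s B"
proof -
 define C where "C n = (if n = 0 then A else if n = 1 then B else {})" for n :: nat
 have "A Un B = (UN n. C n)" by (auto simp: C_def split: if_splits)
 hence "hm s (A Un B) <= (\<Sum>n. hm s (C n))"
  using hausdorff_subadditive[of s C] by simp
 also have "... = (SUM n:{0,1}. hm s (C n))"
  by (rule suminf_finite) (auto simp: C_def hausdorff_empty)
 also have "... = hm s A + hm s B" by (simp add: C_def)
 finally show ?thesis .
qed

lemma hausdorff_affine_le:
 fixes A :: "'a::real_normed_vector set"
 assumes l: "l > 0" and s: "s >= 0"
 shows "hm s ((%x. a + l *R x) ` A) <= ennreal (l powr s) * hm s A"
 unfolding hausdorff_measure_def[of s "(%x. a + l *R x) ` A"]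
proof (rule SUP_least)
 fix de :: real assume "de : {0<..}"
 hence de: "de > 0" by simp
 have "hp s de ((%x. a + l *R x) ` A) <= ennreal (l powr s) * hp s (de / l) A"
 proof -
  have "hp s de ((%x. a + l *R x) ` A) <= ennreal (l powr s) * (\<Sum>n. ennreal (unit_ball_vol s * (diameter (U n) / 2) powr s))"
   if U: "A <= (UN n. U n)" "!!n. bounded (U n) & diameter (U n) <= de / l" for U :: "nat => 'a set"
  proof -
   define W where "W n = (%x. a + l *R x) ` U n" for n
   have dW: "diameter (W n) <= l * diameter (U n)" for n
   proof (rule diameter_le)
    show "W n ~= {} | 0 <= l * diameter (U n)" using l U(2) diameter_ge_0 by (metis less_imp_le mult_nonneg_nonneg)
    fix x y assume "x : W n" "y : W n"
    then obtain x' y' where xy: "x' : U n" "y' : U n" "x = a + l *R x'" "y = a + l *R y'" by (auto simp: W_def)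
    have "norm (x - y) = l * dist x' y'" using l xy by (simp add: dist_norm scaleR_diff_right[symmetric])
    also have "... <= l * diameter (U n)" using l xy U(2) by (intro mult_left_mono diameter_bounded_bound) auto
    finally show "norm (x - y) <= l * diameter (U n)" .
   qed
   have bW: "bounded (W n)" for n
   proof -
    have "W n = (+) a ` (scaleR l ` U n)" by (auto simp: W_def)
    thus ?thesis using U(2) bounded_translation bounded_scaling by metis
   qed
   have "hp s de ((%x. a + l *R x) ` A) <= (\<Sum>n. ennreal (unit_ball_vol s * (diameter (W n) / 2) powr s))"
   proof (rule hp_le)
    show "(%x. a + l *R x) ` A <= (UN n. W n)" using U(1) unfolding W_def by blast
    show "bounded (W n) & diameter (W n) <= de" for n
    proof -
     have "l * diameter (U n) <= l * (de / l)" using U(2)[of n] l by (intro mult_left_mono) auto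
     thus ?thesis using dW[of n] bW[of n] l by simp
    qed
   qed
   also have "... <= (\<Sum>n. ennreal (l powr s) * ennreal (unit_ball_vol s * (diameter (U n) / 2) powr s))"
   proof (rule suminf_le)
    fix n
    have "(diameter (W n) / 2) powr s <= (l * (diameter (U n) / 2)) powr s"
     using dW[of n] s bW diameter_ge_0 by (intro powr_mono2) auto
    also have "... = l powr s * (diameter (U n) / 2) powr s"
     using l U(2)[of n] diameter_ge_0 by (intro powr_mult)
    finally have "unit_ball_vol s * (diameter (W n) / 2) powr s <= l powr s * (unit_ball_vol s * (diameter (U n) / 2) powr s)"
     using s by (metis mult.left_commute mult_left_mono unit_ball_vol_nonneg)
    thus "ennreal (unit_ball_vol s * (diameter (W n) / 2) powr s) <= ennreal (l powr s) * ennreal (unit_ball_vol s * (diameter (U n) / 2) powr s)"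
     by (simp add: ennreal_mult'[symmetric] ennreal_leI)
   qed auto
   also have "... = ennreal (l powr s) * (\<Sum>n. ennreal (unit_ball_vol s * (diameter (U n) / 2) powr s))"
    by (rule ennreal_suminf_cmult)
   finally show ?thesis .
  qed
  moreover have "ennreal (l powr s) * ennreal (l powr (- s)) = 1"
   using l by (simp add: ennreal_mult'[symmetric] powr_add[symmetric])
  ultimately have "ennreal (l powr (- s)) * hp s de ((%x. a + l *R x) ` A) <= hp s (de / l) A"
   unfolding hausdorff_premeasure_def[of s "de / l" A]
   by (intro INF_greatest) (smt (verit, ccfv_threshold) mem_Collect_eq mult.assoc mult.commute mult.right_neutral mult_left_mono zero_le)
  hence "ennreal (l powr s) * (ennreal (l powr (- s)) * hp s de ((%x. a + l *R x) ` A))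
   <= ennreal (l powr s) * hp s (de / l) A"
   by (intro mult_left_mono) auto
  thus ?thesis by (simp add: mult.assoc[symmetric] \<open>ennreal (l powr s) * ennreal (l powr (- s)) = 1\<close>)
 qed
 also have "... <= ennreal (l powr s) * hm s A"
  using de l by (intro mult_left_mono hp_le_measure) auto
 finally show "hp s de ((%x. a + l *R x) ` A) <= ennreal (l powr s) * hm s A" .
qed

section \<open>Area on the interface and its comparison with Hausdorff measure\<close>

definition proj :: "'n => real^'n => real^'n" where
 "proj k x = x - (x $ k) *R axis k 1"

lemma proj_nth [simp]: "proj k x $ i = (if i = k then 0 else x $ i)"
 by (simp add: proj_def axis_def)

lemma proj_measurable [measurable]: "proj k : bm"
 unfolding proj_def by (intro borel_measurable_continuous_onI continuous_intros)

lemma continuous_proj: "continuous_on S (proj k)"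
 unfolding proj_def by (intro continuous_intros)

definition slab :: "'n => (real^'n) set" where
 "slab k = {x. 0 < x $ k & x $ k < 1}"

abbreviation "cyl k S == {x : slab k. proj k x : S}"

text \<open>The \<open>(N-1)\<close>-dimensional Lebesgue measure of \<open>S \<inter> interface k\<close>, as the volume of a cylinder of height 1.\<close>

definition area :: "'n::finite => (real^'n) set => ennreal" where
 "area k S = em (cyl k S)"

lemma slab_borel [measurable]: "slab k : bor"
 unfolding slab_def by measurable

lemma cyl_borel [measurable]: "S : bor ==> cyl k S : bor"
proof -
 assume "S : bor"
 hence "slab k Int proj k -` S : bor" using measurable_sets[OF proj_measurable] by (intro sets.Int) auto
 thus ?thesis by (simp add: vimage_def Int_def)
qed

definition flat_cube :: "'n => real^'n => real => (real^'n) set" where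
 "flat_cube k a l = {x. x $ k = 0 & (ALL i. i ~= k --> a $ i <= x $ i & x $ i <= a $ i + l)}"

lemma flat_cube_affine:
 assumes "l > 0"
 shows "flat_cube k a l = (%x. proj k a + l *R x) ` flat_cube k 0 1"
proof (intro equalityI subsetI)
 fix x assume x: "x : flat_cube k a l"
 have "x = proj k a + l *R ((1 / l) *R (x - proj k a))" using assms by simp
 moreover have "(1 / l) *R (x - proj k a) : flat_cube k 0 1"
  using x assms by (auto simp: flat_cube_def divide_le_eq)
 ultimately show "x : (%x. proj k a + l *R x) ` flat_cube k 0 1" by (rule image_eqI)
qed (use assms in \<open>auto simp: flat_cube_def mult_left_le\<close>)

lemma flat_cube_borel: "flat_cube k a l : bor"
proof -
 have "closed (flat_cube k a l)"
  unfolding flat_cube_def by (intro closed_Collect_conj closed_Collect_all closed_Collect_imp closed_Collect_eq closed_Collect_le continuous_intros) auto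
 thus ?thesis by simp
qed

lemma area_flat_cube:
 fixes k :: "'n::finite"
 assumes l: "l >= 0"
 shows "area k (flat_cube k a l) = ennreal (l ^ (CARD('n) - 1))"
proof -
 define lo where "lo = (\<chi> i. if i = k then 0 else a $ i)"
 define hi where "hi = (\<chi> i. if i = k then 1 else a $ i + l)"
 have vol: "(PROD i:UNIV. hi $ i - lo $ i) = l ^ (CARD('n) - 1)"
 proof -
  have "(PROD i:UNIV. hi $ i - lo $ i) = (hi $ k - lo $ k) * (PROD i:UNIV - {k}. hi $ i - lo $ i)"
   by (rule prod.remove) auto
  also have "(PROD i:UNIV - {k}. hi $ i - lo $ i) = (PROD i:UNIV - {k}. l)"
   by (intro prod.cong) (auto simp: hi_def lo_def)
  finally show ?thesis by (simp add: hi_def lo_def)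
 qed
 have m: "em (cbox lo hi) = ennreal (l ^ (CARD('n) - 1))"
 proof -
  have "ALL i. lo $ i <= hi $ i" using l by (simp add: lo_def hi_def)
  hence "vol (cbox lo hi) = (PROD i:UNIV. hi $ i - lo $ i)"
   by (intro content_cbox_cart) (simp add: interval_ne_empty_cart)
  thus ?thesis by (metis vol emeasure_eq_ennreal_measure emeasure_lborel_cbox_finite infinity_ennreal_def less_irrefl)
 qed
 have sub: "cyl k (flat_cube k a l) <= cbox lo hi"
  by (auto simp: slab_def flat_cube_def mem_box_cart lo_def hi_def)
 have sub2: "box lo hi <= cyl k (flat_cube k a l)"
 proof
  fix x assume "x : box lo hi"
  hence x: "lo $ i < x $ i" "x $ i < hi $ i" for i by (auto simp: mem_box_cart)
  have "0 < x $ k" "x $ k < 1" using x[of k] by (auto simp: lo_def hi_def)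
  moreover have "a $ i <= x $ i" "x $ i <= a $ i + l" if "i ~= k" for i using x[of i] that by (auto simp: lo_def hi_def)
  ultimately show "x : cyl k (flat_cube k a l)" by (simp add: slab_def flat_cube_def)
 qed
 have "em (box lo hi) = em (cbox lo hi)"
  by (simp add: emeasure_lborel_box_eq emeasure_lborel_cbox_eq)
 thus ?thesis unfolding area_def
  using emeasure_mono[OF sub, of lborel] emeasure_mono[OF sub2, of lborel] cyl_borel[OF flat_cube_borel, of k k a l] m by simp
qed

text \<open>The cube is covered by m^(N-1) cells of diameter at most N/m; the powers of m cancel,
  which leaves the constant \<open>C\<close> at every mesh size.\<close>

lemma hm_cube_finite:
 fixes k :: "'n::finite"
 assumes N: "CARD('n) >= 2"
 shows "hm (real CARD('n) - 1) (flat_cube k 0 1) < \<infinity>"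
proof -
 let ?s = "real CARD('n) - 1"
 define C where "C = unit_ball_vol ?s * (real CARD('n) / 2) powr ?s"
 have s: "?s > 0" using N by simp
 have "hp ?s de (flat_cube k 0 1) <= ennreal C" if de: "de > 0" for de
 proof -
  obtain m :: nat where m: "real CARD('n) / de < real m" using reals_Archimedean2 by blast
  have m0: "m > 0" using m de by (metis divide_nonneg_pos less_le_trans not_gr0 of_nat_0 of_nat_0_le_iff order_less_irrefl le_less_trans)
  define F where "F = (PiE (UNIV - {k}) (%_. {..<m}) :: ('n => nat) set)"
  have F: "finite F" "card F = m ^ (CARD('n) - 1)" unfolding F_def by (simp_all add: finite_PiE card_PiE)
  define cell where "cell f = {x. x $ k = 0 & (ALL i. i ~= k --> real (f i) / m <= x $ i & x $ i <= (real (f i) + 1) / m)}" for f :: "'n => nat"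
  have diff: "norm (x - y) <= real CARD('n) / m" if "x : cell f" "y : cell f" for x y f
  proof -
   have "<|(x - y) $ i|> <= 1 / m" for i
   proof (cases "i = k")
    case False
    thus ?thesis using that[unfolded cell_def] by (auto simp: abs_le_iff add_divide_distrib) (smt (verit))+
   qed (use that in \<open>auto simp: cell_def\<close>)
   hence "(SUM i:UNIV. <|(x - y) $ i|>) <= (SUM i:(UNIV::'n set). 1 / m)" by (intro sum_mono)
   thus ?thesis using norm_le_l1_cart[of "x - y"] by simp
  qed
  have bc: "bounded (cell f)" for f
   unfolding bounded_def dist_norm using diff[of _ f] by blast
  have dc: "diameter (cell f) <= real CARD('n) / m" for f using diff by (intro diameter_le) auto
  obtain h where h: "bij_betw h {..<card F} F" using F(1) by (metis bij_betw_from_nat_into_finite)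
  define U where "U n = (if n < card F then cell (h n) else {})" for n
  have "hp ?s de (flat_cube k 0 1) <= (\<Sum>n. ennreal (unit_ball_vol ?s * (diameter (U n) / 2) powr ?s))"
  proof (rule hp_le)
   show "flat_cube k 0 1 <= (UN n. U n)"
   proof
    fix x assume x: "x : flat_cube k 0 1"
    \<comment> \<open>The index of a cell containing \<open>x\<close>; \<open>min (m - 1)\<close>
      assigns the coordinate 1 to the last cell.\<close>
    define f where "f i = (if i = k then undefined else min (m - 1) (nat \<lfloor>real m * x $ i\<rfloor>))" for i
    have "min (m - 1) j < m" for j using m0 by linarith
    hence fF: "f : F" by (simp add: F_def f_def PiE_iff extensional_def)
    have "real (f i) / m <= x $ i & x $ i <= (real (f i) + 1) / m" if "i ~= k" for i
    proof -
     have xi: "0 <= x $ i" "x $ i <= 1" using x that by (auto simp: flat_cube_def)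
     have "real (nat \<lfloor>real m * x $ i\<rfloor>) <= real m * x $ i" using xi by simp
     hence 1: "real (f i) <= real m * x $ i" using that by (simp add: f_def)
     have "real m * x $ i <= real (f i) + 1"
     proof (cases "nat \<lfloor>real m * x $ i\<rfloor> <= m - 1")
      case True
      have "real m * x $ i <= real (nat \<lfloor>real m * x $ i\<rfloor>) + 1" using xi by linarith
      thus ?thesis using that True by (simp add: f_def)
     next
      case False
      hence "f i = m - 1" using that by (simp add: f_def)
      moreover have "real m * x $ i <= real m * 1" using xi by (intro mult_left_mono) auto
      ultimately show ?thesis using m0 by (simp add: of_nat_diff)
     qed
     thus ?thesis using 1 m0 by (simp add: divide_le_eq le_divide_eq mult.commute)
    qed
    hence "x : cell f" using x by (simp add: cell_def flat_cube_def)
    moreover obtain n where "n < card F" "h n = f" using h fF by (metis bij_betw_iff_bijections lessThan_iff)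
    ultimately show "x : (UN n. U n)" by (auto simp: U_def)
   qed
   show "bounded (U n) & diameter (U n) <= de" for n
   proof -
    have "real CARD('n) / m <= de" using m m0 de by (simp add: field_simps)
    thus ?thesis using bc dc[of "h n"] de by (auto simp: U_def)
   qed
  qed
  also have "... = (\<Sum>n<card F. ennreal (unit_ball_vol ?s * (diameter (U n) / 2) powr ?s))"
   by (rule suminf_finite) (auto simp: U_def)
  also have "... <= (\<Sum>n<card F. ennreal (unit_ball_vol ?s * (real CARD('n) / m / 2) powr ?s))"
  proof (rule sum_mono)
   fix n assume "n : {..<card F}"
   hence "diameter (U n) <= real CARD('n) / m" "0 <= diameter (U n)" using dc bc diameter_ge_0 by (auto simp: U_def)
   hence "(diameter (U n) / 2) powr ?s <= (real CARD('n) / m / 2) powr ?s" using s by (intro powr_mono2) auto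
   thus "ennreal (unit_ball_vol ?s * (diameter (U n) / 2) powr ?s) <= ennreal (unit_ball_vol ?s * (real CARD('n) / m / 2) powr ?s)"
    using s by (intro ennreal_leI mult_left_mono) auto
  qed
  also have "... = ennreal (real (card F) * (unit_ball_vol ?s * (real CARD('n) / m / 2) powr ?s))"
   by (simp add: ennreal_mult'[symmetric] ennreal_of_nat_eq_real_of_nat)
  also have "real (card F) * (unit_ball_vol ?s * (real CARD('n) / m / 2) powr ?s) = C"
  proof -
   have "(real CARD('n) / m / 2) powr ?s = (real CARD('n) / 2) powr ?s / real m powr ?s"
    using m0 by (simp add: powr_divide[symmetric] divide_divide_eq_left mult.commute)
   moreover have "real m powr ?s = real (card F)"
   proof -
    have "?s = real (CARD('n) - 1)" using N by simp
    thus ?thesis using m0 F(2) by (simp only: powr_realpow of_nat_power of_nat_0_less_iff)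
   qed
   moreover have "real (card F) > 0" using F(2) m0 by simp
   ultimately show ?thesis by (simp add: C_def)
  qed
  finally show ?thesis .
 qed
 hence "hm ?s (flat_cube k 0 1) <= ennreal C"
  unfolding hausdorff_measure_def by (intro SUP_least) auto
 thus ?thesis using le_less_trans by fastforce
qed

lemma emeasure_cbox_cart:
 fixes lo hi :: "real^'n"
 assumes "!!i. lo $ i <= hi $ i"
 shows "em (cbox lo hi) = ennreal (PROD i:UNIV. hi $ i - lo $ i)"
proof -
 have "vol (cbox lo hi) = (PROD i:UNIV. hi $ i - lo $ i)"
  using assms by (intro content_cbox_cart) (simp add: interval_ne_empty_cart)
 thus ?thesis by (metis emeasure_eq_ennreal_measure emeasure_lborel_cbox_finite infinity_ennreal_def less_irrefl)
qed

lemma prod_remove_const: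
 fixes k :: "'n::finite" and c d :: real
 shows "(PROD i:UNIV. if i = k then c else d) = c * d ^ (CARD('n) - 1)"
proof -
 have "(PROD i:UNIV. if i = k then c else d) = c * (PROD i:UNIV - {k}. if i = k then c else d)"
  by (subst prod.remove[of _ k]) auto
 also have "(PROD i:UNIV - {k}. if i = k then c else d) = (PROD i:UNIV - {k}. d)" by (intro prod.cong) auto
 finally show ?thesis by simp
qed

text \<open>The cylinder over a covering set of diameter d lies in a box of volume (2d)^(N-1).
  Comparison with the unit volume of the cylinder over the cube bounds every covering sum from
  below; the 4 in \<open>c\<close> comes from 2d = 4 (d/2).\<close>

lemma hm_cube_pos:
 fixes k :: "'n::finite"
 assumes N: "CARD('n) >= 2"
 shows "0 < hm (real CARD('n) - 1) (flat_cube k 0 1)"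
proof -
 let ?s = "real CARD('n) - 1"
 let ?Q = "flat_cube k 0 1"
 have s: "?s > 0" "?s = real (CARD('n) - 1)" using N by auto
 define c where "c = unit_ball_vol ?s / 4 powr ?s"
 have c: "c > 0" using unit_ball_vol_pos[OF less_imp_le[OF s(1)]] by (simp add: c_def)
 have "ennreal c <= hp ?s 1 ?Q"
  unfolding hausdorff_premeasure_def
 proof (rule INF_greatest)
  fix U :: "nat => (real^'n) set"
  assume "U : {U. ?Q <= (UN n. U n) & (ALL n. bounded (U n) & diameter (U n) <= 1)}"
  hence U: "?Q <= (UN n. U n)" "!!n. bounded (U n)" by auto
  define d where "d n = diameter (U n)" for n
  have d: "d n >= 0" for n unfolding d_def using U(2) by (rule diameter_ge_0)
  define P where "P n B <-> B : bor & cyl k (U n) <= B & em B <= ennreal ((2 * d n) ^ (CARD('n) - 1))" for n B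
  have exP: "EX B. P n B" for n
  proof (cases "EX p. p : slab k & proj k p : U n")
   case False
   thus ?thesis by (intro exI[of _ "{}"]) (auto simp: P_def)
  next
   case True
   then obtain p where p: "proj k p : U n" by blast
   define lo where "lo = (\<chi> i. if i = k then 0 else p $ i - d n)"
   define hi where "hi = (\<chi> i. if i = k then 1 else p $ i + d n)"
   have "cyl k (U n) <= cbox lo hi"
   proof
    fix x assume x: "x : cyl k (U n)"
    have "<|x $ i - p $ i|> <= d n" if "i ~= k" for i
    proof -
     have "<|(proj k x - proj k p) $ i|> <= norm (proj k x - proj k p)" by (rule component_le_norm_cart)
     also have "... <= d n" unfolding d_def dist_norm[symmetric] using x p by (intro diameter_bounded_bound U(2)) auto
     finally show ?thesis using that by simp
    qed
    thus "x : cbox lo hi" using x by (fastforce simp: mem_box_cart lo_def hi_def slab_def abs_le_iff)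
   qed
   moreover have "em (cbox lo hi) = ennreal ((2 * d n) ^ (CARD('n) - 1))"
   proof -
    have "(PROD i:UNIV. hi $ i - lo $ i) = (PROD i:UNIV. if i = k then 1 else 2 * d n)"
     by (intro prod.cong) (auto simp: hi_def lo_def)
    thus ?thesis using d[of n] by (subst emeasure_cbox_cart) (auto simp: lo_def hi_def prod_remove_const)
   qed
   ultimately show ?thesis by (intro exI[of _ "cbox lo hi"]) (auto simp: P_def)
  qed
  define B where "B n = (SOME X. P n X)" for n
  have "P n (B n)" for n unfolding B_def by (rule someI_ex[OF exP])
  hence B: "B n : bor" "cyl k (U n) <= B n"
   "em (B n) <= ennreal ((2 * d n) ^ (CARD('n) - 1))" for n unfolding P_def by blast+
  have "1 = area k ?Q" using area_flat_cube[of 1 k 0] by simp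
  also have "... <= em (UN n. B n)"
   unfolding area_def
  proof (rule emeasure_mono)
   show "cyl k (?Q) <= (UN n. B n)"
   proof
    fix x assume x: "x : cyl k (?Q)"
    then obtain n where "proj k x : U n" using U(1) by auto
    hence "x : B n" using x B(2)[of n] by auto
    thus "x : (UN n. B n)" by blast
   qed
  qed (use B(1) in auto)
  also have "... <= (\<Sum>n. em (B n))" using B(1) by (intro emeasure_subadditive_countably) auto
  also have "... <= (\<Sum>n. ennreal ((2 * d n) ^ (CARD('n) - 1)))" using B(3) by (intro suminf_le) auto
  finally have "ennreal c * 1 <= ennreal c * (\<Sum>n. ennreal ((2 * d n) ^ (CARD('n) - 1)))" by (intro mult_left_mono) auto
  also have "... = (\<Sum>n. ennreal c * ennreal ((2 * d n) ^ (CARD('n) - 1)))" by (rule ennreal_suminf_cmult[symmetric])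
  also have "... = (\<Sum>n. ennreal (unit_ball_vol ?s * (diameter (U n) / 2) powr ?s))"
  proof (intro suminf_cong)
   fix n
   have "(2 * d n) ^ (CARD('n) - 1) = (4 * (d n / 2)) powr ?s"
   proof (cases "d n = 0")
    case True
    thus ?thesis using N by simp
   next
    case False
    hence "2 * d n > 0" using d[of n] by simp
    from powr_realpow[OF this, of "CARD('n) - 1"] show ?thesis by (simp add: s(2)[symmetric])
   qed
   also have "... = 4 powr ?s * (d n / 2) powr ?s" by (rule powr_mult)
   finally have "c * (2 * d n) ^ (CARD('n) - 1) = unit_ball_vol ?s * (d n / 2) powr ?s" by (simp add: c_def)
   thus "ennreal c * ennreal ((2 * d n) ^ (CARD('n) - 1)) = ennreal (unit_ball_vol ?s * (diameter (U n) / 2) powr ?s)"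
    using c by (simp add: ennreal_mult'[symmetric] d_def)
  qed
  finally show "ennreal c <= (\<Sum>n. ennreal (unit_ball_vol ?s * (diameter (U n) / 2) powr ?s))" by simp
 qed
 also have "... <= hm ?s ?Q" by (rule hp_le_measure) simp
 finally show ?thesis using c by (metis ennreal_less_zero_iff less_le_trans)
qed

text \<open>A cover of the cylinder over \<open>S\<close> by cubes of \<open>\<real>\<^sup>N\<close> has a horizontal slice which is an efficient cover of
 \<open>S\<close> by flat cubes.\<close>

lemma hausdorff_le_area:
 fixes k :: "'n::finite" and S :: "(real^'n) set"
 assumes N: "CARD('n) >= 2" and S: "S : bor" "bounded S" "S <= interface k"
 shows "hm (real CARD('n) - 1) S <= hm (real CARD('n) - 1) (flat_cube k 0 1) * area k S"
proof -
 let ?s = "real CARD('n) - 1"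
 let ?n = "CARD('n) - 1"
 let ?kp = "hm ?s (flat_cube k 0 1)"
 have s: "?s > 0" "?s = real ?n" using N by auto
 define C where "C = cyl k S"
 have Cb: "C : bor" unfolding C_def using S(1) by simp
 obtain R where R: "R > 0" "!!x. x : S ==> norm x <= R" using S(2) bounded_pos by blast
 \<comment> \<open>All edges of the enclosing box are equal, so the dyadic intervals of
   \<open>covering_lemma\<close> are cubes.\<close>
 define b :: "real^'n" where "b = (\<chi> i. R + 1)"
 have bi: "b $ i = R + 1" for i by (simp add: b_def)
 have Csub: "C <= cbox (-b) b"
 proof
  fix x assume x: "x : C"
  have "<|x $ i|> <= R + 1" for i
  proof (cases "i = k")
   case True thus ?thesis using x R(1) by (auto simp: C_def slab_def)
  next
   case False
   have "<|proj k x $ i|> <= R" using component_le_norm_cart[of "proj k x" i] R(2)[of "proj k x"] x by (auto simp: C_def)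
   thus ?thesis using False by simp
  qed
  thus "x : cbox (-b) b" by (auto simp: mem_box_cart bi abs_le_iff) (smt (verit))
 qed
 have ne: "box (-b) b ~= {}" using R(1) by (simp add: interval_ne_empty_cart bi)
 have kkp: "?kp < \<infinity>" by (rule hm_cube_finite[OF N])
 have areaC: "area k S = em C" by (simp add: area_def C_def)
 have Cfin: "fin C"
  using emeasure_bounded_finite[OF bounded_subset[OF bounded_cbox Csub]] by simp
 have key: "hm ?s S <= ?kp * (area k S + ennreal e)" if e: "e > 0" for e
 proof -
  obtain G where G: "open G" "C <= G" "em (G - C) < ennreal e"
   using outer_regular_lborel[OF Cb e] by blast
  have gauge: "gauge (%x. if x : G then G else UNIV)" using G(1) by (auto simp: gauge_def)
  obtain \<D> where \<D>: "countable \<D>" "!!K. K : \<D> ==> interior K ~= {} & (EX c d. K = cbox c d)"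
   "pairwise (%A B. interior A Int interior B = {}) \<D>"
   "!!K. K : \<D> ==> EX x:C Int K. K <= (if x : G then G else UNIV)"
   "!!u v. cbox u v : \<D> ==> EX n. ALL i:Basis. v <.> i - u <.> i = (b <.> i - (- b) <.> i) / 2^n"
   "C <= \<Union>\<D>"
   by (rule covering_lemma[OF Csub ne gauge]) blast
  have sub: "K <= G" if K: "K : \<D>" for K
  proof -
   obtain x where "x : C" "K <= (if x : G then G else UNIV)" using \<D>(4)[OF K] by blast
   moreover from this have "x : G" using G(2) by blast
   ultimately show ?thesis by simp
  qed
  define J where "J = to_nat_on \<D> ` \<D>"
  define D where "D = from_nat_into \<D>"
  have DJ: "D n : \<D>" if "n : J" for n
   using that \<D>(1) by (auto simp: J_def D_def)
  have Dinj: "m = n" if "m : J" "n : J" "D m = D n" for m n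
   using that \<D>(1) by (auto simp: J_def D_def)
  have Dcov: "EX n:J. K = D n" if "K : \<D>" for K
   using that \<D>(1) by (intro bexI[of _ "to_nat_on \<D> K"]) (auto simp: J_def D_def)
  define P where "P n q <-> D n = cbox (fst q) (fst (snd q)) & snd (snd q) > 0 & (ALL i. fst (snd q) $ i = fst q $ i + snd (snd q))"
   for n and q :: "(real^'n) \<times> (real^'n) \<times> real"
  have exP: "EX q. P n q" if n: "n : J" for n
  proof -
   obtain u v where uv: "D n = cbox u v" using \<D>(2)[OF DJ[OF n]] by blast
   have "cbox u v : \<D>" using DJ[OF n] uv by simp
   from \<D>(5)[OF this] obtain m where m: "!!i. i : Basis ==> v <.> i - u <.> i = (b <.> i - (- b) <.> i) / 2^m" by blast
   have "v $ i - u $ i = 2 * (R + 1) / 2 ^ m" for i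
    using m[of "axis i 1"] by (simp add: inner_axis bi axis_in_Basis_iff)
   hence "v $ i = u $ i + 2 * (R + 1) / 2 ^ m" for i by (metis add_diff_cancel_left' diff_add_cancel add.commute)
   hence "P n (u, v, 2 * (R + 1) / 2 ^ m)" using uv R(1) by (simp add: P_def)
   thus ?thesis by blast
  qed
  define q where "q n = (SOME q. P n q)" for n
  have Pq: "P n (q n)" if "n : J" for n unfolding q_def by (rule someI_ex[OF exP[OF that]])
  define u where "u n = fst (q n)" for n
  define v where "v n = fst (snd (q n))" for n
  define l where "l n = snd (snd (q n))" for n
  have uvl: "D n = cbox (u n) (v n)" "l n > 0" "v n $ i = u n $ i + l n" if "n : J" for n i
   using Pq[OF that] by (auto simp: P_def u_def v_def l_def)
  define B where "B n = (if n : J then interior (D n) else {})" for n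
  have "disjoint_family B"
   unfolding disjoint_family_on_def
  proof (intro ballI impI)
   fix m n :: nat assume "m ~= n"
   show "B m Int B n = {}"
   proof (cases "m : J & n : J")
    case True
    hence "D m : \<D>" "D n : \<D>" "D m ~= D n" using DJ Dinj \<open>m ~= n\<close> by blast+
    hence "interior (D m) Int interior (D n) = {}" using \<D>(3) by (simp add: pairwise_def)
    thus ?thesis using True by (simp add: B_def)
   qed (auto simp: B_def)
  qed
  moreover have "B n : sets lborel" for n by (simp add: B_def)
  ultimately have "(\<Sum>n. em (B n)) = em (UN n. B n)"
   by (intro suminf_emeasure) auto
  also have "... <= em G"
  proof (rule emeasure_mono)
   have "B n <= G" for n
   proof (cases "n : J")
    case True
    thus ?thesis using sub[OF DJ[OF True]] interior_subset[of "D n"] by (simp add: B_def)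
   qed (simp add: B_def)
   thus "(UN n. B n) <= G" by blast
  qed (use G(1) in simp)
  also have "... = em C + em (G - C)"
   using G Cb plus_emeasure[of C lborel "G - C"] by (simp add: Un_absorb1)
  also have "... < area k S + ennreal e"
   using G(3) Cfin by (simp add: areaC ennreal_add_left_cancel_less)
  finally have small: "(\<Sum>n. em (B n)) < area k S + ennreal e" .
  have mB: "em (B n) = (NN t. (if n : J then ennreal (l n ^ ?n) * ind {u n $ k..v n $ k} t else 0))" for n
  proof (cases "n : J")
   case True
   have "em (B n) = em (cbox (u n) (v n))"
    using True uvl(1)[OF True] by (simp add: B_def interior_cbox emeasure_lborel_box_eq emeasure_lborel_cbox_eq)
   also have "... = ennreal (PROD i:UNIV. v n $ i - u n $ i)"
    using uvl(2,3)[OF True] by (intro emeasure_cbox_cart) (simp add: less_imp_le)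
   also have "(PROD i:UNIV. v n $ i - u n $ i) = (PROD i:(UNIV::'n set). l n)"
    using uvl(3)[OF True] by (intro prod.cong) auto
   also have "... = l n ^ ?n * l n" by (metis prod_constant card_gt_0_iff finite UNIV_not_empty power_minus_mult zero_less_card_finite)
   also have "ennreal (l n ^ ?n * l n) = (NN t. ennreal (l n ^ ?n) * ind {u n $ k..v n $ k} t)"
    using uvl(2)[OF True] uvl(3)[OF True, of k] by (simp add: nn_integral_cmult ennreal_mult)
   finally show ?thesis using True by simp
  qed (simp add: B_def)
  \<comment> \<open>The total (N-1)-dimensional size of the cubes met by the plane at height
    \<open>t\<close>. Its integral over all heights is the total volume of the cubes, so at some
    height in (0,1) it is within the bound.\<close>
  define g where "g t = (\<Sum>n. if n : J then ennreal (l n ^ ?n) * ind {u n $ k..v n $ k} t else 0)" for t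
  have "EX t. 0 < t & t < 1 & g t <= area k S + ennreal e"
  proof (rule ccontr)
   assume "~ ?thesis"
   hence gt: "area k S + ennreal e <= g t" if "0 < t" "t < 1" for t using that by (metis less_imp_le not_le)
   have "area k S + ennreal e = (NN t. (area k S + ennreal e) * ind {0<..<1::real} t)"
    by (simp add: nn_integral_cmult)
   also have "... <= (NN t. g t)" using gt by (intro nn_integral_mono) (auto simp: indicator_def)
   also have "... = (\<Sum>n. em (B n))"
    unfolding g_def mB by (rule nn_integral_suminf) auto
   finally show False using small by simp
  qed
  then obtain t where t: "0 < t" "t < 1" "g t <= area k S + ennreal e" by blast
  define A where "A n = (if n : J & u n $ k <= t & t <= v n $ k then flat_cube k (u n) (l n) else {})" for n
  have "S <= (UN n. A n)"
  proof
   fix x assume x: "x : S"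
   have xk: "x $ k = 0" using x S(3) by (auto simp: interface_def)
   define y where "y = x + t *R axis k 1"
   have y: "y $ i = (if i = k then t else x $ i)" for i using xk by (simp add: y_def axis_def)
   have "proj k y = x" using xk by (simp add: vec_eq_iff y)
   hence "y : C" using t x by (simp add: C_def slab_def y)
   then obtain K where K: "K : \<D>" "y : K" using \<D>(6) by blast
   then obtain n where n: "n : J" "y : D n" using Dcov by blast
   have mem: "u n $ i <= y $ i" "y $ i <= v n $ i" for i
    using n(2) unfolding uvl(1)[OF n(1)] by (simp_all add: mem_box_cart)
   have uy: "y $ i <= u n $ i + l n" for i
    using mem(2)[of i] unfolding uvl(3)[OF n(1)] .
   have "u n $ k <= t" "t <= v n $ k" using mem[of k] y[of k] by simp_all
   moreover have "u n $ i <= x $ i & x $ i <= u n $ i + l n" if "i ~= k" for i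
    using mem(1)[of i] uy[of i] y[of i] that by simp
   ultimately have "x : A n" by (simp add: A_def flat_cube_def n(1) xk)
   thus "x : (UN n. A n)" by blast
  qed
  hence "hm ?s S <= (\<Sum>n. hm ?s (A n))"
   by (rule order_trans[OF hausdorff_mono hausdorff_subadditive])
  also have "... <= (\<Sum>n. ?kp * (if n : J then ennreal (l n ^ ?n) * ind {u n $ k..v n $ k} t else 0))"
  proof (rule suminf_le)
   fix n
   show "hm ?s (A n) <= ?kp * (if n : J then ennreal (l n ^ ?n) * ind {u n $ k..v n $ k} t else 0)"
   proof (cases "n : J & u n $ k <= t & t <= v n $ k")
    case True
    have "hm ?s (flat_cube k (u n) (l n)) <= ennreal (l n powr ?s) * ?kp"
     unfolding flat_cube_affine[OF uvl(2)[OF conjunct1[OF True]]] using True uvl(2) s(1) by (intro hausdorff_affine_le) auto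
    moreover have "l n powr ?s = l n ^ ?n" using uvl(2)[of n] True unfolding s(2) by (intro powr_realpow) auto
    ultimately show ?thesis using True by (simp add: A_def mult.commute)
   qed (auto simp: A_def hausdorff_empty)
  qed auto
  also have "... = ?kp * g t" unfolding g_def by (rule ennreal_suminf_cmult)
  also have "... <= ?kp * (area k S + ennreal e)" using t(3) by (intro mult_left_mono) auto
  finally show ?thesis .
 qed
 show ?thesis
 proof (rule ennreal_le_epsilon)
  fix e :: real assume e: "e > 0"
  define q where "q = enn2real ?kp"
  have q: "?kp = ennreal q" "q >= 0" using kkp by (auto simp: q_def less_top)
  have "hm ?s S <= ?kp * (area k S + ennreal (e / (q + 1)))" using e q(2) by (intro key) simp
  also have "... = ?kp * area k S + ?kp * ennreal (e / (q + 1))" by (rule distrib_left)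
  also have "?kp * ennreal (e / (q + 1)) <= ennreal e"
   unfolding q(1) using e q(2) by (simp add: ennreal_mult'[symmetric] ennreal_leI field_simps)
  finally show "hm ?s S <= ?kp * area k S + ennreal e" by (simp add: add_left_mono)
 qed
qed

lemma area_mono: "S <= T ==> T : bor ==> area k S <= area k T"
 unfolding area_def by (intro emeasure_mono) auto

text \<open>The lower bound follows from the upper bound on the complement in a cube.\<close>

lemma area_le_hausdorff:
 fixes k :: "'n::finite" and S :: "(real^'n) set"
 assumes N: "CARD('n) >= 2" and S: "S : bor" "S <= interface k"
 shows "hm (real CARD('n) - 1) (flat_cube k 0 1) * area k S <= hm (real CARD('n) - 1) S"
proof -
 let ?s = "real CARD('n) - 1"
 let ?n = "CARD('n) - 1"
 let ?kp = "hm ?s (flat_cube k 0 1)"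
 have s: "?s > 0" "?s = real ?n" using N by auto
 have kkp: "?kp < \<infinity>" by (rule hm_cube_finite[OF N])
 have bdd: "?kp * area k T <= hm ?s T" if T: "T : bor" "T <= interface k" "bounded T" for T
 proof -
  obtain R where R: "R > 0" "!!x. x : T ==> norm x <= R" using T(3) bounded_pos by blast
  define a :: "real^'n" where "a = (\<chi> i. - R)"
  let ?Q = "flat_cube k a (2 * R)"
  have TQ: "T <= ?Q"
  proof
   fix x assume x: "x : T"
   have "<|x $ i|> <= R" for i using component_le_norm_cart[of x i] R(2)[OF x] by simp
   thus "x : ?Q" using x T(2) by (auto simp: flat_cube_def interface_def a_def abs_le_iff) (smt (verit))+
  qed
  have aQ: "area k ?Q = ennreal ((2 * R) ^ ?n)" using R(1) by (intro area_flat_cube) simp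
  have sc: "flat_cube k 0 1 = (%x. - (1 / (2 * R)) *R proj k a + (1 / (2 * R)) *R x) ` ?Q"
   using R(1) by (subst (2) flat_cube_affine) (auto simp: image_image scaleR_add_right)
  have "hm ?s ((%x. - (1 / (2 * R)) *R proj k a + (1 / (2 * R)) *R x) ` ?Q)
   <= ennreal ((1 / (2 * R)) powr ?s) * hm ?s ?Q"
   by (rule hausdorff_affine_le) (use R(1) s(1) in auto)
  hence "?kp <= ennreal ((1 / (2 * R)) powr ?s) * hm ?s ?Q"
   unfolding sc[symmetric] .
  \<comment> \<open>Rescaling to the unit cube bounds the Hausdorff measure of the large cube from
    below. Subadditivity and the upper estimate on the complement of \<open>T\<close> then leave the
    bound for \<open>T\<close>.\<close>
  hence "ennreal ((2 * R) ^ ?n) * ?kp <= ennreal ((2 * R) ^ ?n) * (ennreal ((1 / (2 * R)) powr ?s) * hm ?s ?Q)"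
   by (intro mult_left_mono) auto
  also have "... = hm ?s ?Q"
  proof -
   have pw: "(1 / (2 * R)) powr ?s = (1 / (2 * R)) ^ ?n" unfolding s(2) by (rule powr_realpow) (use R(1) in simp)
   have one: "x ^ ?n * (1 / x) ^ ?n = 1" if "x > 0" for x :: real using that by (simp add: power_one_over)
   have "ennreal ((2 * R) ^ ?n) * ennreal ((1 / (2 * R)) powr ?s) = ennreal ((2 * R) ^ ?n * (1 / (2 * R)) powr ?s)"
    by (rule ennreal_mult'[symmetric]) (use R(1) in simp)
   also have "... = 1" unfolding pw by (subst one) (use R(1) in simp_all)
   finally show ?thesis by (simp only: mult.assoc[symmetric] mult_1)
  qed
  also have "... <= hm ?s T + hm ?s (?Q - T)"
   using hausdorff_Un[of ?s T "?Q - T"] TQ by (simp add: Un_absorb1)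
  also have "... <= hm ?s T + ?kp * area k (?Q - T)"
  proof (intro add_left_mono hausdorff_le_area[OF N])
   show "?Q - T : bor" using flat_cube_borel T(1) by auto
   have "?Q <= cbox (\<chi> i. - R) (\<chi> i. R)"
   proof
    fix x assume "x : ?Q"
    hence "x $ k = 0" "!!i. i ~= k ==> - R <= x $ i & x $ i <= - R + 2 * R" by (simp_all add: flat_cube_def a_def)
    hence "- R <= x $ i & x $ i <= R" for i using R(1) by (cases "i = k") auto
    thus "x : cbox (\<chi> i. - R) (\<chi> i. R)" by (simp add: mem_box_cart)
   qed
   thus "bounded (?Q - T)" using bounded_cbox bounded_subset by blast
   show "?Q - T <= interface k" by (auto simp: flat_cube_def interface_def)
  qed
  finally have 1: "?kp * area k ?Q <= hm ?s T + ?kp * area k (?Q - T)" unfolding aQ by (subst mult.commute)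
  have "area k ?Q = area k T + area k (?Q - T)"
  proof -
   have "cyl k (?Q) = cyl k T Un cyl k (?Q - T)" using TQ by auto
   thus ?thesis unfolding area_def using T(1) flat_cube_borel[of k a "2* R"]
    by (simp only:) (subst plus_emeasure, auto)
  qed
  hence "?kp * area k T + ?kp * area k (?Q - T) <= hm ?s T + ?kp * area k (?Q - T)"
   using 1 by (simp add: distrib_left)
  moreover have "?kp * area k (?Q - T) < top"
  proof -
   have "area k (?Q - T) <= area k ?Q" by (intro area_mono flat_cube_borel) auto
   also have "... < top" using aQ by simp
   finally show ?thesis using kkp by (simp add: ennreal_mult_less_top)
  qed
  ultimately show ?thesis by (subst (asm) (1 2) add.commute) (auto simp: ennreal_add_left_cancel_le)
 qed
 \<comment> \<open>Unbounded sets are exhausted by balls, along which \<open>area\<close> is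
   continuous.\<close>
 have "?kp * area k S = (SUP n. ?kp * area k (S Int cball 0 (real n)))"
 proof -
  have "area k S = (SUP n. area k (S Int cball 0 (real n)))"
   unfolding area_def
  proof (subst SUP_emeasure_incseq)
   show "incseq (%n. cyl k (S Int cball 0 (real n)))" by (auto simp: incseq_def)
   have "(UN n. cyl k (S Int cball 0 (real n))) = cyl k S"
    using real_arch_simple by auto
   thus "em (cyl k S) = em (UN n. cyl k (S Int cball 0 (real n)))" by simp
  qed (use S(1) in auto)
  thus ?thesis by (simp add: SUP_mult_left_ennreal)
 qed
 also have "... <= hm ?s S"
 proof (rule SUP_least)
  fix n
  have "?kp * area k (S Int cball 0 (real n)) <= hm ?s (S Int cball 0 (real n))"
   using S by (intro bdd) auto
  also have "... <= hm ?s S" by (intro hausdorff_mono) auto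
  finally show "?kp * area k (S Int cball 0 (real n)) <= hm ?s S" .
 qed
 finally show ?thesis .
qed

section \<open>Convolution\<close>

lemma DERIV_max_power:
 "((%t::real. max 0 t ^ Suc (Suc n)) hrd real (Suc (Suc n)) * max 0 t ^ Suc n) (at t)"
proof -
 consider "t < 0" | "t > 0" | "t = 0" by linarith
 thus ?thesis
 proof cases
  case 1
  have "((%t::real. 0) hrd real (Suc (Suc n)) * max 0 t ^ Suc n) (at t)" using 1 by simp
  thus ?thesis
   by (rule has_field_derivative_transform_within_open[of _ _ _ "{..<0}"]) (use 1 in auto)
 next
  case 2
  have "((%t::real. t ^ Suc (Suc n)) hrd real (Suc (Suc n)) * max 0 t ^ Suc n) (at t)"
   using 2 DERIV_pow[of "Suc (Suc n)" t] by simp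
  thus ?thesis
   by (rule has_field_derivative_transform_within_open[of _ _ _ "{0<..}"]) (use 2 in auto)
 next
  case 3
  have "((%h::real. max 0 h ^ Suc n) ~~> max 0 0 ^ Suc n) (at 0)" by (intro tendsto_intros)
  hence "((%h::real. max 0 h ^ Suc n) ~~> 0) (at 0)" by simp
  hence "((%h::real. max 0 h ^ Suc (Suc n) / h) ~~> 0) (at 0)"
   by (rule Lim_transform_eventually) (auto simp: eventually_at_filter max_def)
  thus ?thesis using 3 by (simp add: DERIV_def)
 qed
qed

definition is_C1 :: "('a::euclidean_space => real) => bool" where
 "is_C1 u <-> (EX Du. C1 u Du)"

lemma is_C1I: "C1 u Du ==> is_C1 u"
 by (auto simp: is_C1_def)

lemma is_C1_intros:
 "is_C1 (%x. c)" "is_C1 (%x. x <.> a)"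
 "is_C1 u ==> is_C1 v ==> is_C1 (%x. u x + v x)"
 "is_C1 u ==> is_C1 v ==> is_C1 (%x. u x * v x)"
 unfolding is_C1_def using C1_const C1_inner C1_add C1_mult by blast+

lemma is_C1_compose:
 assumes "is_C1 u" "!!t. (F hrd F' t) (at t)" "cont F'"
 shows "is_C1 (%x. F (u x))"
 using assms C1_compose unfolding is_C1_def by blast

lemma is_C1_max_power: "is_C1 u ==> is_C1 (%x. max 0 (u x) ^ Suc (Suc n))"
 by (rule is_C1_compose[where F' = "%t. real (Suc (Suc n)) * max 0 t ^ Suc n", OF _ DERIV_max_power])
  (auto intro!: continuous_intros)

lemma is_C1_sum: "finite I ==> (!!i. i : I ==> is_C1 (u i)) ==> is_C1 (%x. SUM i:I. u i x)"
 by (induction I rule: finite_induct) (auto intro: is_C1_intros)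

lemma is_C1_translate: "is_C1 u ==> is_C1 (%x. u (x + a))"
 using C1_translate unfolding is_C1_def by blast

definition conv :: "('a::euclidean_space => real) => ('a => 'b::{banach,second_countable_topology}) => 'a => 'b" where
 "conv g f x = (LBINT y. g y *R f (x - y))"

lemma csupp_reflect:
 assumes "csupp f" shows "csupp (%y. f (x - y))"
proof -
 obtain R where R: "!!x. R <= norm x ==> f x = 0" using assms by (auto simp: csupp_def)
 have "f (x - y) = 0" if "R + norm x <= norm y" for y
  using R[of "x - y"] that norm_triangle_ineq2[of y x] by (simp add: norm_minus_commute)
 thus ?thesis by (rule csuppI)
qed

lemma conv_integrable:
 fixes f :: "'a::euclidean_space => 'b::{banach,second_countable_topology}"
 assumes g: "g : bm" "!!y. <|g y|> <= M" and f: "cont f" "csupp f"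
 shows "lint (%y. g y *R f (x - y))"
proof -
 have c: "cont (%y. f (x - y))" by (intro continuous_on_compose2[OF f(1)] continuous_intros) auto
 have "lint (%y. M *R f (x - y))"
  by (intro integrable_scaleR_right lint_csupp c csupp_reflect f)
 thus ?thesis
 proof (rule Bochner_Integration.integrable_bound)
  have [measurable]: "(%y. f (x - y)) : bm" using c by (rule borel_csupp)
  show "(%y. g y *R f (x - y)) : borel_measurable lborel" using g(1) by measurable
  show "AEL y. norm (g y *R f (x - y)) <= norm (M *R f (x - y))" (is "AE y in _. ?G1 y")
  proof (intro AE_I2)
   fix y
   have "<|g y|> <= <|M|>" using g(2)[of y] by linarith
   thus "?G1 y" by (simp add: mult_right_mono)
  qed
 qed
qed

lemma conv_increment:
 fixes F :: "'a::euclidean_space => 'b::{banach,second_countable_topology}"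
 assumes g: "g : bm" "!!y. <|g y|> <= M"
  and F: "cont F" "!!z. R <= norm z ==> F z = 0" "!!z. norm (F z) <= e"
 shows "norm (LBINT y. g y *R F (x - y)) <= M * e * vol (ball (0::'a) R)"
proof -
 have M: "M >= 0" using g(2)[of 0] by linarith
 have e: "e >= 0" using F(3)[of 0] norm_ge_zero order_trans by blast
 have cs: "csupp F" using F(2) by (rule csuppI)
 have B: "vol (ball x R) = vol (ball (0::'a) R)"
  using content_ball_conv_unit_ball[of R x] content_ball_conv_unit_ball[of R "0::'a"] by (cases "R >= 0") (auto simp: ball_empty)
 have iB: "lint (ind (ball x R) :: 'a => real)"
  using emeasure_bounded_finite[of "ball x R"] by (subst integrable_indicator_iff) auto
 have "norm (LBINT y. g y *R F (x - y)) <= (LBINT y. norm (g y *R F (x - y)))"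
  by (rule integral_norm_bound)
 also have "... <= (LBINT y. M * e * ind (ball x R) y)"
 proof (rule integral_mono)
  show "lint (%y. norm (g y *R F (x - y)))" by (rule integrable_norm[OF conv_integrable[OF g F(1) cs]])
  show "lint (%y. M * e * ind (ball x R) y)" using iB by simp
  show "norm (g y *R F (x - y)) <= M * e * ind (ball x R) y" for y
  proof (cases "norm (x - y) < R")
   case True
   have "<|g y|> * norm (F (x - y)) <= M * e" using g(2) F(3) M by (intro mult_mono) auto
   thus ?thesis using True by (simp add: dist_norm)
  next
   case False
   hence "F (x - y) = 0" by (intro F(2)) simp
   thus ?thesis using M e by simp
  qed
 qed
 also have "... = M * e * vol (ball (0::'a) R)" by (simp add: B)
 finally show ?thesis .
qed

lemma norm_add_ge: "norm z - norm h <= norm (z + h)" for z h :: "'a::real_normed_vector"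
 using norm_triangle_ineq4[of "z + h" h] by simp

text \<open>All regularity comes from \<open>f\<close>: increments of the convolution are
  convolutions of \<open>g\<close> with increments of \<open>f\<close>, which are uniformly small
  and supported in a fixed ball. This is applied to indicators \<open>g\<close>.\<close>

lemma conv_C1:
 fixes f :: "'a::euclidean_space => real"
 assumes g: "g : bm" "!!y. <|g y|> <= M" and f: "C1 f Df" "csupp f"
 shows "C1 (conv g f) (conv g Df)"
proof -
 have cf: "cont f" and cD: "cont Df" and sD: "csupp Df"
  using C1_cont[OF f(1)] C1_cont_grad[OF f(1)] csupp_grad[OF f] by auto
 obtain R where R: "R > 0" "!!x. R <= norm x ==> f x = 0" using f(2) by (rule csuppE) blast
 have R': "Df x = 0" if "R < norm x" for x by (rule C1_grad_zero_outside[OF f(1) R(2) that])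
 define m where "m = vol (ball (0::'a) (R + 1))"
 have m: "m >= 0" by (simp add: m_def)
 have M: "M >= 0" using g(2)[of 0] by linarith
 show ?thesis
  unfolding C1_def
 proof (intro conjI allI)
  fix x
  have "ALL e>0. EX d>0. ALL y. norm (y - x) < d --> norm (conv g f y - conv g f x - conv g Df x <.> (y - x)) <= e * norm (y - x)" (is "ALL e>0. ?G1 e")
  proof (intro allI impI)
   fix e :: real assume e: "e > 0"
   define e' where "e' = e / ((M + 1) * (m + 1))"
   have e': "e' > 0" using e M m by (simp add: e'_def)
   obtain d where d: "d > 0" "!!x h. norm h < d ==> <|f (x + h) - f x - Df x <.> h|> <= e' * norm h"
    using C1_uniform_remainder[OF f e'] by blast
   have "norm (conv g f y - conv g f x - conv g Df x <.> (y - x)) <= e * norm (y - x)" if y: "norm (y - x) < min d 1" for y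
   proof -
    define h where "h = y - x"
    define F where "F z = f (z + h) - f z - Df z <.> h" for z
    have cF: "cont F" unfolding F_def
     by (intro continuous_intros cf cD continuous_on_compose2[OF cf]) auto
    have i: "lint (%z. g z *R f (y - z))" "lint (%z. g z *R f (x - z))"
     "lint (%z. g z *R Df (x - z))"
     by (intro conv_integrable[OF g] cf f cD sD)+
    have "conv g f y - conv g f x - conv g Df x <.> h = (LBINT z. g z *R F (x - z))"
    proof -
     have "conv g Df x <.> h = (LBINT z. (g z *R Df (x - z)) <.> h)"
      unfolding conv_def by (rule integral_inner_left[symmetric]) (rule i)
     moreover have "(%z. g z *R F (x - z)) = (%z. g z *R f (y - z) - g z *R f (x - z) - (g z *R Df (x - z)) <.> h)"
      by (simp add: F_def h_def algebra_simps)
     moreover have "lint (%z. (g z *R Df (x - z)) <.> h)" using i(3) by (rule integrable_inner_left)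
     ultimately show ?thesis unfolding conv_def using i(1,2) by (simp only: Bochner_Integration.integral_diff Bochner_Integration.integrable_diff)
    qed
    also have "norm ... <= M * (e' * norm h) * vol (ball (0::'a) (R + 1))"
    proof (rule conv_increment[OF g cF])
     show "norm (F z) <= e' * norm h" for z unfolding F_def using d(2)[of h z] y by (simp add: h_def)
     show "F z = 0" if "R + 1 <= norm z" for z
     proof -
      have "norm z - norm h <= norm (z + h)" "norm h < 1" using y norm_add_ge[of z h] by (simp_all add: h_def)
      hence "R <= norm (z + h)" using that by simp
      thus ?thesis using that R(2) R'[of z] by (simp add: F_def)
     qed
    qed
    also have "... <= (M + 1) * (e' * norm h) * (m + 1)"
     using M m e' by (intro mult_mono) (auto simp: m_def)
    also have "... = (e' * ((M + 1) * (m + 1))) * norm h" by (simp only: mult_ac)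
    also have "e' * ((M + 1) * (m + 1)) = e" using M m by (simp add: e'_def)
    finally show ?thesis by (simp add: h_def)
   qed
   thus "?G1 e"
    using d(1) by (intro exI[of _ "min d 1"]) auto
  qed
  thus "(conv g f has_derivative (<.>) (conv g Df x)) (at x)"
   by (simp add: has_derivative_at_alt bounded_linear_inner_right)
 next
  show "cont (conv g Df)"
   unfolding continuous_on_iff
  proof (intro ballI allI impI)
   fix x :: 'a and e :: real assume e: "e > 0"
   define e' where "e' = e / ((M + 1) * (m + 1))"
   have e': "e' > 0" using e M m by (simp add: e'_def)
   obtain d where d: "d > 0" "!!x y. norm (x - y) < d ==> norm (Df x - Df y) < e'"
    using csupp_uniformly_continuous[OF cD sD e'] by blast
   have "dist (conv g Df y) (conv g Df x) < e" if y: "dist y x < min d 1" for y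
   proof -
    define h where "h = y - x"
    define F where "F z = Df (z + h) - Df z" for z
    have cF: "cont F" unfolding F_def
     by (intro continuous_intros cD continuous_on_compose2[OF cD]) auto
    have i: "lint (%z. g z *R Df (y - z))" "lint (%z. g z *R Df (x - z))"
     by (intro conv_integrable[OF g] cD sD)+
    have "conv g Df y - conv g Df x = (LBINT z. g z *R F (x - z))"
    proof -
     have "(%z. g z *R F (x - z)) = (%z. g z *R Df (y - z) - g z *R Df (x - z))"
      by (simp add: F_def h_def algebra_simps)
     thus ?thesis unfolding conv_def using i by simp
    qed
    also have "norm ... <= M * e' * vol (ball (0::'a) (R + 1))"
    proof (rule conv_increment[OF g cF])
     show "norm (F z) <= e'" for z unfolding F_def using d(2)[of "z + h" z] y by (simp add: h_def dist_norm)
     show "F z = 0" if "R + 1 <= norm z" for z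
     proof -
      have "norm z - norm h <= norm (z + h)" "norm h < 1" using y norm_add_ge[of z h] by (simp_all add: h_def dist_norm)
      hence "R < norm (z + h)" using that by simp
      thus ?thesis using that R' by (simp add: F_def)
     qed
    qed
    also have "... < (M + 1) * e' * (m + 1)"
    proof -
     have "M * e' * m <= M * e' * (m + 1)" using M e' by (intro mult_left_mono) auto
     also have "... < (M + 1) * e' * (m + 1)" using M m e' by (intro mult_strict_right_mono) auto
     finally show ?thesis by (simp add: m_def)
    qed
    also have "... = e" using M m by (simp add: e'_def)
    finally show ?thesis by (simp add: dist_norm)
   qed
   thus "EX d>0. ALL y:UNIV. dist y x < d --> dist (conv g Df y) (conv g Df x) < e"
    using d(1) by (intro exI[of _ "min d 1"]) auto
  qed
 qed
qed

lemma conv_inner: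
 fixes f :: "'a::euclidean_space => 'a"
 assumes g: "g : bm" "!!y. <|g y|> <= M" and f: "cont f" "csupp f"
 shows "conv g f x <.> v = conv g (%x. f x <.> v) x"
proof -
 have "conv g f x <.> v = (LBINT y. (g y *R f (x - y)) <.> v)"
  unfolding conv_def by (rule integral_inner_left[symmetric]) (rule conv_integrable[OF g f])
 thus ?thesis by (simp add: conv_def)
qed

section \<open>Test fields\<close>

lemma vector_field_derivative:
 fixes T :: "real^'n => real^'n"
 assumes T: "!!i. C1 (%x. T x $ i) (D i)"
 shows "(T has_derivative (%h. \<chi> i. D i x <.> h)) (at x)"
proof -
 have "((%x. T x <.> b) has_derivative (%h. (\<chi> i. D i x <.> h) <.> b)) (at x)" if "b : Basis" for b
 proof -
  obtain i where "b = axis i 1" using \<open>b : Basis\<close> by (auto simp: Basis_vec_def)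
  thus ?thesis using C1_has_derivative[OF T[of i], of x] by (simp add: inner_axis)
 qed
 thus ?thesis using has_derivative_componentwise_within[of T _ x UNIV] by blast
qed

lemma jacobian_C1:
 fixes T :: "real^'n => real^'n"
 assumes T: "!!i. C1 (%x. T x $ i) (D i)"
 shows "jacobian T (at x) = (\<chi> i. D i x)"
proof -
 have "frechet_derivative T (at x) = (%h. \<chi> i. D i x <.> h)"
  using frechet_derivative_at[OF vector_field_derivative[OF T]] by simp
 thus ?thesis by (simp add: jacobian_def matrix_def vec_eq_iff inner_axis)
qed

lemma divergence_C1:
 fixes T :: "real^'n => real^'n"
 assumes T: "!!i. C1 (%x. T x $ i) (D i)"
 shows "divergence T x = (SUM i:UNIV. D i x $ i)"
 by (simp add: divergence_def jacobian_C1[OF T] trace_def)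

lemma test_fieldI:
 fixes T :: "real^'n => real^'n"
 assumes T: "!!i. C1 (%x. T x $ i) (D i)" and n: "!!x. norm (T x) <= 1"
  and S: "compact S" "S <= A" "!!x. x ~: S ==> T x = 0"
 shows "T : test_fields A"
proof -
 have "T differentiable_on UNIV"
  using vector_field_derivative[OF T] by (auto simp: differentiable_on_def differentiable_def)
 moreover have "cont (%x. jacobian T (at x))"
  unfolding jacobian_C1[OF T] by (intro continuous_on_vec_lambda C1_cont_grad[OF T])
 moreover have sub: "closure {x. T x ~= 0} <= S"
  using S by (intro closure_minimal) (auto intro: compact_imp_closed)
 hence "compact (closure {x. T x ~= 0})"
  using bounded_subset[OF compact_imp_bounded[OF S(1)] sub] by (simp add: compact_eq_bounded_closed)
 ultimately show ?thesis using n S(2) sub unfolding test_fields_def by auto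
qed

lemma test_fieldD:
 fixes T :: "real^'n => real^'n"
 assumes "T : test_fields A"
 obtains D S where "!!i. C1 (%x. T x $ i) (D i)" "!!x. norm (T x) <= 1" "compact S" "S <= A" "!!x. x ~: S ==> T x = 0"
proof -
 have T: "T differentiable_on UNIV" "cont (%x. jacobian T (at x))"
  "compact (closure {x. T x ~= 0})" "closure {x. T x ~= 0} <= A" "!!x. norm (T x) <= 1"
  using assms by (auto simp: test_fields_def)
 have d: "(T has_derivative (%h. jacobian T (at x) *v h)) (at x)" for x
  using T(1) jacobian_works[of T "at x"] by (simp add: differentiable_on_def)
 have C: "C1 (%x. T x $ i) (%x. jacobian T (at x) $ i)" for i
  unfolding C1_def
 proof (intro conjI allI)
  fix x
  have "(%h. (jacobian T (at x) *v h) $ i) = (<.>) (jacobian T (at x) $ i)"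
   by (auto simp: fun_eq_iff matrix_vector_mult_def inner_vec_def)
  thus "((%x. T x $ i) has_derivative (<.>) (jacobian T (at x) $ i)) (at x)"
   using bounded_linear.has_derivative[OF bounded_linear_vec_nth d, of i x] by simp
 next
  show "cont (%x. jacobian T (at x) $ i)" using T(2) by (intro continuous_intros)
 qed
 have "T x = 0" if "x ~: closure {x. T x ~= 0}" for x using that closure_subset[of "{x. T x ~= 0}"] by blast
 from that[OF C T(5,3,4) this] show ?thesis .
qed

lemma perimeter_ge:
 "T : test_fields A ==> ennreal (LINT x:Om|lebesgue. divergence T x) <= perimeter Om A"
 unfolding perimeter_def by (rule SUP_upper)

section \<open>Mollification\<close>

text \<open>With \<open>sg = 1\<close> or \<open>sg = - 1\<close> this is either half-space, so that
  statements about one side are proved once for both.\<close>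

definition hs :: "real => 'n => (real^'n) set" where
 "hs sg k = {x. 0 < sg * x $ k}"

text \<open>The exponent 3 makes the kernel twice continuously differentiable: the gradient of a
  mollified indicator has to be C1 itself, because it enters a test field.\<close>

definition bump_raw :: "real => 'a::euclidean_space => real" where
 "bump_raw ep x = max 0 (1 - (norm x)^2 / ep^2) ^ 3"

definition bump :: "real => 'a::euclidean_space => real" where
 "bump ep x = bump_raw ep x / (LBINT y. bump_raw ep (y::'a))"

lemma bump_raw_outside: "ep > 0 ==> ep <= norm x ==> bump_raw ep x = 0"
 by (simp add: bump_raw_def le_divide_eq power_mono)

lemma continuous_bump_raw: "cont (bump_raw ep)"
 unfolding bump_raw_def by (cases "ep = 0") (auto intro!: continuous_intros)

lemma bump_integral_pos:
 assumes "ep > 0" shows "0 < (LBINT y. bump_raw ep (y::'a::euclidean_space))"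
proof -
 let ?B = "ball (0::'a) (ep / 2)"
 have m: "0 < vol ?B" using assms content_ball_pos by simp
 have fB: "fin ?B" using emeasure_bounded_finite[of ?B] by simp
 \<comment> \<open>On the ball of half the radius the base is at least 3/4, whose cube is
   27/64.\<close>
 have "(LBINT y. (27/64) * ind ?B (y::'a)) <= (LBINT y. bump_raw ep (y::'a))"
 proof (rule integral_mono)
  show "lint (%y. (27/64) * ind ?B (y::'a) :: real)"
   using fB by (intro integrable_mult_right) (subst integrable_indicator_iff, auto)
  show "lint (bump_raw ep :: 'a => real)"
   using bump_raw_outside[OF assms] by (intro lint_csupp continuous_bump_raw csuppI) auto
  show "(27/64) * ind ?B y <= bump_raw ep y" for y :: 'a
  proof (cases "y : ?B")
   case True
   have "(norm y)^2 <= (ep / 2)^2" using True by (intro power_mono) auto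
   hence "(norm y)^2 / ep^2 <= 1/4" using assms by (simp add: power_divide divide_le_eq)
   hence "3/4 <= 1 - (norm y)^2 / ep^2" by linarith
   hence "3/4 <= max 0 (1 - (norm y)^2 / ep^2)" by (rule order_trans) simp
   hence "(3/4) ^ 3 <= max 0 (1 - (norm y)^2 / ep^2) ^ 3" by (rule power_mono) simp
   thus ?thesis using True by (simp add: bump_raw_def power3_eq_cube)
  qed (simp add: bump_raw_def)
 qed
 hence "(27/64) * vol ?B <= (LBINT y. bump_raw ep (y::'a))" by simp
 thus ?thesis using m by linarith
qed

lemma bump_nonneg: "ep > 0 ==> 0 <= bump ep (x::'a::euclidean_space)"
 unfolding bump_def by (rule divide_nonneg_pos[OF _ bump_integral_pos]) (simp_all add: bump_raw_def)

lemma bump_outside: "ep > 0 ==> ep <= norm x ==> bump ep x = 0"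
 by (simp add: bump_def bump_raw_outside)

lemma csupp_bump: "ep > 0 ==> csupp (bump ep)"
 using bump_outside by (intro csuppI) auto

lemma continuous_bump: "cont (bump ep :: 'a::euclidean_space => real)"
proof -
 have "bump ep = (%x::'a. bump_raw ep x * (1 / (LBINT y. bump_raw ep (y::'a))))"
  by (simp add: bump_def fun_eq_iff)
 thus ?thesis using continuous_on_mult_right[OF continuous_bump_raw] by metis
qed

lemma bump_minus: "bump ep (- x) = bump ep x"
 by (simp add: bump_def bump_raw_def)

lemma integrable_bump: "ep > 0 ==> lint (bump ep :: 'a::euclidean_space => real)"
 by (intro lint_csupp continuous_bump csupp_bump)

lemma integral_bump: "ep > 0 ==> (LBINT x. bump ep (x::'a::euclidean_space)) = 1"
 using bump_integral_pos[of ep, where 'a='a] by (simp add: bump_def)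

lemma bump_bounded: "ep > 0 ==> EX M. ALL x. <|bump ep (x::'a::euclidean_space)|> <= M"
proof -
 assume ep: "ep > 0"
 have "bump_raw ep x <= 1" for x :: 'a unfolding bump_raw_def by (rule power_le_one) auto
 moreover have "0 <= bump_raw ep x" for x :: 'a by (simp add: bump_raw_def)
 ultimately have "<|bump ep x|> <= 1 / (LBINT y. bump_raw ep (y::'a))" for x :: 'a
  using bump_integral_pos[OF ep, where 'a='a] by (simp add: bump_def divide_right_mono)
 thus ?thesis by blast
qed

lemma bump_C2:
 fixes ep :: real
 shows "EX Db. C1 (bump ep :: 'a::euclidean_space => real) Db & (ALL v. is_C1 (%x. Db x <.> v))"
proof -
 define c where "c = 1 / (LBINT y. bump_raw ep (y::'a))"
 define q where "q x = 1 + (- (1 / ep^2)) * (norm (x - 0))^2" for x :: 'a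
 have qC: "C1 q (%x. 0 + ((- (1 / ep^2)) *R (2 *R (x - 0)) + ((norm (x - 0))^2) *R 0))"
  unfolding q_def by (intro C1_add C1_mult C1_const C1_norm_sq)
 have q: "C1 q (%x. (- 2 / ep^2) *R x)" using qC by simp
 define F' where "F' t = c * (3 * max 0 t ^ 2)" for t :: real
 have F: "((%t. c * max 0 t ^ 3) hrd F' t) (at t)" for t
  unfolding F'_def using DERIV_cmult[OF DERIV_max_power[of 1 t], of c] by (simp add: numeral_eq_Suc)
 have "C1 (%x. c * max 0 (q x) ^ 3) (%x. F' (q x) *R ((- 2 / ep^2) *R x))"
  by (rule C1_compose[OF q F]) (auto simp: F'_def intro!: continuous_intros)
 moreover have "(%x. c * max 0 (q x) ^ 3) = (bump ep :: 'a => real)"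
  by (simp add: fun_eq_iff bump_def bump_raw_def q_def c_def)
 moreover have "is_C1 (%x. (F' (q x) *R ((- 2 / ep^2) *R x)) <.> v)" for v
 proof -
  have "(%x. (F' (q x) *R ((- 2 / ep^2) *R x)) <.> v) = (%x. (c * (3 * (- 2 / ep^2)) * max 0 (q x) ^ Suc (Suc 0)) * (x <.> v))"
   by (simp add: fun_eq_iff F'_def numeral_eq_Suc)
  thus ?thesis by (simp only:) (intro is_C1_intros is_C1_max_power is_C1I[OF q])
 qed
 ultimately show ?thesis by (intro exI[of _ "%x. F' (q x) *R ((- 2 / ep^2) *R x)"]) auto
qed

lemma lborel_integral_reflect:
 fixes f :: "'a::euclidean_space => 'b::{banach,second_countable_topology}"
 assumes "f : bm"
 shows "(LBINT x. f (- x)) = (LBINT x. f x)"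
proof -
 have "lborel = distr lborel borel (uminus :: 'a => 'a)"
  using lborel_affine[of "- 1" "0::'a"] by (simp add: density_1)
 hence "(LBINT x. f x) = (LINT x|distr lborel borel uminus. f x)" by simp
 also have "... = (LBINT x. f (- x))" using assms by (intro integral_distr) auto
 finally show ?thesis by simp
qed

lemma integrable_indicator_times:
 fixes f :: "'a::euclidean_space => real"
 assumes "lint f" "A : bor"
 shows "lint (%x. ind A x * f x)"
 using integrable_mult_indicator[of A lborel f] assms by simp

text \<open>By Fubini and the evenness of the kernel, the mollification is moved from the set to the
  function tested against it.\<close>

lemma conv_bump_adjoint:
 fixes h :: "'a::euclidean_space => real"
 assumes ep: "ep > 0" and Om[measurable]: "Om : bor" and h: "cont h" "csupp h"
 shows "(LBINT x. conv (ind Om) (bump ep) x * h x) = (LBINT y:Om. conv (bump ep) h y)"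
proof -
 let ?b = "bump ep :: 'a => real"
 have [measurable]: "?b : bm" "h : bm"
  by (intro borel_csupp continuous_bump h)+
 obtain R where R: "R > 0" "!!x. R <= norm x ==> h x = 0" using h(2) by (rule csuppE) blast
 define k where "k p = ?b (fst p - snd p) * h (fst p)" for p :: "'a \<times> 'a"
 have ck: "cont k" unfolding k_def
  by (intro continuous_intros continuous_on_compose2[OF continuous_bump] continuous_on_compose2[OF h(1)]) auto
 have sk: "csupp k"
 proof (rule csuppI[of "2 * R + ep"])
  fix p :: "'a \<times> 'a" assume p: "2 * R + ep <= norm p"
  show "k p = 0"
  proof (rule ccontr)
   assume "k p ~= 0"
   hence "norm (fst p) < R" "norm (fst p - snd p) < ep"
    using R(2)[of "fst p"] bump_outside[OF ep, of "fst p - snd p"] by (auto simp: k_def not_le[symmetric])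
   moreover from this have "norm (snd p) < R + ep" using norm_triangle_sub[of "snd p" "fst p"] by (simp add: norm_minus_commute)
   moreover have "norm p <= norm (fst p) + norm (snd p)" by (metis norm_Pair_le prod.collapse)
   ultimately show False using p by simp
  qed
 qed
 have ik: "integrable (lborel \<Otimes>\<^sub>M lborel) (%(x, y). ind Om y * k (x, y))"
 proof -
  have "UNIV \<times> Om : sets (borel :: ('a \<times> 'a) measure)"
   unfolding borel_prod[symmetric] by (intro pair_measureI) auto
  from integrable_indicator_times[OF lint_csupp[OF ck sk] this]
  have "integrable (lborel \<Otimes>\<^sub>M lborel) (%p. ind (UNIV \<times> Om) p * k p)" by (simp add: lborel_prod)
  moreover have "(%p. ind (UNIV \<times> Om) p * k p) = (%(x, y). ind Om y * k (x, y))"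
   by (auto simp: fun_eq_iff indicator_def)
  ultimately show ?thesis by simp
 qed
 have "(LBINT x. conv (ind Om) ?b x * h x) = (LBINT x. LBINT y. ind Om y * k (x, y))"
 proof (rule Bochner_Integration.integral_cong[OF refl])
  fix x
  have "conv (ind Om) ?b x * h x = (LBINT y. ind Om y *R ?b (x - y)) * h x" by (simp add: conv_def)
  also have "... = (LBINT y. (ind Om y *R ?b (x - y)) * h x)"
  proof (rule Bochner_Integration.integral_mult_left[symmetric])
   show "lint (%y. ind Om y *R ?b (x - y))" if "h x ~= 0"
    by (rule conv_integrable[where M = 1]) (auto intro!: continuous_bump csupp_bump[OF ep])
  qed
  finally show "conv (ind Om) ?b x * h x = (LBINT y. ind Om y * k (x, y))" by (simp add: k_def mult.assoc)
 qed
 also have "... = (LBINT y. LBINT x. ind Om y * k (x, y))"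
  using lborel_pair.Fubini_integral[of "%x y. ind Om y * k (x, y)"] ik by simp
 also have "... = (LBINT y:Om. conv ?b h y)"
  unfolding sli_def
 proof (rule Bochner_Integration.integral_cong[OF refl])
  fix y
  have "(LBINT x. k (x, y)) = (LBINT x. k (x + y, y))"
   using integral_translate[of "%x. k (x, y)" y] by (simp add: k_def)
  also have "... = (LBINT x. k (- x + y, y))"
   using lborel_integral_reflect[of "%x. k (x + y, y)"] by (simp add: k_def)
  also have "... = conv ?b h y" by (simp add: conv_def k_def bump_minus add.commute)
  finally show "(LBINT x. ind Om y * k (x, y)) = ind Om y *R conv ?b h y" by simp
 qed
 finally show ?thesis .
qed

lemma moll_bounds:
 fixes Om :: "'a::euclidean_space set"
 assumes ep: "ep > 0" and Om: "Om : bor"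
 shows "0 <= conv (ind Om) (bump ep) x" (is ?G1) "conv (ind Om) (bump ep) x <= 1" (is ?G2)
proof -
 show ?G1
  unfolding conv_def by (intro integral_nonneg_AE AE_I2) (simp add: bump_nonneg[OF ep])
 have i: "lint (%y. ind A y *R bump ep (x - y))" if "A : bor" for A
  using that by (intro conv_integrable[where M = 1] continuous_bump csupp_bump[OF ep]) auto
 have "conv (ind Om) (bump ep) x <= conv (ind UNIV) (bump ep) x"
  unfolding conv_def
 proof (rule integral_mono[OF i[OF Om] i[of UNIV]])
  show "ind Om y *R bump ep (x - y) <= ind UNIV y *R bump ep (x - y)" for y
   by (simp add: bump_nonneg[OF ep] indicator_def)
 qed simp
 also have "... = (LBINT y. bump ep (x - y))" by (simp add: conv_def)
 also have "... = 1"
 proof -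
  have "(LBINT y. bump ep (x - y)) = (LBINT y. bump ep (y + (- x)))"
   using bump_minus[of ep "x - _"] by (simp add: algebra_simps)
  also have "... = 1" using integral_translate[of "bump ep" "- x"] borel_csupp[OF continuous_bump] integral_bump[OF ep] by metis
  finally show ?thesis .
 qed
 finally show ?G2 .
qed

lemma C1_compose_pos:
 assumes u: "C1 u Du" "!!x. u x > 0" and F: "!!t. t > 0 ==> (F hrd F' t) (at t)" "continuous_on {0<..} F'"
 shows "C1 (%x. F (u x)) (%x. F' (u x) *R Du x)"
 unfolding C1_def
proof safe
 fix x
 have "(F has_derivative (%h. F' (u x) * h)) (at (u x))"
  using F(1)[OF u(2)] by (simp add: has_field_derivative_def)
 from has_derivative_compose[OF C1_has_derivative[OF u(1)] this]
 show "((%x. F (u x)) has_derivative (%h. (F' (u x) *R Du x) <.> h)) (at x)" by simp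
 show "cont (%x. F' (u x) *R Du x)"
  using C1_cont[OF u(1)] C1_cont_grad[OF u(1)] continuous_on_compose2[OF F(2)] u(2)
  by (intro continuous_intros) auto
qed

lemma is_C1_inverse_sqrt:
 assumes u: "is_C1 u" "!!x. u x > 0" shows "is_C1 (%x. inverse (sqrt (u x)))"
proof -
 obtain Du where Du: "C1 u Du" using u(1) by (auto simp: is_C1_def)
 define F' where "F' t = - (inverse (sqrt t) * (inverse (sqrt t) / 2) * inverse (sqrt t))" for t :: real
 have "C1 (%x. inverse (sqrt (u x))) (%x. F' (u x) *R Du x)"
 proof (rule C1_compose_pos[OF Du u(2), of "%t. inverse (sqrt t)" F'])
  show "((%t. inverse (sqrt t)) hrd F' t) (at t)" if "t > 0" for t
   unfolding F'_def by (rule DERIV_inverse'[OF DERIV_real_sqrt]) (use that in auto)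
  show "continuous_on {0<..} F'" unfolding F'_def by (intro continuous_intros) auto
 qed
 thus ?thesis by (rule is_C1I)
qed

text \<open>Dividing by \<open>sqrt (de^2 + a^2)\<close> instead of \<open>a\<close> keeps a
  normalised gradient C1 where the gradient vanishes; the loss is at most \<open>de\<close>.\<close>

lemma sqrt_regularize:
 fixes a de :: real
 assumes "a >= 0" "de > 0" shows "a - de <= a^2 * inverse (sqrt (de^2 + a^2))"
proof -
 have pos: "sqrt (de^2 + a^2) > 0" using assms by (simp add: add_pos_nonneg)
 have "(a - de) * sqrt (de^2 + a^2) <= a^2"
 proof (cases "a <= de")
  case True
  hence "(a - de) * sqrt (de^2 + a^2) <= 0" using pos by (simp add: mult_nonpos_nonneg)
  thus ?thesis by (smt (verit) zero_le_power2)
 next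
  case False
  have "sqrt (de^2 + a^2) <= de + a" using sqrt_sum_squares_le_sum[of de a] assms by simp
  hence "(a - de) * sqrt (de^2 + a^2) <= (a - de) * (de + a)" using False by (intro mult_left_mono) auto
  also have "... = a^2 - de^2" by (simp add: power2_eq_square algebra_simps)
  finally show ?thesis by (smt (verit) zero_le_power2)
 qed
 thus ?thesis using pos by (simp only: divide_inverse[symmetric] pos_le_divide_eq)
qed

lemma moll_C2:
 fixes Om :: "'a::euclidean_space set"
 assumes ep: "ep > 0" and Om: "Om : bor"
 obtains DU where "C1 (conv (ind Om) (bump ep)) DU" "!!v. is_C1 (%x. DU x <.> v)"
proof -
 obtain Db where Db: "C1 (bump ep :: 'a => real) Db" "!!v. is_C1 (%x. Db x <.> v)" using bump_C2 by blast
 have g: "(ind Om :: 'a => real) : bm" "!!y. <|ind Om y :: real|> <= 1"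
  using Om by (auto simp: indicator_def)
 have "C1 (conv (ind Om) (bump ep)) (conv (ind Om) Db)"
  by (rule conv_C1[OF g Db(1) csupp_bump[OF ep]])
 moreover have "is_C1 (%x. conv (ind Om) Db x <.> v)" for v
 proof -
  obtain D2 where D2: "C1 (%x. Db x <.> v) D2" using Db(2)[of v] by (auto simp: is_C1_def)
  have sD: "csupp Db" by (rule csupp_grad[OF Db(1) csupp_bump[OF ep]])
  have "C1 (conv (ind Om) (%x. Db x <.> v)) (conv (ind Om) D2)"
   by (rule conv_C1[OF g D2 csupp_inner[OF sD]])
  moreover have "conv (ind Om) (%x. Db x <.> v) = (%x. conv (ind Om) Db x <.> v)"
   using conv_inner[OF g C1_cont_grad[OF Db(1)] sD] by (simp add: fun_eq_iff)
  ultimately show ?thesis by (auto simp: is_C1_def)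
 qed
 ultimately show ?thesis using that by blast
qed

text \<open>The test field is the mollification of \<open>- zt\<close> times the regularised unit
  gradient of \<open>?U\<close>, the mollified indicator. Moving the mollification onto the set and
  integrating by parts turns the integral of its divergence over \<open>Om\<close> into the weighted
  total variation of \<open>?U\<close>, up to the regularisation.\<close>

lemma moll_perimeter:
 fixes Om :: "(real^'n) set"
 assumes ep: "ep > 0" and Om: "Om : bor" and sg: "pm sg"
  and zt: "is_C1 zt" "csupp zt" "!!x. 0 <= zt x" "!!x. zt x <= 1" "!!x. zt x ~= 0 ==> 2 * ep <= sg * x $ k"
  and U: "C1 (conv (ind Om) (bump ep)) DU"
  and P: "perimeter Om (hs sg k) < \<infinity>"
 shows "(LBINT x. zt x * norm (DU x)) <= enn2real (perimeter Om (hs sg k))"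
proof -
 let ?U = "conv (ind Om) (bump ep) :: real^'n => real"
 let ?P = "enn2real (perimeter Om (hs sg k))"
 have U2: "is_C1 (%x. DU x <.> v)" for v
 proof -
  obtain DU' where D: "C1 ?U DU'" "!!v. is_C1 (%x. DU' x <.> v)" using moll_C2[OF ep Om] by blast
  have "DU' = DU" using grad_unique[OF C1_has_derivative[OF D(1)] C1_has_derivative[OF U]] by auto
  thus ?thesis using D(2) by simp
 qed
 obtain Dzt where Dzt: "C1 zt Dzt" using zt(1) by (auto simp: is_C1_def)
 have czt: "cont zt" by (rule C1_cont[OF Dzt])
 have cD: "cont DU" by (rule C1_cont_grad[OF U])
 have i1: "lint (%x. zt x * norm (DU x))" and i2: "lint zt"
  by (intro lint_csupp csupp_mult zt continuous_intros czt cD)+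
 have main: "(LBINT x. zt x * norm (DU x)) - de * (LBINT x. zt x) <= ?P" if de: "de > 0" for de
 proof -
  define r where "r x = inverse (sqrt (de^2 + (norm (DU x))^2))" for x
  have pos: "de^2 + (norm (DU x))^2 > 0" for x using de by (simp add: add_pos_nonneg)
  have r0: "r x > 0" for x unfolding r_def using pos[of x] by simp
  have rC: "is_C1 r"
   unfolding r_def
  proof (rule is_C1_inverse_sqrt[OF _ pos])
   have "(%x. de^2 + (norm (DU x))^2) = (%x. de^2 + (SUM b:Basis. (DU x <.> b) * (DU x <.> b)))"
    by (simp add: power2_norm_eq_inner euclidean_inner[of "DU _" "DU _"])
   thus "is_C1 (%x. de^2 + (norm (DU x))^2)"
    by (simp only:) (intro is_C1_intros is_C1_sum U2 finite_Basis)
  qed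
  define T where "T x = (- (zt x * r x)) *R DU x" for x
  have "is_C1 (%x. T x $ i)" for i
  proof -
   have "(%x. T x $ i) = (%x. (-1) * (zt x * r x) * (DU x <.> axis i 1))"
    by (simp add: T_def fun_eq_iff inner_axis)
   thus ?thesis by (simp only:) (intro is_C1_intros zt rC U2)
  qed
  then obtain D where D: "!!i. C1 (%x. T x $ i) (D i)" unfolding is_C1_def by metis
  have nT: "norm (T x) <= 1" for x
  proof -
   have "norm (DU x) <= sqrt (de^2 + (norm (DU x))^2)" by (rule real_le_rsqrt) simp
   hence "r x * norm (DU x) <= 1" unfolding r_def using pos[of x] by (simp add: divide_inverse[symmetric] mult.commute)
   hence "zt x * (r x * norm (DU x)) <= 1 * 1" using zt(3,4) r0[of x] by (intro mult_mono) auto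
   thus ?thesis using zt(3)[of x] r0[of x] by (simp add: T_def abs_mult mult.assoc)
  qed
  obtain R where R: "R > 0" "!!x. R <= norm x ==> zt x = 0" using zt(2) by (rule csuppE) blast
  have T0: "T x = 0" if "zt x = 0" for x using that by (simp add: T_def)
  have sT: "csupp T" using R T0 by (intro csuppI) auto
  have sTi: "csupp (%x. T x $ i)" for i using R T0 by (intro csuppI[of R]) auto
  have cT: "cont T"
  proof -
   have "cont (%x. \<chi> i. T x $ i)"
    by (intro continuous_on_vec_lambda C1_cont[OF D])
   thus ?thesis by simp
  qed
  \<comment> \<open>\<open>T\<close> vanishes where \<open>sg * x $ k < 2 * ep\<close>, so its
    mollification vanishes where \<open>sg * x $ k < ep\<close> and is admissible in the open
    half-space.\<close>
  define X where "X = conv (bump ep) T"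
  obtain M where M: "!!x::real^'n. <|bump ep x|> <= M" using bump_bounded[OF ep] by blast
  have g: "(bump ep :: real^'n => real) : bm" by (rule borel_csupp[OF continuous_bump])
  have XC: "C1 (%x. X x $ i) (conv (bump ep) (D i))" for i
  proof -
   have "(%x. X x $ i) = conv (bump ep) (%x. T x $ i)"
    using conv_inner[OF g M cT sT, of _ "axis i 1"] by (simp add: X_def inner_axis fun_eq_iff)
   thus ?thesis using conv_C1[OF g M D sTi] by simp
  qed
  have XT: "X : test_fields (hs sg k)"
  proof (rule test_fieldI[OF XC])
   show "norm (X x) <= 1" for x
   proof -
    have i: "lint (%y. bump ep y *R T (x - y))" by (rule conv_integrable[OF g M cT sT])
    have "norm (X x) <= (LBINT y. norm (bump ep y *R T (x - y)))" unfolding X_def conv_def by (rule integral_norm_bound)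
    also have "... <= (LBINT y. bump ep (y :: real^'n))"
    proof (rule integral_mono[OF integrable_norm[OF i] integrable_bump[OF ep]])
     show "norm (bump ep y *R T (x - y)) <= bump ep y" for y
      using mult_left_mono[OF nT, of "bump ep y"] bump_nonneg[OF ep, of y] by simp
    qed
    finally show ?thesis by (simp add: integral_bump[OF ep])
   qed
   let ?S = "{x. ep <= sg * x $ k} Int cball 0 (R + ep)"
   have "closed {x :: real^'n. ep <= sg * x $ k}" by (intro closed_Collect_le continuous_intros)
   thus "compact ?S" by (simp add: closed_Int_compact)
   show "?S <= hs sg k" using ep by (auto simp: hs_def)
   show "X x = 0" if x: "x ~: ?S" for x
   proof -
    have 0: "bump ep y *R T (x - y) = 0" for y
    proof (rule ccontr)
     assume ne: "bump ep y *R T (x - y) ~= 0"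
     hence y: "norm y < ep" using bump_outside[OF ep, of y] by (auto simp: not_le[symmetric])
     have z: "zt (x - y) ~= 0" using ne T0 by auto
     hence "2 * ep <= sg * (x - y) $ k" by (rule zt(5))
     moreover have "<|sg * y $ k|> < ep" using component_le_norm_cart[of y k] y sg by (simp add: abs_mult)
     ultimately have "ep <= sg * x $ k" by (simp add: right_diff_distrib)
     moreover have "norm x <= R + ep"
      using R(2)[of "x - y"] z y norm_triangle_sub[of x y] by (smt (verit))
     ultimately show False using x by simp
    qed
    show ?thesis unfolding X_def conv_def 0 by simp
   qed
  qed
  have cdiv: "cont (%x. SUM i:UNIV. D i x $ i)"
   by (intro continuous_intros C1_cont_grad[OF D])
  have sDi: "csupp (%x. D i x $ i)" for i
   using csupp_inner[OF csupp_grad[OF D sTi], of i "axis i 1"] by (simp add: inner_axis)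
  have sdiv: "csupp (%x. SUM i:UNIV. D i x $ i)"
  proof -
   have "D i x = 0" if "R + 1 <= norm x" for i x
    by (rule C1_grad_zero_outside[OF D, of R]) (use R T0 that in auto)
   thus ?thesis by (intro csuppI[of "R + 1"]) simp
  qed
  have divX: "divergence X x = conv (bump ep) (%x. SUM i:UNIV. D i x $ i) x" for x
  proof -
   have "divergence X x = (SUM i:UNIV. conv (bump ep) (D i) x $ i)" by (rule divergence_C1[OF XC])
   also have "... = (SUM i:UNIV. conv (bump ep) (%x. D i x $ i) x)"
    using conv_inner[OF g M C1_cont_grad[OF D] csupp_grad[OF D sTi], of _ x "axis _ 1"] by (simp add: inner_axis)
   also have "... = conv (bump ep) (%x. SUM i:UNIV. D i x $ i) x"
    unfolding conv_def real_scaleR_def sum_distrib_left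
    using conv_integrable[OF g M _ sDi, of _ x] C1_cont_grad[OF D]
    by (intro Bochner_Integration.integral_sum[symmetric]) (auto intro!: continuous_intros)
   finally show ?thesis .
  qed
  have cdX: "cont (%x. divergence X x)"
   unfolding divergence_C1[OF XC] by (intro continuous_intros C1_cont_grad[OF XC])
  have "ennreal (LINT x:Om|lebesgue. divergence X x) <= perimeter Om (hs sg k)"
   by (rule perimeter_ge[OF XT])
  hence "(LINT x:Om|lebesgue. divergence X x) <= ?P"
   using P by (metis enn2real_mono enn2real_nonneg enn2real_ennreal ennreal_neg infinity_ennreal_def le_cases order_trans)
  moreover have "(LINT x:Om|lebesgue. divergence X x) = (LBINT x:Om. divergence X x)"
   unfolding sli_def using borel_csupp[OF cdX] Om by (intro integral_completion) auto
  moreover have "(LBINT x:Om. divergence X x) = (LBINT x. ?U x * (SUM i:UNIV. D i x $ i))"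
   unfolding divX by (rule conv_bump_adjoint[OF ep Om cdiv sdiv, symmetric])
  moreover have "(LBINT x. ?U x * (SUM i:UNIV. D i x $ i)) = (LBINT x. zt x * ((norm (DU x))^2 * r x))"
  proof -
   have cU: "cont ?U" by (rule C1_cont[OF U])
   have part: "(LBINT x. ?U x * D i x $ i) + (LBINT x. T x $ i * DU x $ i) = 0" (is ?G3)
    and ia: "lint (%x. ?U x * D i x $ i)" (is ?G1) and ib: "lint (%x. T x $ i * DU x $ i)" (is ?G2) for i
   proof -
    have "C1 (%x. ?U x * T x $ i) (%x. ?U x *R D i x + (T x $ i) *R DU x)" by (rule C1_mult[OF U D])
    from integral_grad_zero[OF this csupp_mult(2)[OF sTi], of "axis i 1"]
    have z: "(LBINT x. ?U x * D i x $ i + T x $ i * DU x $ i) = 0" by (simp add: inner_axis inner_add_left)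
    have "cont (%x. D i x $ i)" by (intro continuous_intros C1_cont_grad[OF D])
    thus a: ?G1
     by (intro lint_csupp csupp_mult(2) sDi continuous_on_mult cU)
    have "cont (%x. DU x $ i)" by (intro continuous_intros cD)
    thus b: ?G2
     by (intro lint_csupp csupp_mult(1) sTi continuous_on_mult C1_cont[OF D])
    show ?G3
     using z a b by simp
   qed
   have "(LBINT x. ?U x * (SUM i:UNIV. D i x $ i)) = (SUM i:UNIV. LBINT x. ?U x * D i x $ i)"
    unfolding sum_distrib_left by (rule Bochner_Integration.integral_sum) (rule ia)
   also have "... = (SUM i:UNIV. - (LBINT x. T x $ i * DU x $ i))"
    using part by (intro sum.cong) (auto simp: eq_neg_iff_add_eq_0)
   also have "... = - (LBINT x. (SUM i:UNIV. T x $ i * DU x $ i))"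
    using ib by (simp add: sum_negf)
   also have "(%x. SUM i:UNIV. T x $ i * DU x $ i) = (%x. - (zt x * ((norm (DU x))^2 * r x)))"
   proof
    fix x
    have "(SUM i:UNIV. T x $ i * DU x $ i) = T x <.> DU x" by (simp add: inner_vec_def)
    thus "(SUM i:UNIV. T x $ i * DU x $ i) = - (zt x * ((norm (DU x))^2 * r x))"
     by (simp add: T_def power2_norm_eq_inner)
   qed
   finally show ?thesis by simp
  qed
  moreover have "(LBINT x. zt x * norm (DU x)) - de * (LBINT x. zt x) <= (LBINT x. zt x * ((norm (DU x))^2 * r x))"
  proof -
   have "(LBINT x. zt x * norm (DU x)) - de * (LBINT x. zt x) = (LBINT x. zt x * norm (DU x) - de * zt x)"
    using i1 i2 by simp
   also have "... <= (LBINT x. zt x * ((norm (DU x))^2 * r x))"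
   proof (rule integral_mono)
    obtain Dr where "C1 r Dr" using rC by (auto simp: is_C1_def)
    from C1_cont[OF this] show "lint (%x. zt x * ((norm (DU x))^2 * r x))"
     by (intro lint_csupp csupp_mult(1) zt continuous_intros czt cD)
    show "zt x * norm (DU x) - de * zt x <= zt x * ((norm (DU x))^2 * r x)" for x
     using mult_left_mono[OF sqrt_regularize[of "norm (DU x)" de] zt(3)[of x]] de
     by (simp add: r_def right_diff_distrib mult.commute)
   qed (use i1 i2 in simp)
   finally show ?thesis .
  qed
  ultimately show ?thesis by simp
 qed
 have z0: "(LBINT x. zt x) >= 0" using zt(3) by (intro integral_nonneg_AE) auto
 show ?thesis
 proof (rule field_le_epsilon)
  fix e :: real assume e: "e > 0"
  let ?z = "LBINT x. zt x"
  have "(LBINT x. zt x * norm (DU x)) - e / (?z + 1) * ?z <= ?P" using main[of "e / (?z + 1)"] e z0 by simp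
  moreover have "e / (?z + 1) * ?z <= e" using e z0 by (simp add: field_simps)
  ultimately show "(LBINT x. zt x * norm (DU x)) <= ?P + e" by linarith
 qed
qed

section \<open>Traces on the interface\<close>

lemma integral_coordinate_affine:
 fixes f :: "'a::euclidean_space => real"
 assumes f[measurable]: "f : bm" and e: "e : Basis" and t: "t ~= 0"
 shows "(LBINT x. f x) = <|t|> * (LBINT x. f (x + ((t - 1) * (x <.> e)) *R e))"
proof -
 define L where "L x = x + ((t - 1) * (x <.> e)) *R e" for x :: 'a
 have [measurable]: "L : bm" unfolding L_def by measurable
 have "lborel = density (distr lborel borel L) (%_. ennreal <|t|>)"
 proof (rule measure_eqI)
  fix A :: "'a set" assume "A : sets lborel"
  hence [measurable]: "A : bor" by simp
  have "em A = ennreal <|t|> * (NN x. ind A (x + ((t - 1) * (x <.> e) + x <.> 0 + 0) *R e))"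
   using nn_integral_coordinate_affine[OF _ e _ t, of "ind A" 0 0] by simp
  also have "... = emeasure (density (distr lborel borel L) (%_. ennreal <|t|>)) A"
   by (simp add: emeasure_density nn_integral_cmult nn_integral_distr L_def del: nn_integral_indicator)
  finally show "em A = emeasure (density (distr lborel borel L) (%_. ennreal <|t|>)) A" .
 qed simp
 hence "(LBINT x. f x) = (LINT x|density (distr lborel borel L) (%_. ennreal <|t|>). f x)" by simp
 also have "... = (LINT x|distr lborel borel L. <|t|> *R f x)" by (intro integral_density) auto
 also have "... = (LBINT x. <|t|> *R f (L x))" by (intro integral_distr) auto
 finally show ?thesis by (simp add: L_def)
qed

lemma hs_borel [measurable]: "hs sg k : bor"
 unfolding hs_def by measurable

lemma sign_square: "pm sg ==> sg * sg = (1::real)"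
 by (metis abs_mult_self_eq mult.right_neutral)

text \<open>The half-space integral of the normal derivative is the derivative of the integral over a
 sliding half-space; the increment is an integral over a thin layer, rescaled to the slab.\<close>

lemma halfspace_trace:
 fixes u :: "real^'n => real"
 assumes u: "C1 u Du" "csupp u" and sg: "pm sg"
 shows "(LBINT x:hs sg k. Du x $ k) = - sg * (LBINT x:slab k. u (proj k x))"
proof -
 define e where "e = (axis k 1 :: real^'n)"
 have e: "e : Basis" and xe: "x <.> e = x $ k" for x by (auto simp: e_def Basis_vec_def inner_axis)
 have sg2: "sg * sg = 1" using sg by (rule sign_square)
 have cu: "cont u" by (rule C1_cont[OF u(1)])
 have [measurable]: "u : bm" by (rule borel_csupp[OF cu])
 define I where "I t = (LBINT x:hs sg k. u (x + t *R (sg *R e)))" for t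
 have "(I hrd (LBINT x:hs sg k. Du x <.> (sg *R e))) (at 0)"
  unfolding I_def by (rule translated_integral_deriv[OF u hs_borel])
 hence "((%t. (I t - I 0) / t) ~~> (LBINT x:hs sg k. Du x <.> (sg *R e))) (at 0)"
  by (simp add: DERIV_def)
 moreover have inv0: "filterlim (%n. inv_Suc n) (at 0) sequentially"
  using LIMSEQ_inverse_real_of_nat by (simp add: filterlim_at)
 ultimately have l1: "(%n. (I (inv_Suc n) - I 0) / inv_Suc n)
   ----> (LBINT x:hs sg k. Du x <.> (sg *R e))"
  by (rule filterlim_compose)
 define J where "J t = (LBINT x:slab k. u (proj k x + (sg * t * x $ k) *R e))" for t
 have IJ: "(I t - I 0) / t = - J t" if t: "t > 0" for t
 proof -
  have "I t = (LBINT x:{x. x - t *R (sg *R e) : hs sg k}. u x)"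
   unfolding I_def by (rule set_integral_translate) auto
  also have "{x. x - t *R (sg *R e) : hs sg k} = {x. t < sg * x $ k}"
   using sg2 by (auto simp: hs_def e_def right_diff_distrib mult.assoc[symmetric] mult.commute[of t sg])
  finally have It: "I t = (LBINT x:{x. t < sg * x $ k}. u x)" .
  have m[measurable]: "{x. t < sg * x $ k} : sets (borel :: (real^'n) measure)" by measurable
  have "(LBINT x:hs sg k. u x) - (LBINT x:{x. t < sg * x $ k}. u x)
    = (LBINT x. (ind (hs sg k) x - ind {x. t < sg * x $ k} x) * u x)"
   using sint_csupp[OF cu u(2) hs_borel[of sg k]] sint_csupp[OF cu u(2) m]
   by (simp add: sli_def set_integrable_def left_diff_distrib)
  also have "... = <|sg * t|> * (LBINT x. (%x. (ind (hs sg k) x - ind {x. t < sg * x $ k} x) * u x)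
    (x + ((sg * t - 1) * (x <.> e)) *R e))"
   using t sg by (intro integral_coordinate_affine[OF _ e]) auto
  \<comment> \<open>The layer contains one of its two faces, which becomes the plane
    \<open>x $ k = 1\<close> after stretching and is then dropped as a null set.\<close>
  also have "(%x. (%x. (ind (hs sg k) x - ind {x. t < sg * x $ k} x) * u x) (x + ((sg * t - 1) * (x <.> e)) *R e))
   = (%x. (ind (slab k) x + ind {x. x $ k = 1} x) * u (proj k x + (sg * t * x $ k) *R e))"
  proof
   fix x :: "real^'n"
   have 1: "x + ((sg * t - 1) * (x <.> e)) *R e = proj k x + (sg * t * x $ k) *R e"
    unfolding xe by (simp add: proj_def e_def algebra_simps)
   have 2: "sg * (proj k x + (sg * t * x $ k) *R e) $ k = t * x $ k"
    using sg2 by (simp add: e_def mult.assoc[symmetric])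
   have 3: "0 < t * x $ k <-> 0 < x $ k" "t < t * x $ k <-> 1 < x $ k" using t by (simp_all add: zero_less_mult_iff)
   show "(%x. (ind (hs sg k) x - ind {x. t < sg * x $ k} x) * u x) (x + ((sg * t - 1) * (x <.> e)) *R e)
    = (ind (slab k) x + ind {x. x $ k = 1} x) * u (proj k x + (sg * t * x $ k) *R e)"
   proof -
    define y where "y = proj k x + (sg * t * x $ k) *R e"
    have "y : hs sg k <-> 0 < x $ k" "sg * y $ k = t * x $ k" using 2 3 by (simp_all only: y_def hs_def mem_Collect_eq)
    hence "ind (hs sg k) y - ind {x. t < sg * x $ k} y = (ind (slab k) x + ind {x. x $ k = 1} x :: real)"
     using 3 by (cases "x $ k" "1::real" rule: linorder_cases) (simp_all add: slab_def indicator_def)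
    thus ?thesis unfolding 1 y_def[symmetric] by simp
   qed
  qed
  also have "(LBINT x. (ind (slab k) x + ind {x. x $ k = 1} x) * u (proj k x + (sg * t * x $ k) *R e)) = J t"
   unfolding J_def sli_def
  proof (rule integral_cong_AE)
   have "AEL x. x <.> e ~= 1" by (rule AE_hyperplane) (simp add: e_def)
   thus "AEL x. (ind (slab k) x + ind {x. x $ k = 1} x) * u (proj k x + (sg * t * x $ k) *R e)
     = ind (slab k) x *R u (proj k x + (sg * t * x $ k) *R e)"
    by eventually_elim (simp add: xe)
  qed auto
  finally have "I 0 - I t = t * J t" unfolding It using t sg by (simp add: I_def abs_mult)
  thus ?thesis using t by (simp add: field_simps)
 qed
 have "(%n. J (inv_Suc n)) ----> (LBINT x:slab k. u (proj k x))"
 proof -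
  obtain M where M: "!!x. <|u x|> <= M"
  proof -
   obtain R where R: "R > 0" "!!x. R <= norm x ==> u x = 0" using u(2) by (rule csuppE) blast
   have "compact (u ` cball 0 R)" by (intro compact_continuous_image continuous_on_subset[OF cu]) auto
   then obtain M where M: "!!y. y : u ` cball 0 R ==> <|y|> <= M" using compact_imp_bounded bounded_real by metis
   have "<|u x|> <= max M 0" for x using M[of "u x"] R(2)[of x] by (cases "norm x <= R") (auto simp: le_max_iff_disj)
   thus ?thesis by (rule that)
  qed
  obtain R where R: "R > 0" "!!x. R <= norm x ==> u x = 0" using u(2) by (rule csuppE) blast
  let ?B = "ball (0::real^'n) (R + 1)"
  have iB: "lint (%x::real^'n. M * ind ?B x)"
   using emeasure_bounded_finite[of ?B] by (intro integrable_mult_right) (subst integrable_indicator_iff, auto)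
  have b: "norm (ind (slab k) x *R u (proj k x + (sg * t * x $ k) *R e)) <= M * ind ?B x" if t: "0 <= t" for t x
  proof (cases "x : slab k & u (proj k x + (sg * t * x $ k) *R e) ~= 0")
   case True
   hence "norm (proj k x + (sg * t * x $ k) *R e) < R" using R(2) by (meson not_le)
   moreover have "norm (proj k x) <= norm (proj k x + (sg * t * x $ k) *R e)"
    by (rule norm_le_componentwise_cart) (auto simp: e_def axis_def)
   moreover have "norm x <= norm (proj k x) + norm ((x $ k) *R axis k 1 :: real^'n)"
    using norm_triangle_ineq[of "proj k x" "(x $ k) *R axis k 1"] by (simp add: proj_def)
   moreover have "norm ((x $ k) *R axis k 1 :: real^'n) <= 1" using True by (simp add: slab_def)
   ultimately have "norm x < R + 1" by linarith
   moreover have "0 <= M" using M[of 0] by linarith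
   ultimately show ?thesis using M by (simp add: indicator_def)
  next
   case False
   thus ?thesis using M[of 0] by (auto simp: indicator_def)
  qed
  show ?thesis
   unfolding J_def sli_def
  proof (rule integral_dominated_convergence[OF _ _ iB])
   show "AEL x. (%n. ind (slab k) x *R u (proj k x + (sg * inv_Suc n * x $ k) *R e))
     ----> ind (slab k) x *R u (proj k x)"
   proof (intro AE_I2 tendsto_scaleR tendsto_const)
    fix x :: "real^'n"
    have "(%n. proj k x + (sg * inv_Suc n * x $ k) *R e) ----> proj k x + (sg * 0 * x $ k) *R e"
     by (intro tendsto_intros LIMSEQ_inverse_real_of_nat)
    hence "(%n. proj k x + (sg * inv_Suc n * x $ k) *R e) ----> proj k x" by simp
    thus "(%n. u (proj k x + (sg * inv_Suc n * x $ k) *R e)) ----> u (proj k x)"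
     by (rule continuous_on_tendsto_compose[OF cu]) auto
   qed
   show "AEL x. norm (ind (slab k) x *R u (proj k x + (sg * inv_Suc n * x $ k) *R e))
     <= M * ind ?B x" for n
    by (intro AE_I2 b) simp
  qed auto
 qed
 from tendsto_minus[OF this]
 have "(%n. (I (inv_Suc n) - I 0) / inv_Suc n) ----> - (LBINT x:slab k. u (proj k x))"
  by (subst IJ) auto
 from LIMSEQ_unique[OF l1 this]
 have "(LBINT x:hs sg k. sg * Du x $ k) = - (LBINT x:slab k. u (proj k x))"
  by (simp add: xe)
 hence "sg * (sg * (LBINT x:hs sg k. Du x $ k)) = sg * (- (LBINT x:slab k. u (proj k x)))"
  by simp
 thus ?thesis using sg2 by (simp add: mult.assoc[symmetric])
qed

section \<open>L1 continuity of translations and convergence of mollified indicators\<close>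

lemma open_translate_small:
 fixes G :: "'a::euclidean_space set"
 assumes G: "open G" "fin G" and de: "de > 0"
 obtains d where "d > 0" "!!h. norm h < d ==> em {x : G. x + h ~: G} < ennreal de"
proof (cases "- G = {}")
 case True
 hence 0: "{x : G. x + h ~: G} = {}" for h by auto
 have "em {x : G. x + h ~: G} < ennreal de" for h unfolding 0 using de by simp
 thus ?thesis using that[of 1] by simp
next
 case False
 \<comment> \<open>A vector shorter than \<open>inv_Suc n\<close> can carry only points of
   \<open>B n\<close> out of \<open>G\<close>; these sets decrease to the empty set because
   \<open>G\<close> is open.\<close>
 define B where "B n = G Int {x. infdist x (- G) < inv_Suc n}" for n
 have oB: "open (B n)" for n
  unfolding B_def by (intro open_Int G(1) open_Collect_less continuous_intros)
 have "(%n. em (B n)) ----> em (\<Inter>n. B n)"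
 proof (rule Lim_emeasure_decseq)
  show "range B <= sets lborel" using oB by auto
  show "decseq B"
  proof (rule decseq_SucI)
   fix n
   have "inverse (real (Suc (Suc n))) <= inv_Suc n" by (intro le_imp_inverse_le) auto
   thus "B (Suc n) <= B n" unfolding B_def by (blast intro: less_le_trans)
  qed
  have "em (B n) <= em G" for n using G(1) by (intro emeasure_mono) (auto simp: B_def)
  thus "em (B n) ~= \<infinity>" for n using G(2) by (metis infinity_ennreal_def leD)
 qed
 moreover have "(\<Inter>n. B n) = {}"
 proof -
  have "EX n. x ~: B n" for x
  proof (cases "x : G")
   case True
   hence "infdist x (- G) > 0"
    using in_closed_iff_infdist_zero[of "- G" x] G(1) False infdist_nonneg[of x "- G"] by (auto simp: closed_open)
   then obtain n where "inv_Suc n < infdist x (- G)" using reals_Archimedean by blast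
   thus ?thesis by (auto simp: B_def intro!: exI[of _ n])
  qed (auto simp: B_def)
  thus ?thesis by auto
 qed
 ultimately have "(%n. em (B n)) ----> 0" by simp
 hence "EVS n. em (B n) < ennreal de" using de by (intro order_tendstoD) auto
 then obtain n where n: "em (B n) < ennreal de" by (auto simp: eventually_sequentially)
 have "em {x : G. x + h ~: G} < ennreal de" if h: "norm h < inv_Suc n" for h
 proof -
  have "{x : G. x + h ~: G} <= B n"
  proof
   fix x assume "x : {x : G. x + h ~: G}"
   hence x: "x : G" "x + h : - G" by auto
   have "infdist x (- G) <= dist x (x + h)" using x(2) by (rule infdist_le)
   thus "x : B n" using h x(1) by (simp add: B_def dist_norm)
  qed
  thus ?thesis using n oB[of n] by (intro order_le_less_trans[OF emeasure_mono n]) auto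
 qed
 thus ?thesis using that[of "inv_Suc n"] by simp
qed

text \<open>By outer regularity \<open>E\<close> is almost an open set \<open>G\<close>: a point
  leaving \<open>E\<close> either leaves \<open>G\<close> or lands in the small set
  \<open>G - E\<close>.\<close>

lemma translate_small:
 fixes E :: "'a::euclidean_space set"
 assumes E[measurable]: "E : bor" and fE: "fin E" and de: "de > 0"
 obtains d where "d > 0" "!!h. norm h < d ==> em {x : E. x + h ~: E} < ennreal de"
proof -
 have "E : sets lebesgue" using E by simp
 from sets_lebesgue_outer_open[OF this, of "de/2"] de
 obtain G where G: "open G" "E <= G" "emeasure lebesgue (G - E) < ennreal (de/2)" by auto
 have [measurable]: "G : bor" using G(1) by simp
 have GE: "em (G - E) < ennreal (de/2)" using G(3) by simp
 have "em G <= em E + em (G - E)"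
  using G(2) by (subst plus_emeasure) (auto simp: Un_absorb1)
 also have "... < \<infinity>" using fE GE by (simp add: less_top[symmetric] top_unique) (metis ennreal_less_top order.strict_trans less_irrefl)
 finally have fG: "fin G" .
 obtain d where d: "d > 0" "!!h. norm h < d ==> em {x : G. x + h ~: G} < ennreal (de/2)"
  using open_translate_small[OF G(1) fG, of "de/2"] de by auto
 have "em {x : E. x + h ~: E} < ennreal de" if h: "norm h < d" for h
 proof -
  have "em {x : E. x + h ~: E} <= em ({x : G. x + h ~: G} Un {x. x + h : G - E})"
   using G(2) by (intro emeasure_mono) auto
  also have "... <= em {x : G. x + h ~: G} + em {x. x + h : G - E}"
   by (intro emeasure_subadditive) auto
  also have "em {x. x + h : G - E} = em (G - E)"
  proof -
   have "em (G - E) = emeasure (distr lborel borel ((+) h)) (G - E)" by (simp add: lborel_distr_plus)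
   also have "... = em ((+) h -` (G - E) Int space lborel)" by (rule emeasure_distr) auto
   also have "(+) h -` (G - E) Int space lborel = {x. x + h : G - E}" by (auto simp: add.commute)
   finally show ?thesis by simp
  qed
  also have "em {x : G. x + h ~: G} + em (G - E) < ennreal (de/2) + ennreal (de/2)"
   by (rule add_strict_mono[OF d(2)[OF h] GE])
  also have "... = ennreal de" using de by (subst ennreal_plus[symmetric]) auto
  finally show ?thesis .
 qed
 thus ?thesis using that d(1) by blast
qed

lemma L1_translation:
 fixes E :: "'a::euclidean_space set"
 assumes E[measurable]: "E : bor" and fE: "fin E" and de: "de > 0"
 obtains d where "d > 0" "!!h. norm h < d ==> (NN x. ennreal <|ind E (x + h) - ind E x|>) <= ennreal de"
proof -
 obtain d where d: "d > 0" "!!h. norm h < d ==> em {x : E. x + h ~: E} < ennreal (de/2)"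
  using translate_small[OF E fE, of "de/2"] de by auto
 have "(NN x. ennreal <|ind E (x + h) - ind E x|>) <= ennreal de" if h: "norm h < d" for h
 proof -
  have "(NN x. ennreal <|ind E (x + h) - ind E x|>)
    = (NN x. ind {x : E. x + h ~: E} x + ind {x : E. x + (- h) ~: E} (h + x))"
   by (intro nn_integral_cong) (auto simp: indicator_def add.commute)
  also have "... = em {x : E. x + h ~: E} + (NN x. ind {x : E. x + (- h) ~: E} (h + x))"
   by (subst nn_integral_add) auto
  also have "(NN x. ind {x : E. x + (- h) ~: E} (h + x)) = em {x : E. x + (- h) ~: E}"
  proof -
   have "em {x : E. x + (- h) ~: E} = (\<integral>\<^sup>+x. ind {x : E. x + (- h) ~: E} x \<partial>distr lborel borel ((+) h))"
    by (simp add: lborel_distr_plus)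
   also have "... = (NN x. ind {x : E. x + (- h) ~: E} (h + x))" by (rule nn_integral_distr) auto
   finally show ?thesis by simp
  qed
  also have "em {x : E. x + h ~: E} + em {x : E. x + (- h) ~: E} <= ennreal (de/2) + ennreal (de/2)"
   using d(2)[of h] d(2)[of "- h"] h by (intro add_mono less_imp_le) auto
  also have "... = ennreal de" using de by (subst ennreal_plus[symmetric]) auto
  finally show ?thesis .
 qed
 thus ?thesis using that d(1) by blast
qed

text \<open>The difference is an average of translation differences by \<open>a - y\<close> with
  \<open>norm y < ep\<close>, all of length below \<open>d\<close>. The shift \<open>a\<close> is
  included because the trial functions are shifted mollifications.\<close>

lemma moll_L1:
 fixes E :: "'a::euclidean_space set"
 assumes E[measurable]: "E : bor" and ep: "ep > 0"
  and d: "!!h. norm h < d ==> (NN x. ennreal <|ind E (x + h) - ind E x|>) <= ennreal de"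
  and a: "norm a + ep < d"
 shows "(NN x. ennreal <|conv (ind E) (bump ep) (x + a) - ind E x|>) <= ennreal de"
proof -
 let ?b = "bump ep :: 'a => real"
 have [measurable]: "?b : bm" by (intro borel_csupp continuous_bump)
 have i1: "lint (%y. ?b y * ind E (x - y))" for x
 proof (rule Bochner_Integration.integrable_bound[OF integrable_bump[OF ep]])
  show "AEL y. norm (?b y * ind E (x - y)) <= norm (?b y)" by (simp add: indicator_def)
 qed measurable
 have flip: "conv (ind E) ?b x = (LBINT y. ?b y * ind E (x - y))" for x
 proof -
  have m: "(%y. ind E y * ?b (x - y)) : bm" by measurable
  have "conv (ind E) ?b x = (LBINT y. ind E y * ?b (x - y))" by (simp add: conv_def)
  also have "... = (LBINT y. ind E (y + x) * ?b (x - (y + x)))"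
   using integral_translate[OF m, of x] by simp
  also have "... = (LBINT y. ind E (- y + x) * ?b (x - (- y + x)))"
   by (rule lborel_integral_reflect[symmetric]) measurable
  finally show ?thesis by (simp add: mult.commute)
 qed
 have "(NN x. ennreal <|conv (ind E) ?b (x + a) - ind E x|>)
  <= (NN x. (NN y. ennreal (?b y) * ennreal <|ind E (x + (a - y)) - ind E x|>))"
 proof (rule nn_integral_mono)
  fix x
  have "conv (ind E) ?b (x + a) - ind E x
    = (LBINT y. ?b y * ind E (x + a - y)) - (LBINT y. ?b y * ind E x)"
   using integral_bump[OF ep, where 'a='a] by (simp add: flip)
  also have "... = (LBINT y. ?b y * ind E (x + a - y) - ?b y * ind E x)"
   using i1[of "x + a"] integrable_bump[OF ep, where 'a='a] by (intro Bochner_Integration.integral_diff[symmetric]) auto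
  finally have eq: "conv (ind E) ?b (x + a) - ind E x = (LBINT y. ?b y * ind E (x + a - y) - ?b y * ind E x)" .
  have "ennreal <|conv (ind E) ?b (x + a) - ind E x|> <= (NN y. ennreal (norm (?b y * ind E (x + a - y) - ?b y * ind E x)))"
   unfolding eq real_norm_def[symmetric]
   using i1[of "x + a"] integrable_bump[OF ep, where 'a='a] by (intro integral_norm_bound_ennreal) auto
  also have "... = (NN y. ennreal (?b y) * ennreal <|ind E (x + (a - y)) - ind E x|>)"
   by (intro nn_integral_cong) (simp add: ennreal_mult'[symmetric] bump_nonneg[OF ep] abs_mult right_diff_distrib[symmetric] add_diff_eq)
  finally show "ennreal <|conv (ind E) ?b (x + a) - ind E x|>
   <= (NN y. ennreal (?b y) * ennreal <|ind E (x + (a - y)) - ind E x|>)" .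
 qed
 also have "... = (NN y. (NN x. ennreal (?b y) * ennreal <|ind E (x + (a - y)) - ind E x|>))"
  by (rule lborel_pair.Fubini'[symmetric]) measurable
 also have "... <= (NN y. ennreal (?b y) * ennreal de)"
 proof (rule nn_integral_mono)
  fix y
  show "(NN x. ennreal (?b y) * ennreal <|ind E (x + (a - y)) - ind E x|>) <= ennreal (?b y) * ennreal de"
  proof (cases "norm y < ep")
   case True
   hence "norm (a - y) < d" using a norm_triangle_ineq4[of a y] by linarith
   thus ?thesis by (subst nn_integral_cmult) (auto intro!: mult_left_mono d)
  next
   case False
   thus ?thesis using bump_outside[OF ep, of y] by simp
  qed
 qed
 also have "... = (NN y. ennreal (?b y)) * ennreal de" by (rule nn_integral_multc) measurable
 also have "(NN y. ennreal (?b y)) = 1"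
  using nn_integral_eq_integral[OF integrable_bump[OF ep, where 'a='a]] integral_bump[OF ep, where 'a='a] by (simp add: bump_nonneg[OF ep])
 finally show ?thesis by simp
qed

section \<open>Trial functions\<close>

text \<open>The square makes the function C1, with a gradient of order 1/R; the total variation
  added by cutting off therefore vanishes as \<open>R\<close> grows.\<close>

definition cutoff :: "real => 'a::euclidean_space => real" where
 "cutoff R x = max 0 (1 - (norm x)^2 / R^2) ^ 2"

lemma cutoff_outside: "R > 0 ==> R <= norm x ==> cutoff R x = 0"
 by (simp add: cutoff_def le_divide_eq power_mono)

lemma cutoff_bounds: "0 <= cutoff R x" "cutoff R x <= 1"
 unfolding cutoff_def by (auto intro!: power_le_one)

lemma csupp_cutoff: "R > 0 ==> csupp (cutoff R)"
 using cutoff_outside by (intro csuppI) auto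

lemma cutoff_tendsto: "(%i. cutoff (real (Suc i)) x) ----> 1"
proof -
 have "(%i. max 0 (1 - (norm x)^2 * (inv_Suc i)^2) ^ 2) ----> max 0 (1 - (norm x)^2 * 0^2) ^ 2"
  by (intro tendsto_intros LIMSEQ_inverse_real_of_nat)
 thus ?thesis by (simp add: cutoff_def divide_inverse power_inverse)
qed

lemma cutoff_C1:
 assumes R: "R > 0"
 obtains D where "C1 (cutoff R :: 'a::euclidean_space => real) D" "!!x. norm (D x) <= 4 / R"
proof -
 define q where "q x = 1 + (- (1 / R^2)) * (norm (x - 0))^2" for x :: 'a
 have qC: "C1 q (%x. 0 + ((- (1 / R^2)) *R (2 *R (x - 0)) + ((norm (x - 0))^2) *R 0))"
  unfolding q_def by (intro C1_add C1_mult C1_const C1_norm_sq)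
 have q: "C1 q (%x. (- 2 / R^2) *R x)" using qC by simp
 define D where "D x = (2 * max 0 (q x)) *R ((- 2 / R^2) *R x)" for x
 have F: "((%t. max 0 t ^ 2) hrd 2 * max 0 t) (at t)" for t :: real
  using DERIV_max_power[of 0 t] by (simp add: numeral_2_eq_2)
 have "C1 (%x. max 0 (q x) ^ 2) D"
  unfolding D_def by (rule C1_compose[OF q F]) (auto intro!: continuous_intros)
 moreover have "(%x. max 0 (q x) ^ 2) = (cutoff R :: 'a => real)"
  by (simp add: fun_eq_iff cutoff_def q_def)
 moreover have "norm (D x) <= 4 / R" for x
 proof (cases "norm x <= R")
  case True
  have "max 0 (q x) <= 1" by (simp add: q_def)
  hence "2 * max 0 (q x) * (2 / R^2 * norm x) <= 2 * 1 * (2 / R^2 * R)"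
   using True R by (intro mult_mono) auto
  thus ?thesis using R by (simp add: D_def power2_eq_square abs_mult)
 next
  case False
  hence "R^2 <= (norm x)^2" using R by (intro power_mono) auto
  hence "q x <= 0" using R by (simp add: q_def le_divide_eq)
  thus ?thesis using R by (simp add: D_def)
 qed
 ultimately show ?thesis using that by simp
qed

text \<open>A C1 step that rises from 0 to 1 over the unit interval, glued from squares of positive
  parts.\<close>

definition ramp :: "real => real" where
 "ramp t = 1 - max 0 (1 - max 0 t ^ 2) ^ 2"

lemma ramp_values: "t <= 0 ==> ramp t = 0" "1 <= t ==> ramp t = 1" "0 <= ramp t" "ramp t <= 1"
proof -
 show "1 <= t ==> ramp t = 1" using one_le_power[of t 2] by (simp add: ramp_def)
 show "0 <= ramp t" unfolding ramp_def using power_le_one[of "max 0 (1 - max 0 t ^ 2)" 2] by simp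
qed (auto simp: ramp_def)

lemma is_C1_ramp: assumes "is_C1 u" shows "is_C1 (%x. ramp (u x))"
proof -
 have "is_C1 (%x. 1 + (-1) * max 0 (1 + (-1) * max 0 (u x) ^ Suc (Suc 0)) ^ Suc (Suc 0))"
  by (intro is_C1_intros is_C1_max_power assms)
 thus ?thesis by (simp add: ramp_def numeral_2_eq_2)
qed

lemma conv_bump_cong:
 assumes ep: "ep > 0" and [measurable]: "A : bor" "B : bor"
  and AE: "AEL y. norm (x - y) < ep --> (y : A <-> y : B)"
 shows "conv (ind A) (bump ep) x = conv (ind B) (bump ep) (x::'a::euclidean_space)"
 unfolding conv_def
proof (rule integral_cong_AE)
 have [measurable]: "(bump ep :: 'a => real) : bm" by (intro borel_csupp continuous_bump)
 show "(%y. ind A y *R bump ep (x - y)) : borel_measurable lborel"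
  "(%y. ind B y *R bump ep (x - y)) : borel_measurable lborel" by measurable
 show "AEL y. ind A y *R bump ep (x - y) = ind B y *R bump ep (x - y)"
  using AE
 proof eventually_elim
  case (elim y)
  thus ?case using bump_outside[OF ep, of "x - y"] by (cases "norm (x - y) < ep") (auto simp: indicator_def)
 qed
qed

lemma conv_bump_UNIV: "ep > 0 ==> conv (ind UNIV) (bump ep) (x::'a::euclidean_space) = 1"
proof -
 assume ep: "ep > 0"
 have "(LBINT y. bump ep (x - y)) = (LBINT y. bump ep (y + (- x)))"
  using bump_minus[of ep "x - _"] by (simp add: algebra_simps)
 also have "... = 1" using integral_translate[of "bump ep" "- x"] borel_csupp[OF continuous_bump] integral_bump[OF ep] by metis
 finally show ?thesis by (simp add: conv_def)
qed

text \<open>The argument is shifted by \<open>4 * ep\<close> into the side \<open>sg\<close>. On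
  that closed side the kernel then reaches only points of the open half-space, so the trace on the
  interface sees one half of the set, and there is room for the weight \<open>zt\<close> of
  \<open>moll_perimeter\<close>.\<close>

definition trial :: "(real^'n) set => 'n => real => real => real => real^'n => real" where
 "trial Om k sg ep R x = cutoff R x * conv (ind Om) (bump ep) (x + (4 * ep * sg) *R axis k 1)"

lemma trial_bounds:
 assumes "ep > 0" "Om : bor"
 shows "0 <= trial Om k sg ep R x" "trial Om k sg ep R x <= cutoff R x"
 using moll_bounds[OF assms, of "x + _"] cutoff_bounds[of R x] by (auto simp: trial_def mult_left_le)

lemma csupp_trial: "R > 0 ==> csupp (trial Om k sg ep R)"
 unfolding trial_def by (intro csupp_mult csupp_cutoff)

lemma near_shift:
 assumes "pm sg" and y: "norm (x + (4 * ep * sg) *R axis k 1 - y) < ep" and x: "0 <= sg * x $ k"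
 shows "y : hs sg k" "norm (x - y) < 5 * ep"
proof -
 have sg2: "sg * sg = 1" using assms(1) by (rule sign_square)
 let ?z = "x + (4 * ep * sg) *R axis k 1 - y"
 have ep: "ep > 0" using y norm_ge_zero order_le_less_trans by blast
 have "<|sg * ?z $ k|> < ep" using component_le_norm_cart[of ?z k] y assms(1) by (simp add: abs_mult)
 moreover have "sg * ?z $ k = sg * x $ k + 4 * ep * (sg * sg) - sg * y $ k" by (simp add: algebra_simps)
 ultimately show "y : hs sg k" unfolding hs_def sg2 using x ep by simp
 have "x - y = ?z - (4 * ep * sg) *R axis k 1" by simp
 hence "norm (x - y) <= norm ?z + norm ((4 * ep * sg) *R axis k 1 :: real^'a)" using norm_triangle_ineq4 by metis
 also have "... < ep + 4 * ep" using y assms(1) ep by (simp add: abs_mult)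
 finally show "norm (x - y) < 5 * ep" by simp
qed

lemma trial_cong:
 assumes "ep > 0" "A : bor" "B : bor" "pm sg" "0 <= sg * x $ k"
  and "AEL y. y : hs sg k --> norm (x - y) < 5 * ep --> (y : A <-> y : B)"
 shows "trial A k sg ep R x = trial B k sg ep R x"
proof -
 have "conv (ind A) (bump ep) (x + (4 * ep * sg) *R axis k 1) = conv (ind B) (bump ep) (x + (4 * ep * sg) *R axis k 1)"
  using assms(6) by (intro conv_bump_cong assms) (auto elim!: eventually_mono dest: near_shift[OF assms(4) _ assms(5)])
 thus ?thesis by (simp add: trial_def)
qed

lemma trial_UNIV: "ep > 0 ==> trial UNIV k sg ep R x = cutoff R x"
 using conv_bump_UNIV[of ep "x + _"] by (simp add: trial_def)

lemma trial_empty: "trial {} k sg ep R x = 0"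
 by (simp add: trial_def conv_def)

text \<open>In the half-space the shifted mollifications of \<open>Om\<close> and of its half agree.
  So the L1 estimate comes from \<open>moll_L1\<close> and the gradient estimate from
  \<open>moll_perimeter\<close>; the gradient of the cutoff contributes the term with
  \<open>4 / R\<close>.\<close>

lemma trial_L1:
 fixes Om :: "(real^'n) set"
 assumes ep: "ep > 0" and R: "R > 0" and Om[measurable]: "Om : bor" and sg: "pm sg"
  and fE: "fin (Om Int hs sg k)" and de: "de >= 0"
  and d: "!!h. norm h < d ==> (NN x. ennreal <|ind (Om Int hs sg k) (x + h) - ind (Om Int hs sg k) x|>) <= ennreal de"
  and small: "5 * ep < d"
 shows "(LBINT x:hs sg k. <|trial Om k sg ep R x - ind Om x|>)
   <= de + (LBINT x:Om Int hs sg k. 1 - cutoff R x)" (is ?L1)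
  and "perimeter Om (hs sg k) < \<infinity> ==> EX Du. C1 (trial Om k sg ep R) Du &
   (LBINT x:hs sg k. norm (Du x)) <= enn2real (perimeter Om (hs sg k)) + 4 / R * (vol (Om Int hs sg k) + de)" (is "_ ==> ?G3")
proof -
 let ?H = "hs sg k" and ?E = "Om Int hs sg k" and ?b = "bump ep :: real^'n => real"
 define a where "a = (4 * ep * sg) *R (axis k 1 :: real^'n)"
 have sg2: "sg * sg = 1" using sg by (rule sign_square)
 define V where "V x = conv (ind ?E) ?b (x + a)" for x
 obtain DV where DV: "C1 (conv (ind ?E) ?b) DV" using moll_C2[OF ep, of ?E] by auto
 obtain DU where DU: "C1 (conv (ind Om) ?b) DU" using moll_C2[OF ep Om] by auto
 obtain Dc where Dc: "C1 (cutoff R :: real^'n => real) Dc" "!!x. norm (Dc x) <= 4 / R" using cutoff_C1[OF R] by blast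
 have cc: "cont (cutoff R :: real^'n => real)" and cDc: "cont Dc"
  using C1_cont[OF Dc(1)] C1_cont_grad[OF Dc(1)] by auto
 have cV: "cont V" unfolding V_def
  by (intro continuous_on_compose2[OF C1_cont[OF DV]] continuous_intros) auto
 have [measurable]: "V : bm" "(cutoff R :: real^'n => real) : bm"
  using cV cc borel_csupp by auto
 have UV: "conv (ind Om) ?b (x + a) = V x" if "x : ?H" for x
  unfolding V_def
  by (intro conv_bump_cong[OF ep] AE_I2) (use near_shift(1)[OF sg, of x ep k] that in \<open>auto simp: a_def hs_def\<close>)
 have nn: "(NN x. ennreal <|V x - ind ?E x|>) <= ennreal de"
  unfolding V_def by (rule moll_L1[OF _ ep d]) (use small ep sg in \<open>auto simp: a_def abs_mult\<close>)
 have iV: "lint (%x. <|V x - ind ?E x|>)"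
  using nn by (intro integrableI_bounded) (auto simp: order_le_less_trans)
 have VL: "(LBINT x. <|V x - ind ?E x|>) <= de"
  using nn nn_integral_eq_integral[OF iV] de by simp
 have iE: "lint (ind ?E :: _ => real)" using fE by (subst integrable_indicator_iff) auto
 have iEc: "lint (%x. ind ?E x * (1 - cutoff R x))"
  by (rule Bochner_Integration.integrable_bound[OF iE])
   (auto intro!: AE_I2 simp: indicator_def abs_le_iff cutoff_bounds add_increasing)
 show ?L1
 proof -
  have "(LBINT x:?H. <|trial Om k sg ep R x - ind Om x|>)
    <= (LBINT x. <|V x - ind ?E x|> + ind ?E x * (1 - cutoff R x))"
   unfolding sli_def
  proof (rule integral_mono_AE')
   show "lint (%x. <|V x - ind ?E x|> + ind ?E x * (1 - cutoff R x))" using iV iEc by simp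
   show "AEL x. ind ?H x *R <|trial Om k sg ep R x - ind Om x|>
     <= <|V x - ind ?E x|> + ind ?E x * (1 - cutoff R x)" (is "AE x in _. ?G1 x")
   proof (intro AE_I2)
    fix x
    show "?G1 x"
    proof (cases "x : ?H")
     case True
     have "trial Om k sg ep R x = cutoff R x * V x" using UV[OF True] by (simp add: trial_def a_def)
     hence "trial Om k sg ep R x - ind Om x = cutoff R x * (V x - ind ?E x) - ind ?E x * (1 - cutoff R x)"
      using True by (simp add: indicator_def algebra_simps)
     moreover have "<|cutoff R x * (V x - ind ?E x)|> <= <|V x - ind ?E x|>"
      using cutoff_bounds[of R x] by (simp add: abs_mult mult_left_le_one_le)
     moreover have "0 <= ind ?E x * (1 - cutoff R x)" using cutoff_bounds[of R x] by simp
     ultimately show ?thesis using True by simp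
    next
     case False
     thus ?thesis using cutoff_bounds[of R x] by simp
    qed
   qed
   show "AEL x. 0 <= <|V x - ind ?E x|> + ind ?E x * (1 - cutoff R x)"
    using cutoff_bounds[of R] by (intro AE_I2 add_nonneg_nonneg mult_nonneg_nonneg) auto
  qed
  also have "... = (LBINT x. <|V x - ind ?E x|>) + (LBINT x. ind ?E x * (1 - cutoff R x))"
   using iV iEc by simp
  finally show ?thesis using VL by (simp add: sli_def)
 qed
 assume P: "perimeter Om (hs sg k) < \<infinity>"
 define Du where "Du x = cutoff R x *R DU (x + a) + conv (ind Om) ?b (x + a) *R Dc x" for x
 have Du: "C1 (trial Om k sg ep R) Du"
  using C1_mult[OF Dc(1) C1_translate[OF DU, of a]] by (simp add: Du_def[abs_def] trial_def[abs_def] a_def)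
 \<comment> \<open>The ramp rises from 0 at height \<open>2 * ep\<close> to 1 at height
   \<open>3 * ep\<close>, while the shifted half-space begins at height \<open>4 * ep\<close>; there
   \<open>zt\<close> equals the shifted cutoff.\<close>
 define zt where "zt x = cutoff R (x - a) * ramp ((1/ep) * (x <.> (sg *R axis k 1)) + (- 2))" for x :: "real^'n"
 have ztr: "(1/ep) * (x <.> (sg *R axis k 1)) + (- 2) = (sg * x $ k - 2 * ep) / ep" for x :: "real^'n"
  using ep by (simp add: inner_axis field_simps)
 have ztC: "is_C1 zt"
  using is_C1_translate[OF is_C1I[OF Dc(1)], of "- a"]
  unfolding zt_def by (intro is_C1_intros is_C1_ramp) simp
 have zts: "csupp zt" unfolding zt_def using csupp_translate[OF csupp_cutoff[OF R], of "- a"] by (intro csupp_mult) simp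
 have zt01: "0 <= zt x" "zt x <= 1" for x
  unfolding zt_def using cutoff_bounds[of R "x - a"] ramp_values(3,4) by (auto intro!: mult_le_one)
 have ztz: "2 * ep <= sg * x $ k" if "zt x ~= 0" for x
 proof (rule ccontr)
  assume "~ 2 * ep <= sg * x $ k"
  hence "(sg * x $ k - 2 * ep) / ep <= 0" using ep by (simp add: divide_le_0_iff)
  thus False using that ramp_values(1) unfolding zt_def ztr by simp
 qed
 have Pz: "(LBINT x. zt x * norm (DU x)) <= enn2real (perimeter Om ?H)"
  by (rule moll_perimeter[OF ep Om sg ztC zts zt01 ztz DU P])
 have cDU: "cont DU" by (rule C1_cont_grad[OF DU])
 obtain Dzt where Dzt: "C1 zt Dzt" using ztC by (auto simp: is_C1_def)
 have izt: "lint (%x. zt x * norm (DU x))"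
  by (intro lint_csupp csupp_mult zts continuous_intros C1_cont[OF Dzt] cDU)
 define f where "f x = ind ?H x * (cutoff R x * norm (DU (x + a)))" for x
 have if_: "lint f"
  unfolding f_def
  by (intro integrable_indicator_times lint_csupp csupp_mult csupp_cutoff R continuous_intros cc continuous_on_compose2[OF cDU]) auto
 have [measurable]: "f : bm" using borel_measurable_integrable[OF if_] by simp
 have "(LBINT x. f x) = (LBINT x. f (x + - a))"
  by (rule integral_translate[symmetric]) measurable
 also have "... <= (LBINT x. zt x * norm (DU x))"
 proof (rule integral_mono_AE'[OF izt])
  show "AEL x. f (x + - a) <= zt x * norm (DU x)"
  proof (intro AE_I2)
   fix x
   have "ind ?H (x - a) * cutoff R (x - a) <= zt x"
   proof (cases "x - a : ?H")
    case True
    hence "0 < sg * x $ k - 4 * ep * (sg * sg)" by (simp add: hs_def a_def algebra_simps)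
    hence "1 <= (sg * x $ k - 2 * ep) / ep" unfolding sg2 using ep by (simp add: le_divide_eq)
    thus ?thesis using ramp_values(2) True unfolding zt_def ztr by simp
   qed (simp add: zt01)
   hence "ind ?H (x - a) * cutoff R (x - a) * norm (DU x) <= zt x * norm (DU x)" by (rule mult_right_mono) simp
   thus "f (x + - a) <= zt x * norm (DU x)" by (simp add: f_def mult.assoc)
  qed
 qed (use zt01 in auto)
 finally have fP: "(LBINT x. f x) <= enn2real (perimeter Om ?H)" using Pz by simp
 have "(LBINT x:?H. norm (Du x)) <= (LBINT x. f x + 4 / R * (<|V x - ind ?E x|> + ind ?E x))"
  unfolding sli_def
 proof (rule integral_mono_AE')
  show "lint (%x. f x + 4 / R * (<|V x - ind ?E x|> + ind ?E x))" using if_ iV iE by simp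
  have f0: "0 <= f x" for x unfolding f_def using cutoff_bounds[of R x] by simp
  show "AEL x. 0 <= f x + 4 / R * (<|V x - ind ?E x|> + ind ?E x)"
   using f0 R by (intro AE_I2 add_nonneg_nonneg mult_nonneg_nonneg) auto
  show "AEL x. ind ?H x *R norm (Du x) <= f x + 4 / R * (<|V x - ind ?E x|> + ind ?E x)" (is "AE x in _. ?G2 x")
  proof (intro AE_I2)
   fix x
   show "?G2 x"
   proof (cases "x : ?H")
    case True
    have V0: "0 <= V x" unfolding V_def by (rule moll_bounds[OF ep]) auto
    have "norm (Du x) <= cutoff R x * norm (DU (x + a)) + V x * norm (Dc x)"
     using norm_triangle_ineq[of "cutoff R x *R DU (x + a)" "V x *R Dc x"] cutoff_bounds[of R x] V0
     by (simp add: Du_def UV[OF True])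
    also have "V x * norm (Dc x) <= V x * (4 / R)" using V0 by (intro mult_left_mono Dc(2))
    also have "V x * (4 / R) <= (<|V x - ind ?E x|> + ind ?E x) * (4 / R)"
     using R by (intro mult_right_mono) auto
    finally show ?thesis using True by (simp add: f_def mult.commute)
   next
    case False
    thus ?thesis using R by (simp add: f_def)
   qed
  qed
 qed
 also have "... = (LBINT x. f x) + 4 / R * ((LBINT x. <|V x - ind ?E x|>) + vol ?E)"
  using if_ iV iE by simp
 also have "... <= enn2real (perimeter Om ?H) + 4 / R * (vol ?E + de)"
 proof (rule add_mono[OF fP mult_left_mono])
  show "(LBINT x. <|V x - ind ?E x|>) + vol ?E <= vol ?E + de" using VL by simp
 qed (use R in simp)
 finally show ?G3
  using Du by blast
qed

section \<open>Boundary points and the jump between the two traces\<close>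

abbreviation "null_or_full Om x r \<equiv> (AEL y. y : ball x r --> y : Om) | (AEL y. y : ball x r --> y ~: Om)"

lemma not_bdryE:
 fixes Om :: "(real^'n) set"
 assumes Om[measurable]: "Om : bor" and x: "x ~: bdry Om"
 obtains r where "r > 0" "null_or_full Om x r"
proof -
 obtain r where r: "r > 0" and "emeasure lebesgue (Om Int ball x r) = 0 | ~ emeasure lebesgue (Om Int ball x r) < emeasure lebesgue (ball x r)"
  using x unfolding bdry_def by (auto simp: zero_less_iff_neq_zero)
 then consider "em (Om Int ball x r) = 0" | "em (ball x r) <= em (Om Int ball x r)"
  by (auto simp: not_less)
 hence "null_or_full Om x r"
 proof cases
  case 1
  hence "AEL y. y ~: Om Int ball x r" by (intro AE_not_in) (auto simp: null_sets_def)
  hence "AEL y. y : ball x r --> y ~: Om" by eventually_elim auto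
  thus ?thesis ..
 next
  case 2
  have fin: "fin (ball x r)" by (rule emeasure_bounded_finite) simp
  have "em (ball x r - Om Int ball x r) = em (ball x r) - em (Om Int ball x r)"
   using finite_sub[OF fin, of "Om Int ball x r"] by (intro emeasure_Diff) auto
  also have "... = 0" using 2 fin by (simp add: diff_eq_0_iff_ennreal)
  finally have "AEL y. y ~: ball x r - Om Int ball x r" by (intro AE_not_in) (auto simp: null_sets_def)
  hence "AEL y. y : ball x r --> y : Om" by eventually_elim auto
  thus ?thesis ..
 qed
 thus ?thesis using that r by blast
qed

lemma not_bdryI:
 fixes Om :: "(real^'n) set"
 assumes Om[measurable]: "Om : bor" and r: "r > 0"
  and AE: "null_or_full Om x r"
 shows "x ~: bdry Om"
 using AE
proof
 assume a: "AEL y. y : ball x r --> y : Om"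
 have "em (Om Int ball x r) = em (ball x r)"
  by (rule emeasure_eq_AE) (use a in \<open>auto elim: eventually_mono\<close>)
 thus ?thesis using r unfolding bdry_def by (auto intro!: exI[of _ r])
next
 assume a: "AEL y. y : ball x r --> y ~: Om"
 have "em (Om Int ball x r) = em ({} :: (real^'n) set)"
  by (rule emeasure_eq_AE) (use a in \<open>auto elim: eventually_mono\<close>)
 thus ?thesis using r unfolding bdry_def by (auto intro!: exI[of _ r])
qed

lemma closed_bdry:
 fixes Om :: "(real^'n) set"
 assumes Om: "Om : bor" shows "closed (bdry Om)"
 unfolding closed_def open_contains_ball
proof
 fix x assume "x : - bdry Om"
 then obtain r where r: "r > 0" "null_or_full Om x r"
  using not_bdryE[OF Om] by blast
 have "y ~: bdry Om" if y: "y : ball x (r/2)" for y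
 proof (rule not_bdryI[OF Om, of "r/2"])
  have sub: "z : ball x r" if "z : ball y (r/2)" for z
   using that y dist_triangle[of x z y] by simp
  show "null_or_full Om y (r/2)"
   using r(2)
  proof
   assume "AEL y. y : ball x r --> y : Om"
   hence "AEL z. z : ball y (r/2) --> z : Om" by eventually_elim (use sub in blast)
   thus ?thesis ..
  next
   assume "AEL y. y : ball x r --> y ~: Om"
   hence "AEL z. z : ball y (r/2) --> z ~: Om" by eventually_elim (use sub in blast)
   thus ?thesis ..
  qed
 qed (use r in simp)
 thus "EX e>0. ball x e <= - bdry Om" using r(1) by (intro exI[of _ "r/2"]) auto
qed

text \<open>Near a point off the boundary the set is null or full, so the two one-sided values are
  both 0 or both the cutoff.\<close>

lemma trial_no_jump:
 fixes Om :: "(real^'n) set"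
 assumes Om: "Om : bor" and x: "x $ k = 0" "x ~: bdry Om"
 obtains r where "r > 0" "!!ep R. 0 < ep ==> 5 * ep < r ==> trial Om k (- 1) ep R x = trial Om k 1 ep R x"
proof -
 obtain r where r: "r > 0" "null_or_full Om x r"
  using not_bdryE[OF Om x(2)] by blast
 have "trial Om k (- 1) ep R x = trial Om k 1 ep R x" if ep: "0 < ep" "5 * ep < r" for ep R
  using r(2)
 proof
  assume "AEL y. y : ball x r --> y : Om"
  hence "trial Om k sg ep R x = trial UNIV k sg ep R x" if "pm sg" for sg
   using ep x that Om by (intro trial_cong) (auto elim!: eventually_mono simp: dist_norm)
  thus ?thesis by (simp add: trial_UNIV[OF ep(1)])
 next
  assume "AEL y. y : ball x r --> y ~: Om"
  hence "trial Om k sg ep R x = trial {} k sg ep R x" if "pm sg" for sg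
   using ep x that Om by (intro trial_cong) (auto elim!: eventually_mono simp: dist_norm)
  thus ?thesis by (simp add: trial_empty)
 qed
 thus ?thesis using that r(1) by blast
qed

lemma continuous_trial:
 assumes "ep > 0" "R > 0" "Om : bor" shows "cont (trial Om k sg ep R)"
proof -
 obtain DU where DU: "C1 (conv (ind Om) (bump ep) :: real^'a => real) DU" using moll_C2[OF assms(1,3)] by auto
 obtain Dc where Dc: "C1 (cutoff R :: real^'a => real) Dc" using cutoff_C1[OF assms(2)] by blast
 show ?thesis unfolding trial_def
  by (intro continuous_on_mult C1_cont[OF Dc] continuous_on_compose2[OF C1_cont[OF DU]] continuous_intros) auto
qed

lemma emeasure_slab_ball: "em (cyl k (ball 0 R)) < \<infinity>"
proof -
 have "cyl k (ball 0 R) <= ball 0 (R + 1)"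
 proof
  fix x assume x: "x : cyl k (ball 0 R)"
  have "norm x <= norm (proj k x) + norm ((x $ k) *R axis k 1 :: real^'a)"
   using norm_triangle_ineq[of "proj k x" "(x $ k) *R axis k 1"] by (simp add: proj_def)
  thus "x : ball 0 (R + 1)" using x by (simp add: slab_def)
 qed
 hence "em (cyl k (ball 0 R)) <= em (ball (0::real^'a) (R + 1))" by (intro emeasure_mono) auto
 also have "... < \<infinity>" by (rule emeasure_bounded_finite) simp
 finally show ?thesis .
qed

text \<open>The jump is at most 1 and tends to 0 at every interface point off the boundary; by
  dominated convergence only the boundary part of the interface contributes in the limit.\<close>

lemma trial_jump_bound:
 fixes Om :: "(real^'n) set"
 assumes Om: "Om : bor" and R: "R > 0" and de: "de > 0"
 obtains N where "!!n. N <= n ==> ennreal <|LBINT x:slab k. trial Om k (- 1) (inv_Suc n) R (proj k x) - trial Om k 1 (inv_Suc n) R (proj k x)|>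
  <= area k (bdry Om Int interface k) + ennreal de"
proof -
 define d where "d n x = trial Om k (- 1) (inv_Suc n) R (proj k x) - trial Om k 1 (inv_Suc n) R (proj k x)" for n x
 define S where "S = cyl k (bdry Om Int interface k)"
 have [measurable]: "bdry Om Int interface k : bor"
 proof -
  have "closed (interface k)" unfolding interface_def by (intro closed_Collect_eq continuous_intros)
  thus ?thesis using closed_bdry[OF Om] by auto
 qed
 have [measurable]: "S : bor" unfolding S_def by measurable
 have [measurable]: "d n : bm" for n
  unfolding d_def by (intro borel_csupp continuous_intros continuous_on_compose2[OF continuous_trial[OF _ R Om]] continuous_proj) auto
 let ?B = "cyl k (ball 0 R)"
 have db: "<|d n x|> <= ind (ball 0 R) (proj k x)" for n x
  using trial_bounds[of "inv_Suc n" Om k "- 1" R "proj k x"] trial_bounds[of "inv_Suc n" Om k 1 R "proj k x"]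
   cutoff_bounds[of R "proj k x"] cutoff_outside[OF R, of "proj k x"] Om
  by (cases "norm (proj k x) < R") (auto simp: d_def)
 have "(%n. (NN x. ind (slab k - S) x * ennreal <|d n x|>)) ----> (\<integral>\<^sup>+x. 0 \<partial>(lborel :: (real^'n) measure))"
 proof (rule nn_integral_dominated_convergence[where w = "ind ?B"])
  show "(NN x. ind ?B x) < \<infinity>" using emeasure_slab_ball[of k R] by simp
  show "AEL x. ind (slab k - S) x * ennreal <|d n x|> <= ind ?B x" (is "AE x in _. ?G1 x") for n
  proof (intro AE_I2)
   fix x show "?G1 x"
    using db[of n x] by (cases "x : ?B") (auto simp: indicator_def ennreal_le_1 split: if_splits)
  qed
  show "AEL x. (%n. ind (slab k - S) x * ennreal <|d n x|>) ----> 0" (is "AE x in _. ?G2 x")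
  proof (intro AE_I2)
   fix x
   show "?G2 x"
   proof (cases "x : slab k - S")
    case True
    hence "proj k x ~: bdry Om" by (auto simp: S_def interface_def)
    then obtain r where r: "r > 0" "!!ep. 0 < ep ==> 5 * ep < r ==> trial Om k (- 1) ep R (proj k x) = trial Om k 1 ep R (proj k x)"
     using trial_no_jump[OF Om, of "proj k x" k] by (metis proj_nth)
    have "EVS n. inv_Suc n < r / 5"
     using r(1) by (intro order_tendstoD[OF LIMSEQ_inverse_real_of_nat]) auto
    hence "EVS n. ind (slab k - S) x * ennreal <|d n x|> = 0"
     by eventually_elim (use r(2) in \<open>simp add: d_def\<close>)
    thus ?thesis by (rule tendsto_eventually)
   qed simp
  qed
 qed measurable
 hence "(%n. (NN x. ind (slab k - S) x * ennreal <|d n x|>)) ----> 0" by simp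
 hence "EVS n. (NN x. ind (slab k - S) x * ennreal <|d n x|>) < ennreal de"
  by (rule order_tendstoD) (use de in simp)
 then obtain N where N: "!!n. N <= n ==> (NN x. ind (slab k - S) x * ennreal <|d n x|>) < ennreal de"
  by (auto simp: eventually_sequentially)
 have "ennreal <|LBINT x:slab k. d n x|> <= area k (bdry Om Int interface k) + ennreal de" if n: "N <= n" for n
 proof -
  have i: "lint (%x. ind (slab k) x *R d n x)"
  proof (rule Bochner_Integration.integrable_bound[of _ "ind ?B :: _ => real"])
   show "lint (ind ?B :: _ => real)" using emeasure_slab_ball[of k R] by (subst integrable_indicator_iff) auto
   show "AEL x. norm (ind (slab k) x *R d n x) <= norm (ind ?B x :: real)" (is "AE x in _. ?G3 x")
   proof (intro AE_I2)
    fix x show "?G3 x"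
     using db[of n x] by (cases "norm (proj k x) < R") (auto simp: indicator_def)
   qed
  qed measurable
  have "ennreal <|LBINT x:slab k. d n x|> <= (NN x. ennreal (norm (ind (slab k) x *R d n x)))"
   unfolding sli_def real_norm_def[symmetric] by (rule integral_norm_bound_ennreal[OF i])
  also have "... <= (NN x. ind S x + ind (slab k - S) x * ennreal <|d n x|>)"
  proof (rule nn_integral_mono)
   fix x
   have "<|d n x|> <= 1" using db[of n x] by (cases "norm (proj k x) < R") (auto simp: indicator_def)
   thus "ennreal (norm (ind (slab k) x *R d n x)) <= ind S x + ind (slab k - S) x * ennreal <|d n x|>"
    by (auto simp: indicator_def ennreal_le_1)
  qed
  also have "... = em S + (NN x. ind (slab k - S) x * ennreal <|d n x|>)"
   by (subst nn_integral_add) auto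
  also have "... <= area k (bdry Om Int interface k) + ennreal de"
   using N[OF n] unfolding area_def S_def[symmetric] by (intro add_left_mono) simp
  finally show ?thesis .
 qed
 thus ?thesis using that unfolding d_def by blast
qed

text \<open>One radius \<open>ep i\<close> must serve both sides, because the jump compares two
  traces at the same scale. It is chosen after the cutoff radius \<open>Suc i\<close>.\<close>

theorem trial_sequence:
 fixes Om :: "(real^'n) set"
 assumes Om: "Om : bor"
  and fE: "!!sg. pm sg ==> fin (Om Int hs sg k)"
  and P: "!!sg. pm sg ==> perimeter Om (hs sg k) < \<infinity>"
 obtains ep where "!!i. 0 < ep i" "ep ----> 0"
  "!!i. ennreal <|LBINT x:slab k. trial Om k (- 1) (ep i) (Suc i) (proj k x) - trial Om k 1 (ep i) (Suc i) (proj k x)|>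
   <= area k (bdry Om Int interface k) + ennreal (inv_Suc i)"
  "!!sg i. pm sg ==> EX Du. C1 (trial Om k sg (ep i) (Suc i)) Du & (LBINT x:hs sg k. norm (Du x))
   <= enn2real (perimeter Om (hs sg k)) + 4 * inv_Suc i * (vol (Om Int hs sg k) + inv_Suc i)"
  "!!sg. pm sg ==> (%i. LBINT x:hs sg k. <|trial Om k sg (ep i) (Suc i) x - ind (Om Int hs sg k) x|>) ----> 0"
proof -
 define T where "T d i sg <-> (ALL h. norm h < d --> (NN x. ennreal <|ind (Om Int hs sg k) (x + h) - ind (Om Int hs sg k) x|>) <= ennreal (inv_Suc i))"
  for d and i :: nat and sg
 \<comment> \<open>The condition \<open>real i <= real n\<close> forces the chosen radii
   \<open>ep i\<close> to tend to 0.\<close>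
 define Q where "Q i n <-> real i <= real n & ennreal <|LBINT x:slab k. trial Om k (- 1) (inv_Suc n) (Suc i) (proj k x) - trial Om k 1 (inv_Suc n) (Suc i) (proj k x)|>
  <= area k (bdry Om Int interface k) + ennreal (inv_Suc i) & (ALL sg. pm sg --> (EX d. T d i sg & 5 * inv_Suc n < d))" for i n :: nat
 have ex: "EX n. Q i n" for i
 proof -
  have exd: "EX d>0. T d i sg" if "pm sg" for sg
  proof -
   have "Om Int hs sg k : bor" using Om by auto
   from L1_translation[OF this fE[OF that], of "inv_Suc i"] show ?thesis unfolding T_def by auto
  qed
  obtain d1 where d1: "d1 > 0" "T d1 i 1" using exd[of 1] by auto
  obtain d2 where d2: "d2 > 0" "T d2 i (- 1)" using exd[of "- 1"] by auto
  obtain N where N: "!!n. N <= n ==> ennreal <|LBINT x:slab k. trial Om k (- 1) (inv_Suc n) (Suc i) (proj k x) - trial Om k 1 (inv_Suc n) (Suc i) (proj k x)|>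
  <= area k (bdry Om Int interface k) + ennreal (inv_Suc i)"
   using trial_jump_bound[OF Om, of "real (Suc i)" "inv_Suc i" k] by auto
  have "EVS n. inv_Suc n < min d1 d2 / 5"
   using d1 d2 by (intro order_tendstoD[OF LIMSEQ_inverse_real_of_nat]) auto
  then obtain M where M: "!!n. M <= n ==> inv_Suc n < min d1 d2 / 5" by (auto simp: eventually_sequentially)
  define n where "n = max i (max N M)"
  have "EX d. T d i sg & 5 * inv_Suc n < d" if "pm sg" for sg
  proof -
   have "sg = 1 | sg = - 1" using that by linarith
   moreover have "5 * inv_Suc n < min d1 d2" using M[of n] unfolding n_def by linarith
   ultimately show ?thesis using d1 d2 by (metis min_less_iff_conj)
  qed
  hence "Q i n" unfolding Q_def using N[of n] by (simp add: n_def)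
  thus ?thesis by blast
 qed
 define nu where "nu i = (SOME n. Q i n)" for i
 have nu: "Q i (nu i)" for i unfolding nu_def using ex by (rule someI_ex)
 define ep where "ep i = inverse (real (Suc (nu i)))" for i
 have pos: "0 < ep i" for i by (simp add: ep_def)
 have lim: "ep ----> 0"
 proof (rule tendsto_sandwich[OF _ _ tendsto_const LIMSEQ_inverse_real_of_nat])
  show "EVS i. 0 <= ep i" using pos by (simp add: less_imp_le)
  show "EVS i. ep i <= inv_Suc i"
   using nu unfolding ep_def Q_def by (intro always_eventually allI le_imp_inverse_le) auto
 qed
 have jump: "ennreal <|LBINT x:slab k. trial Om k (- 1) (ep i) (Suc i) (proj k x) - trial Om k 1 (ep i) (Suc i) (proj k x)|>
   <= area k (bdry Om Int interface k) + ennreal (inv_Suc i)" for i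
  using nu[of i] unfolding Q_def ep_def by blast
 have d: "EX d. T d i sg & 5 * ep i < d" if "pm sg" for i sg
  using nu[of i] that unfolding Q_def ep_def by blast
 have grad: "EX Du. C1 (trial Om k sg (ep i) (Suc i)) Du & (LBINT x:hs sg k. norm (Du x))
   <= enn2real (perimeter Om (hs sg k)) + 4 * inv_Suc i * (vol (Om Int hs sg k) + inv_Suc i)" if sg: "pm sg" for i sg
 proof -
  obtain d where d: "T d i sg" "5 * ep i < d" using d[OF sg] by blast
  have "EX Du. C1 (trial Om k sg (ep i) (Suc i)) Du & (LBINT x:hs sg k. norm (Du x))
   <= enn2real (perimeter Om (hs sg k)) + 4 / real (Suc i) * (vol (Om Int hs sg k) + inv_Suc i)"
   using d unfolding T_def by (intro trial_L1(2)[OF pos _ Om sg fE[OF sg] _ _ d(2) P[OF sg]]) auto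
  thus ?thesis by (simp only: divide_inverse)
 qed
 have L1: "(%i. LBINT x:hs sg k. <|trial Om k sg (ep i) (Suc i) x - ind (Om Int hs sg k) x|>) ----> 0" if sg: "pm sg" for sg
 proof -
  have E: "Om Int hs sg k : bor" using Om by auto
  have eq: "(LBINT x:hs sg k. <|trial Om k sg (ep i) (Suc i) x - ind (Om Int hs sg k) x|>)
   = (LBINT x:hs sg k. <|trial Om k sg (ep i) (Suc i) x - ind Om x|>)" for i
   by (intro set_lebesgue_integral_cong) (auto simp: indicator_def)
  have "(%i. LBINT x:Om Int hs sg k. 1 - cutoff (Suc i) x) ----> (LBINT x:Om Int hs sg k. 0)"
   unfolding sli_def
  proof (rule integral_dominated_convergence[where w = "ind (Om Int hs sg k)"])
   show "lint (ind (Om Int hs sg k) :: _ => real)" using fE[OF sg] E by (subst integrable_indicator_iff) auto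
   show "AEL x. (%i. indicat_real (Om Int hs sg k) x *R (1 - cutoff (Suc i) x)) ----> indicat_real (Om Int hs sg k) x *R 0"
    using tendsto_diff[OF tendsto_const[of 1] cutoff_tendsto] by (intro AE_I2 tendsto_scaleR tendsto_const) simp
   show "AEL x. norm (indicat_real (Om Int hs sg k) x *R (1 - cutoff (Suc i) x)) <= ind (Om Int hs sg k) x" for i
    by (auto intro!: AE_I2 simp: indicator_def abs_le_iff cutoff_bounds add_increasing)
   show "(%x. indicat_real (Om Int hs sg k) x *R (1 - cutoff (Suc i) x)) : borel_measurable lborel" for i
   proof -
    obtain Dc where Dc: "C1 (cutoff (Suc i) :: real^'n => real) Dc" using cutoff_C1[of "real (Suc i)"] by auto
    have [measurable]: "(cutoff (Suc i) :: real^'n => real) : bm" by (rule borel_csupp[OF C1_cont[OF Dc]])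
    show ?thesis using E by measurable
   qed
  qed auto
  hence "(%i. inv_Suc i + (LBINT x:Om Int hs sg k. 1 - cutoff (Suc i) x)) ----> 0 + 0"
   by (intro tendsto_add LIMSEQ_inverse_real_of_nat) (simp add: sli_def)
  hence l: "(%i. inv_Suc i + (LBINT x:Om Int hs sg k. 1 - cutoff (Suc i) x)) ----> 0" by simp
  show ?thesis
   unfolding eq
  proof (rule tendsto_sandwich[OF _ _ tendsto_const l])
   show "EVS i. 0 <= (LBINT x:hs sg k. <|trial Om k sg (ep i) (Suc i) x - ind Om x|>)"
    unfolding sli_def by (intro always_eventually allI integral_nonneg_AE AE_I2) simp
   show "EVS i. (LBINT x:hs sg k. <|trial Om k sg (ep i) (Suc i) x - ind Om x|>)
    <= inv_Suc i + (LBINT x:Om Int hs sg k. 1 - cutoff (Suc i) x)" (is "\<forall>\<^sub>F i in _. ?G1 i")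
   proof (intro always_eventually allI)
    fix i
    obtain d where d: "T d i sg" "5 * ep i < d" using d[OF sg] by blast
    thus "?G1 i"
     unfolding T_def by (intro trial_L1(1)[OF pos _ Om sg fE[OF sg] _ _ d(2)]) auto
   qed
  qed
 qed
 show ?thesis by (rule that[OF pos lim jump grad L1])
qed

section \<open>Caps\<close>

text \<open>\<open>c\<close> is the height of the centre over the interface in units of the radius,
  counted positive into the side \<open>sg\<close>: 0 gives a half-ball and 1 a whole ball touching
  the interface.\<close>

definition cap :: "real => 'n => real => real => (real^'n) set" where
 "cap sg k c r = ball ((c * r * sg) *R axis k 1) r Int hs sg k"

definition disc_area :: "'n::finite => real^'n => real => real" where
 "disc_area k p r = vol (cyl k (ball p r))"

text \<open>Only the normal derivative contributes, since the half-space is invariant under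
  tangential translations.\<close>

lemma halfspace_divergence:
 fixes T :: "real^'n => real^'n"
 assumes T: "!!i. C1 (%x. T x $ i) (D i)" "csupp T" and sg: "pm sg"
 shows "(LBINT x:hs sg k. SUM i:UNIV. D i x $ i) = - sg * (LBINT x:slab k. T (proj k x) $ k)"
proof -
 have sT: "csupp (%x. T x $ i)" for i
  using csupp_inner[OF T(2), of "axis i 1"] by (simp add: inner_axis)
 have sD: "csupp (%x. D i x $ j)" for i j
  using csupp_inner[OF csupp_grad[OF T(1) sT], of i "axis j 1"] by (simp add: inner_axis)
 have cD: "cont (%x. D i x $ j)" for i j by (intro continuous_intros C1_cont_grad[OF T(1)])
 have z: "(LBINT x:hs sg k. D i x $ i) = 0" if i: "i ~= k" for i
 proof -
  have "(%t. LBINT x:hs sg k. T (x + t *R axis i 1) $ i) = (%t. LBINT x:hs sg k. T x $ i)"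
  proof
   fix t
   have "(LBINT x:hs sg k. T (x + t *R axis i 1) $ i) = (LBINT x:{x. x - t *R axis i 1 : hs sg k}. T x $ i)"
    by (rule set_integral_translate) (auto intro!: borel_csupp C1_cont[OF T(1)])
   also have "{x. x - t *R axis i 1 : hs sg k} = hs sg k" using i by (auto simp: hs_def axis_def)
   finally show "(LBINT x:hs sg k. T (x + t *R axis i 1) $ i) = (LBINT x:hs sg k. T x $ i)" .
  qed
  moreover have "((%t. LBINT x:hs sg k. T (x + t *R axis i 1) $ i) hrd (LBINT x:hs sg k. D i x <.> axis i 1)) (at 0)"
   by (rule translated_integral_deriv[OF T(1) sT hs_borel])
  ultimately have "((%t. LBINT x:hs sg k. T x $ i) hrd (LBINT x:hs sg k. D i x $ i)) (at 0)"
   by (simp add: inner_axis)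
  moreover have "((%t. LBINT x:hs sg k. T x $ i) hrd 0) (at 0)" by simp
  ultimately show ?thesis using DERIV_unique by blast
 qed
 have "(LBINT x:hs sg k. SUM i:UNIV. D i x $ i) = (SUM i:UNIV. LBINT x:hs sg k. D i x $ i)"
  using sint_csupp[OF cD sD hs_borel]
  unfolding sli_def set_integrable_def scaleR_sum_right by (rule Bochner_Integration.integral_sum)
 also have "... = (SUM i:UNIV. if i = k then (LBINT x:hs sg k. D k x $ k) else 0)"
  using z by (intro sum.cong) auto
 also have "... = - sg * (LBINT x:slab k. T (proj k x) $ k)"
  using halfspace_trace[OF T(1) sT sg, of k k] by simp
 finally show ?thesis .
qed

definition ramp' :: "real => real" where
 "ramp' t = 4 * max 0 (1 - max 0 t ^ 2) * max 0 t"

lemma ramp_derivative: "(ramp hrd ramp' t) (at t)"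
proof -
 have F: "((%t. max 0 t ^ 2) hrd 2 * max 0 t) (at t)" for t :: real
  using DERIV_max_power[of 0 t] by (simp add: numeral_2_eq_2)
 have "((%t. 1 - max 0 t ^ 2) hrd - (2 * max 0 t)) (at t)"
  using DERIV_diff[OF DERIV_const F, of 1 t] by simp
 from DERIV_chain2[OF F this]
 have "((%t. max 0 (1 - max 0 t ^ 2) ^ 2) hrd 2 * max 0 (1 - max 0 t ^ 2) * - (2 * max 0 t)) (at t)" .
 from DERIV_diff[OF DERIV_const this, of 1]
 have "((%t. 1 - max 0 (1 - max 0 t ^ 2) ^ 2) hrd 4 * max 0 (1 - max 0 t ^ 2) * max 0 t) (at t)" by (simp add: mult.assoc)
 thus ?thesis by (simp add: ramp_def[abs_def] ramp'_def mult.assoc)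
qed

lemma ramp'_values: "0 <= ramp' t" "t <= 0 ==> ramp' t = 0" "1 <= t ==> ramp' t = 0"
proof -
 show "1 <= t ==> ramp' t = 0" using one_le_power[of t 2] by (simp add: ramp'_def)
qed (auto simp: ramp'_def)

lemma continuous_ramp': "cont ramp'"
 unfolding ramp'_def by (intro continuous_intros)

text \<open>A C1 approximation from below of the indicator of the ball, equal to 1 where
  \<open>r^2 - (norm (x - p))^2\<close> is at least \<open>inv_Suc n\<close>.\<close>

definition ball_ramp :: "'a::euclidean_space => real => nat => 'a => real" where
 "ball_ramp p r n x = ramp (real (Suc n) * (r^2 + - ((norm (x - p))^2)))"

lemma ball_ramp_bounds:
 assumes "r > 0" shows "0 <= ball_ramp p r n x" "ball_ramp p r n x <= ind (ball p r) x" (is ?G1)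
proof -
 show "0 <= ball_ramp p r n x" unfolding ball_ramp_def by (rule ramp_values)
 show ?G1
 proof (cases "x : ball p r")
  case False
  hence "r^2 <= (norm (x - p))^2" using assms by (intro power_mono) (auto simp: dist_norm norm_minus_commute)
  hence "real (Suc n) * (r^2 + - ((norm (x - p))^2)) <= 0" by (intro mult_nonneg_nonpos) auto
  thus ?thesis using ramp_values(1) False by (simp add: ball_ramp_def)
 qed (simp add: ball_ramp_def ramp_values)
qed

lemma ball_ramp_tendsto:
 assumes r: "r > 0" shows "(%n. ball_ramp p r n x) ----> ind (ball p r) x"
proof (cases "x : ball p r")
 case True
 hence "(norm (x - p))^2 < r^2" by (intro power_strict_mono) (auto simp: dist_norm norm_minus_commute)
 hence d: "0 < r^2 - (norm (x - p))^2" by simp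
 obtain N where N: "inverse (r^2 - (norm (x - p))^2) < real N" using reals_Archimedean2 by blast
 have "ball_ramp p r n x = 1" if "N <= n" for n
 proof -
  have "inverse (r^2 - (norm (x - p))^2) <= real (Suc n)" using N that by simp
  from mult_right_mono[OF this, of "r^2 - (norm (x - p))^2"] d
  have "1 <= real (Suc n) * (r^2 + - ((norm (x - p))^2))" by simp
  thus ?thesis unfolding ball_ramp_def by (rule ramp_values)
 qed
 hence "EVS n. ball_ramp p r n x = ind (ball p r) x"
  using True by (auto simp: eventually_sequentially)
 thus ?thesis by (rule tendsto_eventually)
next
 case False
 hence "ball_ramp p r n x = 0" for n using ball_ramp_bounds[OF r, of p n x] by simp
 thus ?thesis using False by simp
qed

lemma ball_ramp_C1:
 fixes p :: "'a::euclidean_space"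
 shows "C1 (ball_ramp p r n) (%x. (- 2 * real (Suc n) * ramp' (real (Suc n) * (r^2 + - ((norm (x - p))^2)))) *R (x - p))"
proof -
 have "C1 (%x. real (Suc n) * (r^2 + (- 1) * (norm (x - p))^2))
   (%x. real (Suc n) *R (0 + ((- 1) *R (2 *R (x - p)) + ((norm (x - p))^2) *R 0)) + (r^2 + (- 1) * (norm (x - p))^2) *R 0)"
  by (intro C1_add C1_mult C1_const C1_norm_sq)
 from C1_compose[OF this ramp_derivative continuous_ramp']
 have "C1 (ball_ramp p r n) (%x. ramp' (real (Suc n) * (r^2 + - ((norm (x - p))^2))) *R (real (Suc n) *R ((- 2) *R (x - p))))"
  by (simp add: ball_ramp_def[abs_def])
 moreover have "ramp' t *R (real (Suc n) *R ((- 2) *R v)) = (- 2 * real (Suc n) * ramp' t) *R v" for t and v :: 'a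
  by (simp only: scaleR_scaleR mult_ac)
 ultimately show ?thesis by (simp only:)
qed

lemma csupp_ball_ramp:
 fixes p :: "'a::euclidean_space"
 assumes "r > 0" shows "csupp (ball_ramp p r n)"
proof (rule csuppI)
 fix x :: 'a assume x: "norm p + r <= norm x"
 hence "x ~: ball p r" using norm_triangle_ineq2[of x p] by (auto simp: dist_norm norm_minus_commute)
 thus "ball_ramp p r n x = 0" using ball_ramp_bounds[OF assms, of p n x] by simp
qed

lemma ball_ramp_integral_tendsto:
 fixes ph :: "'a::euclidean_space => 'b::euclidean_space"
 assumes r: "r > 0" and [measurable]: "w : bm" "ph : bm"
  and i: "lint (%x. w x * ind (ball p r) (ph x))"
 shows "(%n. LBINT x. w x * ball_ramp p r n (ph x)) ----> (LBINT x. w x * ind (ball p r) (ph x))"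
proof (rule integral_dominated_convergence[where w = "%x. <|w x * ind (ball p r) (ph x)|>"])
 show "(%x. w x * ind (ball p r) (ph x)) : borel_measurable lborel"
  using borel_measurable_integrable[OF i] .
 have [measurable]: "ball_ramp p r n : bm" for n
  by (rule borel_csupp[OF C1_cont[OF ball_ramp_C1]])
 show "(%x. w x * ball_ramp p r n (ph x)) : borel_measurable lborel" for n by measurable
 show "lint (%x. <|w x * ind (ball p r) (ph x)|>)" using i by (rule integrable_abs)
 show "AEL x. (%n. w x * ball_ramp p r n (ph x)) ----> w x * ind (ball p r) (ph x)"
  by (intro AE_I2 tendsto_mult tendsto_const ball_ramp_tendsto r)
 show "AEL x. norm (w x * ball_ramp p r n (ph x)) <= <|w x * ind (ball p r) (ph x)|>" for n
  using ball_ramp_bounds[OF r, of p n] by (intro AE_I2) (auto simp: abs_mult intro!: mult_left_mono)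
qed

lemma slab_disc_finite:
 fixes p :: "real^'n"
 shows "em (cyl k (ball p r)) < \<infinity>"
proof (rule finite_sub[OF emeasure_slab_ball[of k "norm p + r"]])
 have "ball p r <= ball 0 (norm p + r)"
 proof
  fix x assume "x : ball p r"
  thus "x : ball 0 (norm p + r)" using norm_triangle_ineq2[of x p] by (auto simp: dist_norm norm_minus_commute)
 qed
 thus "cyl k (ball p r) <= cyl k (ball 0 (norm p + r))" by auto
qed measurable

lemma cap_borel [measurable]: "cap sg k c r : bor"
 unfolding cap_def by measurable

lemma set_integrable_slab:
 fixes h :: "real^'n => real"
 assumes "cont h" "csupp h"
 shows "sint (slab k) (%x. h (proj k x))"
proof -
 obtain R where R: "R > 0" "!!x. R <= norm x ==> h x = 0" using assms(2) by (rule csuppE) blast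
 obtain M where M: "!!x. <|h x|> <= M"
 proof -
  have "compact (h ` cball 0 R)" by (intro compact_continuous_image continuous_on_subset[OF assms(1)]) auto
  then obtain M where M: "!!y. y : h ` cball 0 R ==> <|y|> <= M" using compact_imp_bounded bounded_real by metis
  have "<|h x|> <= max M 0" for x using M[of "h x"] R(2)[of x] by (cases "norm x <= R") (auto simp: le_max_iff_disj)
  thus ?thesis by (rule that)
 qed
 have [measurable]: "h : bm" by (rule borel_csupp[OF assms(1)])
 have iB: "lint (ind (cyl k (ball 0 R)) :: _ => real)"
  using emeasure_slab_ball[of k R] by (subst integrable_indicator_iff) auto
 show ?thesis unfolding set_integrable_def
 proof (rule Bochner_Integration.integrable_bound[OF integrable_mult_right[OF iB, of M]])
  show "AEL x. norm (ind (slab k) x *R h (proj k x)) <= norm (M * ind (cyl k (ball 0 R)) x)" (is "AE x in _. ?G1 x")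
  proof (intro AE_I2)
   fix x :: "real^'n"
   show "?G1 x"
    using M[of "proj k x"] R(2)[of "proj k x"] by (cases "norm (proj k x) < R") (auto simp: indicator_def)
  qed
 qed measurable
qed

text \<open>The divergence theorem for \<open>T\<close> on the cap, with the sphere smeared out by
  \<open>ball_ramp\<close>. The weight \<open>L n\<close> of the smeared sphere is measured by the
  same theorem for the radial field \<open>x - p\<close>; \<open>be\<close> bounds the flux through
  the flat disc.\<close>

lemma cap_divergence_le:
 fixes T :: "real^'n => real^'n"
 assumes r: "r > 0" and sg: "pm sg"
  and T: "!!i. C1 (%x. T x $ i) (D i)" "csupp T" "!!x. norm (T x) <= 1"
  and be: "!!x. x $ k = 0 ==> - (sg * T x $ k) <= be"
 shows "(LBINT x:cap sg k c r. SUM i:UNIV. D i x $ i)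
  <= CARD('n) * vol (cap sg k c r) / r + (be - c) * disc_area k ((c * r * sg) *R axis k 1) r"
proof -
 let ?H = "hs sg k"
 define p where "p = (c * r * sg) *R (axis k 1 :: real^'n)"
 define f where "f = ball_ramp p r"
 define L where "L n x = 2 * real (Suc n) * ramp' (real (Suc n) * (r^2 + - ((norm (x - p))^2)))" for n x
 have sg2: "sg * sg = 1" using sg by (rule sign_square)
 have fC: "C1 (f n) (%x. (- L n x) *R (x - p))" for n using ball_ramp_C1[of p r n] by (simp only: f_def L_def mult_minus_left)
 have cf: "cont (f n)" for n by (rule C1_cont[OF fC])
 have sf: "csupp (f n)" for n unfolding f_def by (rule csupp_ball_ramp[OF r])
 have f01: "0 <= f n x" "f n x <= 1" for n x
  unfolding f_def ball_ramp_def by (rule ramp_values)+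
 have L0: "0 <= L n x" for n x unfolding L_def using ramp'_values(1) by simp
 have cL: "cont (L n)" for n unfolding L_def
  by (intro continuous_intros continuous_on_compose2[OF continuous_ramp']) auto
 have Lout: "L n x = 0" if "r <= norm (x - p)" for n x
 proof -
  have "r^2 <= (norm (x - p))^2" using that r by (intro power_mono) auto
  hence "real (Suc n) * (r^2 + - ((norm (x - p))^2)) <= 0" by (intro mult_nonneg_nonpos) auto
  thus ?thesis by (simp only: L_def ramp'_values(2) mult_zero_right)
 qed
 have sL: "csupp (L n)" for n
 proof (rule csuppI)
  fix x :: "real^'n" assume "norm p + r <= norm x"
  thus "L n x = 0" using norm_triangle_ineq2[of x p] by (intro Lout) auto
 qed
 have iH: "sint ?H (%x. h x)" if "cont h" "csupp h" for h :: "real^'n => real"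
  using that by (intro sint_csupp) auto
 define I where "I n = (LBINT x:?H. f n x)" for n
 define J where "J n = (LBINT x:slab k. f n (proj k x))" for n
 let ?div = "%x. SUM i:UNIV. D i x $ i"
 have step: "(LBINT x:?H. f n x * ?div x) <= be * J n + (CARD('n) * I n - c * r * J n) / sqrt (r^2 - inv_Suc n)"
  if n: "inv_Suc n < r^2" for n
 proof -
  \<comment> \<open>Inner radius of the shell that carries \<open>L n\<close>: there
    \<open>norm (x - p)\<close> is between \<open>s\<close> and \<open>r\<close>, and
    \<open>s\<close> tends to \<open>r\<close>.\<close>
  define s where "s = sqrt (r^2 - inv_Suc n)"
  have s: "s > 0" using n by (simp add: s_def)
  have Lin: "s * L n x <= L n x * norm (x - p)" for x
  proof (cases "s <= norm (x - p)")
   case True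
   from mult_left_mono[OF this L0] show ?thesis by (simp add: mult.commute)
  next
   case False
   hence "(norm (x - p))^2 <= s^2" by (intro power_mono) auto
   hence "inv_Suc n <= r^2 + - ((norm (x - p))^2)" using n by (simp add: s_def)
   from mult_left_mono[OF this, of "real (Suc n)"]
   have "1 <= real (Suc n) * (r^2 + - ((norm (x - p))^2))" by simp
   hence "L n x = 0" by (simp only: L_def ramp'_values(3) mult_zero_right)
   thus ?thesis by simp
  qed
  text \<open>The divergence theorem for \<open>f\<^sub>n \<cdot> (x - p)\<close>.\<close>
  define Di where "Di i x = f n x *R axis i 1 + ((x - p) $ i) *R ((- L n x) *R (x - p))" for i x
  have lin: "C1 (%x::real^'n. (x - p) $ i) (%x. axis i 1)" for i
   using C1_add[OF C1_inner[of "axis i 1 :: real^'n"] C1_const[of "- p $ i"]] by (simp add: inner_axis)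
  have "C1 (%x. (f n x *R (x - p)) $ i) (Di i)" for i
   using C1_mult[OF fC lin, of n i] by (simp add: Di_def[abs_def])
  moreover have "csupp (%x. f n x *R (x - p))"
   using sf[of n] unfolding csupp_def by auto
  ultimately have dv: "(LBINT x:?H. SUM i:UNIV. Di i x $ i) = - sg * (LBINT x:slab k. (f n (proj k x) *R (proj k x - p)) $ k)"
   by (rule halfspace_divergence[OF _ _ sg])
  have Dsum: "(SUM i:UNIV. Di i x $ i) = CARD('n) * f n x - L n x * (norm (x - p))^2" for x
   by (simp add: Di_def sum_subtractf power2_norm_eq_inner inner_vec_def sum_distrib_left mult_ac)
  have iL: "sint ?H (%x. L n x * (norm (x - p))^2)" by (intro iH csupp_mult sL continuous_intros cL)
  have pk: "(f n (proj k x) *R (proj k x - p)) $ k = f n (proj k x) * (- c * r * sg)" for x by (simp add: p_def)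
  have pkI: "(LBINT x:slab k. (f n (proj k x) *R (proj k x - p)) $ k) = J n * (- c * r * sg)"
   unfolding pk J_def by (rule set_integral_mult_left)
  have "CARD('n) * I n - (LBINT x:?H. L n x * (norm (x - p))^2) = - sg * (J n * (- c * r * sg))"
   using dv iL iH[OF cf sf, of n] unfolding Dsum I_def pkI by simp
  also have "... = c * r * J n * (sg * sg)" by (simp only: mult_ac) simp
  finally have radial: "(LBINT x:?H. L n x * (norm (x - p))^2) = CARD('n) * I n - c * r * J n" unfolding sg2 by simp
  text \<open>The divergence theorem for \<open>f\<^sub>n \<cdot> T\<close>.\<close>
  define Ei where "Ei i x = f n x *R D i x + T x $ i *R ((- L n x) *R (x - p))" for i x
  have "C1 (%x. (f n x *R T x) $ i) (Ei i)" for i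
   using C1_mult[OF fC T(1), of n i] by (simp add: Ei_def[abs_def])
  moreover have sfT: "csupp (%x. f n x *R T x)" using sf[of n] unfolding csupp_def by auto
  ultimately have dvT: "(LBINT x:?H. SUM i:UNIV. Ei i x $ i) = - sg * (LBINT x:slab k. (f n (proj k x) *R T (proj k x)) $ k)"
   by (rule halfspace_divergence[OF _ _ sg])
  have Esum: "(SUM i:UNIV. Ei i x $ i) = f n x * ?div x - L n x * (T x <.> (x - p))" for x
   by (simp add: Ei_def sum_subtractf inner_vec_def sum_distrib_left mult_ac)
  have cTi: "cont (%x. T x $ i)" for i by (rule C1_cont[OF T(1)])
  have "cont (%x. \<chi> i. T x $ i)" by (intro continuous_on_vec_lambda cTi)
  hence cT: "cont T" by simp
  have cdiv: "cont ?div" by (intro continuous_intros C1_cont_grad[OF T(1)])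
  have i1: "sint ?H (%x. f n x * ?div x)" by (intro iH csupp_mult sf continuous_on_mult cf cdiv)
  have i2: "sint ?H (%x. L n x * (T x <.> (x - p)))"
   by (intro iH csupp_mult sL continuous_on_mult cL continuous_on_inner cT continuous_intros)
  have bt: "- sg * (LBINT x:slab k. (f n (proj k x) *R T (proj k x)) $ k) <= be * J n"
  proof -
   have cfT: "cont (%x. f n x * T x $ k)" by (intro continuous_on_mult cf cTi)
   have "- sg * (LBINT x:slab k. (f n (proj k x) *R T (proj k x)) $ k)
     = (LBINT x:slab k. - sg * (f n (proj k x) * T (proj k x) $ k))"
    unfolding vector_scaleR_component real_scaleR_def by (rule set_integral_mult_right[symmetric])
   also have "... <= (LBINT x:slab k. be * f n (proj k x))"
   proof (rule set_integral_mono)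
    show "sint (slab k) (%x. - sg * (f n (proj k x) * T (proj k x) $ k))"
     by (intro set_integrable_mult_right impI set_integrable_slab[of "%x. f n x * T x $ k"] cfT csupp_mult sf)
    show "sint (slab k) (%x. be * f n (proj k x))"
     by (intro set_integrable_mult_right impI set_integrable_slab cf sf)
    show "- sg * (f n (proj k x) * T (proj k x) $ k) <= be * f n (proj k x)" for x
     using mult_right_mono[OF be[of "proj k x"] f01(1)[of n "proj k x"]] by (simp add: mult_ac)
   qed
   also have "... = be * J n" by (simp add: J_def)
   finally show ?thesis .
  qed
  have "(LBINT x:?H. f n x * ?div x) - (LBINT x:?H. L n x * (T x <.> (x - p))) <= be * J n"
   using dvT bt i1 i2 unfolding Esum by simp
  \<comment> \<open>As \<open>norm (T x) <= 1\<close>, replacing \<open>T x\<close> by the radial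
    direction loses only the ratio of \<open>s\<close> to \<open>norm (x - p)\<close>, which tends
    to 1 on the shell.\<close>
  moreover have "s * (LBINT x:?H. L n x * (T x <.> (x - p))) <= (LBINT x:?H. L n x * (norm (x - p))^2)"
  proof -
   have "s * (LBINT x:?H. L n x * (T x <.> (x - p))) = (LBINT x:?H. s * (L n x * (T x <.> (x - p))))" by simp
   also have "... <= (LBINT x:?H. L n x * (norm (x - p))^2)"
   proof (rule set_integral_mono[OF _ iL])
    show "sint ?H (%x. s * (L n x * (T x <.> (x - p))))" using i2 by simp
    show "s * (L n x * (T x <.> (x - p))) <= L n x * (norm (x - p))^2" for x
    proof -
     have "T x <.> (x - p) <= 1 * norm (x - p)"
      using norm_cauchy_schwarz[of "T x" "x - p"] mult_right_mono[OF T(3)[of x] norm_ge_zero[of "x - p"]] by linarith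
     hence "s * L n x * (T x <.> (x - p)) <= s * L n x * norm (x - p)" using s L0 by (intro mult_left_mono) auto
     also have "... <= L n x * norm (x - p) * norm (x - p)" by (intro mult_right_mono Lin) simp
     finally show ?thesis by (simp add: power2_eq_square mult.assoc)
    qed
   qed
   finally show ?thesis .
  qed
  hence "(LBINT x:?H. L n x * (T x <.> (x - p))) <= (CARD('n) * I n - c * r * J n) / s"
   using s unfolding radial by (simp add: le_divide_eq mult.commute)
  ultimately show ?thesis unfolding s_def by linarith
 qed
 let ?B = "ball p r"
 have fB: "fin ?B" by (rule emeasure_bounded_finite) simp
 have [measurable]: "?div : bm"
  by (intro borel_csupp continuous_intros C1_cont_grad[OF T(1)])
 have cdiv: "cont ?div" by (intro continuous_intros C1_cont_grad[OF T(1)])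
 have lI: "I ----> vol (cap sg k c r)"
 proof -
  have "lint (ind (cap sg k c r) :: _ => real)"
   using finite_sub[OF fB, of "cap sg k c r"] by (subst integrable_indicator_iff) (auto simp: cap_def p_def)
  moreover have e: "ind (cap sg k c r) = (%x. ind ?H x * ind ?B x :: real)"
   by (auto simp: fun_eq_iff indicator_def cap_def p_def)
  ultimately have "lint (%x. ind ?H x * ind ?B x :: real)" by simp
  from ball_ramp_integral_tendsto[OF r _ _ this] have "I ----> (LBINT x. ind ?H x * ind ?B x)"
   by (simp add: I_def[abs_def] f_def sli_def)
  also have "(LBINT x. ind ?H x * ind ?B x) = vol (cap sg k c r)"
   unfolding e[symmetric] by simp
  finally show ?thesis .
 qed
 have lJ: "J ----> disc_area k p r"
 proof -
  have e: "ind (cyl k (ball p r)) = (%x. ind (slab k) x * ind ?B (proj k x) :: real)"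
   by (auto simp: fun_eq_iff indicator_def)
  have "lint (ind (cyl k (ball p r)) :: _ => real)"
   using slab_disc_finite[of k p r] by (subst integrable_indicator_iff) auto
  hence "lint (%x. ind (slab k) x * ind ?B (proj k x) :: real)" by (simp only: e)
  from ball_ramp_integral_tendsto[OF r _ _ this] have "J ----> (LBINT x. ind (slab k) x * ind ?B (proj k x))"
   by (simp add: J_def[abs_def] f_def sli_def)
  also have "(LBINT x. ind (slab k) x * ind ?B (proj k x)) = disc_area k p r"
   unfolding e[symmetric] disc_area_def by simp
  finally show ?thesis .
 qed
 have lD: "(%n. LBINT x:?H. f n x * ?div x) ----> (LBINT x:cap sg k c r. ?div x)"
 proof -
  obtain R where R: "R > 0" "!!x. R <= norm x ==> T x = 0" using T(2) by (rule csuppE) blast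
  have "D i x = 0" if "R + 1 <= norm x" for i x
   by (rule C1_grad_zero_outside[OF T(1), of R]) (use R that in auto)
  hence sdiv: "csupp ?div" by (intro csuppI[of "R + 1"]) simp
  have e: "(%x. ind (cap sg k c r) x *R ?div x) = (%x. (ind ?H x * ?div x) * ind ?B x)"
   by (auto simp: fun_eq_iff indicator_def cap_def p_def)
  have "lint (%x. ind (cap sg k c r) x *R ?div x)"
   using sint_csupp[OF cdiv sdiv, of "cap sg k c r"] by (simp add: set_integrable_def)
  hence "lint (%x. (ind ?H x * ?div x) * ind ?B x)" by (simp only: e)
  from ball_ramp_integral_tendsto[OF r _ _ this]
  have "(%n. LBINT x. (ind ?H x * ?div x) * ball_ramp p r n x) ----> (LBINT x. (ind ?H x * ?div x) * ind ?B x)"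
   by simp
  thus ?thesis unfolding sli_def e f_def by (simp add: mult_ac)
 qed
 have lS: "(%n. sqrt (r^2 - inv_Suc n)) ----> sqrt (r^2 - 0)"
  by (intro tendsto_intros LIMSEQ_inverse_real_of_nat)
 hence lS: "(%n. sqrt (r^2 - inv_Suc n)) ----> r" using r by simp
 have "(%n. be * J n + (CARD('n) * I n - c * r * J n) / sqrt (r^2 - inv_Suc n))
   ----> be * disc_area k p r + (CARD('n) * vol (cap sg k c r) - c * r * disc_area k p r) / r"
  using r by (intro tendsto_add tendsto_divide tendsto_diff tendsto_mult tendsto_const lI lJ lS) auto
 moreover have "EVS n. inv_Suc n < r^2"
  using r by (intro order_tendstoD[OF LIMSEQ_inverse_real_of_nat]) auto
 hence "EVS n. (LBINT x:?H. f n x * ?div x) <= be * J n + (CARD('n) * I n - c * r * J n) / sqrt (r^2 - inv_Suc n)"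
  by eventually_elim (rule step)
 ultimately have "(LBINT x:cap sg k c r. ?div x)
  <= be * disc_area k p r + (CARD('n) * vol (cap sg k c r) - c * r * disc_area k p r) / r"
  using lD by (intro tendsto_le[OF _ _ lD]) auto
 also have "... = CARD('n) * vol (cap sg k c r) / r + (be - c) * disc_area k p r"
  using r by (simp add: field_simps)
 finally show ?thesis unfolding p_def .
qed

lemma open_hs: "open (hs sg k)"
 unfolding hs_def by (intro open_Collect_less continuous_intros)

lemma convex_hs: "convex (hs sg k)"
proof -
 have "hs sg k = {x. 0 < (sg *R axis k 1) <.> x}" by (auto simp: hs_def inner_commute[of _ "_ :: real^'a"] inner_axis)
 thus ?thesis using convex_halfspace_gt[of 0 "sg *R axis k 1 :: real^'a"] by (simp only:)
qed

lemma cap_open: "open (cap sg k c r)" and cap_convex: "convex (cap sg k c r)" and cap_bounded: "bounded (cap sg k c r)"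
 unfolding cap_def using open_hs convex_hs by (auto intro!: open_Int convex_Int bounded_Int)

lemma cap_cone:
 assumes "x : hs sg k" "y : cap sg k c r" "t > 0" shows "x + t *R y : hs sg k"
proof -
 have "0 < sg * x $ k" "0 < t * (sg * y $ k)" using assms by (auto simp: hs_def cap_def)
 thus ?thesis by (simp add: hs_def algebra_simps)
qed

lemma cap_nonempty:
 assumes "pm sg" "- 1 < c" "c <= 1" "r > 0" shows "cap sg k c r ~= {}"
proof -
 let ?x = "(sg * (r * (1 + c) / 2)) *R (axis k 1 :: real^'a)"
 have "sg * sg = 1" using assms(1) by (rule sign_square)
 hence "sg * ?x $ k = r * (1 + c) / 2" by (simp add: mult.assoc[symmetric])
 moreover have "0 < r * (1 + c) / 2" using assms by simp
 ultimately have "?x : hs sg k" unfolding hs_def mem_Collect_eq by (simp only:)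
 moreover have "(c * r * sg) *R (axis k 1 :: real^'a) - ?x = (sg * (r * (c - 1) / 2)) *R axis k 1"
  unfolding scaleR_left_diff_distrib[symmetric] by (simp add: field_simps)
 hence "dist ((c * r * sg) *R axis k 1) ?x = r * (1 - c) / 2"
  using assms by (simp add: dist_norm abs_mult)
 moreover have "r * (1 - c) / 2 < r" using assms by (simp add: mult_less_cancel_left_pos[of r "1 - c" 2, simplified])
 ultimately have "?x : cap sg k c r" by (simp add: cap_def)
 thus ?thesis by blast
qed

lemma cap_emeasure_finite: "fin (cap sg k c r)"
 by (intro emeasure_bounded_finite cap_bounded)

lemma cap_measure_pos:
 assumes "pm sg" "- 1 < c" "c <= 1" "r > 0" shows "0 < vol (cap sg k c r)"
 using vol_open_pos[OF cap_open cap_bounded cap_nonempty[OF assms]] by simp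

text \<open>\<open>g\<close> is the support function of the whole ball at \<open>- Du x\<close>,
  hence an upper bound on the cap. Its linear part comes from the centre and integrates to a
  multiple of the trace.\<close>

lemma cap_wulff_data:
 fixes u :: "real^'n => real"
 assumes u: "C1 u Du" "csupp u" "!!x. 0 <= u x" and r: "r > 0"
 shows "wulff_data (hs sg k) (cap sg k c r) u Du (%x. r * norm (Du x) + - (c * r * sg) * Du x $ k)"
proof -
 have cD: "cont Du" by (rule C1_cont_grad[OF u(1)])
 have sD: "csupp Du" by (rule csupp_grad[OF u(1,2)])
 have sk: "csupp (%x. Du x $ k)" using csupp_inner[OF sD, of "axis k 1"] by (simp add: inner_axis)
 have "- (Du x <.> y) <= r * norm (Du x) + - (c * r * sg) * Du x $ k" if y: "y : cap sg k c r" for x y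
 proof -
  let ?p = "(c * r * sg) *R (axis k 1 :: real^'n)"
  have "- (Du x <.> y) = Du x <.> (?p - y) - (c * r * sg) * Du x $ k" by (simp add: inner_diff_right inner_axis)
  also have "Du x <.> (?p - y) <= norm (Du x) * norm (?p - y)" by (rule norm_cauchy_schwarz)
  also have "... <= norm (Du x) * r" using y by (intro mult_left_mono) (auto simp: cap_def dist_norm)
  finally show ?thesis by (simp add: mult.commute)
 qed
 moreover have "cont (%x. r * norm (Du x) + - (c * r * sg) * Du x $ k)" by (intro continuous_intros cD)
 moreover have "csupp (%x. r * norm (Du x) + - (c * r * sg) * Du x $ k)" by (intro csupp_add csupp_mult csupp_norm sD sk)
 ultimately show ?thesis using u by (auto simp: wulff_data_def)
qed

lemma cap_wulff_integral:
 fixes u :: "real^'n => real"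
 assumes u: "C1 u Du" "csupp u" and sg: "pm sg"
 shows "(LBINT x:hs sg k. r * norm (Du x) + - (c * r * sg) * Du x $ k)
  = r * ((LBINT x:hs sg k. norm (Du x)) + c * (LBINT x:slab k. u (proj k x)))"
proof -
 have cD: "cont Du" by (rule C1_cont_grad[OF u(1)])
 have sD: "csupp Du" by (rule csupp_grad[OF u(1,2)])
 have sk: "csupp (%x. Du x $ k)" using csupp_inner[OF sD, of "axis k 1"] by (simp add: inner_axis)
 have "sint (hs sg k) (%x. norm (Du x))" "sint (hs sg k) (%x. Du x $ k)"
  by (intro sint_csupp csupp_norm sD sk continuous_intros cD hs_borel)+
 hence "(LBINT x:hs sg k. r * norm (Du x) + - (c * r * sg) * Du x $ k)
   = r * (LBINT x:hs sg k. norm (Du x)) + - (c * r * sg) * (LBINT x:hs sg k. Du x $ k)"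
  by (subst set_integral_add) (auto simp only: set_integrable_mult_right set_integral_mult_right)
 also have "... = r * (LBINT x:hs sg k. norm (Du x)) + c * r * ((sg * sg) * (LBINT x:slab k. u (proj k x)))"
  unfolding halfspace_trace[OF u sg] by (simp only: mult_ac mult_minus_left mult_minus_right minus_minus)
 also have "sg * sg = 1" using sg by (rule sign_square)
 finally show ?thesis by (simp add: algebra_simps)
qed

text \<open>As \<open>E\<close> has the volume of the cap, the root in
  \<open>wulff_inequality\<close> is 1; the term with \<open>c\<close> is a contact energy.\<close>

lemma cap_wulff_inequality:
 fixes u :: "real^'n => real"
 assumes u: "C1 u Du" "csupp u" "!!x. 0 <= u x" and sg: "pm sg" and c: "- 1 < c" "c <= 1" and r: "r > 0"
  and E: "E : bor" "E <= hs sg k" "fin E" "vol E = vol (cap sg k c r)"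
 shows "CARD('n) * (LBINT x:E. min (u x) 1)
  <= r * ((LBINT x:hs sg k. norm (Du x)) + c * (LBINT x:slab k. u (proj k x)))"
proof -
 let ?g = "%x. r * norm (Du x) + - (c * r * sg) * Du x $ k"
 have w: "cont ?g" "csupp ?g" "!!x y. x : hs sg k ==> y : cap sg k c r ==> - (Du x <.> y) <= ?g x"
  using cap_wulff_data[OF u r, of sg k c] by (auto simp: wulff_data_def)
 have pos: "vol E > 0" using cap_measure_pos[OF sg c r] E(4) by simp
 have "DIM(real^'n) * root DIM(real^'n) (vol (cap sg k c r) / vol E) * (LBINT x:E. min (u x) 1) <= (LBINT x:hs sg k. ?g x)"
  by (rule wulff_inequality[OF u open_hs cap_open cap_bounded cap_nonempty[OF sg c r] cap_cone w E(1,2) pos E(3)])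
 thus ?thesis using pos unfolding cap_wulff_integral[OF u(1,2) sg] E(4)[symmetric] by simp
qed

lemma interface_dist:
 assumes y: "y $ k = 0" shows "(dist q y)^2 = (dist (proj k q) y)^2 + (q $ k)^2"
proof -
 have eq: "q - y = (proj k q - y) + (q $ k) *R axis k 1" by (simp add: proj_def)
 have "orthogonal (proj k q - y) ((q $ k) *R axis k 1)"
  using y by (simp add: orthogonal_def inner_axis)
 from norm_add_Pythagorean[OF this] show ?thesis
  unfolding dist_norm eq by simp
qed

lemma flat_dist:
 assumes y: "y $ k = 0" and q: "<|q $ k|> < r"
 shows "dist q y < r <-> dist (proj k q) y < sqrt (r^2 - (q $ k)^2)" (is ?G1)
  and "dist q y <= r <-> dist (proj k q) y <= sqrt (r^2 - (q $ k)^2)" (is ?G2)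
  and "dist q y = r <-> dist (proj k q) y = sqrt (r^2 - (q $ k)^2)" (is ?G3)
proof -
 have r: "r >= 0" using q by linarith
 have "(q $ k)^2 < r^2" using q by (metis abs_ge_zero abs_of_nonneg power2_abs power_strict_mono r zero_less_numeral)
 hence s: "sqrt (r^2 - (q $ k)^2) >= 0" "(sqrt (r^2 - (q $ k)^2))^2 = r^2 - (q $ k)^2" by auto
 have mono: "a < b <-> a^2 < b^2" "a <= b <-> a^2 <= b^2" "a = b <-> a^2 = b^2" if "0 <= a" "0 <= b" for a b :: real
  using power_mono_iff[OF that, of 2] power_mono_iff[OF that(2,1), of 2] by auto
 show ?G1
  using mono(1)[OF zero_le_dist r, of q y] mono(1)[OF zero_le_dist s(1), of "proj k q" y] interface_dist[OF y, of q] s(2) by linarith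
 show ?G2
  using mono(2)[OF zero_le_dist r, of q y] mono(2)[OF zero_le_dist s(1), of "proj k q" y] interface_dist[OF y, of q] s(2) by linarith
 show ?G3
  using mono(3)[OF zero_le_dist r, of q y] mono(3)[OF zero_le_dist s(1), of "proj k q" y] interface_dist[OF y, of q] s(2) by linarith
qed

text \<open>The exceptional points lie on the frontier of a convex cylinder: by
  \<open><|q $ k|> < r\<close> its inside contains \<open>m\<close>, and moving such a point towards
  \<open>m\<close> leads inside at once.\<close>

lemma AE_proj_sphere:
 fixes q :: "real^'n"
 assumes q: "<|q $ k|> < r" shows "AEL x. dist q (proj k x) ~= r"
proof -
 let ?C = "{x. dist q (proj k x) < r}"
 define m where "m = proj k q"
 have mk: "proj k m = m" by (simp add: m_def vec_eq_iff)
 have "dist q m < r" using q by (simp add: m_def dist_norm proj_def)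
 have lin: "proj k (x + t *R (y - x)) = proj k x + t *R (proj k y - proj k x)" for x y t
  by (simp add: vec_eq_iff)
 have "convex ?C"
 proof -
  have "linear (proj k)" by (auto intro!: linearI simp: vec_eq_iff)
  from convex_linear_vimage[OF this convex_ball[of q r]] show ?thesis by (simp add: vimage_def)
 qed
 hence "negligible (frontier ?C)" by (rule negligible_convex_frontier)
 moreover have "{x. dist q (proj k x) = r} <= frontier ?C"
 proof
  fix x assume "x : {x. dist q (proj k x) = r}"
  hence x: "dist q (proj k x) = r" by simp
  have "x : closure ?C"
   unfolding closure_approachable
  proof (intro allI impI)
   fix e :: real assume e: "e > 0"
   define t where "t = min 1 (e / (2 * (norm (m - x) + 1)))"
   have t: "0 < t" "t <= 1" using e by (auto simp: t_def add_nonneg_pos)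
   let ?y = "x + t *R (m - x)"
   have "q - proj k ?y = (1 - t) *R (q - proj k x) + t *R (q - m)" unfolding lin mk by (simp add: algebra_simps)
   hence "dist q (proj k ?y) <= norm ((1 - t) *R (q - proj k x)) + norm (t *R (q - m))"
    unfolding dist_norm using norm_triangle_ineq by metis
   also have "... = (1 - t) * r + t * dist q m" using t x by (simp add: dist_norm)
   also have "... < (1 - t) * r + t * r" using \<open>dist q m < r\<close> t by simp
   also have "... = r" by (simp add: algebra_simps)
   finally have "?y : ?C" by simp
   moreover have "dist ?y x < e"
   proof -
    have "dist ?y x = t * norm (m - x)" using t by (simp add: dist_norm)
    also have "... <= e / (2 * (norm (m - x) + 1)) * norm (m - x)" by (intro mult_right_mono) (auto simp: t_def)
    also have "... < e" using e by (simp add: divide_less_eq add_nonneg_pos)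
    finally show ?thesis .
   qed
   ultimately show "EX y:?C. dist y x < e" by blast
  qed
  moreover have "x ~: interior ?C" using interior_subset[of ?C] x by auto
  ultimately show "x : frontier ?C" by (simp add: frontier_def)
 qed
 ultimately have "negligible {x. dist q (proj k x) = r}" by (rule negligible_subset)
 hence "AE x in lebesgue. x ~: {x. dist q (proj k x) = r}"
  by (intro AE_not_in) (simp add: negligible_iff_null_sets)
 thus ?thesis by (simp add: AE_completion_iff)
qed

text \<open>Once \<open>5 * ep i\<close> is below the distance of an interface point to the sphere,
  the trial function there is the cutoff or 0; the cylinder over the sphere is null.\<close>

lemma cap_trace_tendsto:
 fixes Om :: "(real^'n) set"
 assumes Om: "Om : bor" and sg: "pm sg" and q: "<|q $ k|> < r"
  and AE: "AEL x. x : hs sg k --> (x : Om <-> dist q x < r)"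
  and ep: "!!i. 0 < ep i" "ep ----> 0"
 shows "(%i. LBINT x:slab k. trial Om k sg (ep i) (Suc i) (proj k x)) ----> disc_area k q r"
proof -
 obtain K where K: "!!i. ep i <= K"
 proof -
  have "Bseq ep" using ep(2) by (intro convergent_imp_Bseq) (auto simp: convergent_def)
  then obtain K where K: "!!i. norm (ep i) <= K" by (auto simp: Bseq_def)
  have "ep i <= K" for i using K[of i] by simp
  thus ?thesis by (rule that)
 qed
 have sym: "sg * proj k x $ k = 0" for x :: "real^'n" by simp
 have ball: "trial Om k sg (ep i) R (proj k x) = trial (ball q r) k sg (ep i) R (proj k x)" for i x R
  by (rule trial_cong[OF ep(1) Om _ sg]) (use AE in \<open>auto elim: eventually_mono\<close>)
 have out: "trial Om k sg (ep i) R (proj k x) = 0" if "r + 5 * ep i <= dist q (proj k x)" for i x R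
 proof -
  have "y ~: ball q r" if "norm (proj k x - y) < 5 * ep i" for y
   using that \<open>r + 5 * ep i <= dist q (proj k x)\<close> dist_triangle[of q "proj k x" y] by (auto simp: dist_norm norm_minus_commute)
  hence "trial (ball q r) k sg (ep i) R (proj k x) = trial {} k sg (ep i) R (proj k x)"
   by (intro trial_cong[OF ep(1) _ _ sg]) auto
  thus ?thesis by (simp add: ball trial_empty)
 qed
 have e: "disc_area k q r = (LBINT x. ind (slab k) x *R ind (ball q r) (proj k x))"
 proof -
  have "ind (cyl k (ball q r)) = (%x. ind (slab k) x *R ind (ball q r) (proj k x) :: real)"
   by (auto simp: fun_eq_iff indicator_def)
  hence "(LBINT x. ind (slab k) x *R ind (ball q r) (proj k x)) = (LBINT x. ind (cyl k (ball q r)) x :: real)" by simp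
  thus ?thesis by (simp add: disc_area_def)
 qed
 show ?thesis
  unfolding e sli_def
 proof (rule integral_dominated_convergence[where w = "ind (cyl k (ball q (r + 5 * K)))"])
  show "lint (ind (cyl k (ball q (r + 5 * K))) :: _ => real)"
   using slab_disc_finite[of k q "r + 5 * K"] by (subst integrable_indicator_iff) auto
  show "AEL x. norm (ind (slab k) x *R trial Om k sg (ep i) (Suc i) (proj k x)) <= ind (cyl k (ball q (r + 5 * K))) x" (is "AE x in _. ?G1 x") for i
  proof (intro AE_I2)
   fix x
   have b: "0 <= trial Om k sg (ep i) (Suc i) (proj k x)" "trial Om k sg (ep i) (Suc i) (proj k x) <= 1"
    using trial_bounds[OF ep(1) Om, of k sg i "real (Suc i)" "proj k x"] cutoff_bounds(2)[of "real (Suc i)" "proj k x"] by auto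
   show "?G1 x"
   proof (cases "dist q (proj k x) < r + 5 * K")
    case True
    thus ?thesis using b by (simp add: indicator_def)
   next
    case False
    hence "trial Om k sg (ep i) (Suc i) (proj k x) = 0" using K[of i] by (intro out) linarith
    thus ?thesis by simp
   qed
  qed
  show "AEL x. (%i. ind (slab k) x *R trial Om k sg (ep i) (Suc i) (proj k x)) ----> ind (slab k) x *R ind (ball q r) (proj k x)"
   using AE_proj_sphere[OF q]
  proof eventually_elim
   case (elim x)
   let ?d = "<|dist q (proj k x) - r|>"
   have ev: "EVS i. 5 * ep i < ?d"
   proof -
    have "EVS i. ep i < ?d / 5" using elim by (intro order_tendstoD[OF ep(2)]) auto
    thus ?thesis by eventually_elim simp
   qed
   have "(%i. trial Om k sg (ep i) (Suc i) (proj k x)) ----> ind (ball q r) (proj k x)"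
   proof (cases "dist q (proj k x) < r")
    case True
    have "trial Om k sg (ep i) (Suc i) (proj k x) = cutoff (Suc i) (proj k x)" if i: "5 * ep i < ?d" for i
    proof -
     have "y : ball q r" if "norm (proj k x - y) < 5 * ep i" for y
      using that i True dist_triangle[of q y "proj k x"] by (auto simp: dist_norm)
     hence "trial (ball q r) k sg (ep i) (Suc i) (proj k x) = trial UNIV k sg (ep i) (Suc i) (proj k x)"
      by (intro trial_cong[OF ep(1) _ _ sg]) auto
     thus ?thesis by (simp add: ball trial_UNIV[OF ep(1)])
    qed
    hence "EVS i. cutoff (Suc i) (proj k x) = trial Om k sg (ep i) (Suc i) (proj k x)"
     using ev by (auto elim!: eventually_mono)
    from Lim_transform_eventually[OF cutoff_tendsto this] show ?thesis using True by simp
   next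
    case False
    have "EVS i. trial Om k sg (ep i) (Suc i) (proj k x) = 0"
     using ev by eventually_elim (rule out, use False in linarith)
    thus ?thesis using False by (simp add: tendsto_eventually)
   qed
   thus ?case by (intro tendsto_scaleR tendsto_const)
  qed
  have [measurable]: "trial Om k sg (ep i) (Suc i) : bm" for i
   by (intro borel_csupp continuous_trial ep Om) simp
  show "(%x. ind (slab k) x *R trial Om k sg (ep i) (Suc i) (proj k x)) : borel_measurable lborel" for i by measurable
  show "(%x. ind (slab k) x *R ind (ball q r) (proj k x) :: real) : borel_measurable lborel"
  proof -
   have "(ind (ball q r) :: _ => real) : bm" by (rule borel_measurable_indicator) simp
   from measurable_compose[OF proj_measurable this] show ?thesis by measurable
  qed
 qed
qed

lemma trial_trace_zero:
 fixes Om :: "(real^'n) set"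
 assumes Om: "Om : bor" and sg: "pm sg" and d: "d > 0"
  and AE: "AEL x. x : hs sg k --> x : Om --> d <= sg * x $ k"
  and ep: "ep > 0" "5 * ep < d"
 shows "trial Om k sg ep R (proj k x) = 0"
proof -
 have "trial Om k sg ep R (proj k x) = trial {} k sg ep R (proj k x)"
 proof (rule trial_cong[OF ep(1) Om _ sg])
  show "AEL y. y : hs sg k --> norm (proj k x - y) < 5 * ep --> (y : Om <-> y : {})"
   using AE
  proof eventually_elim
   case (elim y)
   have "sg * y $ k < d" if "norm (proj k x - y) < 5 * ep"
   proof -
    have "<|sg * (proj k x - y) $ k|> <= norm (proj k x - y)" using component_le_norm_cart[of "proj k x - y" k] sg by (simp add: abs_mult)
    thus ?thesis using that ep by simp
   qed
   thus ?case using elim by force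
  qed
 qed auto
 thus ?thesis by (simp add: trial_empty)
qed

section \<open>The volume of a cap\<close>

lemma lborel_translate:
 fixes A :: "'a::euclidean_space set"
 assumes "A : bor" shows "vol {x. x + b : A} = vol A"
proof -
 have "vol A = measure (distr lborel borel ((+) b)) A" by (simp add: lborel_distr_plus)
 also have "... = vol ((+) b -` A Int space lborel)" using assms by (intro measure_distr) auto
 also have "(+) b -` A Int space lborel = {x. x + b : A}" by (auto simp: add.commute)
 finally show ?thesis by simp
qed

definition cap_vol :: "'n::finite => real => real" where
 "cap_vol k c = vol (ball (0 :: real^'n) 1 Int {x. - c < x <.> axis k 1})"

lemma cap_section:
 assumes "pm sg"
 shows "vol (cap sg k c r) = vol (ball (0 :: real^'n) r Int {x. - (c * r) < x <.> (sg *R axis k 1)})"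
proof -
 have s: "sg * sg = 1" using assms by (rule sign_square)
 have "{x. x + (c * r * sg) *R axis k 1 : cap sg k c r} = ball (0 :: real^'n) r Int {x. - (c * r) < x <.> (sg *R axis k 1)}"
 proof -
  have "sg * (x $ k + c * r * sg) = sg * x $ k + c * r * (sg * sg)" for x :: "real^'n" by (simp add: algebra_simps)
  thus ?thesis unfolding s by (auto simp: cap_def hs_def dist_norm inner_axis)
 qed
 thus ?thesis using lborel_translate[OF cap_borel, of "(c * r * sg) *R axis k 1" sg k c r] by simp
qed

lemma cap_measure:
 fixes k :: "'n::finite"
 assumes sg: "pm sg" and r: "r > 0"
 shows "vol (cap sg k c r) = r ^ CARD('n) * cap_vol k c"
proof -
 let ?S = "ball (0 :: real^'n) r Int {x. - (c * r) < x <.> (sg *R axis k 1)}"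
 have S: "?S : bor" by simp
 have s: "sg * sg = 1" using sg by (rule sign_square)
 have "em ?S = emeasure (density (distr lborel borel (%x. 0 + (r * sg) *R x)) (%_. ennreal (<|r * sg|> ^ DIM(real^'n)))) ?S"
  using lborel_affine[of "r * sg" "0 :: real^'n"] r sg by auto
 also have "... = ennreal (r ^ CARD('n)) * em ((%x. 0 + (r * sg) *R x) -` ?S Int space lborel)"
  using r sg S by (subst emeasure_density_const, simp, subst emeasure_distr) (auto simp: abs_mult)
 also have "(%x. 0 + (r * sg) *R x) -` ?S Int space lborel = ball 0 1 Int {x. - c < x <.> axis k 1}"
 proof -
  have "norm ((r * sg) *R x) < r <-> norm x < 1" for x :: "real^'n" using r sg by (simp add: abs_mult mult_less_cancel_left_pos[of r _ 1, simplified])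
  moreover have "- (c * r) < ((r * sg) *R x) <.> (sg *R axis k 1) <-> - c < x <.> axis k 1" for x :: "real^'n"
  proof -
   have e: "((r * sg) *R x) <.> (sg *R axis k 1) = r * (x <.> axis k 1) * (sg * sg)" by (simp add: mult_ac)
   show ?thesis unfolding e s using r mult_less_cancel_left_pos[of r "- c" "x <.> axis k 1"] by (simp add: mult.commute)
  qed
  ultimately show ?thesis by (auto simp: dist_norm simp del: inner_scaleR_left inner_scaleR_right)
 qed
 finally have "vol ?S = r ^ CARD('n) * cap_vol k c"
  unfolding measure_def cap_vol_def using r by (simp add: enn2real_mult)
 thus ?thesis using cap_section[OF sg, of k c r] by simp
qed

lemma cap_vol_continuous: "cont (cap_vol (k::'n::finite))"
proof -
 have "cont (%s. vol (ball (0 :: real^'n) 1 Int {x. s < x <.> axis k 1}))"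
  by (rule section_continuous[OF _ emeasure_bounded_finite]) auto
 from continuous_on_compose2[OF this, of UNIV uminus] show ?thesis
  by (simp add: cap_vol_def[abs_def] continuous_on_minus)
qed

lemma cap_vol_strict_mono:
 fixes k :: "'n::finite"
 assumes "- 1 <= c" "c < d" "d <= 1" shows "cap_vol k c < cap_vol k d"
proof -
 let ?B = "ball (0 :: real^'n) 1" and ?e = "axis k 1 :: real^'n"
 let ?U = "?B Int {x. - d < x <.> ?e & x <.> ?e < - c}"
 have fB: "fin ?B" by (intro emeasure_bounded_finite) simp
 have "(- (c + d) / 2) *R ?e : ?U" using assms by (auto simp: dist_norm abs_less_iff)
 hence "?U ~= {}" by blast
 moreover have "open ?U" by (intro open_Int open_ball open_Collect_conj open_Collect_less continuous_intros)
 moreover have "bounded ?U" by (intro bounded_Int) simp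
 ultimately have "0 < vol ?U" using vol_open_pos[of ?U] by simp
 moreover have "vol (?B Int {x. - c < x <.> ?e}) + vol ?U = vol (?B Int {x. - c < x <.> ?e} Un ?U)"
  using finite_sub[OF fB, of "?B Int {x. - c < x <.> ?e}"] finite_sub[OF fB, of ?U] by (intro measure_Union[symmetric]) auto
 moreover have "vol (?B Int {x. - c < x <.> ?e} Un ?U) <= vol (?B Int {x. - d < x <.> ?e})"
  using finite_sub[OF fB, of "?B Int {x. - d < x <.> ?e}"] assms by (intro measure_mono_fmeasurable) (auto simp: fmeasurable_def)
 ultimately show ?thesis unfolding cap_vol_def by linarith
qed

lemma cap_vol_pos:
 fixes k :: "'n::finite"
 assumes "- 1 < c" "c <= 1" shows "0 < cap_vol k c"
 using cap_vol_strict_mono[of "- 1" c k] assms by (simp add: order_le_less_trans[rotated] cap_vol_def)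

text \<open>For \<open>c <= 0\<close> the cap lies in a box of height \<open>1 + c\<close> and
  half-width \<open>sqrt (1 - c^2)\<close>. This decay at \<open>c = - 1\<close> is what makes disc
  radii at fixed volume unbounded.\<close>

lemma cap_vol_le:
 fixes k :: "'n::finite"
 assumes c: "- 1 < c" "c <= 0"
 shows "cap_vol k c <= (1 + c) * (2 * sqrt (1 - c^2)) ^ (CARD('n) - 1)"
proof -
 let ?s = "sqrt (1 - c^2)"
 have c2: "c^2 <= 1" using c by (simp add: abs_square_le_1)
 define lo hi :: "real^'n" where "lo = (\<chi> i. if i = k then - c else - ?s)" and "hi = (\<chi> i. if i = k then 1 else ?s)"
 have le: "lo $ i <= hi $ i" for i using c c2 by (auto simp: lo_def hi_def intro: order_trans[of _ 0])
 have "ball (0 :: real^'n) 1 Int {x. - c < x <.> axis k 1} <= cbox lo hi"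
 proof
  fix x assume "x : ball (0 :: real^'n) 1 Int {x. - c < x <.> axis k 1}"
  hence x: "norm x < 1" "- c < x $ k" by (auto simp: inner_axis)
  have "<|x $ i|> <= ?s" if i: "i ~= k" for i
  proof -
   have "(x $ i)^2 + (x $ k)^2 = (SUM j:{i, k}. (x $ j)^2)" using i by simp
   also have "... <= (SUM j:UNIV. (x $ j)^2)" by (rule sum_mono2) auto
   also have "... = (norm x)^2" unfolding power2_norm_eq_inner inner_vec_def by (simp add: power2_eq_square)
   also have "... <= 1" using x by (simp add: power_le_one)
   finally have "(x $ i)^2 + (x $ k)^2 <= 1" .
   moreover have "(- c)^2 <= (x $ k)^2" using x c by (intro power_mono) auto
   ultimately show ?thesis by (intro real_le_rsqrt) simp
  qed
  moreover have "x $ k <= 1" using component_le_norm_cart[of x k] x by linarith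
  ultimately show "x : cbox lo hi" using x by (auto simp: mem_box_cart lo_def hi_def abs_le_iff) (smt (verit))
 qed
 hence "em (ball (0 :: real^'n) 1 Int {x. - c < x <.> axis k 1}) <= em (cbox lo hi)"
  by (rule emeasure_mono) simp
 also have "... = ennreal (PROD i:UNIV. hi $ i - lo $ i)" by (rule emeasure_cbox_cart[OF le])
 also have "(PROD i:UNIV. hi $ i - lo $ i) = (PROD i:UNIV. if i = k then 1 + c else 2 * ?s)"
  by (intro prod.cong) (auto simp: lo_def hi_def)
 also have "... = (1 + c) * (2 * ?s) ^ (CARD('n) - 1)" by (rule prod_remove_const)
 finally show ?thesis using c c2 unfolding cap_vol_def measure_def by (intro enn2real_leI) auto
qed

section \<open>Structure of optimal sets\<close>

text \<open>\<open>extremal_unique\<close> gives the cap translated by some \<open>b\<close>. The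
  normal component of \<open>b\<close> is 0: a shift outwards would push a part of the set out of
  the half-space, and a shift inwards would make the traces vanish, where a smaller ball gives a
  better bound.\<close>

lemma extremal_half:
 fixes Om :: "(real^'n) set"
 assumes N: "CARD('n) >= 2" and Om: "Om : bor" and sg: "pm sg" and c: "- 1 < c" "c < 1" and r: "r > 0"
  and fE: "fin (Om Int hs sg k)" and vol: "vol (Om Int hs sg k) = vol (cap sg k c r)"
  and ep: "!!i. 0 < ep i" "ep ----> 0"
  and Du: "!!i. C1 (trial Om k sg (ep i) (Suc i)) (Du i)"
  and lim: "(%i. r * ((LBINT x:hs sg k. norm (Du i x)) + c * (LBINT x:slab k. trial Om k sg (ep i) (Suc i) (proj k x))))
      ----> real CARD('n) * vol (Om Int hs sg k)"
  and L1: "(%i. LBINT x:hs sg k. <|trial Om k sg (ep i) (Suc i) x - ind (Om Int hs sg k) x|>) ----> 0"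
 shows "EX q. q $ k = c * r * sg & (AEL x. x : hs sg k --> (x : Om <-> dist q x < r))"
proof -
 let ?K = "cap sg k c r" and ?E = "Om Int hs sg k" and ?e = "axis k 1 :: real^'n"
 define v where "v = vol ?E"
 have s: "sg * sg = 1" using sg by (rule sign_square)
 have E: "?E : bor" "?E <= hs sg k" using Om by auto
 define u where "u i = trial Om k sg (ep i) (real (Suc i))" for i
 have uC: "C1 (u i) (Du i)" for i unfolding u_def by (rule Du)
 have su: "csupp (u i)" for i unfolding u_def by (rule csupp_trial) simp
 have u0: "0 <= u i x" for i x unfolding u_def by (rule trial_bounds[OF ep(1) Om])
 define G where "G i = (LBINT x:hs sg k. norm (Du i x))" for i
 define t where "t i = (LBINT x:slab k. u i (proj k x))" for i
 have lim': "(%i. r * (G i + c * t i)) ----> real CARD('n) * v" using lim unfolding G_def t_def u_def v_def .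
 have L1': "(%i. LBINT x:hs sg k. <|u i x - ind ?E x|>) ----> 0" using L1 unfolding u_def .
 have ext: "wulff_extremal (hs sg k) ?K ?E"
  unfolding wulff_extremal_def
 proof (intro exI conjI allI)
  show "wulff_data (hs sg k) ?K (u i) (Du i) (%x. r * norm (Du i x) + - (c * r * sg) * Du i x $ k)" for i
   by (rule cap_wulff_data[OF uC su u0 r])
  show "(%i. LBINT x:hs sg k. <|u i x - ind ?E x|>) ----> 0" by (rule L1')
  show "(%i. LBINT x:hs sg k. r * norm (Du i x) + - (c * r * sg) * Du i x $ k) ----> DIM(real^'n) * vol ?E"
   unfolding cap_wulff_integral[OF uC su sg] using lim' by (simp add: G_def t_def v_def)
 qed
 have c1: "c <= 1" using c by simp
 have sl: "x + t *R e : hs sg k" if e: "e : Basis" "e ~= ?e" "x : hs sg k" for e x t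
 proof -
  obtain i where "e = axis i 1" using e(1) by (auto simp: Basis_vec_def)
  thus ?thesis using e by (auto simp: hs_def axis_def split: if_splits)
 qed
 have "EX b. negligible (?E - (%x. x + b) ` ?K Un ((%x. x + b) ` ?K - ?E))"
  by (rule extremal_unique[OF open_hs _ _ N cap_open cap_bounded cap_convex cap_nonempty[OF sg c(1) c1 r] E fE ext vol])
   (rule cap_cone sl; assumption)+
 then obtain b where b: "negligible (?E - (%x. x + b) ` ?K Un ((%x. x + b) ` ?K - ?E))" by blast
 have img: "x : (%x. x + b) ` ?K <-> x - b : ?K" for x by (auto simp: image_iff algebra_simps intro: bexI[of _ "x - b"])
 have "AE x in lebesgue. x ~: ?E - (%x. x + b) ` ?K Un ((%x. x + b) ` ?K - ?E)"
  using b by (intro AE_not_in) (simp add: negligible_iff_null_sets)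
 hence "AEL x. x ~: ?E - (%x. x + b) ` ?K Un ((%x. x + b) ` ?K - ?E)" by (simp add: AE_completion_iff)
 hence AE: "AEL x. x : ?E <-> x - b : ?K" by eventually_elim (use img in auto)
 consider "sg * b $ k < 0" | "sg * b $ k > 0" | "b $ k = 0" using sg by (metis abs_zero linorder_neqE_linordered_idom mult_eq_0_iff zero_neq_one)
 thus ?thesis
 proof cases
  case 1
  \<comment> \<open>The part of the translated cap beyond the interface: open, non-empty, and yet
    null because \<open>?E\<close> misses it.\<close>
  define W where "W = {x. x - b : ?K & sg * x $ k < 0}"
  have "open W"
  proof -
   have "open ((%x. x - b) -` ?K)" by (intro open_vimage cap_open continuous_intros)
   moreover have "open {x::real^'n. sg * x $ k < 0}" by (intro open_Collect_less continuous_intros)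
   ultimately show ?thesis unfolding W_def by (simp add: Collect_conj_eq vimage_def open_Int)
  qed
  moreover have "W ~= {}"
  proof -
   \<comment> \<open>A height small enough to lie in the cap, whose top is at
     \<open>r * (1 + c)\<close>, and to be carried across the interface by \<open>b\<close>.\<close>
   define ta where "ta = min (r * (1 + c) / 2) (- (sg * b $ k) / 2)"
   have rc: "0 < r * (1 + c)" using r c by simp
   have ta: "0 < ta" "ta < r * (1 + c)" "ta < - (sg * b $ k)" using rc 1 by (auto simp: ta_def min_less_iff_disj)
   let ?x = "(ta * sg) *R ?e"
   have "sg * ?x $ k = ta * (sg * sg)" by simp
   hence xk: "sg * ?x $ k = ta" unfolding s by simp
   have "(c * r * sg) *R ?e - ?x = ((c * r - ta) * sg) *R ?e" by (simp add: algebra_simps)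
   hence "dist ((c * r * sg) *R ?e) ?x = <|c * r - ta|>" using sg by (simp add: dist_norm abs_mult)
   moreover have "<|c * r - ta|> < r"
   proof -
    have "c * r < r" using c r by simp
    thus ?thesis using ta by (simp add: abs_less_iff algebra_simps)
   qed
   ultimately have "?x : ?K" using ta(1) unfolding cap_def hs_def Int_iff mem_ball mem_Collect_eq xk by simp
   moreover have "sg * (?x + b) $ k < 0" using xk ta(3) unfolding vector_add_component distrib_left by linarith
   ultimately have "?x + b : W" by (simp add: W_def)
   thus ?thesis by blast
  qed
  moreover have "negligible W" by (rule negligible_subset[OF b]) (auto simp: W_def img hs_def)
  ultimately show ?thesis using open_not_negligible by blast
 next
  case 2
  define d where "d = sg * b $ k"
  have AE0: "AEL x. x : hs sg k --> x : Om --> d <= sg * x $ k"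
   using AE by eventually_elim (auto simp: d_def cap_def hs_def right_diff_distrib)
  have "EVS i. ep i < d / 5" using 2 by (intro order_tendstoD[OF ep(2)]) (simp add: d_def)
  hence t0: "EVS i. t i = 0"
  proof eventually_elim
   case (elim i)
   have "u i (proj k x) = 0" for x unfolding u_def
    by (rule trial_trace_zero[OF Om sg _ AE0 ep(1)]) (use elim 2 in \<open>auto simp: d_def\<close>)
   thus ?case by (simp add: t_def)
  qed
  \<comment> \<open>Radius of a whole ball (\<open>c = 1\<close>) with the volume of the cap. Once
    the traces vanish, the inequality for \<open>r'\<close> contradicts sharpness for
    \<open>r\<close>, since \<open>r' < r\<close>.\<close>
  define r' where "r' = r * root CARD('n) (cap_vol k c / cap_vol k 1)"
  have Vc: "0 < cap_vol k c" "cap_vol k c < cap_vol k 1" using cap_vol_pos[of c k] cap_vol_strict_mono[of c 1 k] c by auto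
  have q: "0 < cap_vol k c / cap_vol k 1" "cap_vol k c / cap_vol k 1 < 1" using Vc by auto
  have N0: "0 < CARD('n)" by simp
  have "root CARD('n) (cap_vol k c / cap_vol k 1) < 1" "0 < root CARD('n) (cap_vol k c / cap_vol k 1)"
   using q real_root_less_mono[OF N0 q(2)] real_root_gt_zero[OF N0 q(1)] by (auto simp: real_root_one)
  hence r': "0 < r'" "r' < r" using r by (auto simp: r'_def)
  have "r' ^ CARD('n) * cap_vol k 1 = r ^ CARD('n) * cap_vol k c"
   using q Vc by (simp add: r'_def power_mult_distrib real_root_pow_pos2[OF N0])
  hence vol': "vol ?E = vol (cap sg k 1 r')" using vol cap_measure[OF sg r, of k c] cap_measure[OF sg r'(1), of k 1] by simp
  have cu: "cont (u i)" for i by (rule C1_cont[OF uC])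
  have lm: "(%i. CARD('n) * (LBINT x:?E. min (u i x) 1)) ----> CARD('n) * v"
   unfolding v_def by (intro tendsto_mult tendsto_const min_integral_tendsto[OF cu su E fE hs_borel L1' E(1) order_refl])
  have ineq: "CARD('n) * (LBINT x:?E. min (u i x) 1) <= r' * (G i + 1 * t i)" for i
   unfolding G_def t_def by (rule cap_wulff_inequality[OF uC su u0 sg _ _ r'(1) E fE vol']) auto
  have "(%i. r' / r * (r * (G i + c * t i))) ----> r' / r * (real CARD('n) * v)" by (intro tendsto_mult tendsto_const lim')
  moreover have "EVS i. r' / r * (r * (G i + c * t i)) = r' * (G i + 1 * t i)"
   using t0 by eventually_elim (use r in simp)
  ultimately have "(%i. r' * (G i + 1 * t i)) ----> r' / r * (real CARD('n) * v)" by (rule Lim_transform_eventually)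
  from tendsto_le[OF _ this lm] ineq have "real CARD('n) * v <= r' / r * (real CARD('n) * v)" by simp
  moreover have "0 < real CARD('n) * v" unfolding v_def vol by (intro mult_pos_pos cap_measure_pos[OF sg c(1) c1 r]) simp
  moreover have "r' / r < 1" using r' r by simp
  ultimately show ?thesis by (smt (verit) mult_less_cancel_right2)
 next
  case 3
  have "AEL x. x : hs sg k --> (x : Om <-> dist (b + (c * r * sg) *R ?e) x < r)"
   using AE
  proof eventually_elim
   case (elim x)
   have "dist ((c * r * sg) *R ?e) (x - b) = dist (b + (c * r * sg) *R ?e) x" by (simp add: dist_norm algebra_simps)
   thus ?case using elim 3 by (auto simp: cap_def hs_def)
  qed
  thus ?thesis using 3 by (intro exI[of _ "b + (c * r * sg) *R ?e"]) simp
 qed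
qed

text \<open>The inequalities of the two sides are divided by \<open>r sg\<close> and weighted by
  \<open>rh sg\<close>. By \<open>balance\<close> the contact terms add up to \<open>l\<close> times
  the jump of the traces, which is at most \<open><|l|> * A\<close> in the limit. If the bound is
  attained, each side is sharp in the limit and \<open>extremal_half\<close> applies.\<close>

theorem two_cap_bound:
 fixes k :: "'n::finite" and Om :: "(real^'n) set" and rh c r v p :: "real => real"
 defines "v \<equiv> %sg. vol (Om Int hs sg k)" and "p \<equiv> %sg. enn2real (perimeter Om (hs sg k))"
 assumes N: "CARD('n) >= 2" and Om: "Om : bor" and c: "!!sg. pm sg ==> <|c sg|> < 1"
  and r: "!!sg. pm sg ==> 0 < r sg" and rh: "!!sg. pm sg ==> 0 < rh sg"
  and balance: "!!sg. pm sg ==> rh sg * c sg = - (sg * l)"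
  and fE: "!!sg. pm sg ==> fin (Om Int hs sg k)"
  and vol: "!!sg. pm sg ==> v sg = vol (cap sg k (c sg) (r sg))"
  and P: "!!sg. pm sg ==> perimeter Om (hs sg k) < \<infinity>"
  and A: "l ~= 0 ==> area k (bdry Om Int interface k) = ennreal A" "A >= 0"
 shows "rh 1 * (CARD('n) * v 1) / r 1 + rh (- 1) * (CARD('n) * v (- 1)) / r (- 1) <= rh 1 * p 1 + rh (- 1) * p (- 1) + <|l|> * A" (is ?G1)
  and "[|<|l|> <= g; rh 1 * p 1 + rh (- 1) * p (- 1) + g * A <= rh 1 * (CARD('n) * v 1) / r 1 + rh (- 1) * (CARD('n) * v (- 1)) / r (- 1)|]
   ==> EX q. (ALL sg. pm sg --> q sg $ k = c sg * r sg * sg & (AEL x. x : hs sg k --> (x : Om <-> dist (q sg) x < r sg))) &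
    g * A <= l * (disc_area k (q (- 1)) (r (- 1)) - disc_area k (q 1) (r 1))" (is "[|_; _|] ==> ?G3")
proof -
 obtain ep where pos: "!!i. 0 < ep i" and lim: "ep ----> 0"
  and jump: "!!i. ennreal <|LBINT x:slab k. trial Om k (- 1) (ep i) (Suc i) (proj k x) - trial Om k 1 (ep i) (Suc i) (proj k x)|>
   <= area k (bdry Om Int interface k) + ennreal (inv_Suc i)"
  and grad: "!!sg i. pm sg ==> EX Du. C1 (trial Om k sg (ep i) (Suc i)) Du & (LBINT x:hs sg k. norm (Du x))
   <= enn2real (perimeter Om (hs sg k)) + 4 * inv_Suc i * (vol (Om Int hs sg k) + inv_Suc i)"
  and L1: "!!sg. pm sg ==> (%i. LBINT x:hs sg k. <|trial Om k sg (ep i) (Suc i) x - ind (Om Int hs sg k) x|>) ----> 0"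
  using trial_sequence[OF Om fE P] by blast
 define u where "u sg i = trial Om k sg (ep i) (real (Suc i))" for sg i
 define N where "N = real CARD('n)"
 have c1: "- 1 < c sg" "c sg < 1" "c sg <= 1" if "pm sg" for sg using c[OF that] by auto
 define ea where "ea sg i = 4 * inv_Suc i * (v sg + inv_Suc i)" for sg i
 define Du where "Du sg i = (SOME Du. C1 (u sg i) Du & (LBINT x:hs sg k. norm (Du x)) <= p sg + ea sg i)" for sg i
 have Du: "C1 (u sg i) (Du sg i) & (LBINT x:hs sg k. norm (Du sg i x)) <= p sg + ea sg i" if "pm sg" for sg i
 proof -
  have "EX Du. C1 (u sg i) Du & (LBINT x:hs sg k. norm (Du x)) <= p sg + ea sg i"
   using grad[OF that, of i] unfolding u_def p_def ea_def v_def .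
  from someI_ex[OF this] show ?thesis unfolding Du_def .
 qed
 define G where "G sg i = (LBINT x:hs sg k. norm (Du sg i x))" for sg i
 define t where "t sg i = (LBINT x:slab k. u sg i (proj k x))" for sg i
 define m where "m sg i = (LBINT x:Om Int hs sg k. min (u sg i x) 1)" for sg i
 have su: "csupp (u sg i)" for sg i unfolding u_def by (rule csupp_trial) simp
 have cu: "cont (u sg i)" for sg i unfolding u_def by (rule continuous_trial[OF pos _ Om]) simp
 have u0: "0 <= u sg i x" for sg i x unfolding u_def by (rule trial_bounds[OF pos Om])
 have i1: "N * m sg i <= r sg * (G sg i + c sg * t sg i)" if sg: "pm sg" for sg i
  unfolding N_def m_def G_def t_def
  using Du[OF sg] by (intro cap_wulff_inequality[OF _ su u0 sg c1(1,3)[OF sg] r[OF sg] _ _ fE[OF sg] vol[OF sg, unfolded v_def]]) (use Om in auto)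
 have lm: "m sg ----> v sg" if sg: "pm sg" for sg
  unfolding m_def v_def
  by (rule min_integral_tendsto[OF cu su _ _ fE[OF sg] hs_borel]) (use Om L1[OF sg] in \<open>auto simp: u_def\<close>)
 have i2: "G sg i <= p sg + ea sg i" if "pm sg" for sg i using Du[OF that] by (simp add: G_def)
 have lea: "ea sg ----> 0" for sg
 proof -
  have "(%i. 4 * inv_Suc i * (v sg + inv_Suc i)) ----> 4 * 0 * (v sg + 0)"
   by (intro tendsto_intros LIMSEQ_inverse_real_of_nat)
  thus ?thesis by (simp add: ea_def[abs_def])
 qed
 \<comment> \<open>For \<open>l = 0\<close> the jump is multiplied by 0, and the boundary area may
   be infinite; so the estimate is claimed for \<open>l ~= 0\<close>.\<close>
 have i3: "<|t (- 1) i - t 1 i|> <= A + inv_Suc i" if "l ~= 0" for i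
 proof -
  have "t (- 1) i - t 1 i = (LBINT x:slab k. u (- 1) i (proj k x) - u 1 i (proj k x))"
   unfolding t_def by (rule set_integral_diff(2)[symmetric]) (intro set_integrable_slab cu su)+
  moreover have "ennreal <|LBINT x:slab k. u (- 1) i (proj k x) - u 1 i (proj k x)|> <= ennreal (A + inv_Suc i)"
   using jump[of i] A(1)[OF that] A(2) by (simp add: u_def ennreal_plus)
  moreover have "0 <= A + inv_Suc i" using A(2) by (intro add_nonneg_nonneg) auto
  ultimately show ?thesis by (simp only: ennreal_le_iff)
 qed
 define X where "X sg i = rh sg * G sg i - sg * l * t sg i" for sg i
 define y where "y sg = rh sg * (N * v sg) / r sg" for sg
 have X: "r sg * (G sg i + c sg * t sg i) = X sg i * r sg / rh sg" if sg: "pm sg" for sg i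
 proof -
  have "rh sg * (G sg i + c sg * t sg i) = rh sg * G sg i + (rh sg * c sg) * t sg i" by (simp add: algebra_simps)
  hence "X sg i = rh sg * (G sg i + c sg * t sg i)" unfolding balance[OF sg] by (simp add: X_def)
  thus ?thesis using rh[OF sg] by simp
 qed
 have YX: "rh sg * (N * m sg i) / r sg <= X sg i" if sg: "pm sg" for sg i
 proof -
  have "rh sg * (N * m sg i) <= rh sg * (X sg i * r sg / rh sg)" using i1[OF sg, of i] rh[OF sg] unfolding X[OF sg] by (intro mult_left_mono) auto
  thus ?thesis using rh[OF sg] r[OF sg] by (simp add: divide_le_eq)
 qed
 have lY: "(%i. rh sg * (N * m sg i) / r sg) ----> y sg" if sg: "pm sg" for sg
  unfolding y_def using r[OF sg] by (intro tendsto_intros lm sg) auto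
 have XX: "X 1 i + X (- 1) i = rh 1 * G 1 i + rh (- 1) * G (- 1) i + l * (t (- 1) i - t 1 i)" for i
  by (simp add: X_def algebra_simps)
 define th where "th i = rh 1 * ea 1 i + rh (- 1) * ea (- 1) i" for i
 have lth: "th ----> 0"
  using tendsto_add[OF tendsto_mult_right_zero[OF lea, of "rh 1" 1] tendsto_mult_right_zero[OF lea, of "rh (- 1)" "- 1"]]
  by (simp add: th_def[abs_def])
 have GG: "rh 1 * G 1 i + rh (- 1) * G (- 1) i <= rh 1 * p 1 + rh (- 1) * p (- 1) + th i" for i
  using mult_left_mono[OF i2[of 1 i], of "rh 1"] mult_left_mono[OF i2[of "- 1" i], of "rh (- 1)"] rh[of 1] rh[of "- 1"]
  by (simp add: th_def algebra_simps)
 have Xup: "X 1 i + X (- 1) i <= rh 1 * p 1 + rh (- 1) * p (- 1) + th i + <|l|> * (A + inv_Suc i)" for i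
 proof -
  have "l * (t (- 1) i - t 1 i) <= <|l|> * <|t (- 1) i - t 1 i|>" by (metis abs_ge_self abs_mult)
  also have "... <= <|l|> * (A + inv_Suc i)"
  proof (cases "l = 0")
   case False
   show ?thesis by (intro mult_left_mono i3[OF False]) simp
  qed simp
  finally show ?thesis unfolding XX using GG[of i] by linarith
 qed
 have lB: "(%i. rh 1 * p 1 + rh (- 1) * p (- 1) + th i + <|l|> * (A + inv_Suc i)) ----> rh 1 * p 1 + rh (- 1) * p (- 1) + 0 + <|l|> * (A + 0)"
  by (intro tendsto_intros lth LIMSEQ_inverse_real_of_nat)
 have Mle: "y 1 + y (- 1) <= rh 1 * p 1 + rh (- 1) * p (- 1) + <|l|> * A"
 proof -
  have "y 1 + y (- 1) <= rh 1 * p 1 + rh (- 1) * p (- 1) + 0 + <|l|> * (A + 0)"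
  proof (rule LIMSEQ_le[OF tendsto_add[OF lY lY] lB])
   show "EX n0. ALL i>=n0. rh 1 * (N * m 1 i) / r 1 + rh (- 1) * (N * m (- 1) i) / r (- 1)
     <= rh 1 * p 1 + rh (- 1) * p (- 1) + th i + <|l|> * (A + inv_Suc i)" (is "EX n0. ALL i>=n0. ?G2 i")
   proof (intro exI[of _ 0] allI impI)
    fix i
    show "?G2 i"
     using YX[of 1 i] YX[of "- 1" i] Xup[of i] by simp
   qed
  qed auto
  thus ?thesis by simp
 qed
 thus ?G1
  by (simp add: y_def N_def)
 assume g: "<|l|> <= g" and eq: "rh 1 * p 1 + rh (- 1) * p (- 1) + g * A <= rh 1 * (CARD('n) * v 1) / r 1 + rh (- 1) * (CARD('n) * v (- 1)) / r (- 1)"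
 have eq': "rh 1 * p 1 + rh (- 1) * p (- 1) + g * A <= y 1 + y (- 1)" using eq by (simp add: y_def N_def)
 have lA: "<|l|> * A <= g * A" using g A(2) by (rule mult_right_mono)
 have eqM: "rh 1 * p 1 + rh (- 1) * p (- 1) + <|l|> * A = y 1 + y (- 1)" "g * A = <|l|> * A" using eq' lA Mle by linarith+
 \<comment> \<open>Both terms of the sum have the lower bound \<open>YX\<close>, and the sum is
   bounded above by \<open>Xup\<close>; when the total is attained, subtracting the lower bound of
   the other side squeezes \<open>X sg\<close>.\<close>
 have lX: "X sg ----> y sg" if sg: "pm sg" for sg
 proof -
  have s: "sg = 1 | sg = - 1" using sg by linarith
  define B where "B i = rh 1 * p 1 + rh (- 1) * p (- 1) + th i + <|l|> * (A + inv_Suc i) - rh (- sg) * (N * m (- sg) i) / r (- sg)" for i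
  have "B ----> (rh 1 * p 1 + rh (- 1) * p (- 1) + 0 + <|l|> * (A + 0)) - y (- sg)"
   unfolding B_def by (intro tendsto_diff lB lY) (use sg in simp)
  moreover have "(rh 1 * p 1 + rh (- 1) * p (- 1) + 0 + <|l|> * (A + 0)) - y (- sg) = y sg" using eqM s by auto
  ultimately have lB': "B ----> y sg" by simp
  show ?thesis
  proof (rule tendsto_sandwich[OF _ _ lY[OF sg] lB'])
   show "EVS i. rh sg * (N * m sg i) / r sg <= X sg i" using YX[OF sg] by simp
   show "EVS i. X sg i <= B i"
   proof (intro always_eventually allI)
    fix i
    have "X sg i + X (- sg) i = X 1 i + X (- 1) i" using s by auto
    thus "X sg i <= B i" using Xup[of i] YX[of "- sg" i] sg unfolding B_def by simp
   qed
  qed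
 qed
 define xi where "xi i = y 1 + y (- 1) - (rh 1 * (N * m 1 i) / r 1 + rh (- 1) * (N * m (- 1) i) / r (- 1)) + th i" for i
 have lxi: "xi ----> 0"
 proof -
  have "xi ----> y 1 + y (- 1) - (y 1 + y (- 1)) + 0" unfolding xi_def by (intro tendsto_intros lY lth) auto
  thus ?thesis by simp
 qed
 \<comment> \<open>Attaining the total leaves at least \<open>g * A\<close>, up to a null sequence,
   for the jump term; in the limit this becomes a statement on the disc areas.\<close>
 have low: "g * A - xi i <= l * (t (- 1) i - t 1 i)" for i
  using YX[of 1 i] YX[of "- 1" i] XX[of i] GG[of i] eqM unfolding xi_def abs_one abs_minus by linarith
 have lN: "(%i. r sg * (G sg i + c sg * t sg i)) ----> N * v sg" if sg: "pm sg" for sg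
 proof -
  have "(%i. X sg i * r sg / rh sg) ----> y sg * r sg / rh sg" using rh[OF sg] by (intro tendsto_intros lX sg) auto
  moreover have "y sg * r sg / rh sg = N * v sg" using rh[OF sg] r[OF sg] by (simp add: y_def)
  ultimately show ?thesis by (simp only: X[OF sg])
 qed
 define Q where "Q sg x <-> x $ k = c sg * r sg * sg & (AEL y. y : hs sg k --> (y : Om <-> dist x y < r sg))" for sg and x :: "real^'n"
 define q where "q sg = (SOME x. Q sg x)" for sg
 have q: "Q sg (q sg)" if sg: "pm sg" for sg
 proof -
  have "EX x. Q sg x" unfolding Q_def
   by (rule extremal_half[OF N Om sg c1(1,2)[OF sg] r[OF sg] fE[OF sg] vol[OF sg, unfolded v_def] pos lim, of "Du sg"])
    (use Du[OF sg] lN[OF sg] L1[OF sg] in \<open>auto simp: u_def G_def t_def v_def N_def\<close>)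
  thus ?thesis unfolding q_def by (rule someI_ex)
 qed
 have qk: "<|q sg $ k|> < r sg" if "pm sg" for sg
  using q[OF that] c[OF that] r[OF that] that unfolding Q_def by (simp add: abs_mult)
 have lt: "t sg ----> disc_area k (q sg) (r sg)" if "pm sg" for sg
  unfolding t_def u_def by (rule cap_trace_tendsto[OF Om that qk[OF that] _ pos lim]) (use q[OF that] in \<open>simp add: Q_def\<close>)
 have "g * A - 0 <= l * (disc_area k (q (- 1)) (r (- 1)) - disc_area k (q 1) (r 1))"
  by (rule LIMSEQ_le[OF tendsto_diff[OF tendsto_const lxi] tendsto_mult[OF tendsto_const tendsto_diff[OF lt lt]]]) (use low in auto)
 thus ?G3
  using q unfolding Q_def by (intro exI[of _ q]) simp
qed

section \<open>The Lagrange multiplier\<close>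

definition cap_radius :: "'n::finite => real => real => real" where
 "cap_radius k v c = root CARD('n) (v / cap_vol k c)"

text \<open>By Pythagoras, the radius of the disc cut out of the interface by the sphere of the cap
  with volume \<open>v\<close> and parameter \<open>c\<close>.\<close>

definition disc_radius :: "'n::finite => real => real => real" where
 "disc_radius k v c = cap_radius k v c * sqrt (1 - c^2)"

lemma cap_radius:
 fixes k :: "'n::finite"
 assumes "- 1 < c" "c <= 1" "v > 0"
 shows "cap_radius k v c > 0" "cap_radius k v c ^ CARD('n) * cap_vol k c = v" (is ?G1)
proof -
 have q: "0 < v / cap_vol k c" using cap_vol_pos[OF assms(1,2), of k] assms(3) by simp
 show "cap_radius k v c > 0" unfolding cap_radius_def using q by (intro real_root_gt_zero) auto
 show ?G1
  unfolding cap_radius_def using q cap_vol_pos[OF assms(1,2), of k] by (subst real_root_pow_pos2) auto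
qed

lemma disc_radius_continuous:
 fixes k :: "'n::finite"
 shows "continuous_on {- 1<..1} (disc_radius k v)"
proof -
 have "continuous_on {- 1<..1} (cap_vol k)" by (rule continuous_on_subset[OF cap_vol_continuous]) simp
 moreover have "cap_vol k c ~= 0" if "c : {- 1<..1}" for c using cap_vol_pos[of c k] that by auto
 ultimately show ?thesis unfolding disc_radius_def cap_radius_def
  by (intro continuous_intros) auto
qed

lemma disc_radius_pos:
 assumes "- 1 < c" "c < 1" "v > 0" shows "disc_radius k v c > 0"
proof -
 have "c^2 < 1" using assms by (simp add: abs_square_less_1)
 thus ?thesis unfolding disc_radius_def using cap_radius(1)[of c v k] assms by simp
qed

lemma disc_radius_le:
 fixes k :: "'n::finite"
 assumes "0 <= c" "c <= 1" "v > 0" shows "disc_radius k v c <= cap_radius k v 0"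
proof -
 have "cap_vol k 0 <= cap_vol k c" using cap_vol_strict_mono[of 0 c k] assms by (cases "c = 0") auto
 hence "v / cap_vol k c <= v / cap_vol k 0" using cap_vol_pos[of 0 k] assms by (intro divide_left_mono) auto
 hence "cap_radius k v c <= cap_radius k v 0" unfolding cap_radius_def by (intro real_root_le_mono) auto
 moreover have "sqrt (1 - c^2) <= 1" "0 <= sqrt (1 - c^2)" using assms by (auto simp: abs_square_le_1)
 ultimately have "cap_radius k v c * sqrt (1 - c^2) <= cap_radius k v 0 * 1"
  using cap_radius(1)[of c v k] cap_radius(1)[of 0 v k] assms by (intro mult_mono) auto
 thus ?thesis by (simp add: disc_radius_def)
qed

lemma disc_radius_large:
 fixes k :: "'n::finite"
 assumes v: "v > 0" and B: "B >= 0"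
 obtains d where "- 1 < d" "d <= 0" "!!c. - 1 < c ==> c < d ==> B < disc_radius k v c"
proof -
 let ?n = "CARD('n) - 1"
 \<comment> \<open>Chosen such that \<open>sqrt (1 + c) < K\<close> makes the lower bound for the
   N-th power of the disc radius exceed \<open>B ^ CARD('n) + 1\<close>.\<close>
 define K where "K = v / (2 ^ ?n * (B ^ CARD('n) + 1))"
 have K: "K > 0" unfolding K_def using v B by (simp add: add_nonneg_pos)
 have "B < disc_radius k v c" if c: "- 1 < c" "c < min 0 (K^2 - 1)" for c
 proof -
  define s where "s = sqrt (1 - c^2)"
  have s1: "1 - c^2 = (1 - c) * (1 + c)" by (simp add: power2_eq_square algebra_simps)
  have s: "s > 0" unfolding s_def s1 using c by simp
  have V: "0 < cap_vol k c" using cap_vol_pos[of c k] c by simp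
  have "sqrt (1 + c) < K" using c K by (intro real_less_lsqrt) auto
  hence "v / K < v / sqrt (1 + c)" using v K c by (intro divide_strict_left_mono) auto
  moreover have "v / K = 2 ^ ?n * (B ^ CARD('n) + 1)" using v B by (simp add: K_def add_nonneg_pos less_imp_neq[symmetric])
  ultimately have "2 ^ ?n * (B ^ CARD('n) + 1) < v * (1 / sqrt (1 + c))" by simp
  also have "1 / sqrt (1 + c) <= s / (1 + c)"
  proof -
   have "s = sqrt (1 - c) * sqrt (1 + c)" unfolding s_def s1 by (rule real_sqrt_mult)
   hence "s / (1 + c) = sqrt (1 - c) / sqrt (1 + c)"
    using c real_sqrt_pow2[of "1 + c"] by (simp add: power2_eq_square field_simps)
   moreover have "1 <= sqrt (1 - c)" using c by simp
   ultimately show ?thesis using c by (simp add: divide_right_mono)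
  qed
  hence "v * (1 / sqrt (1 + c)) <= v * (s / (1 + c))" using v by (intro mult_left_mono) auto
  finally have "B ^ CARD('n) + 1 < v * s / ((1 + c) * 2 ^ ?n)"
   using c by (simp add: less_divide_eq mult_ac)
  also have "... = v * s ^ CARD('n) / ((1 + c) * (2 * s) ^ ?n)"
  proof -
   have "s ^ CARD('n) = s * s ^ ?n" by (simp add: power_eq_if)
   thus ?thesis using s by (simp add: power_mult_distrib)
  qed
  also have "... <= v * s ^ CARD('n) / cap_vol k c"
   using cap_vol_le[of c k] c v s V by (intro divide_left_mono) (auto simp: s_def)
  also have "... = disc_radius k v c ^ CARD('n)"
   using v V by (simp add: disc_radius_def cap_radius_def power_mult_distrib s_def)
  finally have "B ^ CARD('n) < disc_radius k v c ^ CARD('n)" by simp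
  moreover have "0 <= disc_radius k v c" using disc_radius_pos[of c v k] c v by simp
  ultimately show ?thesis by (rule power_less_imp_less_base)
 qed
 moreover have "- 1 < min 0 (K^2 - 1)" using K by simp
 ultimately show ?thesis using that[of "min 0 (K^2 - 1)"] by simp
qed

lemma disc_radius_scaled_continuous:
 fixes k :: "'n::finite"
 assumes "rh > 0"
 shows "S <= {- rh<..rh} ==> continuous_on S (%l. disc_radius k v (l / rh))"
  and "S <= {- rh..<rh} ==> continuous_on S (%l. disc_radius k v (- l / rh))"
proof -
 have "l / rh : {- 1<..1}" if "l : {- rh<..rh}" for l
  using that assms by (auto simp: less_divide_eq divide_le_eq)
 hence "(%l. l / rh) ` S <= {- 1<..1}" if "S <= {- rh<..rh}" for S using that by blast
 thus 1: "continuous_on S (%l. disc_radius k v (l / rh))" if "S <= {- rh<..rh}" for S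
  using that assms by (intro continuous_on_compose2[OF disc_radius_continuous] continuous_intros) auto
 show "continuous_on S (%l. disc_radius k v (- l / rh))" if "S <= {- rh..<rh}"
  using that by (intro continuous_on_compose2[OF 1[OF order_refl], of S uminus] continuous_intros) auto
qed

text \<open>If \<open>rh1 < rh2\<close>, the first disc shrinks to a point as \<open>l\<close> tends
  to \<open>rh1\<close>, while the second keeps a positive radius. Otherwise \<open>l\<close> is
  taken close to \<open>rh2\<close>, where the second radius is unbounded and the first stays below
  that of the half-ball.\<close>

lemma disc_radius_crossing:
 fixes k :: "'n::finite"
 assumes "v1 > 0" "v2 > 0" "rh1 > 0" "rh2 > 0"
 shows "EX l. 0 <= l & l < rh1 & l < rh2 & disc_radius k v1 (l / rh1) < disc_radius k v2 (- l / rh2)"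
proof (cases "rh1 < rh2")
 case True
 define ph where "ph l = disc_radius k v2 (- l / rh2) - disc_radius k v1 (l / rh1)" for l
 have "continuous_on {0..rh1} ph" unfolding ph_def
  using assms True by (intro continuous_on_diff disc_radius_scaled_continuous) auto
 moreover have "ph rh1 > 0"
  using assms True disc_radius_pos[of "- rh1 / rh2" v2 k] by (simp add: ph_def disc_radius_def minus_less_iff[of _ 1] divide_less_eq less_divide_eq)
 moreover have "rh1 : {0..rh1}" using assms by simp
 ultimately have "(ph ~~> ph rh1) (at rh1 within {0..rh1})" by (simp add: continuous_on_def)
 hence "\<forall>\<^sub>F l in at rh1 within {0..rh1}. ph l > 0" by (rule order_tendstoD) fact
 moreover have "at rh1 within {0..rh1} = at_left rh1" using assms by (simp add: at_within_Icc_at_left)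
 moreover have "\<forall>\<^sub>F l in at_left rh1. l : {0<..<rh1}" using assms by (intro eventually_at_leftI) auto
 ultimately have "\<forall>\<^sub>F l in at_left rh1. ph l > 0 & l : {0<..<rh1}" by (auto intro: eventually_conj)
 then obtain l where "ph l > 0" "l : {0<..<rh1}" using eventually_happens[of _ "at_left rh1"] by (auto simp: trivial_limit_at_left_real)
 thus ?thesis using True by (intro exI[of _ l]) (auto simp: ph_def)
next
 case False
 let ?B = "cap_radius k v1 0"
 have "?B >= 0" using cap_radius(1)[of 0 v1 k] assms by simp
 from disc_radius_large[OF assms(2) this, of k] obtain d where d: "- 1 < d" "d <= 0" "!!c. - 1 < c ==> c < d ==> ?B < disc_radius k v2 c" by blast
 define c where "c = (- 1 + d) / 2"
 have c: "- 1 < c" "c < d" "c < 0" using d by (auto simp: c_def)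
 define l where "l = - c * rh2"
 have "0 < (1 + c) * rh2" "c * rh2 < 0" using c assms by (auto intro: mult_neg_pos)
 hence l: "0 <= l" "l < rh2" "- l / rh2 = c" using assms by (auto simp: l_def algebra_simps)
 hence "l < rh1" using False by simp
 hence "disc_radius k v1 (l / rh1) <= ?B" using l assms by (intro disc_radius_le) auto
 also have "... < disc_radius k v2 (- l / rh2)" unfolding l(3) by (rule d(3)[OF c(1,2)])
 finally show ?thesis using l \<open>l < rh1\<close> by blast
qed

text \<open>The difference \<open>h\<close> of the disc radii changes sign while both angles stay
  admissible. If the bound \<open>g\<close> cuts off the sign change, the multiplier sticks at an
  endpoint, and the sign of \<open>h\<close> tells which disc is the larger one; discs of different
  size lead to type II.\<close>

lemma multiplier_exists:
 fixes k :: "'n::finite"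
 assumes v: "vn > 0" "vp > 0" and rh: "rhn > 0" "rhp > 0" and g: "g >= 0"
 obtains l where "<|l|> <= g" "<|l|> < rhn" "<|l|> < rhp"
  "disc_radius k vn (l / rhn) = disc_radius k vp (- l / rhp)
   | l = g & disc_radius k vn (l / rhn) >= disc_radius k vp (- l / rhp)
   | l = - g & disc_radius k vn (l / rhn) <= disc_radius k vp (- l / rhp)"
proof -
 define h where "h l = disc_radius k vn (l / rhn) - disc_radius k vp (- l / rhp)" for l
 define rh0 where "rh0 = min rhn rhp"
 have hc: "continuous_on {a..b} h" if "- rh0 < a" "b < rh0" for a b
  unfolding h_def
  using rh that by (intro continuous_on_diff disc_radius_scaled_continuous) (auto simp: rh0_def)
 obtain l1 where l1: "0 <= l1" "l1 < rh0" "h l1 < 0" using disc_radius_crossing[OF v rh, of k] by (auto simp: h_def rh0_def)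
 obtain l2 where l2: "0 <= l2" "l2 < rh0" "h (- l2) > 0" using disc_radius_crossing[OF v(2,1) rh(2,1), of k] by (auto simp: h_def rh0_def)
 have zero: "EX l. a <= l & l <= b & h l = 0" if "- rh0 < a" "b < rh0" "a <= b" "h a > 0" "h b < 0" for a b
  using IVT2'[of h b 0 a] hc[OF that(1,2)] that by auto
 show ?thesis
 proof (cases "g < rh0")
  case True
  consider "h g >= 0" | "h (- g) <= 0" | "h g < 0" "h (- g) > 0" by linarith
  thus ?thesis
  proof cases
   case 1 thus ?thesis using that[of g] True g by (auto simp: h_def rh0_def)
  next
   case 2 thus ?thesis using that[of "- g"] True g by (auto simp: h_def rh0_def)
  next
   case 3
   then obtain l where "- g <= l" "l <= g" "h l = 0" using zero[of "- g" g] True g by auto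
   thus ?thesis using that[of l] True by (auto simp: h_def rh0_def)
  qed
 next
  \<comment> \<open>Here \<open><|l|> < rh0\<close> implies \<open><|l|> <= g\<close>, so the zero
    of \<open>h\<close> can be used directly.\<close>
  case False
  obtain l where l: "- l2 <= l" "l <= l1" "h l = 0" using zero[of "- l2" l1] l1 l2 by auto
  hence "<|l|> < rh0" using l1 l2 by auto
  thus ?thesis using that[of l] l False by (auto simp: h_def rh0_def)
 qed
qed

lemma disc_area_eq:
 assumes "<|q $ k|> < r"
 shows "disc_area k q r = vol (cyl k (ball (proj k q) (sqrt (r^2 - (q $ k)^2))))"
proof -
 have "cyl k (ball q r) = cyl k (ball (proj k q) (sqrt (r^2 - (q $ k)^2)))"
  using flat_dist(1)[OF _ assms, of "proj k _"] by auto
 thus ?thesis by (simp add: disc_area_def)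
qed

section \<open>Unions of two caps\<close>

lemma sign_cases: "pm sg ==> sg = 1 | sg = (- 1 :: real)"
 by linarith

text \<open>The segment from \<open>x\<close> to an inner point \<open>z\<close> of the cap, taken
  over the centre of its disc, enters the cap at once.\<close>

lemma in_closure_inside:
 fixes q x :: "real^'n"
 assumes sg: "pm sg" and q: "<|q $ k|> < r" and x: "0 <= sg * x $ k" "dist q x <= r"
 shows "x : closure (ball q r Int hs sg k)"
proof -
 have s: "sg * sg = 1" using sg by (rule sign_square)
 define h where "h = (r + <|q $ k|>) / 2"
 have h: "<|q $ k|> < h" "h < r" using q by (auto simp: h_def)
 define z where "z = proj k q + (sg * (h - <|q $ k|>)) *R axis k 1"
 have "sg * z $ k = (sg * sg) * (h - <|q $ k|>)" by (simp add: z_def)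
 hence zk: "sg * z $ k > 0" unfolding s using h by simp
 have "q - z = (q $ k - sg * (h - <|q $ k|>)) *R axis k 1" by (simp add: z_def proj_def algebra_simps)
 hence "dist q z = <|q $ k - sg * (h - <|q $ k|>)|>" by (simp add: dist_norm)
 also have "... <= <|q $ k|> + (h - <|q $ k|>)" using sg h abs_triangle_ineq4[of "q $ k" "sg * (h - <|q $ k|>)"] by (simp add: abs_mult)
 finally have z: "dist q z < r" using h by simp
 show ?thesis
  unfolding closure_approachable
 proof (intro allI impI)
  fix e :: real assume e: "e > 0"
  define t where "t = min 1 (e / (norm (z - x) + 1))"
  have t: "0 < t" "t <= 1" using e by (auto simp: t_def add_nonneg_pos)
  let ?y = "x + t *R (z - x)"
  have "q - ?y = (1 - t) *R (q - x) + t *R (q - z)" by (simp add: algebra_simps)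
  hence "dist q ?y <= norm ((1 - t) *R (q - x)) + norm (t *R (q - z))"
   unfolding dist_norm using norm_triangle_ineq by metis
  also have "... = (1 - t) * dist q x + t * dist q z" using t by (simp add: dist_norm)
  also have "... < (1 - t) * r + t * r" using z x(2) t by (intro add_le_less_mono mult_left_mono) auto
  also have "... = r" by (simp add: algebra_simps)
  finally have "?y : ball q r" by simp
  moreover have "sg * ?y $ k = (1 - t) * (sg * x $ k) + t * (sg * z $ k)" by (simp add: algebra_simps)
  hence "?y : hs sg k" using zk x(1) t by (simp add: hs_def add_nonneg_pos)
  moreover have "dist ?y x < e"
  proof -
   have "dist ?y x = t * norm (z - x)" using t by (simp add: dist_norm)
   also have "... <= e / (norm (z - x) + 1) * norm (z - x)" by (intro mult_right_mono) (auto simp: t_def)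
   also have "... < e" using e by (simp add: divide_less_eq add_nonneg_pos)
   finally show ?thesis .
  qed
  ultimately show "EX y:ball q r Int hs sg k. dist y x < e" by blast
 qed
qed

lemma in_closure_outside:
 fixes q x :: "real^'n"
 assumes sg: "pm sg" and q: "<|q $ k|> < r" and x: "0 <= sg * x $ k" "r <= dist q x"
 shows "x : closure (hs sg k - cball q r)"
proof -
 have s: "sg * sg = 1" using sg by (rule sign_square)
 have r: "r > 0" using q by linarith
 text \<open>A direction \<open>w\<close> leading away from \<open>q\<close> into the half-space.\<close>
 obtain w where w: "w ~= 0" "(x - q) <.> w >= 0" "!!t. 0 < t ==> t <= 1 ==> 0 < sg * (x + t *R w) $ k"
 proof (cases "sg * x $ k = 0")
  case True
  hence xk: "x $ k = 0" using sg by auto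
  define A where "A = (dist (proj k q) x)^2"
  have "r^2 <= (dist q x)^2" using x(2) r by (intro power_mono) auto
  moreover have "<|q $ k|>^2 < r^2" using q by (intro power_strict_mono) auto
  ultimately have A: "A > 0" using interface_dist[OF xk, of q] unfolding A_def power2_abs by linarith
  \<comment> \<open>Small enough that the normal part of \<open>w\<close> costs at most the
    tangential gain: \<open>ea * <|q $ k|> <= A\<close>.\<close>
  define ea where "ea = A / (<|q $ k|> + 1)"
  have ea: "ea > 0" using A by (simp add: ea_def add_nonneg_pos)
  have "<|q $ k|> * A <= A * (<|q $ k|> + 1)" using A by (simp add: algebra_simps)
  hence eaA: "ea * <|q $ k|> <= A" by (simp add: ea_def divide_le_eq add_nonneg_pos mult.commute)
  define w where "w = (x - proj k q) + (ea * sg) *R axis k 1"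
  have wk: "w $ k = ea * sg" using xk by (simp add: w_def)
  have "(x - q) <.> w = A - ea * sg * q $ k"
  proof -
   define d where "d = x - proj k q"
   have "x - q = d - (q $ k) *R axis k 1" by (simp add: d_def proj_def)
   moreover have "d <.> axis k 1 = 0" "axis k 1 <.> d = 0" using xk by (simp_all add: d_def inner_axis inner_commute[of "axis k 1"])
   moreover have "A = d <.> d" by (simp add: A_def d_def dist_norm norm_minus_commute power2_norm_eq_inner)
   moreover have "w = d + (ea * sg) *R axis k 1" by (simp add: w_def d_def)
   ultimately show ?thesis by (simp add: inner_add_right inner_diff_left inner_axis)
  qed
  moreover have "ea * sg * q $ k <= ea * <|q $ k|>"
  proof -
   have "sg * q $ k <= <|q $ k|>" using abs_ge_self[of "sg * q $ k"] sg by (simp add: abs_mult)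
   thus ?thesis using ea by (simp add: mult.assoc)
  qed
  ultimately have "(x - q) <.> w >= 0" using eaA by linarith
  moreover have "w ~= 0" using wk ea sg by auto
  moreover have "0 < sg * (x + t *R w) $ k" if "0 < t" for t
  proof -
   have "sg * (x + t *R w) $ k = t * ea * (sg * sg)" using xk wk by (simp add: mult_ac)
   thus ?thesis unfolding s using that ea by simp
  qed
  ultimately show ?thesis using that by blast
 next
  case False
  hence pos: "0 < sg * x $ k" using x(1) by linarith
  define be where "be = sg * x $ k / (2 * (<|x $ k - q $ k|> + 1))"
  have be: "be > 0" using pos by (simp add: be_def add_nonneg_pos)
  have "x - q ~= 0" using x(2) r by auto
  hence "be *R (x - q) ~= 0" using be by simp
  moreover have "(x - q) <.> (be *R (x - q)) >= 0" using be by simp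
  moreover have "0 < sg * (x + t *R (be *R (x - q))) $ k" if t: "0 < t" "t <= 1" for t
  proof -
   have "<|sg * (t * (be * (x $ k - q $ k)))|> = t * (be * <|x $ k - q $ k|>)" using sg t be by (simp add: abs_mult)
   also have "... <= 1 * (be * <|x $ k - q $ k|>)" using t be by (intro mult_right_mono) auto
   also have "... < be * (2 * (<|x $ k - q $ k|> + 1))" using be by simp
   also have "... = sg * x $ k"
   proof -
    have "0 < 2 * (<|x $ k - q $ k|> + 1)" by (rule mult_pos_pos) (simp_all add: add_nonneg_pos)
    hence "2 * (<|x $ k - q $ k|> + 1) ~= 0" by (rule less_imp_neq[symmetric])
    thus ?thesis unfolding be_def by (rule nonzero_eq_divide_eq[THEN iffD1]) (rule refl)
   qed
   finally have "<|sg * (t * (be * (x $ k - q $ k)))|> < sg * x $ k" .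
   thus ?thesis by (simp add: distrib_left)
  qed
  ultimately show ?thesis using that by blast
 qed
 show ?thesis
  unfolding closure_approachable
 proof (intro allI impI)
  fix e :: real assume e: "e > 0"
  define t where "t = min 1 (e / (norm w + 1))"
  have t: "0 < t" "t <= 1" using e by (auto simp: t_def add_nonneg_pos)
  let ?y = "x + t *R w"
  have "r^2 <= (norm (x - q))^2" using x(2) r by (intro power_mono) (auto simp: dist_norm norm_minus_commute)
  also have "... < (norm (x - q))^2 + 2 * t * ((x - q) <.> w) + t^2 * (norm w)^2"
   using w t by (simp add: add_nonneg_pos)
  also have "... = (norm ((x - q) + t *R w))^2"
   using dot_norm[of "x - q" "t *R w"] by (simp add: power_mult_distrib)
  finally have "r^2 < (norm (?y - q))^2" by (simp add: algebra_simps)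
  hence "r < norm (?y - q)" by (rule power2_less_imp_less) simp
  hence "?y : hs sg k - cball q r" using w(3)[OF t] by (auto simp: hs_def dist_norm norm_minus_commute)
  moreover have "dist ?y x < e"
  proof -
   have "dist ?y x = t * norm w" using t by (simp add: dist_norm)
   also have "... <= e / (norm w + 1) * norm w" by (intro mult_right_mono) (auto simp: t_def)
   also have "... < e" using e by (simp add: divide_less_eq add_nonneg_pos)
   finally show ?thesis .
  qed
  ultimately show "EX y:hs sg k - cball q r. dist y x < e" by blast
 qed
qed

lemma open_AE_nonempty:
 fixes W :: "'a::euclidean_space set"
 assumes W: "open W" "W ~= {}" and AE: "AEL x. x : W --> P x" shows "EX x:W. P x"
proof (rule ccontr)
 assume "~ (EX x:W. P x)"
 with AE have "AEL x. x ~: W" by (auto elim: eventually_mono)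
 hence "W : null_sets lborel" using W(1) by (subst AE_iff_null_sets) auto
 hence "negligible W" by (simp add: negligible_iff_null_sets null_sets_completionI)
 thus False using open_not_negligible[OF W] by blast
qed

lemma bdry_of_open:
 fixes Om :: "(real^'n) set"
 assumes Om: "Om : bor" and U: "open U" "U <= Om" "x : closure U" and V: "open V" "V Int Om = {}" "x : closure V"
 shows "x : bdry Om"
proof (rule ccontr)
 assume "x ~: bdry Om"
 then obtain r where r: "r > 0" "null_or_full Om x r"
  using not_bdryE[OF Om] by blast
 have ne: "U Int ball x r ~= {}" "V Int ball x r ~= {}"
  using U(3) V(3) r(1) unfolding closure_approachable by (force simp: dist_commute)+
 from r(2) show False
 proof
  assume "AEL y. y : ball x r --> y : Om"
  hence "AEL y. y : V Int ball x r --> y : Om" by (auto elim: eventually_mono)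
  from open_AE_nonempty[OF _ ne(2) this] V show False by blast
 next
  assume "AEL y. y : ball x r --> y ~: Om"
  hence "AEL y. y : U Int ball x r --> y ~: Om" by (auto elim: eventually_mono)
  from open_AE_nonempty[OF _ ne(1) this] U show False by blast
 qed
qed

lemma bdry_AE_cong:
 fixes Om :: "(real^'n) set"
 assumes Om: "Om : sets lebesgue" "Om' : sets lebesgue" and AE: "AEL x. x : Om <-> x : Om'"
 shows "bdry Om = bdry Om'"
proof -
 have AE': "AE x in lebesgue. x : Om <-> x : Om'" using AE by (simp add: AE_completion_iff)
 have "emeasure lebesgue (Om Int ball x r) = emeasure lebesgue (Om' Int ball x r)" for x r
  by (rule emeasure_eq_AE) (use AE' Om in \<open>auto elim: eventually_mono\<close>)
 thus ?thesis by (simp add: bdry_def)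
qed

text \<open>The interface, a null set, is left out; a normalized representative contains the part of
  it that joins the caps.\<close>

definition two_caps :: "'n => (real => real^'n) => (real => real) => (real^'n) set" where
 "two_caps k q r = (ball (q 1) (r 1) Int hs 1 k) Un (ball (q (- 1)) (r (- 1)) Int hs (- 1) k)"

lemma two_caps_borel [measurable]: "two_caps k q r : bor"
 unfolding two_caps_def by measurable

lemma two_caps_hs:
 assumes "pm sg" "x : hs sg k" shows "x : two_caps k q r <-> dist (q sg) x < r sg"
 using assms sign_cases[OF assms(1)] by (auto simp: two_caps_def hs_def)

lemma hs_avoid:
 assumes "x $ k ~= 0" shows "EX sg. pm sg & x : hs sg k"
 by (rule exI[of _ "sgn (x $ k)"]) (use assms in \<open>auto simp: hs_def sgn_if\<close>)

lemma near_hs: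
 fixes P :: "real => real^'n => bool"
 assumes "!!sg. pm sg ==> 0 <= sg * x $ k ==> EX de>0. ALL y:ball x de. P sg y"
 shows "EX de>0. ALL y:ball x de. ALL sg. pm sg --> y : hs sg k --> P sg y"
proof -
 have one: "EX de>0. ALL y:ball x de. y : hs sg k --> P sg y" if sg: "pm sg" for sg
 proof (cases "0 <= sg * x $ k")
  case True thus ?thesis using assms[OF sg] by blast
 next
  case False
  have "y ~: hs sg k" if "y : ball x (- (sg * x $ k))" for y
  proof -
   have "<|sg * (y - x) $ k|> <= norm (y - x)" using component_le_norm_cart[of "y - x" k] sg by (simp add: abs_mult)
   thus ?thesis using that by (simp add: hs_def dist_norm norm_minus_commute right_diff_distrib)
  qed
  thus ?thesis using False by (intro exI[of _ "- (sg * x $ k)"]) auto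
 qed
 obtain d1 where d1: "d1 > 0" "ALL y:ball x d1. y : hs 1 k --> P 1 y" using one[of 1] by auto
 obtain d2 where d2: "d2 > 0" "ALL y:ball x d2. y : hs (- 1) k --> P (- 1) y" using one[of "- 1"] by auto
 show ?thesis
  by (intro exI[of _ "min d1 d2"]) (use d1 d2 sign_cases in fastforce)
qed

lemma near_inside:
 fixes x :: "real^'n"
 assumes "!!sg. pm sg ==> 0 <= sg * x $ k ==> dist (q sg) x < r sg"
 shows "EX de>0. AEL y. y : ball x de --> y : two_caps k q r"
proof -
 have "EX de>0. ALL y:ball x de. ALL sg. pm sg --> y : hs sg k --> dist (q sg) y < r sg"
 proof (rule near_hs)
  fix sg :: real assume "pm sg" "0 <= sg * x $ k"
  from assms[OF this] have "x : ball (q sg) (r sg)" by simp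
  then obtain de where "de > 0" "ball x de <= ball (q sg) (r sg)" using open_contains_ball open_ball by blast
  thus "EX de>0. ALL y:ball x de. dist (q sg) y < r sg" by (intro exI[of _ de]) (auto simp: subset_iff)
 qed
 then obtain de where de: "de > 0" "!!y sg. y : ball x de ==> pm sg ==> y : hs sg k ==> dist (q sg) y < r sg" by blast
 have "AEL y. y <.> (axis k 1 :: real^'n) ~= 0" by (rule AE_hyperplane) simp
 hence "AEL y. y : ball x de --> y : two_caps k q r"
 proof eventually_elim
  case (elim y)
  hence "y $ k ~= 0" by (simp add: inner_axis)
  then obtain sg where "pm sg" "y : hs sg k" using hs_avoid by blast
  thus ?case using de(2)[of y sg] two_caps_hs[of sg y k q r] by blast
 qed
 thus ?thesis using de(1) by blast
qed

lemma near_outside: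
 assumes "!!sg. pm sg ==> 0 <= sg * x $ k ==> r sg < dist (q sg) x"
 shows "EX de>0. ALL y:ball x de. y ~: two_caps k q r"
proof -
 have "EX de>0. ALL y:ball x de. ALL sg. pm sg --> y : hs sg k --> r sg < dist (q sg) y"
 proof (rule near_hs)
  fix sg :: real assume "pm sg" "0 <= sg * x $ k"
  from assms[OF this] have "x : - cball (q sg) (r sg)" by simp
  moreover have "open (- cball (q sg) (r sg))" by (simp add: open_Compl)
  ultimately obtain de where "de > 0" "ball x de <= - cball (q sg) (r sg)" using open_contains_ball by blast
  thus "EX de>0. ALL y:ball x de. r sg < dist (q sg) y" by (intro exI[of _ de]) force
 qed
 then obtain de where de: "de > 0" "!!y sg. y : ball x de ==> pm sg ==> y : hs sg k ==> r sg < dist (q sg) y" by blast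
 have "y ~: two_caps k q r" if "y : ball x de" for y
  using de(2)[OF that, of 1] de(2)[OF that, of "- 1"] by (auto simp: two_caps_def)
 thus ?thesis using de(1) by blast
qed

text \<open>The closed condition \<open>0 <= sg * x $ k\<close> selects one side for a point off the
  interface and both sides for a point on it.\<close>

abbreviation "meets k q r x \<equiv> EX sg. pm sg & 0 <= sg * x $ k & dist (q sg) x <= r sg"

abbreviation "avoids k q r x \<equiv> EX sg. pm sg & 0 <= sg * x $ k & r sg <= dist (q sg) x"

text \<open>A side witnessing \<open>meets\<close> supplies open pieces of the set arbitrarily close
  to \<open>x\<close>, a side witnessing \<open>avoids\<close> supplies open pieces of the
  complement; at an interface point the two sides may differ.\<close>

lemma bdry_two_caps:
 assumes q: "!!sg. pm sg ==> <|q sg $ k|> < r sg"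
 shows "x : bdry (two_caps k q r) <-> meets k q r x & avoids k q r x"
proof
 assume x: "x : bdry (two_caps k q r)"
 show "meets k q r x & avoids k q r x"
 proof (rule ccontr)
  assume "~ ?thesis"
  then consider "!!sg. pm sg ==> 0 <= sg * x $ k ==> r sg < dist (q sg) x" | "!!sg. pm sg ==> 0 <= sg * x $ k ==> dist (q sg) x < r sg"
   by (meson not_le)
  thus False
  proof cases
   case 1
   from near_outside[of x k r q] 1 obtain de where "de > 0" "ALL y:ball x de. y ~: two_caps k q r" by blast
   thus False using not_bdryI[OF two_caps_borel, of de x k q r] x by (auto intro: AE_I2)
  next
   case 2
   from near_inside[of x k q r] 2 obtain de where "de > 0" "AEL y. y : ball x de --> y : two_caps k q r" by blast
   thus False using not_bdryI[OF two_caps_borel, of de x k q r] x by blast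
  qed
 qed
next
 assume "meets k q r x & avoids k q r x"
 then obtain sg ta where sg: "pm sg" "0 <= sg * x $ k" "dist (q sg) x <= r sg" and ta: "<|ta|> = 1" "0 <= ta * x $ k" "r ta <= dist (q ta) x" by blast
 show "x : bdry (two_caps k q r)"
 proof (rule bdry_of_open[OF two_caps_borel])
  show "open (ball (q sg) (r sg) Int hs sg k)" "open (hs ta k - cball (q ta) (r ta))" using open_hs by auto
  show "ball (q sg) (r sg) Int hs sg k <= two_caps k q r" by (auto simp: two_caps_hs[OF sg(1)])
  show "(hs ta k - cball (q ta) (r ta)) Int two_caps k q r = {}" by (auto simp: two_caps_hs[OF ta(1)])
  show "x : closure (ball (q sg) (r sg) Int hs sg k)" by (rule in_closure_inside[OF sg(1) q[OF sg(1)] sg(2,3)])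
  show "x : closure (hs ta k - cball (q ta) (r ta))" by (rule in_closure_outside[OF ta(1) q[OF ta(1)] ta(2,3)])
 qed
qed

lemma rim_sphere:
 fixes q :: "real^'n"
 assumes sg: "pm sg" and q: "<|q $ k|> < r"
 shows "rim k (sphere q r Int hs sg k) = sphere (proj k q) (sqrt (r^2 - (q $ k)^2)) Int interface k"
proof -
 let ?a = "sqrt (r^2 - (q $ k)^2)"
 have "closure (sphere q r Int hs sg k) <= sphere q r" by (intro closure_minimal) auto
 hence "rim k (sphere q r Int hs sg k) <= sphere q r Int interface k" by (auto simp: rim_def)
 moreover have "sphere q r Int interface k = sphere (proj k q) ?a Int interface k"
  using flat_dist(3)[OF _ q] by (auto simp: interface_def)
 moreover have "sphere q r Int interface k <= rim k (sphere q r Int hs sg k)"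
 proof
  fix x assume x: "x : sphere q r Int interface k"
  hence xk: "x $ k = 0" and xr: "dist q x = r" by (auto simp: interface_def)
  have s: "sg * sg = 1" using sg by (rule sign_square)
  have a2: "(dist (proj k q) x)^2 = r^2 - (q $ k)^2" using interface_dist[OF xk, of q] xr by simp
  have "<|q $ k|>^2 < r^2" using q by (intro power_strict_mono) auto
  hence a: "?a > 0" "r^2 - (q $ k)^2 > 0" by auto
  \<comment> \<open>A curve on the sphere that starts at \<open>x\<close> and enters the half-space,
    parametrised by its height \<open>h\<close>.\<close>
  define ph where "ph h = proj k q + (sqrt (r^2 - (sg * h - q $ k)^2) / ?a) *R (x - proj k q) + (sg * h) *R axis k 1" for h :: real
  have phk: "ph h $ k = sg * h" for h using xk by (simp add: ph_def)
  have phs: "dist q (ph h) = r" if "<|sg * h - q $ k|> < r" for h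
  proof -
   have "<|sg * h - q $ k|>^2 < r^2" using that by (intro power_strict_mono) auto
   hence p: "0 <= r^2 - (sg * h - q $ k)^2" by simp
   let ?c = "sqrt (r^2 - (sg * h - q $ k)^2) / ?a"
   have e: "ph h - q = ?c *R (x - proj k q) + (sg * h - q $ k) *R axis k 1" by (simp add: ph_def proj_def algebra_simps)
   have "orthogonal (?c *R (x - proj k q)) ((sg * h - q $ k) *R axis k 1)" using xk by (simp add: orthogonal_def inner_axis)
   from norm_add_Pythagorean[OF this] have "(norm (ph h - q))^2 = ?c^2 * (dist (proj k q) x)^2 + (sg * h - q $ k)^2"
    unfolding e by (simp only: norm_scaleR power_mult_distrib power2_abs dist_norm norm_minus_commute[of "proj k q"] norm_axis_1 power_one mult_1_right)
   also have "?c^2 * (dist (proj k q) x)^2 = r^2 - (sg * h - q $ k)^2"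
    unfolding a2 using p a by (simp add: power_divide)
   finally have "(dist q (ph h))^2 = r^2" by (simp add: dist_norm norm_minus_commute)
   thus ?thesis using q by (simp add: power2_eq_iff_nonneg)
  qed
  have "ph 0 = x" using a by (simp add: ph_def)
  moreover have "(ph ~~> ph 0) (at_right 0)"
  proof -
   have "(%h. ph h) \<midarrow>0\<rightarrow> ph 0" unfolding ph_def by (intro tendsto_intros) (use a in auto)
   thus ?thesis by (rule filterlim_at_split[THEN iffD1, THEN conjunct2])
  qed
  moreover have "\<forall>\<^sub>F h in at_right 0. ph h : sphere q r Int hs sg k"
  proof -
   have "\<forall>\<^sub>F h in at_right 0. h : {0<..<r - <|q $ k|>}" using q by (intro eventually_at_rightI) auto
   thus ?thesis
   proof eventually_elim
    case (elim h)
    have "<|sg * h - q $ k|> <= <|h|> + <|q $ k|>" using sg abs_triangle_ineq4[of "sg * h" "q $ k"] by (simp add: abs_mult)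
    hence "dist q (ph h) = r" using elim by (intro phs) auto
    moreover have "sg * ph h $ k = h" unfolding phk using s by (simp add: mult.assoc[symmetric])
    ultimately show ?case using elim by (simp add: hs_def)
   qed
  qed
  moreover from this have "\<forall>\<^sub>F h in at_right 0. ph h : closure (sphere q r Int hs sg k)"
   by eventually_elim (rule subsetD[OF closure_subset])
  ultimately have "x : closure (sphere q r Int hs sg k)"
   using Lim_in_closed_set[OF closed_closure, of ph _ "at_right 0" "ph 0"] by (simp add: trivial_limit_at_right_real)
  thus "x : rim k (sphere q r Int hs sg k)" using x by (simp add: rim_def)
 qed
 ultimately show ?thesis by auto
qed

text \<open>The discs cut out of the interface by the two balls are nested, the larger one lying on the
 side \<open>s\<close>.\<close>

definition nested :: "'n => (real => real^'n) => (real => real) => real => bool" where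
 "nested k q r s <-> <|s|> = 1 & (ALL sg. pm sg --> <|q sg $ k|> < r sg) &
  dist (proj k (q (- s))) (proj k (q s)) + sqrt ((r (- s))^2 - (q (- s) $ k)^2) <= sqrt ((r s)^2 - (q s $ k)^2)"

lemma sign_cases': "<|s|> = 1 ==> pm sg ==> sg = s | sg = (- s :: real)"
 by linarith

lemma nestedD:
 assumes n: "nested k q r s"
 shows "<|s|> = 1" "!!sg. pm sg ==> <|q sg $ k|> < r sg"
  and "x $ k = 0 ==> dist (q (- s)) x < r (- s) ==> dist (q s) x < r s"
  and "x $ k = 0 ==> dist (q (- s)) x <= r (- s) ==> dist (q s) x <= r s"
proof -
 show s: "<|s|> = 1" and q: "!!sg. pm sg ==> <|q sg $ k|> < r sg" using n by (auto simp: nested_def)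
 have qs: "<|q s $ k|> < r s" "<|q (- s) $ k|> < r (- s)" using q[of s] q[of "- s"] s by auto
 have d: "dist (proj k (q s)) x <= dist (proj k (q (- s))) (proj k (q s)) + dist (proj k (q (- s))) x"
  using dist_triangle[of "proj k (q s)" x "proj k (q (- s))"] by (simp add: dist_commute)
 show "dist (q s) x < r s" if "x $ k = 0" "dist (q (- s)) x < r (- s)"
  using that n d unfolding flat_dist(1)[OF that(1) qs(1)] flat_dist(1)[OF that(1) qs(2)] nested_def by linarith
 show "dist (q s) x <= r s" if "x $ k = 0" "dist (q (- s)) x <= r (- s)"
  using that n d unfolding flat_dist(2)[OF that(1) qs(1)] flat_dist(2)[OF that(1) qs(2)] nested_def by linarith
qed

lemma bdry_interface_borel:
 assumes "Om : bor" shows "bdry Om Int interface k : bor"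
proof -
 have "closed (interface k)" unfolding interface_def by (intro closed_Collect_eq continuous_intros)
 thus ?thesis using closed_bdry[OF assms] by (intro borel_closed closed_Int)
qed

lemma bdry_interface:
 assumes n: "nested k q r s"
 shows "bdry (two_caps k q r) Int interface k = {x. x $ k = 0 & dist (q s) x <= r s & r (- s) <= dist (q (- s)) x}"
proof -
 have s: "<|s|> = 1" by (rule nestedD[OF n])
 have "x : bdry (two_caps k q r) <-> dist (q s) x <= r s & r (- s) <= dist (q (- s)) x" if x: "x $ k = 0" for x
 proof -
  have "meets k q r x <-> dist (q s) x <= r s"
   using sign_cases'[OF s] s x nestedD(4)[OF n x] by auto
  moreover have "avoids k q r x <-> r (- s) <= dist (q (- s)) x"
  proof
   assume "avoids k q r x"
   thus "r (- s) <= dist (q (- s)) x" using sign_cases'[OF s] nestedD(3)[OF n x] not_le by metis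
  next
   assume "r (- s) <= dist (q (- s)) x"
   thus "avoids k q r x" using s x by (intro exI[of _ "- s"]) auto
  qed
  ultimately show ?thesis using bdry_two_caps[of q k r x, OF nestedD(2)[OF n]] by simp
 qed
 thus ?thesis by (auto simp: interface_def)
qed

lemma bdry_halfspace:
 assumes q: "!!sg. pm sg ==> <|q sg $ k|> < r sg" and sg: "pm sg"
 shows "bdry (two_caps k q r) Int hs sg k = sphere (q sg) (r sg) Int hs sg k"
proof -
 have bq: "x : bdry (two_caps k q r) <-> meets k q r x & avoids k q r x" for x
  by (rule bdry_two_caps) (rule q)
 have "x : bdry (two_caps k q r) <-> dist (q sg) x = r sg" if x: "x : hs sg k" for x
 proof -
  have e: "<|ta|> = 1 & 0 <= ta * x $ k <-> ta = sg" for ta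
   using sign_cases'[OF sg, of ta] sg x by (auto simp: hs_def)
  show ?thesis unfolding bq conj_assoc[symmetric] e by auto
 qed
 thus ?thesis by auto
qed

text \<open>Up to a null cylinder, the boundary on the interface is the larger disc minus the
  smaller one.\<close>

lemma area_nested:
 assumes n: "nested k q r s"
 shows "area k (bdry (two_caps k q r) Int interface k) = ennreal (disc_area k (q s) (r s) - disc_area k (q (- s)) (r (- s)))" (is ?G1)
  and "disc_area k (q (- s)) (r (- s)) <= disc_area k (q s) (r s)" (is ?G2)
proof -
 have s: "<|s|> = 1" "<|- s|> = 1" using nestedD(1)[OF n] by auto
 let ?C = "%sg. cyl k (ball (q sg) (r sg))"
 have sub: "?C (- s) <= ?C s" using nestedD(3)[OF n, of "proj k _"] by auto
 have fin: "fin (?C sg)" for sg by (rule slab_disc_finite)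
 have [measurable]: "?C sg : bor" for sg by measurable
 have [measurable]: "bdry (two_caps k q r) Int interface k : bor" by (rule bdry_interface_borel[OF two_caps_borel])
 have "area k (bdry (two_caps k q r) Int interface k) = em (?C s - ?C (- s))"
  unfolding area_def
 proof (rule emeasure_eq_AE)
  show "AEL x. x : cyl k (bdry (two_caps k q r) Int interface k) <-> x : ?C s - ?C (- s)"
   using AE_proj_sphere[OF nestedD(2)[OF n s(1)]]
  proof eventually_elim
   case (elim x)
   thus ?case unfolding bdry_interface[OF n] by auto
  qed
 qed measurable
 also have "... = em (?C s) - em (?C (- s))"
  using sub fin[of "- s"] by (intro emeasure_Diff) auto
 also have "... = ennreal (disc_area k (q s) (r s) - disc_area k (q (- s)) (r (- s)))"
  using fin unfolding disc_area_def by (simp add: emeasure_eq_ennreal_measure less_top ennreal_minus)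
 finally show ?G1 .
 show ?G2
  unfolding disc_area_def using sub fin[of s] by (intro measure_mono_fmeasurable) (auto simp: fmeasurable_def)
qed

lemma interface_unit_vector:
 fixes v :: "real^'n"
 assumes N: "CARD('n) >= 2" and v: "v $ k = 0"
 obtains w where "norm w = 1" "w $ k = 0" "v = norm v *R w"
proof (cases "v = 0")
 case True
 have "UNIV ~= {k}"
 proof
  assume "UNIV = {k}"
  hence "CARD('n) = card {k}" by (rule arg_cong)
  thus False using N by simp
 qed
 then obtain j where "j ~= k" by blast
 thus ?thesis using that[of "axis j 1"] True by (simp add: axis_def norm_axis_1[unfolded axis_def])
next
 case False
 thus ?thesis using that[of "(1 / norm v) *R v"] v by simp
qed

lemma slab_window:
 assumes x: "x $ k = 0" "dist p x < r" "r' < dist p' x"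
 shows "open (slab k Int proj k -` (ball p r Int - cball p' r') :: (real^'n) set)" (is "open ?W")
  and "~ negligible (slab k Int proj k -` (ball p r Int - cball p' r'))"
proof -
 have "open (slab k :: (real^'n) set)" unfolding slab_def by (intro open_Collect_conj open_Collect_less continuous_intros)
 thus o: "open ?W" by (intro open_Int open_vimage) (auto intro: continuous_proj)
 have "proj k (x + (1/2) *R axis k 1) = x" using x(1) by (simp add: vec_eq_iff axis_def)
 hence "x + (1/2) *R axis k 1 : ?W" using x by (simp add: slab_def)
 thus "~ negligible ?W" using open_not_negligible[OF o] by blast
qed

text \<open>If the disc radii are equal, \<open>nested\<close> forces equal centres and the boundary
  on the interface is null. Otherwise it contains an open piece of the interface between the two
  rims.\<close>

lemma nested_type:
 fixes Om :: "(real^'n) set"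
 assumes N: "CARD('n) >= 2" and n: "nested k q r s"
  and Om: "Om : sets lebesgue" "normalized Om" and AE: "AEL x. x : Om <-> x : two_caps k q r"
 shows "type_I k Om | type_II k Om"
proof -
 have s: "<|s|> = 1" "<|- s|> = 1" using nestedD(1)[OF n] by auto
 have q: "<|q sg $ k|> < r sg" if "pm sg" for sg by (rule nestedD(2)[OF n that])
 have bq: "x : bdry (two_caps k q r) <-> meets k q r x & avoids k q r x" for x
  by (rule bdry_two_caps) (rule q)
 define m where "m sg = proj k (q sg)" for sg
 define a where "a sg = sqrt ((r sg)^2 - (q sg $ k)^2)" for sg
 have a: "a sg > 0" if "pm sg" for sg
 proof -
  have "<|q sg $ k|>^2 < (r sg)^2" using q[OF that] by (intro power_strict_mono) auto
  thus ?thesis by (simp add: a_def)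
 qed
 have nest: "dist (m (- s)) (m s) + a (- s) <= a s" using n by (simp add: nested_def m_def a_def)
 have mk: "m sg $ k = 0" for sg by (simp add: m_def)
 have bd: "bdry Om = bdry (two_caps k q r)" by (rule bdry_AE_cong[OF Om(1) _ AE]) simp
 have fr: "frontier Om = bdry (two_caps k q r)" using Om(2) by (simp add: normalized_def bd)
 have clo: "x : closure Om <-> meets k q r x" for x
 proof
  assume x: "x : closure Om"
  show "meets k q r x"
  proof (rule ccontr)
   assume c: "~ meets k q r x"
   hence "x ~: frontier Om" unfolding fr bq by blast
   hence "x : interior Om" using x by (simp add: frontier_def)
   then obtain d1 where d1: "d1 > 0" "ball x d1 <= Om" by (auto simp: mem_interior)
   obtain d2 where d2: "d2 > 0" "ALL y:ball x d2. y ~: two_caps k q r" using near_outside[of x k r q] c not_le by blast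
   have "AEL y. y : ball x (min d1 d2) --> False" using AE by eventually_elim (use d1 d2 in auto)
   moreover have "x : ball x (min d1 d2)" using d1(1) d2(1) by simp
   hence "ball x (min d1 d2) ~= {}" by blast
   ultimately show False using open_AE_nonempty[of "ball x (min d1 d2)" "%_. False"] by auto
  qed
 next
  assume "meets k q r x"
  then obtain sg where sg: "pm sg" "0 <= sg * x $ k" "dist (q sg) x <= r sg" by blast
  show "x : closure Om"
   unfolding closure_approachable
  proof (intro allI impI)
   fix e :: real assume e: "e > 0"
   let ?W = "ball (q sg) (r sg) Int hs sg k Int ball x e"
   have 1: "?W ~= {}" using in_closure_inside[OF sg(1) q[OF sg(1)] sg(2,3)] e unfolding closure_approachable by (force simp: dist_commute)
   have 2: "open ?W" using open_hs by auto
   have 3: "AEL y. y : ?W --> y : Om" using AE by eventually_elim (auto simp: two_caps_hs[OF sg(1)])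
   obtain y where "y : ?W" "y : Om" using open_AE_nonempty[OF 2 1 3] by blast
   thus "EX y:Om. dist y x < e" by (auto simp: dist_commute)
  qed
 qed
 have int: "x : Om" if "meets k q r x" "!!sg. pm sg ==> 0 <= sg * x $ k ==> dist (q sg) x < r sg" for x
 proof -
  have "x ~: frontier Om" unfolding fr bq using that(2) not_le by blast
  thus ?thesis using clo[of x] that(1) interior_subset[of Om] by (auto simp: frontier_def)
 qed
 let ?Cap = "%sg. ball (q sg) (r sg) Int hs sg k"
 let ?D = "{x. x $ k = 0 & dist (q (- s)) x < r (- s)}"
 have conn: "connected Om"
 proof -
  \<comment> \<open>The caps are convex, and the smaller disc \<open>?D\<close> lies in the closures
    of both, so it joins them; \<open>Om\<close> is between this connected set and its
    closure.\<close>
  have Cc: "connected (?Cap sg Un ?D)" if sg: "pm sg" for sg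
  proof (rule connected_intermediate_closure[of "?Cap sg"])
   show "connected (?Cap sg)" by (intro convex_connected convex_Int convex_hs) simp
   have "x : closure (?Cap sg)" if "x : ?D" for x
    using that sign_cases'[OF s(1) sg] nestedD(3)[OF n, of x] by (intro in_closure_inside[OF sg q[OF sg]]) auto
   thus "?Cap sg Un ?D <= closure (?Cap sg)" using closure_subset by blast
  qed simp
  have "m (- s) : ?D" using mk[of "- s"] flat_dist(1)[OF mk[of "- s"] q[OF s(2)]] a[OF s(2)] by (simp add: m_def a_def)
  hence ne: "(?Cap s Un ?D) Int (?Cap (- s) Un ?D) ~= {}" by blast
  let ?U = "(?Cap s Un ?D) Un (?Cap (- s) Un ?D)"
  have "connected ?U" by (rule connected_Un[OF Cc[OF s(1)] Cc[OF s(2)] ne])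
  moreover have "?U <= Om"
  proof -
   have "x : Om" if sg: "pm sg" and x: "x : ?Cap sg" for sg x
   proof (rule int)
    show "meets k q r x" using sg x by (intro exI[of _ sg]) (auto simp: hs_def)
    show "dist (q ta) x < r ta" if "<|ta|> = 1" "0 <= ta * x $ k" for ta
     using sign_cases'[OF sg that(1)] that(2) x by (auto simp: hs_def)
   qed
   moreover have "x : Om" if x: "x : ?D" for x
   proof (rule int)
    show "meets k q r x" using s(2) x by (intro exI[of _ "- s"]) auto
    show "dist (q ta) x < r ta" if "<|ta|> = 1" "0 <= ta * x $ k" for ta
     using sign_cases'[OF s(1) that(1)] x nestedD(3)[OF n, of x] by auto
   qed
   ultimately show ?thesis using s by blast
  qed
  moreover have "Om <= closure ?U"
  proof
   fix x assume "x : Om"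
   hence "x : closure Om" using closure_subset by blast
   then obtain sg where sg: "pm sg" "0 <= sg * x $ k" "dist (q sg) x <= r sg" using clo by blast
   have "x : closure (?Cap sg)" by (rule in_closure_inside[OF sg(1) q[OF sg(1)] sg(2,3)])
   moreover have "?Cap sg <= ?U" using sign_cases'[OF s(1) sg(1)] by auto
   ultimately show "x : closure ?U" using closure_mono by blast
  qed
  ultimately show ?thesis by (rule connected_intermediate_closure)
 qed
 have hs1: "hs 1 k = halfspace_pos k" "hs (- 1) k = halfspace_neg k" by (auto simp: hs_def halfspace_pos_def halfspace_neg_def)
 have Gp: "Gamma_pos k Om = sphere (q 1) (r 1) Int hs 1 k" "Gamma_neg k Om = sphere (q (- 1)) (r (- 1)) Int hs (- 1) k"
  using bdry_halfspace[of q k r 1, OF q] bdry_halfspace[of q k r "- 1", OF q] by (simp_all add: Gamma_pos_def Gamma_neg_def bd hs1)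
 have capk: "spherical_cap k H (sphere (q sg) (r sg) Int H)" if sg: "pm sg" for sg H
 proof -
  have "q sg + r sg *R axis k 1 : sphere (q sg) (r sg) Int halfspace_pos k" "q sg - r sg *R axis k 1 : sphere (q sg) (r sg) Int halfspace_neg k"
   using q[OF sg] by (auto simp: halfspace_pos_def halfspace_neg_def dist_norm)
  moreover have "r sg > 0" using q[OF sg] by linarith
  ultimately show ?thesis unfolding spherical_cap_def by (intro exI[of _ "q sg"] exI[of _ "r sg"]) blast
 qed
 have "closure Om Int interface k = cball (m s) (a s) Int interface k"
 proof -
  have "x : closure Om <-> dist (m s) x <= a s" if x: "x $ k = 0" for x
  proof -
   have "x : closure Om <-> dist (q s) x <= r s"
    unfolding clo using sign_cases'[OF s(1)] s x nestedD(4)[OF n x] by auto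
   thus ?thesis using flat_dist(2)[OF x q[OF s(1)]] by (simp add: m_def a_def)
  qed
  thus ?thesis by (auto simp: interface_def)
 qed
 hence "flat_ball k (closure Om Int interface k)"
  unfolding flat_ball_def using mk[of s] a[OF s(1)] by (intro exI[of _ "m s"] exI[of _ "a s"]) (simp add: interface_def)
 hence shape: "common_shape k Om"
  unfolding common_shape_def Gp using conn capk[of 1] capk[of "- 1"] by (simp add: hs1)
 have rims: "rim k (Gamma_pos k Om) = sphere (m 1) (a 1) Int interface k" "rim k (Gamma_neg k Om) = sphere (m (- 1)) (a (- 1)) Int interface k"
  unfolding Gp m_def a_def using rim_sphere[of 1 "q 1" k "r 1"] rim_sphere[of "- 1" "q (- 1)" k "r (- 1)"] q[of 1] q[of "- 1"] by auto
 have G0: "Gamma_0 k Om = bdry (two_caps k q r) Int interface k" by (simp add: Gamma_0_def bd)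
 have G0b: "Gamma_0 k Om : bor" "bounded (Gamma_0 k Om)" "Gamma_0 k Om <= interface k"
 proof -
  show "Gamma_0 k Om : bor" unfolding G0 by (rule bdry_interface_borel[OF two_caps_borel])
  have "Gamma_0 k Om <= cball (q s) (r s)" unfolding G0 bdry_interface[OF n] by auto
  thus "bounded (Gamma_0 k Om)" using bounded_cball bounded_subset by blast
 qed (simp add: G0)
 show ?thesis
 proof (cases "a (- s) = a s")
  case True
  hence "m (- s) = m s" using nest by simp
  hence eq: "m 1 = m (- 1)" "a 1 = a (- 1)" using True sign_cases[OF s(1)] by auto
  have "AEL x. x ~: cyl k (Gamma_0 k Om)"
   using AE_proj_sphere[OF q[OF s(1)]]
  proof eventually_elim
   case (elim x)
   have "r (- s) <= dist (q (- s)) (proj k x) <-> r s <= dist (q s) (proj k x)"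
    using flat_dist(1)[OF _ q[OF s(1)], of "proj k x"] flat_dist(1)[OF _ q[OF s(2)], of "proj k x"] True \<open>m (- s) = m s\<close>
    by (simp add: m_def a_def not_less[symmetric])
   thus ?case using elim unfolding G0 bdry_interface[OF n] by auto
  qed
  hence "area k (Gamma_0 k Om) = 0"
   unfolding area_def using G0b(1) by (subst (asm) AE_iff_null_sets[symmetric]) (auto simp: null_sets_def)
  hence "hm (real CARD('n) - 1) (Gamma_0 k Om) = 0"
   using hausdorff_le_area[OF N G0b] by simp
  thus ?thesis using shape rims eq by (simp add: type_I_def)
 next
  case False
  hence lt: "a (- s) < a s" using nest zero_le_dist[of "m (- s)" "m s"] by linarith
  obtain w where w: "norm w = 1" "w $ k = 0" "m s - m (- s) = norm (m s - m (- s)) *R w"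
   using interface_unit_vector[OF N, of "m s - m (- s)" k] mk by auto
  \<comment> \<open>A point of the larger disc outside the smaller closed one: starting at the
    larger centre, it is moved away from the smaller centre by the mean of the two radii.\<close>
  define y where "y = m s + ((a (- s) + a s) / 2) *R w"
  have yk: "y $ k = 0" using w mk by (simp add: y_def)
  have y1: "dist (m s) y < a s" using w lt a[OF s(2)] by (simp add: y_def dist_norm)
  have "y - m (- s) = (norm (m s - m (- s)) + (a (- s) + a s) / 2) *R w" using w(3) by (simp add: y_def algebra_simps)
  moreover have "0 <= norm (m s - m (- s)) + (a (- s) + a s) / 2" using a[OF s(1)] a[OF s(2)] by (intro add_nonneg_nonneg) auto
  ultimately have "norm (y - m (- s)) = norm (m s - m (- s)) + (a (- s) + a s) / 2" using w(1) by simp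
  moreover have "a (- s) < (a (- s) + a s) / 2" using lt by simp
  ultimately have y2: "a (- s) < dist (m (- s)) y" using norm_ge_zero[of "m s - m (- s)"] unfolding dist_norm norm_minus_commute[of "m (- s)" y] by linarith
  let ?W = "slab k Int proj k -` (ball (q s) (r s) Int - cball (q (- s)) (r (- s)))"
  have "dist (q s) y < r s" "r (- s) < dist (q (- s)) y"
   using flat_dist(1)[OF yk q[OF s(1)]] y1 flat_dist(2)[OF yk q[OF s(2)]] y2 by (auto simp: m_def a_def not_le[symmetric])
  note W = slab_window[OF yk this]
  have "em ?W ~= 0" using W by (auto simp: negligible_iff_null_sets null_sets_def)
  moreover have "em ?W <= area k (Gamma_0 k Om)"
   unfolding area_def using G0b(1) by (intro emeasure_mono) (auto simp: G0 bdry_interface[OF n])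
  ultimately have "area k (Gamma_0 k Om) > 0" by (simp add: zero_less_iff_neq_zero) (metis le_zero_eq)
  hence "0 < hm (real CARD('n) - 1) (flat_cube k 0 1) * area k (Gamma_0 k Om)"
   using hm_cube_pos[OF N, of k] by (simp add: ennreal_zero_less_mult_iff)
  also have "... <= hm (real CARD('n) - 1) (Gamma_0 k Om)" by (rule area_le_hausdorff[OF N G0b(1,3)])
  finally have H: "hm (real CARD('n) - 1) (Gamma_0 k Om) > 0" .
  have "a (- 1) ~= a 1" using False sign_cases[OF s(1)] by auto
  hence "EX c r c' r'. c : interface k & c' : interface k & r > 0 & r' > 0 & r ~= r' &
    rim k (Gamma_neg k Om) = sphere c r Int interface k & rim k (Gamma_pos k Om) = sphere c' r' Int interface k"
   using a[of 1] a[of "- 1"] mk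
   by (intro exI[of _ "m (- 1)"] exI[of _ "a (- 1)"] exI[of _ "m 1"] exI[of _ "a 1"] conjI rims) (auto simp: interface_def)
  hence "type_II k Om" unfolding type_II_def using shape H by blast
  thus ?thesis ..
 qed
qed

text \<open>The inclusion is tested at points of the smaller disc on the ray that leads away from
  the centre of the larger one.\<close>

lemma ball_subset_nested:
 fixes q :: "real => real^'n"
 assumes N: "CARD('n) >= 2" and s: "<|s|> = 1" and q: "!!sg. pm sg ==> <|q sg $ k|> < r sg"
  and sub: "!!x. x $ k = 0 ==> dist (q (- s)) x < r (- s) ==> dist (q s) x <= r s"
 shows "nested k q r s"
proof -
 have s2: "<|- s|> = 1" using s by simp
 define m where "m sg = proj k (q sg)" for sg
 define a where "a sg = sqrt ((r sg)^2 - (q sg $ k)^2)" for sg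
 have mk: "m sg $ k = 0" for sg by (simp add: m_def)
 have a: "a (- s) > 0"
 proof -
  have "<|q (- s) $ k|>^2 < (r (- s))^2" using q[OF s2] by (intro power_strict_mono) auto
  thus ?thesis by (simp add: a_def)
 qed
 obtain w where w: "norm w = 1" "w $ k = 0" "m (- s) - m s = norm (m (- s) - m s) *R w"
  using interface_unit_vector[OF N, of "m (- s) - m s" k] mk by auto
 have "norm (m (- s) - m s) + a (- s) <= a s"
 proof (rule dense_le)
  fix z assume z: "z < norm (m (- s) - m s) + a (- s)"
  define t where "t = max 0 (z - norm (m (- s) - m s))"
  have t: "0 <= t" "t < a (- s)" "z <= norm (m (- s) - m s) + t" using z a by (auto simp: t_def)
  define y where "y = m (- s) + t *R w"
  have yk: "y $ k = 0" using mk w by (simp add: y_def)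
  have "dist (m (- s)) y < a (- s)" using t w by (simp add: y_def dist_norm)
  hence "dist (q (- s)) y < r (- s)" using flat_dist(1)[OF yk q[OF s2]] by (simp add: m_def a_def)
  hence "dist (q s) y <= r s" by (rule sub[OF yk])
  hence "dist (m s) y <= a s" using flat_dist(2)[OF yk q[OF s]] by (simp add: m_def a_def)
  moreover have "y - m s = (norm (m (- s) - m s) + t) *R w" using w(3) by (simp add: y_def algebra_simps)
  hence "norm (y - m s) = norm (m (- s) - m s) + t" using w(1) t(1) by simp
  ultimately show "z <= a s" using t(3) by (simp add: dist_norm norm_minus_commute)
 qed
 thus ?thesis using s q by (simp add: nested_def m_def a_def dist_norm)
qed

text \<open>Nestedness is read off the equality case: the part of the interface where exactly one of the
 two traces vanishes lies in the boundary.\<close>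

lemma trace_balance_nested:
 fixes q :: "real => real^'n"
 assumes N: "CARD('n) >= 2" and q: "!!sg. pm sg ==> <|q sg $ k|> < r sg"
  and A: "area k (bdry (two_caps k q r) Int interface k) = ennreal A" "A >= 0"
  and g: "g > 0" "<|l|> <= g" and bal: "g * A <= l * (disc_area k (q (- 1)) (r (- 1)) - disc_area k (q 1) (r 1))"
 shows "EX s. nested k q r s"
proof -
 let ?C = "%sg. cyl k (ball (q sg) (r sg))"
 have [measurable]: "?C sg : bor" for sg by measurable
 have fin: "?C sg : fmeasurable lborel" for sg using slab_disc_finite[of k "q sg" "r sg"] by (simp add: fmeasurable_def)
 define x1 where "x1 = vol (?C (- 1) - ?C 1)"
 define x2 where "x2 = vol (?C 1 - ?C (- 1))"
 have x0: "0 <= x1" "0 <= x2" by (simp_all add: x1_def x2_def)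
 have I: "vol (?C sg) = vol (?C sg - ?C ta) + vol (?C sg Int ?C ta)" for sg ta
 proof -
  have "vol (?C sg) = vol ((?C sg - ?C ta) Un (?C sg Int ?C ta))" by (rule arg_cong[where f = "vol"]) blast
  also have "... = vol (?C sg - ?C ta) + vol (?C sg Int ?C ta)"
   using fin[of sg] by (intro measure_Un_AE) (auto intro: fmeasurable_Diff fmeasurable_Int_fmeasurable)
  finally show ?thesis .
 qed
 have diff: "disc_area k (q (- 1)) (r (- 1)) - disc_area k (q 1) (r 1) = x1 - x2"
  using I[of "- 1" 1] I[of 1 "- 1"] by (simp add: disc_area_def x1_def x2_def Int_commute)
 have bq: "x : bdry (two_caps k q r) <-> meets k q r x & avoids k q r x" for x
  by (rule bdry_two_caps) (rule q)
 have "x1 + x2 <= A"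
 proof -
  have [measurable]: "bdry (two_caps k q r) Int interface k : bor" by (rule bdry_interface_borel[OF two_caps_borel])
  have "em ((?C (- 1) - ?C 1) Un (?C 1 - ?C (- 1))) <= area k (bdry (two_caps k q r) Int interface k)"
   unfolding area_def
  proof (rule emeasure_mono)
   have "x : bdry (two_caps k q r)" if x: "x $ k = 0" "pm sg" "dist (q sg) x < r sg" "~ dist (q (- sg)) x < r (- sg)" for x sg
    unfolding bq using x by (intro conjI exI[of _ sg] exI[of _ "- sg"]) auto
   from this[of "proj k _" 1] this[of "proj k _" "- 1"]
   show "(?C (- 1) - ?C 1) Un (?C 1 - ?C (- 1)) <= cyl k (bdry (two_caps k q r) Int interface k)"
    by (auto simp: interface_def)
  qed measurable
  moreover have "em ((?C (- 1) - ?C 1) Un (?C 1 - ?C (- 1))) = ennreal (x1 + x2)"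
  proof -
   have f: "?C sg - ?C ta : fmeasurable lborel" for sg ta using fin[of sg] by (intro fmeasurable_Diff) auto
   have "vol ((?C (- 1) - ?C 1) Un (?C 1 - ?C (- 1))) = x1 + x2"
    unfolding x1_def x2_def by (intro measure_Un_AE f) auto
   thus ?thesis using emeasure_eq_measure2[OF fmeasurable.Un[OF f f]] by metis
  qed
  ultimately show ?thesis using A by (simp add: ennreal_le_iff)
 qed
 \<comment> \<open>The boundary area is at least \<open>x1 + x2\<close>, while the balance allows at
   most the absolute difference of \<open>x1\<close> and \<open>x2\<close>; so one of the two set
   differences is null.\<close>
 hence "g * (x1 + x2) <= l * (x1 - x2)" using bal g(1) unfolding diff by (smt (verit) mult_left_mono)
 also have "... <= <|l|> * <|x1 - x2|>" unfolding abs_mult[symmetric] by (rule abs_ge_self)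
 also have "... <= g * <|x1 - x2|>" by (rule mult_right_mono[OF g(2) abs_ge_zero])
 finally have "x1 + x2 <= <|x1 - x2|>" using g(1) by simp
 hence "x1 = 0 | x2 = 0" using x0 by linarith
 hence "EX s::real. <|s|> = 1 & vol (?C (- s) - ?C s) = 0"
 proof
  assume "x1 = 0" thus ?thesis unfolding x1_def by (intro exI[of _ 1]) simp
 next
  assume "x2 = 0" thus ?thesis unfolding x2_def by (intro exI[of _ "- 1"]) simp
 qed
 then obtain s :: real where s: "<|s|> = 1" and z: "vol (?C (- s) - ?C s) = 0" by blast
 have "dist (q s) x <= r s" if x: "x $ k = 0" "dist (q (- s)) x < r (- s)" for x
 proof (rule ccontr)
  assume nx: "~ dist (q s) x <= r s"
  let ?W = "slab k Int proj k -` (ball (q (- s)) (r (- s)) Int - cball (q s) (r s))"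
  have "~ negligible ?W" by (rule slab_window[OF x]) (use nx in simp)
  moreover have "em (?C (- s) - ?C s) = 0"
   using z fin[of "- s"] emeasure_eq_measure2[of "?C (- s) - ?C s" lborel] fmeasurable_Diff[OF fin] by simp
  hence "negligible (?C (- s) - ?C s)" by (simp add: negligible_iff_null_sets null_sets_def)
  hence "negligible ?W" by (rule negligible_subset) auto
  ultimately show False by blast
 qed
 hence "nested k q r s" by (intro ball_subset_nested[OF N s q])
 thus ?thesis by blast
qed

section \<open>Invariance under null sets\<close>

lemma test_fields_mono: "A <= B ==> test_fields A <= test_fields B"
 by (auto simp: test_fields_def)

lemma perimeter_mono: "A <= B ==> perimeter Om A <= perimeter Om B"
 unfolding perimeter_def by (intro SUP_subset_mono test_fields_mono) auto

lemma perimeter_AE_cong: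
 fixes Om :: "(real^'n) set"
 assumes Om: "Om : sets lebesgue" "Om' : sets lebesgue" and AE: "AEL x. x : Om <-> x : Om'"
 shows "perimeter Om A = perimeter Om' A"
 unfolding perimeter_def
proof (rule SUP_cong[OF refl])
 fix T :: "real^'n => real^'n" assume "T : test_fields A"
 then obtain D where D: "!!i. C1 (%x. T x $ i) (D i)" using test_fieldD by metis
 have "cont (%x. divergence T x)" unfolding divergence_C1[OF D] by (intro continuous_intros C1_cont_grad[OF D])
 hence "(%x. divergence T x) : bm" by (rule borel_csupp)
 hence [measurable]: "(%x. divergence T x) : borel_measurable lebesgue" by (simp add: measurable_completion)
 have AE': "AE x in lebesgue. x : Om <-> x : Om'" using AE by (simp add: AE_completion_iff)
 have "(LINT x:Om|lebesgue. divergence T x) = (LINT x:Om'|lebesgue. divergence T x)"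
  unfolding sli_def
 proof (rule integral_cong_AE)
  show "(%x. indicat_real Om x *R divergence T x) : borel_measurable lebesgue"
   "(%x. indicat_real Om' x *R divergence T x) : borel_measurable lebesgue" using Om by measurable
  show "AE x in lebesgue. indicat_real Om x *R divergence T x = indicat_real Om' x *R divergence T x"
   using AE' by eventually_elim (auto simp: indicator_def)
 qed
 thus "ennreal (LINT x:Om|lebesgue. divergence T x) = ennreal (LINT x:Om'|lebesgue. divergence T x)" by simp
qed

lemma energy_AE_cong:
 assumes "Om : sets lebesgue" "Om' : sets lebesgue" "AEL x. x : Om <-> x : Om'"
 shows "energy k rhn rhp gm Om = energy k rhn rhp gm Om'"
 by (simp add: energy_def Gamma_0_def perimeter_AE_cong[OF assms] bdry_AE_cong[OF assms])

lemma admissible_AE_cong: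
 fixes Om :: "(real^'n) set"
 assumes Om: "Om : sets lebesgue" "Om' : sets lebesgue" and AE: "AEL x. x : Om <-> x : Om'"
 shows "admissible k rhn rhp Vn Vp Om <-> admissible k rhn rhp Vn Vp Om'"
proof -
 have AE': "AE x in lebesgue. x : Om <-> x : Om'" using AE by (simp add: AE_completion_iff)
 have "emeasure lebesgue (Om Int H) = emeasure lebesgue (Om' Int H)" if "H : bor" for H
  by (rule emeasure_eq_AE) (use AE' Om that in \<open>auto elim: eventually_mono\<close>)
 moreover have "halfspace_neg k : bor" "halfspace_pos k : bor"
  using hs_borel[of "- 1" k] hs_borel[of 1 k] by (simp_all add: hs_def halfspace_neg_def halfspace_pos_def)
 ultimately show ?thesis by (simp add: admissible_def finite_perimeter_def perimeter_AE_cong[OF assms] Om)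
qed

lemma negligible_AE_eq:
 fixes Om Om' :: "(real^'n) set"
 assumes "negligible ((Om' - Om) Un (Om - Om'))" shows "AEL x. x : Om' <-> x : Om"
proof -
 have "AE x in lebesgue. x ~: (Om' - Om) Un (Om - Om')"
  using assms by (intro AE_not_in) (simp add: negligible_iff_null_sets)
 hence "AEL x. x ~: (Om' - Om) Un (Om - Om')" by (simp add: AE_completion_iff)
 thus ?thesis by eventually_elim auto
qed

lemma borel_representative:
 fixes Om :: "(real^'n) set"
 assumes "Om : sets lebesgue"
 obtains Om' where "Om' : bor" "AEL x. x : Om <-> x : Om'"
proof -
 from sets_completionE[OF assms] obtain S N N' where S: "Om = S Un N" "N <= N'" "N' : null_sets lborel" "S : sets lborel" .
 have "AEL x. x ~: N'" using S(3) by (rule AE_not_in)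
 hence "AEL x. x : Om <-> x : S" by eventually_elim (use S in auto)
 thus ?thesis using that[of S] S(4) by simp
qed

section \<open>The concentric competitor\<close>

lemma cap_integral_lebesgue:
 fixes T :: "real^'n => real^'n"
 assumes D: "!!i. C1 (%x. T x $ i) (D i)" and A: "A : bor"
 shows "(LINT x:A|lebesgue. divergence T x) = (LBINT x:A. SUM i:UNIV. D i x $ i)"
proof -
 have "cont (%x. SUM i:UNIV. D i x $ i)" by (intro continuous_intros C1_cont_grad[OF D])
 hence "(%x. SUM i:UNIV. D i x $ i) : bm" by (rule borel_csupp)
 hence "(%x. indicat_real A x *R (SUM i:UNIV. D i x $ i)) : borel_measurable lborel"
  using A by (intro borel_measurable_scaleR borel_measurable_indicator) auto
 thus ?thesis unfolding sli_def divergence_C1[OF D] by (rule integral_completion)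
qed

lemma test_field_csupp:
 assumes "compact S" "!!x. x ~: S ==> T x = 0" shows "csupp T"
proof -
 obtain B where B: "!!x. x : S ==> norm x <= B" using compact_imp_bounded[OF assms(1)] by (auto simp: bounded_iff)
 have "T x = 0" if "B + 1 <= norm x" for x using B[of x] that by (intro assms(2)) force
 thus ?thesis by (rule csuppI)
qed

definition cap_center :: "'n => (real => real) => (real => real) => real => real^'n" where
 "cap_center k c r sg = (c sg * r sg * sg) *R axis k 1"

lemma two_caps_centered: "pm sg ==> two_caps k (cap_center k c r) r Int hs sg k = cap sg k (c sg) (r sg)"
 using two_caps_hs[of sg _ k "cap_center k c r" r] by (auto simp: cap_def cap_center_def)

text \<open>A test field with compact support in the open half-space vanishes on the interface, so
  \<open>cap_divergence_le\<close> applies with \<open>be = 0\<close>.\<close>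

lemma cap_perimeter_le:
 fixes k :: "'n::finite" and c r :: "real => real" and sg :: real
 assumes r: "r sg > 0" and sg: "pm sg"
 defines "B \<equiv> CARD('n) * vol (cap sg k (c sg) (r sg)) / r sg - c sg * disc_area k (cap_center k c r sg) (r sg)"
 shows "perimeter (two_caps k (cap_center k c r) r) (hs sg k) <= ennreal B" "0 <= B"
proof -
 let ?Om = "two_caps k (cap_center k c r) r"
 have le: "(LBINT x:cap sg k (c sg) (r sg). SUM i:UNIV. D i x $ i) <= B"
  if D: "!!i. C1 (%x. T x $ i) (D i)" "csupp T" "!!x. norm (T x) <= 1" and T0: "!!x. x $ k = 0 ==> T x = 0" for T :: "real^'n => real^'n" and D
  using cap_divergence_le[OF r sg D, of k 0 "c sg"] T0 by (simp add: B_def cap_center_def)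
 show "0 <= B" using le[of "%_. 0" "%_ _. 0"] by (simp add: C1_const csupp_def)
 show "perimeter ?Om (hs sg k) <= ennreal B"
  unfolding perimeter_def
 proof (rule SUP_least)
  fix T :: "real^'n => real^'n" assume "T : test_fields (hs sg k)"
  then obtain D S where D: "!!i. C1 (%x. T x $ i) (D i)" "!!x. norm (T x) <= 1" and S: "compact S" "S <= hs sg k" "!!x. x ~: S ==> T x = 0"
   using test_fieldD by metis
  have z: "D i x = 0" if "x ~: S" for i x
  proof (rule C1_grad_zero[OF D(1), of "- S"])
   show "open (- S)" using compact_imp_closed[OF S(1)] by (rule open_Compl)
  qed (use that S(3) in auto)
  have "(LINT x:?Om|lebesgue. divergence T x) = (LBINT x:?Om. SUM i:UNIV. D i x $ i)"
   by (rule cap_integral_lebesgue[OF D(1)]) simp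
  also have "... = (LBINT x:cap sg k (c sg) (r sg). SUM i:UNIV. D i x $ i)"
   unfolding sli_def two_caps_centered[OF sg, of k c r, symmetric]
  proof (intro Bochner_Integration.integral_cong refl)
   fix x
   have "(SUM i:UNIV. D i x $ i) = 0" if "x ~: hs sg k"
   proof -
    have "x ~: S" using S(2) that by blast
    thus ?thesis by (simp add: z)
   qed
   thus "indicat_real ?Om x *R (SUM i:UNIV. D i x $ i) = indicat_real (?Om Int hs sg k) x *R (SUM i:UNIV. D i x $ i)"
    by (cases "x : hs sg k") (auto simp: indicator_def)
  qed
  also have "... <= B"
  proof (rule le[OF D(1) test_field_csupp[OF S(1,3)] D(2)])
   fix x :: "real^'n" assume "x $ k = 0"
   hence "x ~: hs sg k" by (simp add: hs_def)
   thus "T x = 0" using S(2,3) by blast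
  qed
  finally show "ennreal (LINT x:?Om|lebesgue. divergence T x) <= ennreal B" by (rule ennreal_leI)
 qed
qed

text \<open>For fields on the whole space the flux through each disc is bounded by its area, which
  is \<open>cap_divergence_le\<close> with \<open>be = 1\<close>.\<close>

lemma two_caps_finite_perimeter:
 fixes k :: "'n::finite"
 assumes r: "!!sg. pm sg ==> r sg > 0"
 shows "finite_perimeter (two_caps k (cap_center k c r) r)"
proof -
 let ?Om = "two_caps k (cap_center k c r) r"
 define B where "B sg = CARD('n) * vol (cap sg k (c sg) (r sg)) / r sg + (1 - c sg) * disc_area k (cap_center k c r sg) (r sg)" for sg
 have "perimeter ?Om UNIV <= ennreal (B 1 + B (- 1))"
  unfolding perimeter_def
 proof (rule SUP_least)
  fix T :: "real^'n => real^'n" assume "T : test_fields UNIV"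
  then obtain D S where D: "!!i. C1 (%x. T x $ i) (D i)" "!!x. norm (T x) <= 1" and S: "compact S" "!!x. x ~: S ==> T x = 0"
   using test_fieldD by metis
  have sT: "csupp T" by (rule test_field_csupp[OF S])
  have le: "(LBINT x:cap sg k (c sg) (r sg). SUM i:UNIV. D i x $ i) <= B sg" if sg: "pm sg" for sg
   unfolding B_def cap_center_def
  proof (rule cap_divergence_le[OF r[OF sg] sg D(1) sT D(2)])
   fix x
   have "<|sg * T x $ k|> <= 1" using component_le_norm_cart[of "T x" k] D(2)[of x] sg by (simp add: abs_mult)
   thus "- (sg * T x $ k) <= 1" by linarith
  qed
  obtain R where R: "R > 0" "!!x. R <= norm x ==> T x = 0" using sT by (rule csuppE) blast
  have "D i x = 0" if "R + 1 <= norm x" for i x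
   by (rule C1_grad_zero_outside[OF D(1), of R]) (use R that in auto)
  hence sdiv: "csupp (%x. SUM i:UNIV. D i x $ i)" by (intro csuppI[of "R + 1"]) simp
  have cdiv: "cont (%x. SUM i:UNIV. D i x $ i)" by (intro continuous_intros C1_cont_grad[OF D(1)])
  have un: "?Om = cap 1 k (c 1) (r 1) Un cap (- 1) k (c (- 1)) (r (- 1))" by (simp add: two_caps_def cap_def cap_center_def)
  have dis: "cap 1 k (c 1) (r 1) Int cap (- 1) k (c (- 1)) (r (- 1)) = {}" by (auto simp: cap_def hs_def)
  have "(LINT x:?Om|lebesgue. divergence T x) = (LBINT x:?Om. SUM i:UNIV. D i x $ i)"
   by (rule cap_integral_lebesgue[OF D(1)]) simp
  also have "... = (LBINT x:cap 1 k (c 1) (r 1). SUM i:UNIV. D i x $ i) + (LBINT x:cap (- 1) k (c (- 1)) (r (- 1)). SUM i:UNIV. D i x $ i)"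
   unfolding un by (intro set_integral_Un dis sint_csupp cdiv sdiv cap_borel)
  also have "... <= B 1 + B (- 1)" by (intro add_mono le) auto
  finally show "ennreal (LINT x:?Om|lebesgue. divergence T x) <= ennreal (B 1 + B (- 1))" by (rule ennreal_leI)
 qed
 thus ?thesis by (auto simp: finite_perimeter_def order_le_less_trans)
qed

section \<open>The minimum value\<close>

lemma hs_halfspace: "hs 1 k = halfspace_pos k" "hs (- 1) k = halfspace_neg k"
 by (auto simp: hs_def halfspace_pos_def halfspace_neg_def)

context
 fixes k :: "'n::finite" and rhn rhp gm Vn Vp g l :: real
 assumes N: "CARD('n) >= 2" and pos: "Vn > 0" "Vp > 0" "rhn > 0" "rhp > 0" and gm: "gm >= 0"
  and g: "g = gm * enn2real (hm (real CARD('n) - 1) (flat_cube k 0 1))"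
  and l: "<|l|> <= g" "<|l|> < rhn" "<|l|> < rhp"
begin

definition "dens sg = (if sg = (1::real) then rhp else rhn)"

definition "half_vol sg = (if sg = 1 then Vp else Vn) / dens sg"

text \<open>Young's law: the equation \<open>dens sg * angle sg = - (sg * l)\<close> gives the
  contact terms of the two sides opposite coefficients.\<close>

definition "angle sg = - (sg * l) / dens sg"

definition "radius sg = cap_radius k (half_vol sg) (angle sg)"

text \<open>The common value of the lower bound and of the energy of the concentric configuration.\<close>

definition "min_energy = CARD('n) * Vp / radius 1 + CARD('n) * Vn / radius (- 1)"

definition "weighted_perimeter Om = dens 1 * enn2real (perimeter Om (hs 1 k)) + dens (- 1) * enn2real (perimeter Om (hs (- 1) k))"

lemma mult_data:
 assumes sg: "pm sg"
 shows "0 < dens sg" "<|angle sg|> < 1" "0 < radius sg" "dens sg * angle sg = - (sg * l)" (is ?G1) "vol (cap sg k (angle sg) (radius sg)) = half_vol sg" (is ?G2)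
proof -
 show d: "0 < dens sg" using pos by (simp add: dens_def)
 have "<|l|> < dens sg" using l by (simp add: dens_def)
 thus a: "<|angle sg|> < 1" using d sg by (simp add: angle_def abs_mult)
 have v: "0 < half_vol sg" using pos d by (simp add: half_vol_def)
 have c: "- 1 < angle sg" "angle sg <= 1" using a by auto
 show r: "0 < radius sg" unfolding radius_def by (rule cap_radius(1)[OF c v])
 show ?G1 using d by (simp add: angle_def)
 show ?G2
  unfolding cap_measure[OF sg r] unfolding radius_def by (rule cap_radius(2)[OF c v])
qed

lemma center_less_radius:
 assumes "pm sg" "(q :: real^'n) $ k = angle sg * radius sg * sg" shows "<|q $ k|> < radius sg"
 using mult_strict_right_mono[OF mult_data(2,3)[OF assms(1)]] mult_data(3)[OF assms(1)] assms by (simp add: abs_mult)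

lemma min_energy_eq:
 "dens 1 * (CARD('n) * half_vol 1) / radius 1 + dens (- 1) * (CARD('n) * half_vol (- 1)) / radius (- 1) = min_energy"
 using pos by (simp add: min_energy_def half_vol_def dens_def)

lemma weighted_perimeter_nonneg: "0 <= weighted_perimeter Om"
 using pos by (simp add: weighted_perimeter_def dens_def)

lemma admissible_halves:
 assumes Om: "Om : bor" and adm: "admissible k rhn rhp Vn Vp Om" and sg: "pm sg"
 shows "fin (Om Int hs sg k)" (is ?G1) "vol (Om Int hs sg k) = half_vol sg" (is ?G2) "perimeter Om (hs sg k) < \<infinity>" (is ?G3)
proof -
 have cancel: "e = ennreal (V / rh)" if "ennreal rh * e = ennreal V" "rh > 0" "V > 0" for e rh V
 proof (cases e)
  case (real x)
  hence "rh * x = V" using that by (simp add: ennreal_mult'[symmetric])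
  thus ?thesis using real that by (simp add: field_simps)
 qed (use that in \<open>simp add: ennreal_mult_top\<close>)
 have "emeasure lebesgue (Om Int halfspace_neg k) = ennreal (Vn / rhn)" "emeasure lebesgue (Om Int halfspace_pos k) = ennreal (Vp / rhp)"
  using adm pos by (auto simp: admissible_def intro!: cancel)
 hence e: "em (Om Int hs sg k) = ennreal (half_vol sg)"
  using sign_cases[OF sg] Om hs_borel[of 1 k] hs_borel[of "- 1" k] by (auto simp: half_vol_def dens_def hs_halfspace)
 thus ?G1 by simp
 show ?G2 unfolding measure_def e using pos by (simp add: half_vol_def dens_def)
 have "perimeter Om (hs sg k) <= perimeter Om UNIV" by (rule perimeter_mono) simp
 thus ?G3 using adm by (auto simp: admissible_def finite_perimeter_def order_le_less_trans)
qed

text \<open>The constant \<open>g\<close> contains the factor between area and Hausdorff measure, so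
  the interface term becomes \<open>g\<close> times an area.\<close>

lemma energy_ge_area:
 assumes Om: "Om : bor" and adm: "admissible k rhn rhp Vn Vp Om"
 shows "ennreal (weighted_perimeter Om) + ennreal g * area k (bdry Om Int interface k) <= energy k rhn rhp gm Om"
proof -
 let ?kp = "hm (real CARD('n) - 1) (flat_cube k 0 1)"
 have p: "perimeter Om (halfspace_pos k) = ennreal (enn2real (perimeter Om (hs 1 k)))"
  "perimeter Om (halfspace_neg k) = ennreal (enn2real (perimeter Om (hs (- 1) k)))"
  using admissible_halves(3)[OF assms, of 1] admissible_halves(3)[OF assms, of "- 1"] by (simp_all add: hs_halfspace)
 have "ennreal g = ennreal gm * ?kp"
  using hm_cube_finite[OF N, of k] gm unfolding g by (simp add: ennreal_mult)
 hence "ennreal g * area k (bdry Om Int interface k) = ennreal gm * (?kp * area k (bdry Om Int interface k))" by (simp add: mult.assoc)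
 also have "... <= ennreal gm * hm (real CARD('n) - 1) (Gamma_0 k Om)"
  unfolding Gamma_0_def by (intro mult_left_mono area_le_hausdorff[OF N bdry_interface_borel[OF Om]]) auto
 finally show ?thesis
  unfolding energy_def p weighted_perimeter_def using pos
  by (simp add: dens_def ennreal_plus ennreal_mult' add.commute add_left_mono)
qed

lemma weighted_perimeter_bound:
 assumes Om: "Om : bor" and adm: "admissible k rhn rhp Vn Vp Om" and A: "l ~= 0 ==> area k (bdry Om Int interface k) = ennreal A" "A >= 0"
 shows "min_energy <= weighted_perimeter Om + <|l|> * A" (is ?G1)
  and "weighted_perimeter Om + g * A <= min_energy ==> EX q. (ALL sg. pm sg --> q sg $ k = angle sg * radius sg * sg &
    (AEL x. x : hs sg k --> (x : Om <-> dist (q sg) x < radius sg))) &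
    g * A <= l * (disc_area k (q (- 1)) (radius (- 1)) - disc_area k (q 1) (radius 1))" (is "_ ==> ?G2")
proof -
 note h = admissible_halves[OF Om adm]
 have v: "vol (Om Int hs sg k) = vol (cap sg k (angle sg) (radius sg))" if "pm sg" for sg
  using h(2)[OF that] mult_data(5)[OF that] by simp
 note b = two_cap_bound[OF N Om mult_data(2,3,1,4) h(1) v h(3) A]
 show ?G1 using b(1) h(2)[of 1] h(2)[of "- 1"] min_energy_eq by (simp add: weighted_perimeter_def)
 assume "weighted_perimeter Om + g * A <= min_energy"
 thus ?G2
  using h(2)[of 1] h(2)[of "- 1"] min_energy_eq by (intro b(2) l(1)) (simp_all add: weighted_perimeter_def)
qed

lemma admissible_borel:
 assumes adm: "admissible k rhn rhp Vn Vp Om"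
 obtains Om' where "Om' : bor" "AEL x. x : Om <-> x : Om'" "admissible k rhn rhp Vn Vp Om'" "energy k rhn rhp gm Om' = energy k rhn rhp gm Om"
proof -
 have leb: "Om : sets lebesgue" using adm by (simp add: admissible_def finite_perimeter_def)
 then obtain Om' where Om': "Om' : bor" "AEL x. x : Om <-> x : Om'" by (rule borel_representative)
 have leb': "Om' : sets lebesgue" using Om'(1) by simp
 show ?thesis by (rule that[OF Om'])
  (use adm admissible_AE_cong[OF leb leb' Om'(2)] energy_AE_cong[OF leb leb' Om'(2)] in auto)
qed

lemma energy_lower_bound:
 assumes "admissible k rhn rhp Vn Vp Om"
 shows "ennreal min_energy <= energy k rhn rhp gm Om"
proof -
 from assms obtain Om' where Om': "Om' : bor" "admissible k rhn rhp Vn Vp Om'" "energy k rhn rhp gm Om' = energy k rhn rhp gm Om" by (rule admissible_borel)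
 note bound = weighted_perimeter_bound(1)[OF Om'(1,2)]
 define a where "a = area k (bdry Om' Int interface k)"
 let ?P = "weighted_perimeter Om'"
 have "ennreal min_energy <= ennreal ?P + ennreal g * a"
 \<comment> \<open>If \<open>l = 0\<close>, the interface term is simply dropped. Otherwise
   \<open>g > 0\<close>, and an infinite boundary area makes the right-hand side infinite.\<close>
 proof (cases "l = 0")
  case True
  hence "ennreal min_energy <= ennreal ?P" using bound[of 0] by (intro ennreal_leI) simp
  thus ?thesis by (rule order_trans) simp
 next
  case False
  hence g0: "g > 0" using l(1) by linarith
  show ?thesis
  proof (cases a)
   case (real A)
   have "min_energy <= ?P + <|l|> * A" using bound[of A] real by (simp add: a_def)
   also have "... <= ?P + g * A" using l(1) real by (intro add_left_mono mult_right_mono) auto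
   finally have "ennreal min_energy <= ennreal (?P + g * A)" by (rule ennreal_leI)
   also have "... = ennreal ?P + ennreal g * a" using weighted_perimeter_nonneg g0 real by (simp add: ennreal_plus ennreal_mult)
   finally show ?thesis .
  qed (use g0 in \<open>simp add: ennreal_mult_top\<close>)
 qed
 thus ?thesis using energy_ge_area[OF Om'(1,2)] Om'(3) unfolding a_def by simp
qed

text \<open>Positivity of \<open>gm\<close> makes \<open>g\<close> positive. This bounds the
  boundary area of an optimal set and lets the balance of the traces force the discs to be
  nested.\<close>

lemma optimal_type:
 assumes gm': "gm > 0" and adm: "admissible k rhn rhp Vn Vp Om" and norm: "normalized Om" and opt: "energy k rhn rhp gm Om <= ennreal min_energy"
 shows "type_I k Om | type_II k Om"
proof -
 have Om: "Om : sets lebesgue" using adm by (simp add: admissible_def finite_perimeter_def)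
 from adm obtain Om' where Om': "Om' : bor" "AEL x. x : Om <-> x : Om'" "admissible k rhn rhp Vn Vp Om'" "energy k rhn rhp gm Om' = energy k rhn rhp gm Om"
  by (rule admissible_borel)
 let ?P = "weighted_perimeter Om'"
 have "enn2real (hm (real CARD('n) - 1) (flat_cube k 0 1)) > 0"
  using hm_cube_finite[OF N, of k] hm_cube_pos[OF N, of k] by (simp add: enn2real_positive_iff)
 hence g0: "g > 0" using gm' g by simp
 have E: "ennreal ?P + ennreal g * area k (bdry Om' Int interface k) <= ennreal min_energy"
  using energy_ge_area[OF Om'(1,3)] opt unfolding Om'(4) by (rule order_trans)
 obtain A where A: "area k (bdry Om' Int interface k) = ennreal A" "A >= 0"
 proof (cases "area k (bdry Om' Int interface k)")
  case top
  thus ?thesis using E g0 by (simp add: ennreal_mult_top top_unique)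
 qed (use that in blast)
 have "0 <= min_energy" using pos mult_data(3)[of 1] mult_data(3)[of "- 1"] by (simp add: min_energy_def)
 moreover have "ennreal (?P + g * A) <= ennreal min_energy"
  using E A weighted_perimeter_nonneg g0 by (simp add: ennreal_plus ennreal_mult)
 ultimately have "?P + g * A <= min_energy" by (simp only: ennreal_le_iff)
 from weighted_perimeter_bound(2)[OF Om'(1,3) A this]
 obtain q where q: "!!sg. pm sg ==> q sg $ k = angle sg * radius sg * sg"
  "!!sg. pm sg ==> AEL x. x : hs sg k --> (x : Om' <-> dist (q sg) x < radius sg)"
  and bal: "g * A <= l * (disc_area k (q (- 1)) (radius (- 1)) - disc_area k (q 1) (radius 1))" by blast
 note qk = center_less_radius[OF _ q(1)]
 have "AEL x. x <.> (axis k 1 :: real^'n) ~= 0" by (rule AE_hyperplane) simp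
 moreover have "AEL x. x : hs 1 k --> (x : Om' <-> dist (q 1) x < radius 1)" using q(2)[of 1] by simp
 moreover have "AEL x. x : hs (- 1) k --> (x : Om' <-> dist (q (- 1)) x < radius (- 1))" using q(2)[of "- 1"] by simp
 ultimately have AE': "AEL x. x : Om' <-> x : two_caps k q radius"
 proof eventually_elim
  case (elim x)
  hence "x $ k ~= 0" by (simp add: inner_axis)
  then obtain sg where sg: "pm sg" "x : hs sg k" using hs_avoid by blast
  thus ?case using elim(2,3) two_caps_hs[OF sg, of q radius] sign_cases[OF sg(1)] by auto
 qed
 have "bdry Om' = bdry (two_caps k q radius)" by (rule bdry_AE_cong[OF _ _ AE']) (use Om'(1) in simp_all)
 then obtain s where s: "nested k q radius s"
  using trace_balance_nested[OF N qk _ A(2) g0 l(1) bal] A(1) by metis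
 have "AEL x. x : Om <-> x : two_caps k q radius" using Om'(2) AE' by eventually_elim auto
 thus ?thesis by (rule nested_type[OF N s Om norm])
qed

text \<open>Beyond \<open>min_energy\<close> the weighted perimeters of the caps contribute
  \<open>l * (D 1 - D (- 1))\<close>; in each alternative of \<open>sel\<close> the interface term
  is the negative of this.\<close>

lemma concentric_minimizer:
 assumes sel: "disc_radius k (Vn / rhn) (l / rhn) = disc_radius k (Vp / rhp) (- l / rhp)
   | l = g & disc_radius k (Vn / rhn) (l / rhn) >= disc_radius k (Vp / rhp) (- l / rhp)
   | l = - g & disc_radius k (Vn / rhn) (l / rhn) <= disc_radius k (Vp / rhp) (- l / rhp)"
 shows "EX q s. nested k q radius s & admissible k rhn rhp Vn Vp (two_caps k q radius) & energy k rhn rhp gm (two_caps k q radius) <= ennreal min_energy"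
proof -
 define q where "q = cap_center k angle radius"
 let ?Om = "two_caps k q radius" and ?kp = "hm (real CARD('n) - 1) (flat_cube k 0 1)"
 have qk: "q sg $ k = angle sg * radius sg * sg" and pq: "proj k (q sg) = 0" for sg
  by (simp_all add: q_def cap_center_def vec_eq_iff axis_def)
 note qr = center_less_radius[OF _ qk]
 define a where "a sg = sqrt ((radius sg)^2 - (q sg $ k)^2)" for sg
 have a: "a sg = disc_radius k (half_vol sg) (angle sg)" if sg: "pm sg" for sg
 proof -
  have "sg^2 = 1" using sg by (metis power2_abs one_power2)
  hence "(radius sg)^2 - (q sg $ k)^2 = (radius sg)^2 * (1 - (angle sg)^2)" by (simp add: qk power_mult_distrib algebra_simps)
  thus ?thesis using mult_data(3)[OF sg] by (simp add: a_def disc_radius_def radius_def[symmetric] real_sqrt_mult)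
 qed
 define D where "D sg = disc_area k (q sg) (radius sg)" for sg
 have Deq: "D 1 = D (- 1)" if "a 1 = a (- 1)"
  using that disc_area_eq[OF qr, of 1] disc_area_eq[OF qr, of "- 1"] by (simp add: D_def pq a_def)
 have nest: "nested k q radius s" if "<|s|> = 1" "a (- s) <= a s" for s
  using that qr by (simp add: nested_def pq a_def)
 have a1: "a 1 = disc_radius k (Vp / rhp) (- l / rhp)" "a (- 1) = disc_radius k (Vn / rhn) (l / rhn)"
  using a[of 1] a[of "- 1"] by (simp_all add: half_vol_def dens_def angle_def)
 text \<open>The multiplier is chosen such that the interface term is exactly compensated.\<close>
 have "EX s. nested k q radius s & g * (D s - D (- s)) = l * (D (- 1) - D 1)"
  using sel unfolding a1[symmetric]
 proof (elim disjE conjE)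
  assume "a (- 1) = a 1"
  thus ?thesis using nest[of 1] Deq by (intro exI[of _ 1]) simp
 next
  assume "l = g" "a (- 1) >= a 1"
  thus ?thesis using nest[of "- 1"] by (intro exI[of _ "- 1"]) simp
 next
  assume "l = - g" "a (- 1) <= a 1"
  thus ?thesis using nest[of 1] by (intro exI[of _ 1]) (simp add: algebra_simps)
 qed
 then obtain s where s: "nested k q radius s" and gs: "g * (D s - D (- s)) = l * (D (- 1) - D 1)" by blast
 have Ds: "area k (bdry ?Om Int interface k) = ennreal (D s - D (- s))" "D (- s) <= D s"
  using area_nested[OF s] by (simp_all add: D_def)
 have em: "em (?Om Int hs sg k) = ennreal (half_vol sg)" if sg: "pm sg" for sg
  unfolding q_def two_caps_centered[OF sg] using mult_data(5)[OF sg] cap_emeasure_finite[of sg k "angle sg" "radius sg"]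
  by (metis emeasure_eq_ennreal_measure infinity_ennreal_def less_irrefl)
 have "finite_perimeter ?Om" unfolding q_def by (rule two_caps_finite_perimeter) (rule mult_data)
 hence adm: "admissible k rhn rhp Vn Vp ?Om"
  using em[of 1] em[of "- 1"] pos by (simp add: admissible_def hs_halfspace[symmetric] half_vol_def dens_def ennreal_mult'[symmetric])
 define B where "B sg = CARD('n) * half_vol sg / radius sg - angle sg * D sg" for sg
 have B: "perimeter ?Om (hs sg k) <= ennreal (B sg)" "0 <= B sg" if sg: "pm sg" for sg
  using cap_perimeter_le[of radius sg k angle] mult_data(3,5)[OF sg] sg by (simp_all add: B_def D_def q_def)
 have H: "ennreal gm * hm (real CARD('n) - 1) (Gamma_0 k ?Om) <= ennreal (g * (D s - D (- s)))"
 proof -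
  have "bounded (bdry ?Om Int interface k)"
   unfolding bdry_interface[OF s] by (rule bounded_subset[OF bounded_cball, of _ "q s" "radius s"]) auto
  hence "hm (real CARD('n) - 1) (Gamma_0 k ?Om) <= ?kp * ennreal (D s - D (- s))"
   unfolding Gamma_0_def Ds(1)[symmetric] by (intro hausdorff_le_area[OF N bdry_interface_borel]) auto
  hence "ennreal gm * hm (real CARD('n) - 1) (Gamma_0 k ?Om) <= ennreal gm * (?kp * ennreal (D s - D (- s)))"
   by (rule mult_left_mono) simp
  also have "?kp = ennreal (enn2real ?kp)" using hm_cube_finite[OF N, of k] by simp
  also have "ennreal gm * (ennreal (enn2real ?kp) * ennreal (D s - D (- s))) = ennreal (g * (D s - D (- s)))"
   unfolding g using gm Ds(2) by (simp add: ennreal_mult mult.assoc)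
  finally show ?thesis .
 qed
 have "energy k rhn rhp gm ?Om <= ennreal rhn * ennreal (B (- 1)) + ennreal rhp * ennreal (B 1) + ennreal (g * (D s - D (- s)))"
  unfolding energy_def hs_halfspace[symmetric] by (intro add_mono mult_left_mono B H) auto
 also have "... = ennreal (rhn * B (- 1) + rhp * B 1 + g * (D s - D (- s)))"
  using B(2)[of 1] B(2)[of "- 1"] pos Ds(2) gm g by (simp add: ennreal_plus ennreal_mult)
 also have "rhn * B (- 1) + rhp * B 1 + g * (D s - D (- s)) = min_energy"
  unfolding gs using pos by (simp add: B_def half_vol_def dens_def angle_def min_energy_def algebra_simps)
 finally show ?thesis using s adm by blast
qed

end

theorem theorem3p2:
  fixes k :: "'n::finite" and \<rho>n \<rho>p \<gamma> Vn Vp :: real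
  assumes "CARD('n) \<ge> 2"
    and "Vn > 0" and "Vp > 0" and "\<rho>n > 0" and "\<rho>p > 0" and "\<gamma> \<ge> 0"
  shows "(\<exists>\<Omega>. minimizer k \<rho>n \<rho>p \<gamma> Vn Vp \<Omega> \<and> normalized \<Omega> \<and> (type_I k \<Omega> \<or> type_II k \<Omega>)) \<and>
    (\<gamma> > 0 \<longrightarrow>
      (\<forall>\<Omega>. minimizer k \<rho>n \<rho>p \<gamma> Vn Vp \<Omega> \<and> normalized \<Omega> \<longrightarrow> type_I k \<Omega> \<or> type_II k \<Omega>))"
proof -
 note N = assms(1) and pos = assms(2-5) and \<gamma> = assms(6)
 define g where "g = \<gamma> * enn2real (hm (real CARD('n) - 1) (flat_cube k 0 1))"
 have "g >= 0" using \<gamma> by (simp add: g_def)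
 moreover have "Vn / \<rho>n > 0" "Vp / \<rho>p > 0" using pos by auto
 ultimately obtain l where l: "<|l|> <= g" "<|l|> < \<rho>n" "<|l|> < \<rho>p"
  and sel: "disc_radius k (Vn / \<rho>n) (l / \<rho>n) = disc_radius k (Vp / \<rho>p) (- l / \<rho>p)
   | l = g & disc_radius k (Vn / \<rho>n) (l / \<rho>n) >= disc_radius k (Vp / \<rho>p) (- l / \<rho>p)
   | l = - g & disc_radius k (Vn / \<rho>n) (l / \<rho>n) <= disc_radius k (Vp / \<rho>p) (- l / \<rho>p)"
  using multiplier_exists[of "Vn / \<rho>n" "Vp / \<rho>p" \<rho>n \<rho>p g k] pos by metis
 note ctx = N pos \<gamma> g_def l
 obtain q r s where nest: "nested k q r s" and adm: "admissible k \<rho>n \<rho>p Vn Vp (two_caps k q r)"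
  and en: "energy k \<rho>n \<rho>p \<gamma> (two_caps k q r) <= ennreal (min_energy k \<rho>n \<rho>p Vn Vp l)"
  using concentric_minimizer[OF ctx sel] by blast
 have leb: "two_caps k q r : sets lebesgue" by simp
 \<comment> \<open>The types speak of connectedness and closures, so the union of the open caps is
   replaced by a normalized representative; admissibility and energy do not change.\<close>
 obtain Om0 where Om0: "Om0 : sets lebesgue" "negligible ((Om0 - two_caps k q r) Un (two_caps k q r - Om0))" "normalized Om0"
  using normalized_representative[OF leb] by blast
 have AE: "AEL x. x : Om0 <-> x : two_caps k q r" by (rule negligible_AE_eq[OF Om0(2)])
 have "admissible k \<rho>n \<rho>p Vn Vp Om0" using admissible_AE_cong[OF Om0(1) leb AE] adm by blast
 moreover have "energy k \<rho>n \<rho>p \<gamma> Om0 <= energy k \<rho>n \<rho>p \<gamma> Om'" if "admissible k \<rho>n \<rho>p Vn Vp Om'" for Om'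
  using order_trans[OF en energy_lower_bound[OF ctx that]] energy_AE_cong[OF Om0(1) leb AE] by simp
 ultimately have "minimizer k \<rho>n \<rho>p \<gamma> Vn Vp Om0" by (simp add: minimizer_def)
 moreover have "type_I k Om0 | type_II k Om0" by (rule nested_type[OF N nest Om0(1,3) AE])
 moreover have "type_I k Om | type_II k Om" if "\<gamma> > 0" "minimizer k \<rho>n \<rho>p \<gamma> Vn Vp Om" "normalized Om" for Om
  by (rule optimal_type[OF ctx that(1) _ that(3)]) (use that(2) adm en in \<open>auto simp: minimizer_def intro: order_trans\<close>)
 ultimately show ?thesis using Om0(3) by blast
qed

end
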